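(* Let $d\ge 1$, $0<\lambda\le\Lambda$, and let $f:\mathbf{R}^d\to\mathbf{R}$ be a $C^\infty$ function of compact support. For $0<\varepsilon\le 1$ let $u_\varepsilon(x,t,\omega)$ denote the solution of the random parabolic equation described in the context with initial data $h(x)=f(\varepsilon x)$, $x\in\mathbf{Z}^d$, and let $u_{\rm hom}$ be the solution of $\partial_t u_{\rm hom}(x,t)=\sum_{i,j=1}^d (\mathbf{a}_{\rm hom})_{ij}\,\partial_i\partial_j u_{\rm hom}(x,t)$ for $x\in\mathbf{R}^d$, $t>0$, with $u_{\rm hom}(x,0)=f(x)$, where $\mathbf{a}_{\rm hom}$ is the homogenized matrix defined in the context. (i) (Discrete time.) Suppose the translation group is $\tau_{x,t}$, $x\in\mathbf{Z}^d$, $t\in\mathbf{Z}$, that one of the operators $\tau_{\mathbf{e}_j,0}$, $j=1,\dots,d$, or $\tau_{0,1}$ is ergodic on $(\Omega,\mathcal{F},P)$, and that $4d\Lambda\le 1$. Then for the solution of the discrete-time equation, $$\lim_{\varepsilon\to 0}\ \sup_{x\in\varepsilon\mathbf{Z}^d,\ t\in\varepsilon^2\mathbf{Z}_{\ge 0}}\big|\langle u_\varepsilon(x/\varepsilon,t/\varepsilon^2,\cdot)\rangle-u_{\rm hom}(x,t)\big|=0 .$$ (ii) (Continuous time.) Suppose the translation group is $\tau_{x,t}$, $x\in\mathbf{Z}^d$, $t\in\mathbf{R}$, and that one of the operators $\tau_{\mathbf{e}_j,0}$, $j=1,\dots,d$, or the one-parameter group $\{\tau_{0,t}\}_{t\in\mathbf{R}}$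 is ergodic on $(\Omega,\mathcal{F},P)$. Then for the solution of the continuous-time equation, $$\lim_{\varepsilon\to 0}\ \sup_{x\in\varepsilon\mathbf{Z}^d,\ t>0}\big|\langle u_\varepsilon(x/\varepsilon,t/\varepsilon^2,\cdot)\rangle-u_{\rm hom}(x,t)\big|=0 .$$
   Context: $(\Omega,\mathcal{F},P)$ is a probability space, $\langle\cdot\rangle$ denotes expectation w.r.t. $P$. Space translations $\tau_{x,0}$, $x\in\mathbf{Z}^d$, and time translations $\tau_{0,t}$ ($t\in\mathbf{Z}$ in the discrete case, $t\in\mathbf{R}$ in the continuous case) are measure-preserving maps $\Omega\to\Omega$ with $\tau_{x,0}\tau_{y,0}=\tau_{x+y,0}$, $\tau_{0,t}\tau_{0,s}=\tau_{0,t+s}$, $\tau_{0,0}=$ identity, the space and time translations commute, and $\tau_{x,t}=\tau_{x,0}\tau_{0,t}$. $\mathbf{a}:\Omega\to\{$real symmetric $d\times d$ matrices$\}$ is bounded measurable with $\lambda I_d\le\mathbf{a}(\omega)\le\Lambda I_d$ for all $\omega$. On functions $\phi:\mathbf{Z}^d\to\mathbf{R}$, $\nabla=(\nabla_1,\dots,\nabla_d)$ (a column operator) with $\nabla_i\phi(x)=\phi(x+\mathbf{e}_i)-\phi(x)$, and its adjoint $\nabla^*=(\nabla_1^*,\dots,\nabla_d^* )$ (a row operator) with $\nabla_i^*\phi(x)=\phi(x-\mathbf{e}_i)-\phi(x)$; $\mathbf{e}_i$ is the $i$-th unit vector. Discrete-time equation: $u(x,t+1,\omega)-u(x,t,\omega)=-\nabla^*\mathbf{a}(\tau_{x,t}\omega)\nabla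 u(x,t,\omega)$ for $x\in\mathbf{Z}^d$, $t\in\mathbf{Z}_{\ge0}$, $u(x,0,\omega)=h(x)$. Continuous-time equation: $\partial_t u(x,t,\omega)=-\nabla^*\mathbf{a}(\tau_{x,t}\omega)\nabla u(x,t,\omega)$ for $x\in\mathbf{Z}^d$, $t\ge0$, $u(x,0,\omega)=h(x)$. Homogenized matrix. For $\xi\in\mathbf{R}^d$ and measurable $\psi:\Omega\to\mathbf{C}$ set $\partial_{j,\xi}\psi(\omega)=e^{-i\mathbf{e}_j\cdot\xi}\psi(\tau_{\mathbf{e}_j,0}\omega)-\psi(\omega)$, $\partial^*_{j,\xi}\psi(\omega)=e^{i\mathbf{e}_j\cdot\xi}\psi(\tau_{-\mathbf{e}_j,0}\omega)-\psi(\omega)$, $\partial_\xi=(\partial_{1,\xi},\dots,\partial_{d,\xi})$ (column), $\partial_\xi^*$ the corresponding row operator. Let $\Pi$ be the orthogonal projection on $L^2(\Omega)$ onto functions of mean zero. For $\Re\eta>0$ let $\Phi(\xi,\eta,\cdot)=(\Phi_1,\dots,\Phi_d)$, $\Phi_j\in L^2(\Omega)$, be the unique (row vector) solution of $e^\eta\Phi(\xi,\eta,\tau_{0,1}\omega)-\Phi(\xi,\eta,\omega)+\Pi\partial_\xi^*\mathbf{a}(\omega)\partial_\xi\Phi(\xi,\eta,\omega)=-\Pi\partial_\xi^*\mathbf{a}(\omega)$ in the discrete case (with $4d\Lambda\le1$), respectively of $\eta\Phi(\xi,\eta,\omega)+\partial\Phi(\xi,\eta,\omega)+\Pi\partial_\xi^*\mathbf{a}(\omega)\partial_\xi\Phi(\xi,\eta,\omega)=-\Pi\partial_\xi^*\mathbf{a}(\omega)$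 in the continuous case, where $\partial$ is the infinitesimal generator of $t\mapsto\tau_{0,t}$. Here $\partial_\xi\Phi$ is the $d\times d$ matrix with entries $\partial_{i,\xi}\Phi_j$, and for a matrix-valued $M$, $\partial_\xi^*M$ is the row vector with $j$-th entry $\sum_i\partial^*_{i,\xi}M_{ij}$. Set $q(\xi,\eta)=\langle\mathbf{a}(\cdot)\rangle+\langle\mathbf{a}(\cdot)\partial_\xi\Phi(\xi,\eta,\cdot)\rangle$. Under the ergodicity hypotheses of the theorem the limit $\mathbf{a}_{\rm hom}=q(0,0):=\lim_{(\xi,\eta)\to(0,0)}q(\xi,\eta)$ exists; it is a symmetric matrix with $\lambda I_d\le\mathbf{a}_{\rm hom}\le\Lambda I_d$.
   Formalization: In (ii) the map (t,ω) ↦ τ_{0,t}ω is assumed jointly measurable, the usual meaning of a measurable flow; without it the equation along t ↦ a(τ_{x,t}ω) and the generator ∂ need not be defined. *)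

theory Defs
  imports "HOL-Analysis.Analysis" "HOL-Probability.Probability"
begin

definition ue :: "'d::finite \<Rightarrow> int^'d" where
  "ue i = axis i 1"

definition rvec :: "int^'d::finite \<Rightarrow> real^'d" where
  "rvec z = (\<chi> i. real_of_int (z $ i))"

definition flux :: "(int^'d::finite \<Rightarrow> real^'d^'d) \<Rightarrow> (int^'d \<Rightarrow> real) \<Rightarrow> int^'d \<Rightarrow> real^'d" where
  "flux A v y = A y *v (\<chi> j. v (y + ue j) - v y)"

text \<open>(grad^* A grad v)(x) with grad_i^* phi(x) = phi(x - e_i) - phi(x).\<close>
definition Lop :: "(int^'d::finite \<Rightarrow> real^'d^'d) \<Rightarrow> (int^'d \<Rightarrow> real) \<Rightarrow> int^'d \<Rightarrow> real" where
  "Lop A v x = (\<Sum>i\<in>UNIV. flux A v (x - ue i) $ i - flux A v x $ i)"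

text \<open>Solution of the discrete-time equation u(x,t+1) - u(x,t) = - grad^* a(tau_{x,t} omega) grad u(x,t),
  u(x,0) = h(x); T = space translations, S = time translations, tau_{x,t} = T x o S t.\<close>
primrec dsol :: "(int^'d::finite \<Rightarrow> 'w \<Rightarrow> 'w) \<Rightarrow> (int \<Rightarrow> 'w \<Rightarrow> 'w) \<Rightarrow> ('w \<Rightarrow> real^'d^'d)
    \<Rightarrow> (int^'d \<Rightarrow> real) \<Rightarrow> 'w \<Rightarrow> nat \<Rightarrow> int^'d \<Rightarrow> real" where
  "dsol T S a h \<omega> 0 = h"
| "dsol T S a h \<omega> (Suc n) =
     (\<lambda>x. dsol T S a h \<omega> n x - Lop (\<lambda>y. a (T y (S (int n) \<omega>))) (dsol T S a h \<omega> n) x)"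

text \<open>u is the (bounded) solution of the continuous-time equation
  d/dt u(x,t,omega) = - grad^* a(tau_{x,t} omega) grad u(x,t,omega), u(x,0,omega) = h(x),
  written in integrated form.\<close>
definition is_csol :: "'w measure \<Rightarrow> (int^'d::finite \<Rightarrow> 'w \<Rightarrow> 'w) \<Rightarrow> (real \<Rightarrow> 'w \<Rightarrow> 'w) \<Rightarrow> ('w \<Rightarrow> real^'d^'d)
    \<Rightarrow> (int^'d \<Rightarrow> real) \<Rightarrow> (int^'d \<Rightarrow> real \<Rightarrow> 'w \<Rightarrow> real) \<Rightarrow> bool" where
  "is_csol M T S a h u \<longleftrightarrow>
     (\<forall>\<omega>\<in>space M. \<forall>x. u x 0 \<omega> = h x) \<and>
     (\<forall>\<omega>\<in>space M. \<exists>C. \<forall>x t. 0 \<le> t \<longrightarrow> \<bar>u x t \<omega>\<bar> \<le> C) \<and>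
     (\<forall>\<omega>\<in>space M. \<forall>x. \<forall>t\<ge>0.
        ((\<lambda>s. Lop (\<lambda>y. a (T y (S s \<omega>))) (\<lambda>y. u y s \<omega>) x) has_integral (h x - u x t \<omega>)) {0..t})"

definition mpres :: "'w measure \<Rightarrow> ('w \<Rightarrow> 'w) \<Rightarrow> bool" where
  "mpres M f \<longleftrightarrow> f \<in> measurable M M \<and> distr M M f = M"

definition ergodic_map :: "'w measure \<Rightarrow> ('w \<Rightarrow> 'w) \<Rightarrow> bool" where
  "ergodic_map M f \<longleftrightarrow> mpres M f \<and>
     (\<forall>A\<in>sets M. f -` A \<inter> space M = A \<longrightarrow> measure M A = 0 \<or> measure M A = 1)"

definition ergodic_flow :: "'w measure \<Rightarrow> (real \<Rightarrow> 'w \<Rightarrow> 'w) \<Rightarrow> bool" where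
  "ergodic_flow M S \<longleftrightarrow> (\<forall>t. mpres M (S t)) \<and>
     (\<forall>A\<in>sets M. (\<forall>t. S t -` A \<inter> space M = A) \<longrightarrow> measure M A = 0 \<or> measure M A = 1)"

definition translation_groups :: "'w measure \<Rightarrow> (int^'d::finite \<Rightarrow> 'w \<Rightarrow> 'w) \<Rightarrow> ('t::ab_group_add \<Rightarrow> 'w \<Rightarrow> 'w) \<Rightarrow> bool" where
  "translation_groups M T S \<longleftrightarrow>
     (\<forall>x. mpres M (T x)) \<and> (\<forall>t. mpres M (S t)) \<and>
     (\<forall>\<omega>\<in>space M. T 0 \<omega> = \<omega> \<and> S 0 \<omega> = \<omega>) \<and>
     (\<forall>x y. \<forall>\<omega>\<in>space M. T (x + y) \<omega> = T x (T y \<omega>)) \<and>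
     (\<forall>t s. \<forall>\<omega>\<in>space M. S (t + s) \<omega> = S t (S s \<omega>)) \<and>
     (\<forall>x t. \<forall>\<omega>\<in>space M. T x (S t \<omega>) = S t (T x \<omega>))"

definition coeff_ok :: "'w measure \<Rightarrow> real \<Rightarrow> real \<Rightarrow> ('w \<Rightarrow> real^'d::finite^'d) \<Rightarrow> bool" where
  "coeff_ok M l L a \<longleftrightarrow> a \<in> borel_measurable M \<and>
     (\<forall>\<omega>\<in>space M. transpose (a \<omega>) = a \<omega> \<and>
        (\<forall>\<xi>. l * (\<xi> \<bullet> \<xi>) \<le> \<xi> \<bullet> (a \<omega> *v \<xi>) \<and> \<xi> \<bullet> (a \<omega> *v \<xi>) \<le> L * (\<xi> \<bullet> \<xi>)))"

definition L2 :: "'w measure \<Rightarrow> ('w \<Rightarrow> complex) \<Rightarrow> bool" where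
  "L2 M \<psi> \<longleftrightarrow> \<psi> \<in> borel_measurable M \<and> integrable M (\<lambda>\<omega>. (cmod (\<psi> \<omega>))\<^sup>2)"

definition L2norm :: "'w measure \<Rightarrow> ('w \<Rightarrow> complex) \<Rightarrow> real" where
  "L2norm M \<psi> = sqrt (integral\<^sup>L M (\<lambda>\<omega>. (cmod (\<psi> \<omega>))\<^sup>2))"

definition Pi0 :: "'w measure \<Rightarrow> ('w \<Rightarrow> complex) \<Rightarrow> 'w \<Rightarrow> complex" where
  "Pi0 M \<psi> \<omega> = \<psi> \<omega> - integral\<^sup>L M \<psi>"

definition dxi :: "(int^'d::finite \<Rightarrow> 'w \<Rightarrow> 'w) \<Rightarrow> real^'d \<Rightarrow> 'd \<Rightarrow> ('w \<Rightarrow> complex) \<Rightarrow> 'w \<Rightarrow> complex" where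
  "dxi T \<xi> j \<psi> \<omega> = exp (- \<i> * complex_of_real (\<xi> $ j)) * \<psi> (T (ue j) \<omega>) - \<psi> \<omega>"

definition dxis :: "(int^'d::finite \<Rightarrow> 'w \<Rightarrow> 'w) \<Rightarrow> real^'d \<Rightarrow> 'd \<Rightarrow> ('w \<Rightarrow> complex) \<Rightarrow> 'w \<Rightarrow> complex" where
  "dxis T \<xi> j \<psi> \<omega> = exp (\<i> * complex_of_real (\<xi> $ j)) * \<psi> (T (- ue j) \<omega>) - \<psi> \<omega>"

definition ac :: "('w \<Rightarrow> real^'d::finite^'d) \<Rightarrow> 'd \<Rightarrow> 'd \<Rightarrow> 'w \<Rightarrow> complex" where
  "ac a i k \<omega> = complex_of_real (a \<omega> $ i $ k)"

definition aDPhi :: "(int^'d::finite \<Rightarrow> 'w \<Rightarrow> 'w) \<Rightarrow> ('w \<Rightarrow> real^'d^'d) \<Rightarrow> real^'d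
    \<Rightarrow> ('d \<Rightarrow> 'w \<Rightarrow> complex) \<Rightarrow> 'd \<Rightarrow> 'd \<Rightarrow> 'w \<Rightarrow> complex" where
  "aDPhi T a \<xi> \<Phi> i j \<omega> = (\<Sum>k\<in>UNIV. ac a i k \<omega> * dxi T \<xi> k (\<Phi> j) \<omega>)"

definition divs :: "(int^'d::finite \<Rightarrow> 'w \<Rightarrow> 'w) \<Rightarrow> real^'d \<Rightarrow> ('d \<Rightarrow> 'd \<Rightarrow> 'w \<Rightarrow> complex) \<Rightarrow> 'd \<Rightarrow> 'w \<Rightarrow> complex" where
  "divs T \<xi> Mx j \<omega> = (\<Sum>i\<in>UNIV. dxis T \<xi> i (Mx i j) \<omega>)"

definition Phi_eq_disc :: "'w measure \<Rightarrow> (int^'d::finite \<Rightarrow> 'w \<Rightarrow> 'w) \<Rightarrow> (int \<Rightarrow> 'w \<Rightarrow> 'w) \<Rightarrow> ('w \<Rightarrow> real^'d^'d)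
    \<Rightarrow> real^'d \<Rightarrow> complex \<Rightarrow> ('d \<Rightarrow> 'w \<Rightarrow> complex) \<Rightarrow> bool" where
  "Phi_eq_disc M T S a \<xi> \<eta> \<Phi> \<longleftrightarrow> (\<forall>j. L2 M (\<Phi> j)) \<and>
     (\<forall>j. AE \<omega> in M. exp \<eta> * \<Phi> j (S 1 \<omega>) - \<Phi> j \<omega> + Pi0 M (divs T \<xi> (aDPhi T a \<xi> \<Phi>) j) \<omega>
                       = - Pi0 M (divs T \<xi> (ac a) j) \<omega>)"

definition has_gen :: "'w measure \<Rightarrow> (real \<Rightarrow> 'w \<Rightarrow> 'w) \<Rightarrow> ('w \<Rightarrow> complex) \<Rightarrow> ('w \<Rightarrow> complex) \<Rightarrow> bool" where
  "has_gen M S \<psi> g \<longleftrightarrow> L2 M \<psi> \<and> L2 M g \<and>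
     ((\<lambda>h. L2norm M (\<lambda>\<omega>. (\<psi> (S h \<omega>) - \<psi> \<omega>) / complex_of_real h - g \<omega>)) \<longlongrightarrow> 0) (at 0)"

definition Phi_eq_cont :: "'w measure \<Rightarrow> (int^'d::finite \<Rightarrow> 'w \<Rightarrow> 'w) \<Rightarrow> (real \<Rightarrow> 'w \<Rightarrow> 'w) \<Rightarrow> ('w \<Rightarrow> real^'d^'d)
    \<Rightarrow> real^'d \<Rightarrow> complex \<Rightarrow> ('d \<Rightarrow> 'w \<Rightarrow> complex) \<Rightarrow> bool" where
  "Phi_eq_cont M T S a \<xi> \<eta> \<Phi> \<longleftrightarrow> (\<forall>j. L2 M (\<Phi> j)) \<and>
     (\<forall>j. \<exists>g. has_gen M S (\<Phi> j) g \<and>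
        (AE \<omega> in M. \<eta> * \<Phi> j \<omega> + g \<omega> + Pi0 M (divs T \<xi> (aDPhi T a \<xi> \<Phi>) j) \<omega>
                       = - Pi0 M (divs T \<xi> (ac a) j) \<omega>))"

definition qmat :: "'w measure \<Rightarrow> (int^'d::finite \<Rightarrow> 'w \<Rightarrow> 'w) \<Rightarrow> ('w \<Rightarrow> real^'d^'d) \<Rightarrow> real^'d
    \<Rightarrow> ('d \<Rightarrow> 'w \<Rightarrow> complex) \<Rightarrow> 'd \<Rightarrow> 'd \<Rightarrow> complex" where
  "qmat M T a \<xi> \<Phi> i j = integral\<^sup>L M (ac a i j) + integral\<^sup>L M (aDPhi T a \<xi> \<Phi> i j)"

text \<open>A = a_hom = lim_{(xi,eta) -> (0,0), Re eta > 0} q(xi,eta), where q is computed from the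
  (unique) L^2 solution Phi of the corrector equation PhiEq.\<close>
definition is_ahom :: "'w measure \<Rightarrow> (int^'d::finite \<Rightarrow> 'w \<Rightarrow> 'w) \<Rightarrow> ('w \<Rightarrow> real^'d^'d)
    \<Rightarrow> (real^'d \<Rightarrow> complex \<Rightarrow> ('d \<Rightarrow> 'w \<Rightarrow> complex) \<Rightarrow> bool) \<Rightarrow> real^'d^'d \<Rightarrow> bool" where
  "is_ahom M T a PhiEq A \<longleftrightarrow>
     (\<forall>\<delta>>0. \<exists>r>0. \<forall>\<xi> \<eta> \<Phi>. 0 < Re \<eta> \<longrightarrow> norm \<xi> + cmod \<eta> < r \<longrightarrow> PhiEq \<xi> \<eta> \<Phi> \<longrightarrow>
        (\<forall>i j. cmod (qmat M T a \<xi> \<Phi> i j - complex_of_real (A $ i $ j)) < \<delta>))"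

text \<open>f is C^infinity: all iterated partial derivatives exist and are continuous
  (D is = partial_{is} f, for a list is of coordinate directions).\<close>
definition smooth_fun :: "(real^'d::finite \<Rightarrow> real) \<Rightarrow> bool" where
  "smooth_fun f \<longleftrightarrow> (\<exists>D. D [] = f \<and> (\<forall>is. continuous_on UNIV (D is)) \<and>
     (\<forall>is i x. ((\<lambda>s. D is (x + s *\<^sub>R axis i 1)) has_real_derivative D (i # is) x) (at 0)))"

definition compact_support :: "(real^'d::finite \<Rightarrow> real) \<Rightarrow> bool" where
  "compact_support f \<longleftrightarrow> compact (closure {x. f x \<noteq> 0})"

definition heat_sol :: "real^'d::finite^'d \<Rightarrow> (real^'d \<Rightarrow> real) \<Rightarrow> (real^'d \<Rightarrow> real \<Rightarrow> real) \<Rightarrow> bool" where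
  "heat_sol A f v \<longleftrightarrow>
     (\<forall>x. v x 0 = f x) \<and>
     continuous_on (UNIV \<times> {0..}) (\<lambda>(x, t). v x t) \<and>
     (\<exists>C. \<forall>x t. 0 \<le> t \<longrightarrow> \<bar>v x t\<bar> \<le> C) \<and>
     (\<exists>Dt Dx Dxx.
        (\<forall>x. \<forall>t>0. ((\<lambda>s. v x s) has_real_derivative Dt x t) (at t)) \<and>
        (\<forall>i x. \<forall>t>0. ((\<lambda>s. v (x + s *\<^sub>R axis i 1) t) has_real_derivative Dx i x t) (at 0)) \<and>
        (\<forall>i j x. \<forall>t>0. ((\<lambda>s. Dx j (x + s *\<^sub>R axis i 1) t) has_real_derivative Dxx i j x t) (at 0)) \<and>
        continuous_on (UNIV \<times> {0<..}) (\<lambda>(x, t). Dt x t) \<and>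
        (\<forall>i. continuous_on (UNIV \<times> {0<..}) (\<lambda>(x, t). Dx i x t)) \<and>
        (\<forall>i j. continuous_on (UNIV \<times> {0<..}) (\<lambda>(x, t). Dxx i j x t)) \<and>
        (\<forall>x. \<forall>t>0. Dt x t = (\<Sum>i\<in>UNIV. \<Sum>j\<in>UNIV. A $ i $ j * Dxx i j x t)))"

end

theory Submission
  imports Defs "HOL-Library.Groups_Big_Fun"
begin

text \<open>Taking expectations turns the random evolution into a Fourier multiplier on the lattice: the
  plane wave with frequency \<open>\<epsilon> \<zeta>\<close> corrected by the cell function is an approximate eigenfunction,
  with decay rate close to \<open>\<epsilon>\<^sup>2 (\<zeta> \<bullet> (A *v \<zeta>))\<close>. Ergodicity (von Neumann) makes the corrector small
  after multiplication by \<open>\<epsilon>\<close>. Continuous time is reached by an Euler scheme. Fourier inversion on the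
  lattice and dominated convergence give the limit for compact time intervals; the \<open>L\<^sup>2\<close> decay of the
  multiplier handles large times, and a maximum principle identifies the heat solution.\<close>

text \<open>Ergodicity supplies no rate, and the existence of the limit of q, which
  \<open>is_ahom\<close> expresses, does not by itself make the corrector small. What is required is
  that \<epsilon> times its norm tends to 0 along \<xi> = \<epsilon> \<zeta>, \<eta> = \<epsilon>^2,
  whereas energy estimates give only boundedness. The remedy is perturbation around the medium L
  times the identity: there the equation commutes with translations, so a difference on the right
  side moves onto the solution and gains a power of \<epsilon>. Coboundaries are dense by
  ergodicity, and the true coefficient enters through a contraction with factor below 1. Time enters
  only through the relation \<open>Tm\<close> of the locale \<open>parab\<close>, so both parts of
  the theorem share this argument. Powers of the eigenvalue are compared through geometric series,
  which makes the error uniform over all times. A single Euler step of an ergodic flow can fail to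
  be ergodic; the Euler scheme is therefore tested with the cell function of the continuous
  equation. Its coefficients are exact time averages, since along an orbit the coefficient is merely
  measurable in time.\<close>

abbreviation cr :: "real => complex" where "cr == complex_of_real"
notation scaleR (infixr "*." 75)

abbreviation ei :: "real => complex" where "ei x == exp (\<i> * complex_of_real x)"
abbreviation em :: "real => complex" where "em x == exp (- \<i> * complex_of_real x)"

section \<open>Square-integrable functions with values in a Euclidean space\<close>

definition l2 :: "'w measure => ('w => 'b::euclidean_space) => bool" where
 "l2 M f \<longleftrightarrow> f : borel_measurable M & integrable M (%w. (norm (f w))^2)"

text \<open>On complex-valued functions this is the real part of the Hermitian product, the part in
  which energy estimates are formulated.\<close>

definition ip :: "'w measure => ('w => 'b::euclidean_space) => ('w => 'b) => real" where
 "ip M f g = (\<integral>w. f w \<bullet> g w \<partial>M)"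

definition nn :: "'w measure => ('w => 'b::euclidean_space) => real" where
 "nn M f = sqrt (\<integral>w. (norm (f w))^2 \<partial>M)"

lemma L2_iff_l2: "L2 M f \<longleftrightarrow> l2 M f" and L2norm_eq_nn: "L2norm M f = nn M f"
 by (simp_all add: L2_def l2_def L2norm_def nn_def)

lemma l2_meas [measurable_dest]: "l2 M f ==> f : borel_measurable M"
 by (simp add: l2_def)

lemma l2_sq: "l2 M f ==> integrable M (%w. (norm (f w))^2)"
 by (simp add: l2_def)

lemma nn_nonneg [simp]: "0 <= nn M f"
 by (simp add: nn_def)

lemma nn_sq: "(nn M f)^2 = (\<integral>w. (norm (f w))^2 \<partial>M)"
 by (simp add: nn_def)

lemma nn_sq_ip: "(nn M f)^2 = ip M f f"
 by (simp add: nn_sq ip_def power2_norm_eq_inner)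

lemma ip_commute: "ip M f g = ip M g f"
 by (simp add: ip_def inner_commute)

lemma l2_bound:
 assumes "l2 M g" "f : borel_measurable M" "AE w in M. norm (f w) <= C * norm (g w)"
 shows "l2 M f"
proof -
 have "integrable M (%w. C^2 * (norm (g w))^2)" using assms(1) by (simp add: l2_def)
 hence "integrable M (%w. (norm (f w))^2)"
 proof (rule Bochner_Integration.integrable_bound)
  show "AE x in M. norm ((norm (f x))^2) <= norm (C^2 * (norm (g x))^2)"
  using assms(3) by eventually_elim (simp add: power_mult_distrib[symmetric] power_mono)
 qed (use assms in auto)
 thus ?thesis using assms by (simp add: l2_def)
qed

lemma l2_add [intro]:
 assumes "l2 M f" "l2 M g" shows "l2 M (%w. f w + g w)"
proof -
 have "integrable M (%w. 2 * (norm (f w))^2 + 2 * (norm (g w))^2)"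
  using assms by (simp add: l2_def)
 hence "integrable M (%w. (norm (f w + g w))^2)"
 proof (rule Bochner_Integration.integrable_bound)
  show "AE x in M. norm ((norm (f x + g x))^2) <= norm (2 * (norm (f x))^2 + 2 * (norm (g x))^2)"
  proof (rule AE_I2)
  fix x
  have "(norm (f x + g x))^2 <= (norm (f x) + norm (g x))^2"
  by (simp add: norm_triangle_ineq power_mono)
  also have "... <= 2 * (norm (f x))^2 + 2 * (norm (g x))^2"
  using sum_squares_bound[of "norm (f x)" "norm (g x)"] by (simp add: power2_sum)
  finally show "norm ((norm (f x + g x))^2) <= norm (2 * (norm (f x))^2 + 2 * (norm (g x))^2)"
  by simp
  qed
 qed (use assms in \<open>auto simp: l2_def\<close>)
 moreover have "(%w. f w + g w) : borel_measurable M"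
  using assms by (intro borel_measurable_add) (auto simp: l2_def)
 ultimately show ?thesis by (simp add: l2_def)
qed

lemma l2_scaleR [intro]: "l2 M f ==> l2 M (%w. c *. f w)"
 by (rule l2_bound[of M f _ "\<bar>c\<bar>"]) (auto simp: l2_def)

lemma l2_mult [intro]: "l2 M f ==> l2 M (%w. c * f w)" for f :: "'w => complex"
 by (rule l2_bound[of M f _ "norm c"]) (auto simp: l2_def norm_mult)

lemma l2_uminus [intro]: "l2 M f ==> l2 M (%w. - f w)"
 by (rule l2_bound[of M f _ 1]) (auto simp: l2_def)

lemma l2_diff [intro]: "l2 M f ==> l2 M g ==> l2 M (%w. f w - g w)"
 using l2_add[of M f "%w. - g w"] by auto

lemma l2_zero [intro, simp]: "l2 M (%w. 0)"
 by (simp add: l2_def)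

lemma l2_sum [intro]: "(!!i. i : I ==> l2 M (f i)) ==> l2 M (%w. SUM i:I. f i w)"
 by (induction I rule: infinite_finite_induct) auto

lemma borel_measurable_vec_nth [measurable]: "(%x::complex^'d::finite. x $ i) : borel_measurable borel"
 by (intro borel_measurable_continuous_onI continuous_intros)

lemma l2_nth [intro]: "l2 M F ==> l2 M (%w. F w $ i)" for F :: "'w => complex^'d::finite"
 by (rule l2_bound[of M F _ 1])
  (auto simp: l2_def Finite_Cartesian_Product.norm_nth_le intro: measurable_compose[OF _ borel_measurable_vec_nth])

lemma l2_cart_norm2: "(norm x)^2 = (SUM i:UNIV. (cmod (x $ i))^2)" for x :: "complex^'d::finite"
 by (simp add: norm_vec_def L2_set_def sum_nonneg)

lemma measurable_vec_lambda:
 "(!!i. f i : borel_measurable M) ==> (%w. (\<chi> i. f i w) :: 'b::euclidean_space^'d::finite) : borel_measurable M"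
proof -
 assume a: "!!i. f i : borel_measurable M"
 have "(%w. (\<chi> i. f i w) :: 'b^'d) = (%w. SUM i:UNIV. axis i (f i w))"
  by (simp add: fun_eq_iff vec_eq_iff axis_def sum.delta)
 moreover have "(%w. axis i (f i w) :: 'b^'d) : borel_measurable M" for i
 proof -
  have "linear (axis i :: 'b => 'b^'d)"
  by (auto simp: linear_iff vec_eq_iff axis_def)
  hence "continuous_on UNIV (axis i :: 'b => 'b^'d)"
  by (simp add: linear_continuous_on linear_conv_bounded_linear)
  thus ?thesis using a[of i] borel_measurable_continuous_onI measurable_compose by blast
 qed
 ultimately show ?thesis by simp
qed

lemma l2_vec [intro]:
 assumes "!!i. l2 M (f i)" shows "l2 M (%w. (\<chi> i. f i w) :: complex^'d::finite)"
 using assms by (auto simp: l2_def l2_cart_norm2 intro!: measurable_vec_lambda)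

lemma integrable_ip:
 assumes "l2 M f" "l2 M g" shows "integrable M (%w. f w \<bullet> g w)"
proof -
 have "integrable M (%w. (norm (f w))^2 + (norm (g w))^2)"
  using assms by (simp add: l2_def)
 thus ?thesis
 proof (rule Bochner_Integration.integrable_bound)
  show "AE x in M. norm (f x \<bullet> g x) <= norm ((norm (f x))^2 + (norm (g x))^2)"
  proof (rule AE_I2)
  fix x
  have "\<bar>f x \<bullet> g x\<bar> <= norm (f x) * norm (g x)" by (rule Cauchy_Schwarz_ineq2)
  also have "... <= (norm (f x))^2 + (norm (g x))^2"
  using sum_squares_bound[of "norm (f x)" "norm (g x)"]
  mult_nonneg_nonneg[OF norm_ge_zero[of "f x"] norm_ge_zero[of "g x"]] by linarith
  finally show "norm (f x \<bullet> g x) <= norm ((norm (f x))^2 + (norm (g x))^2)" by simp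
  qed
 qed (use assms in \<open>auto simp: l2_def\<close>)
qed

lemma ip_add_left: "l2 M f ==> l2 M g ==> l2 M h ==> ip M (%w. f w + g w) h = ip M f h + ip M g h"
 by (simp add: ip_def inner_add_left integrable_ip)

lemma ip_diff_left: "l2 M f ==> l2 M g ==> l2 M h ==> ip M (%w. f w - g w) h = ip M f h - ip M g h"
 by (simp add: ip_def inner_diff_left integrable_ip)

lemma ip_add_right: "l2 M f ==> l2 M g ==> l2 M h ==> ip M h (%w. f w + g w) = ip M h f + ip M h g"
 by (simp add: ip_def inner_add_right integrable_ip)

lemma ip_diff_right: "l2 M f ==> l2 M g ==> l2 M h ==> ip M h (%w. f w - g w) = ip M h f - ip M h g"
 by (simp add: ip_def inner_diff_right integrable_ip)

lemma ip_scaleR_left [simp]: "ip M (%w. c *. f w) g = c * ip M f g"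
 and ip_scaleR_right [simp]: "ip M g (%w. c *. f w) = c * ip M g f"
 and ip_minus_left [simp]: "ip M (%w. - f w) g = - ip M f g"
 and ip_minus_right [simp]: "ip M g (%w. - f w) = - ip M g f"
 by (simp_all add: ip_def)

lemma ip_sum_right: "(!!i. i : I ==> l2 M (f i)) ==> l2 M h ==>
  ip M h (%w. SUM i:I. f i w) = (SUM i:I. ip M h (f i))"
 by (simp add: ip_def inner_sum_right integrable_ip)

lemma ip_cart: "l2 M F ==> l2 M G ==> ip M F G = (SUM i:UNIV. ip M (%w. F w $ i) (%w. G w $ i))"
 for F G :: "'w => complex^'d::finite"
 unfolding ip_def inner_vec_def by (rule Bochner_Integration.integral_sum) (intro integrable_ip; blast)

lemma nn_cart_sq: "l2 M F ==> (nn M F)^2 = (SUM i:UNIV. (nn M (%w. F w $ i))^2)"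
 for F :: "'w => complex^'d::finite"
 by (simp add: nn_sq_ip ip_cart)

lemma nn_add_sq:
 "l2 M f ==> l2 M g ==> (nn M (%w. f w + g w))^2 = (nn M f)^2 + 2 * ip M f g + (nn M g)^2"
 by (simp add: nn_sq_ip ip_add_left ip_add_right l2_add ip_commute[of M g f])

lemma nn_diff_sq:
 "l2 M f ==> l2 M g ==> (nn M (%w. f w - g w))^2 = (nn M f)^2 - 2 * ip M f g + (nn M g)^2"
 by (simp add: nn_sq_ip ip_diff_left ip_diff_right l2_diff ip_commute[of M g f])

lemma nn_scaleR [simp]: "nn M (%w. c *. f w) = \<bar>c\<bar> * nn M f"
 by (simp add: nn_def power_mult_distrib real_sqrt_mult)

lemma nn_mult [simp]: "nn M (%w. c * f w) = norm c * nn M f" for f :: "'w => complex"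
 by (simp add: nn_def power_mult_distrib norm_mult real_sqrt_mult)

lemma nn_uminus [simp]: "nn M (%w. - f w) = nn M f"
 by (simp add: nn_def)

lemma nn_zero [simp]: "nn M (%w. 0) = 0"
 by (simp add: nn_def)

text \<open>Discriminant argument: the squared norm of s f + t g is a nonnegative quadratic form in
  (s, t).\<close>

lemma ip_le:
 assumes "l2 M f" "l2 M g" shows "\<bar>ip M f g\<bar> <= nn M f * nn M g"
proof -
 define A B where "A = nn M f" and "B = nn M g"
 have "0 <= (nn M (%w. s *. f w + t *. g w))^2" for s t by simp
 hence q: "0 <= s^2 * A^2 + 2 * (s * t * ip M f g) + t^2 * B^2" for s t
  using assms by (subst (asm) nn_add_sq) (auto simp: A_def B_def power_mult_distrib mult_ac)
 have AB: "A >= 0" "B >= 0" by (auto simp: A_def B_def)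
 have "(ip M f g)^2 <= A^2 * B^2"
 proof (cases "A = 0")
  case True
  have "ip M f g = 0"
  proof (rule ccontr)
  assume i: "ip M f g ~= 0"
  \<comment> \<open>If the norm of f vanishes, the form is linear in s; at this s, with t = 1, it
    takes the value -1.\<close>
  from q[of "- (B^2 + 1) / (2 * ip M f g)" 1] i have "0 <= - (B^2+1) + B^2"
  by (simp add: True field_simps)
  thus False by simp
  qed
  thus ?thesis by (simp add: True)
 next
  case False
  have "0 <= A^2 * (A^2 * B^2 - (ip M f g)^2)"
  using q[of "- ip M f g" "A^2"] by (simp add: power2_eq_square algebra_simps)
  thus ?thesis using False by (simp add: zero_le_mult_iff)
 qed
 hence "(ip M f g)^2 <= (A * B)^2" by (simp add: power_mult_distrib)
 thus ?thesis using AB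
  by (metis A_def B_def abs_le_square_iff abs_of_nonneg mult_nonneg_nonneg)
qed

lemma nn_triangle:
 assumes "l2 M f" "l2 M g" shows "nn M (%w. f w + g w) <= nn M f + nn M g"
proof (rule power2_le_imp_le)
 show "(nn M (%w. f w + g w))^2 <= (nn M f + nn M g)^2"
  using ip_le[OF assms] by (simp add: nn_add_sq assms power2_sum)
qed simp

lemma nn_triangle_diff:
 assumes "l2 M f" "l2 M g" shows "nn M (%w. f w - g w) <= nn M f + nn M g"
 using nn_triangle[of M f "%w. - g w"] assms by auto

lemma nn_triangle_sub:
 assumes "l2 M f" "l2 M g" shows "nn M f <= nn M g + nn M (%w. f w - g w)"
 using nn_triangle[of M g "%w. f w - g w"] assms by auto

lemma nn_minus_commute: "nn M (%w. f w - g w) = nn M (%w. g w - f w)"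
 by (simp add: nn_def norm_minus_commute)

lemma nn_triangle3:
 assumes "l2 M f" "l2 M g" "l2 M h"
 shows "nn M (%w. f w - h w) <= nn M (%w. f w - g w) + nn M (%w. g w - h w)"
 using nn_triangle[of M "%w. f w - g w" "%w. g w - h w"] assms by auto

lemma nn_sum_le: "finite I ==> (!!i. i : I ==> l2 M (f i)) ==>
 nn M (%w. SUM i:I. f i w) <= (SUM i:I. nn M (f i))"
proof (induction I rule: finite_induct)
 case (insert x F)
 have "nn M (%w. SUM i:insert x F. f i w) = nn M (%w. f x w + (SUM i:F. f i w))"
  using insert by simp
 also have "... <= nn M (f x) + nn M (%w. SUM i:F. f i w)" using insert by (intro nn_triangle) auto
 finally show ?case using insert by auto
qed simp

lemma nn_cong_AE: "f : borel_measurable M ==> g : borel_measurable M ==> AE w in M. f w = g w ==> nn M f = nn M g"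
 unfolding nn_def by (auto intro!: integral_cong_AE)

lemma nn_mono_AE:
 assumes "l2 M g" "f : borel_measurable M" "AE w in M. norm (f w) <= C * norm (g w)" "C >= 0"
 shows "nn M f <= C * nn M g"
proof -
 have "(nn M f)^2 <= (\<integral>w. C^2 * (norm (g w))^2 \<partial>M)"
  unfolding nn_sq
 proof (rule integral_mono_AE)
  show "integrable M (%w. (norm (f w))^2)" using l2_bound[OF assms(1-3)] by (simp add: l2_def)
  show "AE x in M. (norm (f x))^2 <= C^2 * (norm (g x))^2"
  using assms(3) by eventually_elim (simp add: power_mult_distrib[symmetric] power_mono)
 qed (use assms in \<open>auto simp: l2_def\<close>)
 also have "... = (C * nn M g)^2" by (simp add: nn_sq power_mult_distrib)
 finally show ?thesis using assms(4) by (auto intro: power2_le_imp_le)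
qed

lemma nn_zero_AE:
 assumes "l2 M f" "nn M f = 0" shows "AE w in M. f w = 0"
proof -
 have "(\<integral>w. (norm (f w))^2 \<partial>M) = 0" using assms(2) by (simp add: nn_def)
 hence "AE w in M. (norm (f w))^2 = 0"
  by (subst (asm) integral_nonneg_eq_0_iff_AE) (use assms in \<open>auto simp: l2_def\<close>)
 thus ?thesis by simp
qed

section \<open>Composition with measure-preserving maps\<close>

lemma mpres_meas [measurable_dest]: "mpres M h ==> h : measurable M M"
 by (simp add: mpres_def)

lemma mpres_integral:
 fixes f :: "'w => 'b::{banach,second_countable_topology}"
 assumes "mpres M h" and [measurable]: "f : borel_measurable M"
 shows "(\<integral>w. f (h w) \<partial>M) = (\<integral>w. f w \<partial>M)"
proof -
 have [measurable]: "h : measurable M M" and d: "distr M M h = M" using assms by (auto simp: mpres_def)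
 have "(\<integral>w. f w \<partial>M) = (\<integral>w. f w \<partial>distr M M h)" by (simp add: d)
 also have "... = (\<integral>w. f (h w) \<partial>M)" by (rule integral_distr) simp_all
 finally show ?thesis by simp
qed

lemma mpres_integrable:
 fixes f :: "'w => 'b::{banach,second_countable_topology}"
 assumes "mpres M h" and [measurable]: "f : borel_measurable M"
 shows "integrable M (%w. f (h w)) = integrable M f"
proof -
 have [measurable]: "h : measurable M M" and d: "distr M M h = M" using assms by (auto simp: mpres_def)
 have "integrable M f = integrable (distr M M h) f" by (simp add: d)
 also have "... = integrable M (%w. f (h w))" by (rule integrable_distr_eq) simp_all
 finally show ?thesis by simp
qed

lemma mpres_AE:
 assumes "mpres M h" "AE w in M. P w" shows "AE w in M. P (h w)"
proof -
 have [measurable]: "h : measurable M M" and d: "distr M M h = M" using assms by (auto simp: mpres_def)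
 have "AE w in distr M M h. P w" using assms(2) unfolding d .
 thus ?thesis by (rule AE_distrD[rotated]) simp
qed

lemma l2_comp: "l2 M f ==> mpres M h ==> l2 M (%w. f (h w))"
 by (auto simp: l2_def mpres_integrable[of M h "%w. (norm (f w))^2"] mpres_def intro: measurable_compose)

lemma nn_comp: "l2 M f ==> mpres M h ==> nn M (%w. f (h w)) = nn M f"
 unfolding nn_def by (subst mpres_integral[of M h "%w. (norm (f w))^2"]) (auto dest: l2_meas l2_sq)

section \<open>L2 over a probability space: completeness and contractions\<close>

context prob_space
begin

lemma l2_const [intro, simp]: "l2 M (%w. c)"
 by (simp add: l2_def)

lemma nn_const [simp]: "nn M (%w. c) = norm c"
 by (simp add: nn_def prob_space)

lemma ip_const_const [simp]: "ip M (%w. a) (%w. b) = a \<bullet> b"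
 by (simp add: ip_def prob_space)

lemma l2_integrable [intro]:
 assumes "l2 M f" shows "integrable M f"
proof -
 have "integrable M (%w. 1 + (norm (f w))^2)" using assms by (simp add: l2_def)
 thus ?thesis
 proof (rule Bochner_Integration.integrable_bound)
  show "AE x in M. norm (f x) <= norm (1 + (norm (f x))^2)"
  proof (rule AE_I2)
  fix x
  have "2 * norm (f x) <= 1 + (norm (f x))^2" using sum_squares_bound[of 1 "norm (f x)"] by simp
  hence "norm (f x) <= 1 + (norm (f x))^2" using norm_ge_zero[of "f x"] by linarith
  thus "norm (f x) <= norm (1 + (norm (f x))^2)" by simp
  qed
 qed (use assms in \<open>auto simp: l2_def\<close>)
qed

lemma ip_const: "l2 M f ==> ip M f (%w. c) = expectation f \<bullet> c"
 unfolding ip_def by (rule integral_inner_left) auto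

lemma norm_expectation_le:
 assumes "l2 M f" shows "norm (expectation f) <= nn M f"
proof (cases "expectation f = 0")
 case False
 have "(norm (expectation f))^2 = ip M f (%w. expectation f)"
  by (simp add: ip_const assms power2_norm_eq_inner)
 also have "... <= nn M f * norm (expectation f)" using ip_le[of M f "%w. expectation f"] assms by simp
 finally show ?thesis using False by (simp add: power2_eq_square)
qed simp

lemma nn_bounded:
 assumes "f : borel_measurable M" "AE w in M. norm (f w) <= C" "0 <= C"
 shows "l2 M f" "nn M f <= C"
proof -
 have c: "AE w in M. norm (f w) <= 1 * norm C" using assms(2,3) by simp
 show "l2 M f" by (rule l2_bound[OF _ assms(1) c]) simp
 show "nn M f <= C" using nn_mono_AE[OF _ assms(1) c] assms(3) by simp
qed

lemma nn_center:
 assumes "l2 M f" shows "nn M (%w. f w - expectation f) <= nn M f"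
proof (rule power2_le_imp_le)
 show "(nn M (%w. f w - expectation f))^2 <= (nn M f)^2"
  by (simp add: nn_diff_sq assms ip_const power2_norm_eq_inner)
qed simp

lemma expectation_norm_le_nn:
 assumes "l2 M f" shows "expectation (%w. norm (f w)) <= nn M f"
proof -
 have [measurable]: "f : borel_measurable M" using assms by (rule l2_meas)
 have "l2 M (%w. norm (f w))" by (rule l2_bound[OF assms, where C = 1]) auto
 from norm_expectation_le[OF this] show ?thesis by (simp add: nn_def)
qed

text \<open>The sequence is Cauchy in L1 as well, so a subsequence converges almost everywhere;
  Fatou along that subsequence carries the rate \<open>b\<close> over to the limit. The explicit
  rate is kept because both later uses, a fixed-point iteration and a minimising sequence, come with
  one.\<close>

lemma l2_complete:
 fixes s :: "nat => 'a => 'b::euclidean_space"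
 assumes l2: "!!n. l2 M (s n)"
  and C: "!!n m. n <= m ==> nn M (%w. s n w - s m w) <= b n" and b: "b \<longlonglongrightarrow> 0"
 obtains f where "l2 M f" "!!n. nn M (%w. s n w - f w) <= b n"
proof -
 have [measurable]: "s n : borel_measurable M" for n using l2 by (simp add: l2_def)
 have int: "integrable M (s n)" for n using l2 by auto
 have "EX N. ALL i>=N. ALL j>=N. (LINT x|M. norm (s i x - s j x)) < e" if e: "e > 0" for e
 proof -
  obtain N where N: "!!n. n >= N ==> b n < e"
  using order_tendstoD(2)[OF b e] by (auto simp: eventually_sequentially)
  have *: "(LINT x|M. norm (s i x - s j x)) < e" if "i >= N" "i <= j" for i j
  using expectation_norm_le_nn[OF l2_diff[OF l2 l2], of i j] C[OF that(2)] N[OF that(1)] by linarith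
  show ?thesis
  proof (intro exI[of _ N] allI impI)
  fix i j assume "i >= N" "j >= N"
  thus "(LINT x|M. norm (s i x - s j x)) < e"
  using *[of i j] *[of j i] by (cases "i <= j") (auto simp: norm_minus_commute)
  qed
 qed
 then obtain r where r: "strict_mono r" "AE x in M. Cauchy (%i. s (r i) x)"
  using cauchy_L1_AE_cauchy_subseq[of M s] int by metis
 define f where "f = (%x. lim (%i. s (r i) x))"
 have [measurable]: "f : borel_measurable M" unfolding f_def by measurable
 have lim: "AE x in M. (%i. s (r i) x) \<longlonglongrightarrow> f x"
  using r(2) by eventually_elim (simp add: f_def Cauchy_convergent convergent_LIMSEQ_iff[symmetric])
 have b0: "b n >= 0" for n using C[of n n] by (auto intro: order_trans[OF nn_nonneg])
 have F: "(\<integral>\<^sup>+x. ennreal ((norm (s n x - f x))^2) \<partial>M) <= ennreal ((b n)^2)" for n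
 proof -
  have "(\<integral>\<^sup>+x. ennreal ((norm (s n x - f x))^2) \<partial>M)
  = (\<integral>\<^sup>+x. liminf (%i. ennreal ((norm (s n x - s (r i) x))^2)) \<partial>M)"
  proof (rule nn_integral_cong_AE)
  show "AE x in M. ennreal ((norm (s n x - f x))^2) = liminf (%i. ennreal ((norm (s n x - s (r i) x))^2))"
  using lim
  proof eventually_elim
  case (elim x)
  hence "(%i. ennreal ((norm (s n x - s (r i) x))^2)) \<longlonglongrightarrow> ennreal ((norm (s n x - f x))^2)"
  by (intro tendsto_intros)
  from lim_imp_Liminf[OF sequentially_bot this] show ?case by simp
  qed
  qed
  also have "... <= liminf (%i. \<integral>\<^sup>+x. ennreal ((norm (s n x - s (r i) x))^2) \<partial>M)"
  by (rule nn_integral_liminf) measurable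
  also have "... <= ennreal ((b n)^2)"
  proof (rule Liminf_le[OF sequentially_bot], rule eventually_sequentiallyI[of n])
  fix i assume "n <= i"
  hence "n <= r i" using seq_suble[OF r(1), of i] by linarith
  have "(\<integral>\<^sup>+x. ennreal ((norm (s n x - s (r i) x))^2) \<partial>M) = ennreal ((nn M (%w. s n w - s (r i) w))^2)"
  unfolding nn_sq using l2_diff[OF l2 l2] by (intro nn_integral_eq_integral) (auto simp: l2_def)
  also have "... <= ennreal ((b n)^2)"
  using C[OF \<open>n <= r i\<close>] by (intro ennreal_leI power_mono) auto
  finally show "(\<integral>\<^sup>+x. ennreal ((norm (s n x - s (r i) x))^2) \<partial>M) <= ennreal ((b n)^2)" .
  qed
  finally show ?thesis .
 qed
 have l: "l2 M (%w. s n w - f w)" for n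
  unfolding l2_def
 proof
  show "integrable M (%w. (norm (s n w - f w))^2)"
  by (rule integrableI_bounded) (use F[of n] in \<open>auto simp: le_less_trans\<close>)
 qed measurable
 have "nn M (%w. s n w - f w) <= b n" for n
 proof -
  have "ennreal ((nn M (%w. s n w - f w))^2) <= ennreal ((b n)^2)"
  unfolding nn_sq using F[of n] l[of n] by (subst nn_integral_eq_integral[symmetric]) (auto simp: l2_def)
  thus ?thesis using b0[of n] by (auto simp: intro: power2_le_imp_le)
 qed
 moreover have "l2 M f" using l2_diff[OF l2[of 0] l[of 0]] by simp
 ultimately show ?thesis using that by blast
qed

text \<open>Banach iteration from 0, with the geometric tail as rate for \<open>l2_complete\<close>.
  Functions are not identified up to null sets, so the fixed-point equation appears as a vanishing
  norm.\<close>

lemma l2_fixpoint: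
 fixes K :: "('a => 'b::euclidean_space) => 'a => 'b"
 assumes K: "!!f. l2 M f ==> l2 M (K f)"
  and c: "!!f g. l2 M f ==> l2 M g ==> nn M (%w. K f w - K g w) <= q * nn M (%w. f w - g w)"
  and q: "0 <= q" "q < 1"
 obtains f where "l2 M f" "nn M (%w. K f w - f w) = 0"
proof -
 define s where "s n = (K ^^ n) (%_. 0)" for n
 have l: "l2 M (s n)" for n unfolding s_def by (induction n) (auto intro: K)
 define C where "C = nn M (%w. s 0 w - s 1 w)"
 have st: "nn M (%w. s n w - s (Suc n) w) <= q ^ n * C" for n
 proof (induction n)
  case (Suc n)
  have "nn M (%w. s (Suc n) w - s (Suc (Suc n)) w) <= q * nn M (%w. s n w - s (Suc n) w)"
  using c[OF l[of n] l[of "Suc n"]] by (simp add: s_def)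
  also have "... <= q * (q ^ n * C)" using Suc q by (intro mult_left_mono)
  finally show ?case by simp
 qed (simp add: C_def)
 have C0: "C >= 0" by (simp add: C_def)
 have st2: "nn M (%w. s n w - s (n + k) w) <= (q ^ n - q ^ (n+k)) / (1 - q) * C" for n k
 proof (induction k)
  case (Suc k)
  have "nn M (%w. s n w - s (n + Suc k) w) <= nn M (%w. s n w - s (n + k) w) + nn M (%w. s (n+k) w - s (Suc (n + k)) w)"
  using nn_triangle3[OF l[of n] l[of "n+k"] l[of "n + Suc k"]] by simp
  also have "... <= (q ^ n - q ^ (n+k)) / (1 - q) * C + q ^ (n+k) * C" using Suc st by (intro add_mono)
  also have "... = (q ^ n - q ^ (n+Suc k)) / (1 - q) * C"
  using q by (simp add: field_simps)
  finally show ?case .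
 qed simp
 define b where "b n = q ^ n / (1 - q) * C" for n
 have "nn M (%w. s n w - s m w) <= b n" if "n <= m" for n m
 proof -
  have "nn M (%w. s n w - s m w) <= (q ^ n - q ^ m) / (1 - q) * C" using st2[of n "m - n"] that by simp
  also have "... <= b n" unfolding b_def using q C0 by (intro mult_right_mono divide_right_mono) auto
  finally show ?thesis .
 qed
 moreover have b: "b \<longlonglongrightarrow> 0" unfolding b_def
  by (rule tendsto_eq_intros LIMSEQ_power_zero | use q in simp)+
 ultimately obtain f where f: "l2 M f" "!!n. nn M (%w. s n w - f w) <= b n"
  using l2_complete[of s b] l by metis
 have "nn M (%w. K f w - f w) <= 2 * b n" for n
 proof -
  have "nn M (%w. K f w - f w) <= nn M (%w. K f w - s (Suc n) w) + nn M (%w. s (Suc n) w - f w)"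
  by (rule nn_triangle3) (auto intro: K f l)
  also have "nn M (%w. K f w - s (Suc n) w) <= q * nn M (%w. f w - s n w)"
  using c[OF f(1) l[of n]] by (simp add: s_def)
  also have "... <= 1 * b n" using f(2)[of n] q by (intro mult_mono) (auto simp: nn_minus_commute)
  also have "nn M (%w. s (Suc n) w - f w) <= b (Suc n)" by (rule f(2))
  also have "b (Suc n) <= b n" unfolding b_def using q C0
  by (intro mult_right_mono divide_right_mono) (auto simp: mult_left_le_one_le)
  finally show ?thesis by simp
 qed
 moreover have "(%n. 2 * b n) \<longlonglongrightarrow> 0" using tendsto_mult[OF tendsto_const b] by fastforce
 ultimately have "nn M (%w. K f w - f w) <= 0" by (meson LIMSEQ_le_const)
 thus ?thesis using that[OF f(1)] by (simp add: order_antisym)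
qed

end

section \<open>Elliptic real matrices acting on complex vectors\<close>

definition ellip :: "real => real => real^'d^'d => bool" where
 "ellip l L A \<longleftrightarrow> transpose A = A & (ALL xi. l * (xi \<bullet> xi) <= xi \<bullet> (A *v xi) & xi \<bullet> (A *v xi) <= L * (xi \<bullet> xi))"

definition cmv :: "real^'d::finite^'d => complex^'d => complex^'d" where
 "cmv A F = (\<chi> i. SUM k:UNIV. cr (A $ i $ k) * F $ k)"

definition reV :: "complex^'d::finite => real^'d" where "reV F = (\<chi> i. Re (F $ i))"
definition imV :: "complex^'d::finite => real^'d" where "imV F = (\<chi> i. Im (F $ i))"

lemma inner_reV_imV: "F \<bullet> G = reV F \<bullet> reV G + imV F \<bullet> imV G"
 by (simp add: inner_vec_def inner_complex_def reV_def imV_def sum.distrib)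

lemma reV_cmv: "reV (cmv A F) = A *v reV F" and imV_cmv: "imV (cmv A F) = A *v imV F"
 by (simp_all add: vec_eq_iff reV_def imV_def cmv_def matrix_vector_mult_def)

lemma cmv_add: "cmv A (F + G) = cmv A F + cmv A G"
 and cmv_diff: "cmv A (F - G) = cmv A F - cmv A G"
 by (simp_all add: vec_eq_iff cmv_def algebra_simps sum.distrib sum_subtractf)

lemma norm_sq_reV_imV: "(norm F)^2 = reV F \<bullet> reV F + imV F \<bullet> imV F"
 by (simp add: power2_norm_eq_inner inner_reV_imV)

lemma sym_inner: "transpose A = A ==> x \<bullet> (A *v y) = (A *v x) \<bullet> y" for A :: "real^'d::finite^'d"
 by (metis dot_lmul_matrix vector_transpose_matrix)

text \<open>Positivity of the form at x - (1/c) B x, combined with the upper bound at B x. This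
  takes the place of a square root of B.\<close>

lemma psd_norm_le:
 fixes B :: "real^'d::finite^'d"
 assumes s: "transpose B = B" and p: "!!x. 0 <= x \<bullet> (B *v x)" and c: "!!x. x \<bullet> (B *v x) <= c * (x \<bullet> x)" "c > 0"
 shows "(B *v x) \<bullet> (B *v x) <= c * (x \<bullet> (B *v x))"
proof -
 define y where "y = B *v x"
 have "0 <= (x - (1/c) *. y) \<bullet> (B *v (x - (1/c) *. y))" by (rule p)
 also have "... = x \<bullet> y - (2/c) * (y \<bullet> y) + (1/c)^2 * (y \<bullet> (B *v y))"
  using sym_inner[OF s, of x y]
  by (simp add: y_def[symmetric] matrix_vector_mult_diff_distrib matrix_vector_mult_scaleR inner_diff_left inner_diff_right
  power2_eq_square algebra_simps inner_commute)
 also have "(1/c)^2 * (y \<bullet> (B *v y)) <= (1/c)^2 * (c * (y \<bullet> y))" by (intro mult_left_mono c) auto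
 finally have "0 <= x \<bullet> y - (1/c) * (y \<bullet> y)" using c(2) by (simp add: power2_eq_square)
 thus ?thesis using c(2) by (simp add: y_def[symmetric] field_simps)
qed

lemma mat_mult_vec: "mat c *v x = c *. x" for x :: "real^'d::finite"
 by (simp add: vec_eq_iff matrix_vector_mult_def mat_def if_distrib if_distribR sum.delta cong: if_cong)

lemma
 assumes e: "ellip l L A" and l: "0 <= l" and L: "0 < L"
 shows ellip_lower: "l * (norm F)^2 <= F \<bullet> cmv A F"
  and ellip_upper: "F \<bullet> cmv A F <= L * (norm F)^2"
  and ellip_norm: "(norm (cmv A F))^2 <= L * (F \<bullet> cmv A F)"
  and ellip_defect: "(norm (L *. F - cmv A F))^2 <= L * (L - l) * (norm F)^2"
proof -
 have s: "transpose A = A" and b: "l * (x \<bullet> x) <= x \<bullet> (A *v x)" "x \<bullet> (A *v x) <= L * (x \<bullet> x)" for x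
  using e by (auto simp: ellip_def)
 have p: "0 <= x \<bullet> (A *v x)" for x using b(1)[of x] l by (meson inner_ge_zero mult_nonneg_nonneg order_trans)
 show "l * (norm F)^2 <= F \<bullet> cmv A F"
  using b(1)[of "reV F"] b(1)[of "imV F"]
  by (simp add: norm_sq_reV_imV inner_reV_imV reV_cmv imV_cmv algebra_simps)
 show "F \<bullet> cmv A F <= L * (norm F)^2"
  using b(2)[of "reV F"] b(2)[of "imV F"]
  by (simp add: norm_sq_reV_imV inner_reV_imV reV_cmv imV_cmv algebra_simps)
 show "(norm (cmv A F))^2 <= L * (F \<bullet> cmv A F)"
  using psd_norm_le[OF s p b(2) L, of "reV F"] psd_norm_le[OF s p b(2) L, of "imV F"]
  by (simp add: norm_sq_reV_imV inner_reV_imV reV_cmv imV_cmv algebra_simps)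
 define B where "B = mat L - A"
 have Bx: "B *v x = L *. x - A *v x" for x
  by (simp add: B_def matrix_vector_mult_diff_rdistrib mat_mult_vec)
 have sB: "transpose B = B" using s by (simp add: B_def transpose_def vec_eq_iff mat_def)
 have pB: "0 <= x \<bullet> (B *v x)" for x using b(2)[of x] by (simp add: Bx inner_diff_right)
 have cB: "x \<bullet> (B *v x) <= (L - l) * (x \<bullet> x)" for x using b(1)[of x] by (simp add: Bx inner_diff_right algebra_simps)
 have cB': "x \<bullet> (B *v x) <= L * (x \<bullet> x)" for x using p[of x] by (simp add: Bx inner_diff_right algebra_simps)
 \<comment> \<open>\<open>psd_norm_le\<close> asks for a positive constant and L - l may be 0, so it
   is applied with L. The product L (L - l) results instead of the square of L - l; for l > 0 it is
   still below L^2, which is all that a contraction requires.\<close>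
 have q: "(B *v x) \<bullet> (B *v x) <= L * (L - l) * (x \<bullet> x)" for x
  using psd_norm_le[OF sB pB cB' L, of x] mult_left_mono[OF cB[of x] less_imp_le[OF L]] by (simp add: mult.assoc)
 have "reV (L *. F - cmv A F) = B *v reV F" "imV (L *. F - cmv A F) = B *v imV F"
  unfolding Bx unfolding reV_cmv[symmetric] imV_cmv[symmetric] by (simp_all add: reV_def imV_def vec_eq_iff)
 thus "(norm (L *. F - cmv A F))^2 <= L * (L - l) * (norm F)^2"
  using q[of "reV F"] q[of "imV F"] by (simp add: norm_sq_reV_imV algebra_simps)
qed

lemma coeff_ok_ellip: "coeff_ok M l L a \<longleftrightarrow> a : borel_measurable M & (ALL w:space M. ellip l L (a w))"
 by (simp add: coeff_ok_def ellip_def)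

lemma ellip_mat: "l <= L ==> ellip l L (mat L :: real^'d::finite^'d)"
 by (auto simp: ellip_def mat_mult_vec transpose_mat intro: mult_right_mono)

lemma cmv_mat [simp]: "cmv (mat L) F = L *. F"
 by (simp add: vec_eq_iff cmv_def mat_def if_distrib if_distribR sum.delta scaleR_conv_of_real[where 'a=complex] cong: if_cong)

lemma borel_measurable_mat_nth: "(%x::real^'d::finite^'d. x $ i $ j) : borel_measurable borel"
 by (intro borel_measurable_continuous_onI continuous_intros)

lemma cmv_measurable:
 assumes "A : borel_measurable M" "F : borel_measurable M"
 shows "(%w. cmv (A w) (F w)) : borel_measurable M"
proof -
 have [measurable]: "(%w. A w $ i $ j) : borel_measurable M" "(%w. F w $ j) : borel_measurable M" for i j
  using measurable_compose[OF assms(1) borel_measurable_mat_nth] measurable_compose[OF assms(2) borel_measurable_vec_nth]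
  by auto
 show ?thesis unfolding cmv_def by (rule measurable_vec_lambda) measurable
qed

lemma l2_cmv:
 assumes "coeff_ok M l L A" "0 <= l" "0 < L" "l2 M F"
 shows "l2 M (%w. cmv (A w) (F w))"
proof (rule l2_bound[OF assms(4), where C = L])
 show "(%w. cmv (A w) (F w)) : borel_measurable M"
  using assms by (auto simp: coeff_ok_def l2_def intro: cmv_measurable)
 show "AE w in M. norm (cmv (A w) (F w)) <= L * norm (F w)"
 proof (rule AE_I2)
  fix w assume "w : space M"
  hence e: "ellip l L (A w)" using assms(1) by (auto simp: coeff_ok_ellip)
  have "(norm (cmv (A w) (F w)))^2 <= L * (L * (norm (F w))^2)"
  using ellip_norm[OF e assms(2,3), of "F w"]
  mult_left_mono[OF ellip_upper[OF e assms(2,3), of "F w"] less_imp_le[OF assms(3)]] by linarith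
  also have "... = (L * norm (F w))^2" by (simp add: power2_eq_square)
  finally show "norm (cmv (A w) (F w)) <= L * norm (F w)"
  by (rule power2_le_imp_le) (use assms(3) in simp)
 qed
qed

lemma
 assumes A: "coeff_ok M l L A" and l: "0 <= l" and L: "0 < L" and F: "l2 M F"
  and lL: "l <= L"
 shows ip_cmv_lower: "l * (nn M F)^2 <= ip M F (%w. cmv (A w) (F w))"
  and ip_cmv_upper: "ip M F (%w. cmv (A w) (F w)) <= L * (nn M F)^2"
  and nn_cmv_sq: "(nn M (%w. cmv (A w) (F w)))^2 <= L * ip M F (%w. cmv (A w) (F w))"
  and nn_cmv_defect: "nn M (%w. L *. F w - cmv (A w) (F w)) <= sqrt (L * (L - l)) * nn M F"
proof -
 note c = l2_cmv[OF A l L F]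
 note i = integrable_ip[OF F c] l2_sq[OF F] l2_sq[OF c] l2_sq[OF l2_diff[OF l2_scaleR[OF F] c], of L]
 have e: "ellip l L (A w)" if "w : space M" for w using A that by (auto simp: coeff_ok_ellip)
 show "l * (nn M F)^2 <= ip M F (%w. cmv (A w) (F w))"
  unfolding nn_sq ip_def integral_mult_right_zero[symmetric]
  by (intro integral_mono ellip_lower[OF e l L]) (use i in auto)
 show "ip M F (%w. cmv (A w) (F w)) <= L * (nn M F)^2"
  unfolding nn_sq ip_def integral_mult_right_zero[symmetric]
  by (intro integral_mono ellip_upper[OF e l L]) (use i in auto)
 show "(nn M (%w. cmv (A w) (F w)))^2 <= L * ip M F (%w. cmv (A w) (F w))"
  unfolding nn_sq ip_def integral_mult_right_zero[symmetric]
  by (intro integral_mono ellip_norm[OF e l L]) (use i in auto)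
 have "(nn M (%w. L *. F w - cmv (A w) (F w)))^2 <= L * (L - l) * (nn M F)^2"
  unfolding nn_sq ip_def integral_mult_right_zero[symmetric]
  by (intro integral_mono ellip_defect[OF e l L]) (use i in auto)
 hence "(nn M (%w. L *. F w - cmv (A w) (F w)))^2 <= (sqrt (L * (L - l)) * nn M F)^2"
  using l L lL by (simp add: power_mult_distrib)
 thus "nn M (%w. L *. F w - cmv (A w) (F w)) <= sqrt (L * (L - l)) * nn M F"
  by (rule power2_le_imp_le) (use l L lL in auto)
qed

section \<open>Differences twisted by a frequency\<close>

definition Dv :: "(int^'d::finite => 'w => 'w) => real^'d => ('w => complex) => 'w => complex^'d" where
 "Dv T xi ps w = (\<chi> j. dxi T xi j ps w)"

definition Ds :: "(int^'d::finite => 'w => 'w) => real^'d => ('w => complex^'d) => 'w => complex" where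
 "Ds T xi F w = (SUM i:UNIV. dxis T xi i (%w. F w $ i) w)"

text \<open>The symbol of the twisted gradient: \<open>Dv\<close> maps the constant function 1 to
  this vector.\<close>

definition ev :: "real^'d::finite => complex^'d" where
 "ev xi = (\<chi> j. em (xi $ j) - 1)"

lemma norm_phase [simp]: "cmod (exp (- (\<i> * cr x))) = 1" "cmod (ei x) = 1"
 by (simp_all add: norm_exp_eq_Re)

lemma cnj_phase: "cnj (exp (- (\<i> * cr x))) = ei x"
 by (simp add: exp_cnj)

lemma inner_cmult_left: "(c * z) \<bullet> wa = z \<bullet> (cnj c * wa)" for c z wa :: complex
 by (simp add: inner_complex_def algebra_simps)

lemma Dv_nth [simp]: "Dv T xi ps w $ j = dxi T xi j ps w"
 by (simp add: Dv_def)

lemma dxi_add: "dxi T xi j (%w. f w + g w) w = dxi T xi j f w + dxi T xi j g w"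
 and dxi_diff: "dxi T xi j (%w. f w - g w) w = dxi T xi j f w - dxi T xi j g w"
 and dxi_mult: "dxi T xi j (%w. c * f w) w = c * dxi T xi j f w"
 and dxi_scaleR: "dxi T xi j (%w. r *. f w) w = r *. dxi T xi j f w"
 and dxi_const: "dxi T xi j (%w. c) w = ev xi $ j * c"
 and dxis_add: "dxis T xi j (%w. f w + g w) w = dxis T xi j f w + dxis T xi j g w"
 and dxis_diff: "dxis T xi j (%w. f w - g w) w = dxis T xi j f w - dxis T xi j g w"
 and dxis_mult: "dxis T xi j (%w. c * f w) w = c * dxis T xi j f w"
 and dxis_scaleR: "dxis T xi j (%w. r *. f w) w = r *. dxis T xi j f w"
 and dxis_const: "dxis T xi j (%w. c) w = cnj (ev xi $ j) * c"
 by (simp_all add: dxi_def dxis_def ev_def algebra_simps exp_cnj scaleR_conv_of_real)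

lemma dxi_sum: "dxi T xi j (%w. SUM i:I. f i w) w = (SUM i:I. dxi T xi j (f i) w)"
 and dxis_sum: "dxis T xi j (%w. SUM i:I. f i w) w = (SUM i:I. dxis T xi j (f i) w)"
 by (simp_all add: dxi_def dxis_def sum_distrib_left sum_subtractf)

lemma Dv_add: "Dv T xi (%w. f w + g w) w = Dv T xi f w + Dv T xi g w"
 and Dv_diff: "Dv T xi (%w. f w - g w) w = Dv T xi f w - Dv T xi g w"
 and Dv_scaleR: "Dv T xi (%w. r *. f w) w = r *. Dv T xi f w"
 by (simp_all add: vec_eq_iff dxi_add dxi_diff dxi_scaleR)

lemma Ds_add: "Ds T xi (%w. F w + G w) w = Ds T xi F w + Ds T xi G w"
 and Ds_diff: "Ds T xi (%w. F w - G w) w = Ds T xi F w - Ds T xi G w"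
 and Ds_scaleR: "Ds T xi (%w. r *. F w) w = r *. Ds T xi F w"
 and Ds_const: "Ds T xi (%w. C) w = (SUM i:UNIV. cnj (ev xi $ i) * C $ i)"
 by (simp_all add: Ds_def dxis_add dxis_diff dxis_scaleR dxis_const sum.distrib sum_subtractf scaleR_right.sum)

lemma nn_cong: "(!!w. w : space M ==> f w = g w) ==> nn M f = nn M g"
 unfolding nn_def by (auto intro!: arg_cong[where f=sqrt] Bochner_Integration.integral_cong)

lemma ip_cong: "(!!w. w : space M ==> f w = f' w) ==> (!!w. w : space M ==> g w = g' w) ==> ip M f g = ip M f' g'"
 unfolding ip_def by (auto intro!: Bochner_Integration.integral_cong)

locale space_shift = prob_space M for M :: "'w measure" +
 fixes T :: "int^'d::finite => 'w => 'w"
 assumes T_mpres: "mpres M (T x)"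
  and T_0: "w : space M ==> T 0 w = w"
  and T_plus: "w : space M ==> T (x + y) w = T x (T y w)"
begin

lemma T_measurable [measurable]: "T x : measurable M M"
 using T_mpres by (simp add: mpres_def)

lemma T_space: "w : space M ==> T x w : space M"
 using T_measurable by (auto simp: measurable_def)

lemma T_commute: "w : space M ==> T x (T y w) = T y (T x w)"
 by (metis T_plus add.commute)

lemma T_uminus [simp]: "w : space M ==> T x (T (- x) w) = w" "w : space M ==> T (- x) (T x w) = w"
 by (simp_all add: T_plus[symmetric] T_0)

lemma l2_T: "l2 M f ==> l2 M (%w. f (T x w))"
 by (rule l2_comp[OF _ T_mpres])

lemma nn_T: "l2 M f ==> nn M (%w. f (T x w)) = nn M f"
 by (rule nn_comp[OF _ T_mpres])

lemma l2_dxi [intro]: "l2 M f ==> l2 M (dxi T xi j f)"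
 unfolding dxi_def[abs_def] by (intro l2_diff l2_mult l2_T)

lemma l2_dxis [intro]: "l2 M f ==> l2 M (dxis T xi j f)"
 unfolding dxis_def[abs_def] by (intro l2_diff l2_mult l2_T)

lemma l2_Dv [intro]: "l2 M f ==> l2 M (Dv T xi f)"
 unfolding Dv_def[abs_def] by (intro l2_vec l2_dxi)

lemma l2_Ds [intro]: "l2 M F ==> l2 M (Ds T xi F)"
 unfolding Ds_def[abs_def] by (intro l2_sum l2_dxis l2_nth)

lemma nn_dxi_le: "l2 M f ==> nn M (dxi T xi j f) <= 2 * nn M f"
 unfolding dxi_def[abs_def]
 using nn_triangle_diff[of M "%w. em (xi $ j) * f (T (ue j) w)" f]
 by (simp add: nn_T l2_T l2_mult)

lemma nn_dxis_le: "l2 M f ==> nn M (dxis T xi j f) <= 2 * nn M f"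
 unfolding dxis_def[abs_def]
 using nn_triangle_diff[of M "%w. ei (xi $ j) * f (T (- ue j) w)" f]
 by (simp add: nn_T l2_T l2_mult)

lemma dxis_eq: "w : space M ==> dxis T xi j f w = - ei (xi $ j) * dxi T xi j f (T (- ue j) w)"
 by (simp add: dxis_def dxi_def algebra_simps exp_minus_inverse)

lemma nn_dxis_eq: "l2 M f ==> nn M (dxis T xi j f) = nn M (dxi T xi j f)"
proof -
 assume f: "l2 M f"
 have "nn M (dxis T xi j f) = nn M (%w. - ei (xi $ j) * dxi T xi j f (T (- ue j) w))"
  by (rule nn_cong) (rule dxis_eq)
 also have "... = nn M (dxi T xi j f)" using nn_T[OF l2_dxi[OF f], of xi j "- ue j"] by (subst nn_mult) simp
 finally show ?thesis .
qed

lemma dxi_commute: "w : space M ==> dxi T xi i (dxi T xi' j f) w = dxi T xi' j (dxi T xi i f) w"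
 by (simp add: dxi_def algebra_simps T_commute)

lemma dxi_dxis_commute: "w : space M ==> dxi T xi i (dxis T xi' j f) w = dxis T xi' j (dxi T xi i f) w"
 by (simp add: dxi_def dxis_def algebra_simps T_commute)

lemma dxis_commute: "w : space M ==> dxis T xi i (dxis T xi' j f) w = dxis T xi' j (dxis T xi i f) w"
 by (simp add: dxis_def algebra_simps T_commute)

lemma dxi_cong: "(!!w. w : space M ==> f w = g w) ==> w : space M ==> dxi T xi j f w = dxi T xi j g w"
 and dxis_cong: "(!!w. w : space M ==> f w = g w) ==> w : space M ==> dxis T xi j f w = dxis T xi j g w"
 by (simp_all add: dxi_def dxis_def T_space)

lemma Ds_cong: "(!!w. w : space M ==> F w = G w) ==> w : space M ==> Ds T xi F w = Ds T xi G w"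
 unfolding Ds_def by (intro sum.cong refl dxis_cong) auto

lemma ip_T: "l2 M f ==> l2 M g ==> ip M (%w. f (T x w)) g = ip M f (%w. g (T (- x) w))"
proof -
 assume f: "l2 M f" and g: "l2 M g"
 note [measurable] = l2_meas[OF f] l2_meas[OF g]
 have "ip M f (%w. g (T (- x) w)) = (\<integral>w. f (T x w) \<bullet> g (T (- x) (T x w)) \<partial>M)"
  unfolding ip_def by (subst mpres_integral[OF T_mpres[of x], symmetric]) simp_all
 also have "... = ip M (%w. f (T x w)) g"
  unfolding ip_def by (intro Bochner_Integration.integral_cong) auto
 finally show ?thesis by simp
qed

lemma ip_dxi:
 assumes "l2 M f" "l2 M g" shows "ip M (dxi T xi j f) g = ip M f (dxis T xi j g)"
proof -
 let ?c = "exp (- (\<i> * cr (xi $ j)))"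
 have "ip M (dxi T xi j f) g = ip M (%w. ?c * f (T (ue j) w)) g - ip M f g"
  unfolding dxi_def[abs_def] using assms by (simp add: ip_diff_left l2_mult l2_T)
 also have "ip M (%w. ?c * f (T (ue j) w)) g = ip M (%w. f (T (ue j) w)) (%w. cnj ?c * g w)"
  unfolding ip_def by (simp add: inner_cmult_left)
 also have "... = ip M f (%w. cnj ?c * g (T (- ue j) w))"
  using assms by (subst ip_T) (auto simp: l2_mult)
 also have "... - ip M f g = ip M f (dxis T xi j g)"
  unfolding dxis_def[abs_def] using assms by (simp add: ip_diff_right l2_mult l2_T cnj_phase)
 finally show ?thesis .
qed

lemma ip_Dv: assumes "l2 M f" "l2 M F" shows "ip M (Dv T xi f) F = ip M f (Ds T xi F)"
proof -
 have "ip M (Dv T xi f) F = (SUM i:UNIV. ip M (dxi T xi i f) (%w. F w $ i))"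
  using assms by (simp add: ip_cart l2_Dv)
 also have "... = (SUM i:UNIV. ip M f (dxis T xi i (%w. F w $ i)))"
  using assms by (intro sum.cong refl ip_dxi l2_nth)
 also have "... = ip M f (Ds T xi F)"
  unfolding Ds_def[abs_def] using assms by (subst ip_sum_right) (auto intro: l2_dxis l2_nth)
 finally show ?thesis .
qed

lemma nn_Dv_sq: "l2 M f ==> (nn M (Dv T xi f))^2 = (SUM i:UNIV. (nn M (dxi T xi i f))^2)"
 using nn_cart_sq[of M "Dv T xi f"] by (simp add: l2_Dv)

lemma nn_dxi_le_Dv: "l2 M f ==> nn M (dxi T xi i f) <= nn M (Dv T xi f)"
proof (rule power2_le_imp_le)
 assume "l2 M f"
 thus "(nn M (dxi T xi i f))^2 <= (nn M (Dv T xi f))^2"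
  unfolding nn_Dv_sq[OF \<open>l2 M f\<close>] by (intro member_le_sum) auto
qed simp

text \<open>Every component of the adjoint difference has operator norm at most 2, and
  Cauchy-Schwarz over the components supplies the dimension. This is the factor 4 d of the stability
  condition in discrete time.\<close>

lemma nn_Ds_sq_le:
 assumes "l2 M F" shows "(nn M (Ds T xi F))^2 <= 4 * real CARD('d) * (nn M F)^2"
proof -
 have "nn M (Ds T xi F) <= (SUM i:UNIV. nn M (dxis T xi i (%w. F w $ i)))"
  unfolding Ds_def[abs_def] using assms by (intro nn_sum_le) auto
 also have "... <= (SUM i:UNIV. 2 * nn M (%w. F w $ i))"
  using assms by (intro sum_mono nn_dxis_le l2_nth)
 finally have "(nn M (Ds T xi F))^2 <= (SUM i:UNIV. 2 * nn M (%w. F w $ i))^2"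
  by (intro power_mono) auto
 also have "... <= real CARD('d) * (SUM i:UNIV. (2 * nn M (%w. F w $ i))^2)"
  using sum_squared_le_sum_of_squares[of "%i. 2 * nn M (%w. F w $ i)" "UNIV :: 'd set"] by (simp add: mult.commute)
 also have "... = 4 * real CARD('d) * (nn M F)^2"
  using assms by (simp add: nn_cart_sq sum_distrib_left power_mult_distrib mult_ac)
 finally show ?thesis .
qed

lemma expectation_T: "l2 M f ==> expectation (%w. f (T x w)) = expectation f"
 by (rule mpres_integral[OF T_mpres l2_meas])

lemma expectation_dxi: "l2 M f ==> expectation (dxi T xi j f) = ev xi $ j * expectation f"
proof -
 assume f: "l2 M f"
 have "expectation (dxi T xi j f) = em (xi $ j) * expectation (%w. f (T (ue j) w)) - expectation f"
  unfolding dxi_def[abs_def] using f l2_integrable[OF l2_T[OF f]] by (subst Bochner_Integration.integral_diff) auto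
 thus ?thesis by (simp add: expectation_T[OF f] ev_def algebra_simps)
qed

lemma expectation_dxis: "l2 M f ==> expectation (dxis T xi j f) = cnj (ev xi $ j) * expectation f"
proof -
 assume f: "l2 M f"
 have "expectation (dxis T xi j f) = ei (xi $ j) * expectation (%w. f (T (- ue j) w)) - expectation f"
  unfolding dxis_def[abs_def] using f l2_integrable[OF l2_T[OF f]] by (subst Bochner_Integration.integral_diff) auto
 thus ?thesis by (simp add: expectation_T[OF f] ev_def algebra_simps exp_cnj)
qed

lemma expectation_Ds: "l2 M F ==> expectation (Ds T xi F) = (SUM i:UNIV. cnj (ev xi $ i) * expectation (%w. F w $ i))"
 unfolding Ds_def[abs_def]
 by (subst Bochner_Integration.integral_sum) (auto simp: expectation_dxis l2_nth intro!: l2_integrable l2_dxis)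

text \<open>Two summations by parts; all twisted differences and their adjoints commute because the
  space translations do. This is the lattice form of the fact that the Laplacian controls every
  second derivative.\<close>

lemma nn_DsDv:
 assumes v: "l2 M v"
 shows "(nn M (Ds T xi (Dv T xi v)))^2 = (SUM i:UNIV. SUM j:UNIV. (nn M (dxi T xi i (dxi T xi j v)))^2)"
proof -
 let ?B = "Ds T xi (Dv T xi v)"
 have "(nn M ?B)^2 = ip M (Dv T xi ?B) (Dv T xi v)"
  using v by (simp add: nn_sq_ip ip_Dv l2_Dv l2_Ds)
 also have "... = (SUM i:UNIV. ip M (dxi T xi i ?B) (dxi T xi i v))"
  using v by (simp add: ip_cart l2_Dv l2_Ds)
 also have "... = (SUM i:UNIV. ip M (Ds T xi (Dv T xi (dxi T xi i v))) (dxi T xi i v))"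
 proof (intro sum.cong refl ip_cong)
  fix i w assume wa: "w : space M"
  show "dxi T xi i ?B w = Ds T xi (Dv T xi (dxi T xi i v)) w"
  unfolding Ds_def[abs_def] dxi_sum by (simp add: dxi_dxis_commute[OF wa]) (intro sum.cong refl dxis_cong dxi_commute wa)
 qed
 also have "... = (SUM i:UNIV. ip M (Dv T xi (dxi T xi i v)) (Dv T xi (dxi T xi i v)))"
  using v by (intro sum.cong refl) (subst ip_commute, auto simp: ip_Dv l2_Dv l2_dxi)
 also have "... = (SUM i:UNIV. SUM j:UNIV. (nn M (dxi T xi j (dxi T xi i v)))^2)"
  using v by (simp add: nn_sq_ip[symmetric] nn_Dv_sq l2_dxi)
 also have "... = (SUM i:UNIV. SUM j:UNIV. (nn M (dxi T xi i (dxi T xi j v)))^2)"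
  by (subst sum.swap) simp
 finally show ?thesis .
qed

lemma nn_dxi_dxi_le: "l2 M v ==> nn M (dxi T xi i (dxi T xi j v)) <= nn M (Ds T xi (Dv T xi v))"
proof (rule power2_le_imp_le)
 assume v: "l2 M v"
 have "(nn M (dxi T xi i (dxi T xi j v)))^2 <= (SUM j:UNIV. (nn M (dxi T xi i (dxi T xi j v)))^2)"
  by (rule member_le_sum) auto
 also have "... <= (SUM i:UNIV. SUM j:UNIV. (nn M (dxi T xi i (dxi T xi j v)))^2)"
  by (rule member_le_sum) (auto intro: sum_nonneg)
 finally show "(nn M (dxi T xi i (dxi T xi j v)))^2 <= (nn M (Ds T xi (Dv T xi v)))^2"
  by (simp add: nn_DsDv[OF v])
qed simp

lemma nn_dxi_dxis_le: "l2 M v ==> nn M (dxi T xi i (dxis T xi j v)) <= nn M (Ds T xi (Dv T xi v))"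
proof -
 assume v: "l2 M v"
 have "nn M (dxi T xi i (dxis T xi j v)) = nn M (dxis T xi j (dxi T xi i v))"
  by (rule nn_cong) (rule dxi_dxis_commute)
 thus ?thesis using nn_dxi_dxi_le[OF v, of xi j i] v by (simp add: nn_dxis_eq l2_dxi)
qed

end

section \<open>The projection onto mean zero and the abstract parabolic problem\<close>

context prob_space
begin

lemma l2_Pi0 [intro]: "l2 M f ==> l2 M (Pi0 M f)"
 unfolding Pi0_def[abs_def] by (intro l2_diff l2_const)

lemma nn_Pi0: "l2 M f ==> nn M (Pi0 M f) <= nn M f"
 unfolding Pi0_def[abs_def] by (rule nn_center)

lemma expectation_Pi0: "l2 M f ==> expectation (Pi0 M f) = 0"
 unfolding Pi0_def[abs_def] by (simp add: prob_space l2_integrable)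

lemma Pi0_id: "expectation f = 0 ==> Pi0 M f = f"
 by (simp add: Pi0_def fun_eq_iff)

lemma ip_Pi0: "l2 M f ==> l2 M g ==> ip M f (Pi0 M g) = ip M (Pi0 M f) g"
 unfolding Pi0_def[abs_def]
 by (simp add: ip_diff_left ip_diff_right ip_const ip_commute[of M "%w. expectation f"] inner_commute)

lemma Pi0_diff: "l2 M f ==> l2 M g ==> Pi0 M (%w. f w - g w) w = Pi0 M f w - Pi0 M g w"
 by (simp add: Pi0_def l2_integrable)

lemma Pi0_add: "l2 M f ==> l2 M g ==> Pi0 M (%w. f w + g w) w = Pi0 M f w + Pi0 M g w"
 by (simp add: Pi0_def l2_integrable)

end

text \<open>\<open>Tm et ps g\<close> reads: g is the time part of the corrector equation applied to
  ps, namely e^\<eta> ps(S 1) - ps in discrete time, and \<eta> ps plus the generator of the flow in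
  continuous time. It is a relation because the generator is unbounded. \<open>th\<close> measures
  the energy lost to explicit time stepping (1 or 0), and \<open>c\<close> is a shift for which the
  shifted time part can be inverted by a formula. The condition 4 d L th \<le> 1 is stability, 2 d L
  \<le> c makes c minus the elliptic part bounded by c, and th c \<le> 1 serves the bound on the
  inverse of the shifted time part.\<close>

locale parab = space_shift M T for M :: "'w measure" and T :: "int^'d::finite => 'w => 'w" +
 fixes Tm :: "real => ('w => complex) => ('w => complex) => bool" and L th c :: real
 assumes L_pos: "0 < L"
  and th: "0 <= th" "4 * real CARD('d) * L * th <= 1" "th * c <= 1"
  and c_pos: "0 < c" "2 * real CARD('d) * L <= c"
  and Tm_l2: "Tm et ps g ==> l2 M ps" "Tm et ps g ==> l2 M g"
  and Tm_AE: "Tm et ps g ==> l2 M g' ==> AE w in M. g w = g' w ==> Tm et ps g'"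
  and Tm_lin: "Tm et ps g ==> Tm et ps' g' ==> Tm et (%w. ps w + k * ps' w) (%w. g w + k * g' w)"
  and Tm_T: "Tm et ps g ==> Tm et (%w. ps (T x w)) (%w. g (T x w))"
  and Tm_shift: "!!et et' ps g. Tm et ps g ==> 0 < et ==> et <= 1 ==> 0 < et' ==> et' <= 1 ==>
  EX r. l2 M r & nn M r <= 3 * \<bar>et - et'\<bar> * nn M ps & Tm et' ps (%w. g w + r w)"
  and Tm_ex: "!!et h. 0 < et ==> et <= 1 ==> l2 M h ==> EX v. Tm et v (%w. h w - c *. v w)"
  and Tm_en: "!!et ps g. Tm et ps g ==> 0 < et ==> 2 * et * (nn M ps)^2 <= 2 * ip M ps g + th * (nn M g)^2"
  and Tm_mean: "!!et ps g. Tm et ps g ==> 0 < et ==> expectation g = 0 ==> expectation ps = 0"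
begin

lemma Tm_diff: "Tm et ps g ==> Tm et ps' g' ==> Tm et (%w. ps w - ps' w) (%w. g w - g' w)"
 using Tm_lin[of et ps g ps' g' "-1"] by simp

lemma Tm_add: "Tm et ps g ==> Tm et ps' g' ==> Tm et (%w. ps w + ps' w) (%w. g w + g' w)"
 using Tm_lin[of et ps g ps' g' 1] by simp

lemma Tm_mult: "Tm et ps g ==> Tm et (%w. k * ps w) (%w. k * g w)"
 using Tm_lin[OF Tm_diff[of et ps g ps g], of ps g k] by simp

lemma Tm_zero: "0 < et ==> et <= 1 ==> Tm et (%w. 0) (%w. 0)"
 using Tm_ex[of et "%w. 0"] Tm_mult[where k=0] by fastforce

lemma Tm_sum: "finite I ==> 0 < et ==> et <= 1 ==> (!!i. i : I ==> Tm et (ps i) (g i)) ==>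
  Tm et (%w. SUM i:I. ps i w) (%w. SUM i:I. g i w)"
 by (induction I rule: finite_induct) (auto intro: Tm_zero Tm_add)

lemma Tm_dxis: "Tm et ps g ==> Tm et (dxis T xi j ps) (dxis T xi j g)"
 unfolding dxis_def[abs_def] by (intro Tm_diff Tm_mult Tm_T)

lemma Tm_dxi: "Tm et ps g ==> Tm et (dxi T xi j ps) (dxi T xi j g)"
 unfolding dxi_def[abs_def] by (intro Tm_diff Tm_mult Tm_T)

text \<open>With E the Dirichlet form of the centred f, the product of f and B f equals E, while the
  squared norm of B f is at most 4 d L E \<le> 2 c E. In the expanded square of c f - B f the cross
  term -2 c E absorbs the last term.\<close>

lemma contraction_nn:
 fixes xi :: "real^'d"
 assumes al: "coeff_ok M l L al" "0 <= l" "l <= L" and f: "l2 M f"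
 defines "B \<equiv> Pi0 M (Ds T xi (%w. cmv (al w) (Dv T xi (Pi0 M f) w)))"
 shows "l2 M B" "nn M (%w. c *. f w - B w) <= c * nn M f"
proof -
 define G where "G = (%w. cmv (al w) (Dv T xi (Pi0 M f) w))"
 have D: "l2 M (Dv T xi (Pi0 M f))" using f by auto
 have G: "l2 M G" unfolding G_def using l2_cmv[OF al(1,2) L_pos D] .
 have B: "B = Pi0 M (Ds T xi G)" by (simp add: B_def G_def)
 show lB: "l2 M B" unfolding B using G by auto
 define E where "E = ip M (Dv T xi (Pi0 M f)) G"
 have G2: "(nn M G)^2 <= L * E" unfolding E_def G_def by (rule nn_cmv_sq[OF al(1,2) L_pos D al(3)])
 have E0: "0 <= E" using G2 L_pos by (smt (verit) zero_le_power2 zero_le_mult_iff)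
 have i: "ip M f B = E" unfolding B E_def using f G by (simp add: ip_Pi0 ip_Dv l2_Pi0 l2_Ds)
 have "(nn M B)^2 <= (nn M (Ds T xi G))^2" unfolding B using G by (intro power_mono nn_Pi0) auto
 also have "... <= 4 * real CARD('d) * (nn M G)^2" by (rule nn_Ds_sq_le[OF G])
 also have "... <= 4 * real CARD('d) * (L * E)" using G2 by (intro mult_left_mono) auto
 also have "... = 2 * (2 * real CARD('d) * L) * E" by simp
 also have "... <= 2 * c * E" using c_pos E0 by (intro mult_right_mono) (auto simp: mult_ac)
 finally have "(nn M (%w. c *. f w - B w))^2 <= (c * nn M f)^2"
  using f lB by (subst nn_diff_sq) (auto simp: i power_mult_distrib)
 thus "nn M (%w. c *. f w - B w) <= c * nn M f"
  by (rule power2_le_imp_le) (use c_pos in auto)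
qed

text \<open>The energy inequality for h - c v, with twice the product of v and h bounded by c |v|^2
  + |h|^2 / c; the coefficient 1 - th c of that product has to be nonnegative. The resulting
  constant is strictly below 1/c, which is what lets the iteration in \<open>existence\<close>
  contract.\<close>

lemma Tm_resolvent_bound:
 assumes T: "Tm et v (%w. h w - c *. v w)" and et: "0 < et" and h: "l2 M h"
 shows "nn M v <= nn M h / sqrt (c * (c + 2 * et))"
proof -
 have v: "l2 M v" using Tm_l2 T by auto
 define x y i where "x = nn M v" and "y = nn M h" and "i = ip M v h"
 have "2 * et * x^2 <= 2 * (i - c * x^2) + th * (y^2 - 2 * (c * i) + c^2 * x^2)"
  using Tm_en[OF T et] v h
  by (simp add: x_def y_def i_def ip_diff_right nn_diff_sq l2_scaleR nn_sq_ip[symmetric] power_mult_distrib ip_commute[of M h])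
 moreover have "2 * i <= c * x^2 + y^2 / c"
 proof -
  have "0 <= (nn M (%w. c *. v w - h w))^2" by simp
  hence "0 <= c^2 * x^2 - 2 * (c * i) + y^2"
  using v h by (subst (asm) nn_diff_sq) (auto simp: x_def y_def i_def power_mult_distrib)
  thus ?thesis using c_pos by (simp add: field_simps power2_eq_square)
 qed
 hence "(1 - th * c) * (2 * i) <= (1 - th * c) * (c * x^2 + y^2 / c)"
  using th by (intro mult_left_mono) auto
 moreover have "(1 - th * c) * (c * x^2 + y^2 / c) = c * x^2 - th * (c^2 * x^2) + y^2 / c - th * y^2"
  using c_pos by (simp add: field_simps power2_eq_square)
 ultimately have "(c + 2 * et) * x^2 <= y^2 / c"
  by (simp add: algebra_simps)
 hence "(c * (c + 2 * et)) * x^2 <= y^2" using c_pos by (simp add: field_simps)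
 hence "(sqrt (c * (c + 2 * et)) * x)^2 <= y^2" using c_pos et by (simp add: power_mult_distrib)
 hence "sqrt (c * (c + 2 * et)) * x <= y" by (rule power2_le_imp_le) (simp add: y_def)
 moreover have "0 < sqrt (c * (c + 2 * et))" using c_pos et by simp
 ultimately show ?thesis by (simp add: x_def y_def pos_le_divide_eq mult.commute)
qed

text \<open>The equation Tm v + B v = g is rewritten as (Tm + c) v = (c - B) v + g. By
  \<open>contraction_nn\<close> the right side is Lipschitz with constant c, and inverting Tm + c
  gains strictly more than c, so Picard iteration converges. The projection is built into B through
  \<open>Pi0 M f\<close> and drops out at the end, when v is seen to have mean zero.\<close>

lemma existence:
 assumes al: "coeff_ok M l L al" "0 <= l" "l <= L" and g: "l2 M g" "expectation g = 0" and et: "0 < et" "et <= 1"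
 obtains v where "expectation v = 0"
  "Tm et v (%w. g w - Pi0 M (Ds T xi (%w. cmv (al w) (Dv T xi v w))) w)"
proof -
 define B where "B f = Pi0 M (Ds T xi (%w. cmv (al w) (Dv T xi (Pi0 M f) w)))" for f
 note B = contraction_nn[OF al, where xi=xi, folded B_def]
 have Bd: "B (%w. f w - f' w) w = B f w - B f' w" if "l2 M f" "l2 M f'" for f f' w
 proof -
  have 1: "Pi0 M (%w. f w - f' w) = (%w. Pi0 M f w - Pi0 M f' w)" using Pi0_diff[OF that] by (simp add: fun_eq_iff)
  have 2: "Ds T xi (%w. cmv (al w) (Dv T xi (Pi0 M (%w. f w - f' w)) w)) =
  (%w. Ds T xi (%w. cmv (al w) (Dv T xi (Pi0 M f) w)) w - Ds T xi (%w. cmv (al w) (Dv T xi (Pi0 M f') w)) w)"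
  by (simp add: 1 Dv_diff cmv_diff Ds_diff fun_eq_iff)
  show ?thesis unfolding B_def 2 using that by (intro Pi0_diff l2_Ds l2_cmv[OF al(1,2) L_pos]) auto
 qed
 define h where "h f = (%w. c *. f w - B f w + g w)" for f
 have lh: "l2 M (h f)" if "l2 M f" for f unfolding h_def by (intro l2_add l2_diff l2_scaleR that B(1) g)
 define K where "K f = (SOME v. Tm et v (%w. h f w - c *. v w))" for f
 have K: "Tm et (K f) (%w. h f w - c *. K f w)" if "l2 M f" for f
  using someI_ex[OF Tm_ex[OF et lh[OF that]]] by (simp add: K_def)
 define q where "q = c / sqrt (c * (c + 2 * et))"
 have "q < 1"
 proof -
  have "sqrt (c * c) < sqrt (c * (c + 2 * et))" using c_pos et by (intro real_sqrt_less_mono) simp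
  thus ?thesis using c_pos et by (simp add: q_def)
 qed
 moreover have "0 <= q" using c_pos et by (simp add: q_def)
 moreover have "nn M (%w. K f w - K f' w) <= q * nn M (%w. f w - f' w)" if f: "l2 M f" "l2 M f'" for f f'
 proof -
  have "Tm et (%w. K f w - K f' w) (%w. (h f w - h f' w) - c *. (K f w - K f' w))"
  using Tm_diff[OF K[OF f(1)] K[OF f(2)]] by (simp add: algebra_simps)
  from Tm_resolvent_bound[OF this et(1)] have "nn M (%w. K f w - K f' w) <= nn M (%w. h f w - h f' w) / sqrt (c * (c + 2 * et))"
  using lh f by auto
  also have "(%w. h f w - h f' w) = (%w. c *. (f w - f' w) - B (%w. f w - f' w) w)"
  by (simp add: h_def Bd[OF f] algebra_simps)
  also have "nn M ... / sqrt (c * (c + 2 * et)) <= c * nn M (%w. f w - f' w) / sqrt (c * (c + 2 * et))"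
  using f c_pos et by (intro divide_right_mono B(2)) auto
  finally show ?thesis by (simp add: q_def)
 qed
 ultimately obtain f where f: "l2 M f" "nn M (%w. K f w - f w) = 0"
  using l2_fixpoint[of K q] K Tm_l2 by metis
 \<comment> \<open>\<open>f\<close> is a fixed point only up to a null set. \<open>K f\<close>
   satisfies its equation exactly, and the right side of that equation agrees almost everywhere with
   g - B v.\<close>
 define v where "v = K f"
 have v: "l2 M v" unfolding v_def using K f Tm_l2 by blast
 have e1: "AE w in M. v w - f w = 0" using nn_zero_AE[OF l2_diff[OF v f(1)]] f(2) by (simp add: v_def)
 have "nn M (%w. B v w - B f w) = 0"
 proof -
  let ?d = "%w. v w - f w"
  have d: "l2 M ?d" using v f by auto
  have "nn M (B ?d) <= nn M (%w. c *. ?d w) + nn M (%w. c *. ?d w - B ?d w)"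
  using nn_triangle_diff[OF l2_scaleR[OF d, of c] l2_diff[OF l2_scaleR[OF d, of c] B(1)[OF d]]] by simp
  also have "... <= 0" using B(2)[OF d] f(2) by (simp add: v_def)
  finally have "nn M (B ?d) = 0" by (simp add: order_antisym)
  moreover have "B ?d = (%w. B v w - B f w)" using Bd[OF v f(1)] by (simp add: fun_eq_iff)
  ultimately show ?thesis by simp
 qed
 hence e2: "AE w in M. B v w - B f w = 0" using nn_zero_AE[OF l2_diff[OF B(1)[OF v] B(1)[OF f(1)]]] by simp
 have T: "Tm et v (%w. g w - B v w)"
 proof (rule Tm_AE[OF K[OF f(1), folded v_def]])
  show "l2 M (%w. g w - B v w)" by (intro l2_diff g B(1)[OF v])
  show "AE w in M. h f w - c *. v w = g w - B v w"
  using e1 e2 by eventually_elim (simp add: h_def)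
 qed
 have "expectation (B v) = 0"
  unfolding B_def using v by (intro expectation_Pi0 l2_Ds l2_cmv[OF al(1,2) L_pos]) auto
 hence "expectation (%w. g w - B v w) = 0"
  using g l2_integrable[OF g(1)] l2_integrable[OF B(1)[OF v]] by simp
 hence "expectation v = 0" by (rule Tm_mean[OF T et(1)])
 with T that show ?thesis unfolding B_def by (simp add: Pi0_id)
qed

text \<open>The reference problem: the corrector equation in the constant medium with coefficient L,
  the upper ellipticity bound. It commutes with translations, and L minus any admissible coefficient
  is positive semidefinite.\<close>

definition Req :: "real => real^'d => ('w => complex) => ('w => complex) => bool" where
 "Req et xi v g \<longleftrightarrow> Tm et v (%w. g w - L *. Ds T xi (Dv T xi v) w)"

lemma Req_l2: assumes "Req et xi v g" shows "l2 M v" "l2 M g"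
proof -
 show v: "l2 M v" using assms Tm_l2 by (auto simp: Req_def)
 have "l2 M (%w. (g w - L *. Ds T xi (Dv T xi v) w) + L *. Ds T xi (Dv T xi v) w)"
  by (intro l2_add l2_scaleR l2_Ds l2_Dv v) (rule Tm_l2(2)[OF assms[unfolded Req_def]])
 thus "l2 M g" by simp
qed

lemma Req_diff: "Req et xi v g ==> Req et xi v' g' ==> Req et xi (%w. v w - v' w) (%w. g w - g' w)"
 unfolding Req_def by (drule (1) Tm_diff) (simp add: Dv_diff[abs_def] Ds_diff[abs_def] algebra_simps)

lemma Req_sum: "finite I ==> 0 < et ==> et <= 1 ==> (!!i. i : I ==> Req et xi (v i) (g i)) ==>
  Req et xi (%w. SUM i:I. v i w) (%w. SUM i:I. g i w)"
proof -
 assume a: "finite I" "0 < et" "et <= 1" "!!i. i : I ==> Req et xi (v i) (g i)"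
 have "Ds T xi (Dv T xi (%w. SUM i:I. v i w)) w = (SUM i:I. Ds T xi (Dv T xi (v i)) w)" for w
  by (simp add: Ds_def dxi_sum[abs_def] dxis_sum sum.swap[of _ UNIV I])
 thus ?thesis
  using Tm_sum[OF a(1-3), of v "%i w. g i w - L *. Ds T xi (Dv T xi (v i)) w"] a(4)
  by (simp add: Req_def sum_subtractf scaleR_right.sum)
qed

lemma Req_scaleR: "Req et xi v g ==> Req et xi (%w. r *. v w) (%w. r *. g w)"
 unfolding Req_def
 by (drule Tm_mult[where k = "cr r"])
  (simp add: Dv_scaleR[abs_def] Ds_scaleR scaleR_conv_of_real[where 'a=complex, symmetric] scaleR_diff_right scaleR_left_commute mult.commute)

lemma Req_dxis: "Req et xi v g ==> Req et xi (dxis T xi' k v) (dxis T xi' k g)"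
proof -
 assume r: "Req et xi v g"
 note v = Req_l2[OF r]
 have "dxis T xi' k (Ds T xi (Dv T xi v)) w = Ds T xi (Dv T xi (dxis T xi' k v)) w" if "w : space M" for w
  unfolding Ds_def[abs_def] dxis_sum Dv_nth
 proof (intro sum.cong refl)
  fix i
  have "dxis T xi' k (dxis T xi i (dxi T xi i v)) w = dxis T xi i (dxis T xi' k (dxi T xi i v)) w"
  by (rule dxis_commute[OF that])
  also have "... = dxis T xi i (dxi T xi i (dxis T xi' k v)) w"
  by (rule dxis_cong[OF _ that]) (rule dxi_dxis_commute[symmetric])
  finally show "dxis T xi' k (dxis T xi i (dxi T xi i v)) w = dxis T xi i (dxi T xi i (dxis T xi' k v)) w" .
 qed
 thus ?thesis
  unfolding Req_def using v
  by (intro Tm_AE[OF Tm_dxis[OF r[unfolded Req_def], of xi' k]] AE_I2 l2_diff l2_scaleR l2_dxis l2_Ds l2_Dv)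
  (auto simp: dxis_diff dxis_scaleR)
qed

lemma Req_ex:
 assumes "l2 M g" "expectation g = 0" "0 < et" "et <= 1"
 obtains v where "Req et xi v g"
proof -
 have "coeff_ok M L L (%w. mat L :: real^'d^'d)" by (simp add: coeff_ok_ellip ellip_mat)
 from existence[OF this _ _ assms] L_pos obtain v where v: "expectation v = 0"
  "Tm et v (%w. g w - Pi0 M (Ds T xi (%w. cmv (mat L) (Dv T xi v w))) w)" by auto
 have l: "l2 M v" using v Tm_l2 by auto
 have "expectation (Ds T xi (%w. cmv (mat L) (Dv T xi v w))) = 0"
  using l by (subst expectation_Ds) (auto simp: l2_Dv l2_scaleR expectation_dxi v(1))
 hence "Req et xi v g" using v(2) by (simp add: Req_def Pi0_id Ds_scaleR)
 thus ?thesis by (rule that)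
qed

text \<open>With H = Dv v - F the equation says that the time part of v is -L times
  \<open>Ds\<close> of H. Stability bounds the loss term by L |H|^2; added to the cross term -2 L
  (Dv v, H), the mixed products of Dv v and F cancel and L (|F|^2 - |Dv v|^2) remains.\<close>

lemma Req_energy:
 assumes R: "Req et xi v (%w. L *. Ds T xi F w)" and F: "l2 M F" and et: "0 < et"
 shows "nn M (Dv T xi v) <= nn M F" "2 * et * (nn M v)^2 <= L * (nn M F)^2"
proof -
 note v = Req_l2(1)[OF R]
 define H where "H = (%w. Dv T xi v w - F w)"
 have lH: "l2 M H" unfolding H_def using v F by auto
 have "Tm et v (%w. (- L) *. Ds T xi H w)"
  using R unfolding Req_def H_def by (simp add: Ds_diff algebra_simps)
 from Tm_en[OF this et]
 have "2 * et * (nn M v)^2 <= - 2 * L * ip M v (Ds T xi H) + th * (L^2 * (nn M (Ds T xi H))^2)"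
  unfolding nn_scaleR ip_scaleR_right by (simp add: power_mult_distrib)
 also have "th * (L^2 * (nn M (Ds T xi H))^2) <= th * (L^2 * (4 * real CARD('d) * (nn M H)^2))"
  using th by (intro mult_left_mono nn_Ds_sq_le lH) auto
 also have "... = (4 * real CARD('d) * L * th) * (L * (nn M H)^2)" by (simp add: power2_eq_square)
 also have "... <= 1 * (L * (nn M H)^2)" using th L_pos by (intro mult_right_mono) auto
 also have "(nn M H)^2 = (nn M (Dv T xi v))^2 - 2 * ip M (Dv T xi v) F + (nn M F)^2"
  unfolding H_def using v F by (intro nn_diff_sq) auto
 also have "ip M v (Ds T xi H) = (nn M (Dv T xi v))^2 - ip M (Dv T xi v) F"
  unfolding H_def using v F lH[unfolded H_def] by (simp add: ip_Dv[symmetric] ip_diff_right l2_Dv nn_sq_ip)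
 finally have *: "2 * et * (nn M v)^2 + L * (nn M (Dv T xi v))^2 <= L * (nn M F)^2"
  by (simp add: algebra_simps)
 moreover have "0 <= 2 * et * (nn M v)^2" "0 <= L * (nn M (Dv T xi v))^2" using et L_pos by auto
 ultimately have "L * (nn M (Dv T xi v))^2 <= L * (nn M F)^2" "2 * et * (nn M v)^2 <= L * (nn M F)^2" by linarith+
 thus "nn M (Dv T xi v) <= nn M F" "2 * et * (nn M v)^2 <= L * (nn M F)^2"
  using L_pos by (auto intro: power2_le_imp_le)
qed

text \<open>Maximal regularity: the energy inequality is applied to each difference of v, which
  amounts to testing the equation with its second-order term. In the expanded square of g = wa + L B
  the cross term is the one that this inequality controls. The last estimate is the plain energy
  inequality, with the loss th |wa|^2 absorbed by the gradient term and by g.\<close>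

lemma Req_H2:
 assumes R: "Req et xi v g" and et: "0 < et" "et <= 1"
 shows "L * nn M (Ds T xi (Dv T xi v)) <= nn M g"
  "2 * et * L * (nn M (Dv T xi v))^2 <= (nn M g)^2"
  "et * nn M v <= (1 + th) * nn M g"
proof -
 note v = Req_l2(1)[OF R] and g = Req_l2(2)[OF R]
 let ?B = "Ds T xi (Dv T xi v)"
 have lB: "l2 M ?B" using v by auto
 define wa where "wa = (%w. g w - L *. ?B w)"
 have T: "Tm et v wa" using R by (simp add: Req_def wa_def)
 have wa: "l2 M wa" using T Tm_l2 by auto
 have "2 * et * (nn M (Dv T xi v))^2 = (SUM i:UNIV. 2 * et * (nn M (dxi T xi i v))^2)"
  using v by (simp add: nn_Dv_sq sum_distrib_left)
 also have "... <= (SUM i:UNIV. 2 * ip M (dxi T xi i v) (dxi T xi i wa) + th * (nn M (dxi T xi i wa))^2)"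
  by (intro sum_mono Tm_en Tm_dxi T et)
 also have "... = 2 * ip M (Dv T xi v) (Dv T xi wa) + th * (nn M (Dv T xi wa))^2"
  using v wa by (simp add: nn_Dv_sq sum_distrib_left sum.distrib ip_cart l2_Dv)
 also have "ip M (Dv T xi v) (Dv T xi wa) = ip M wa ?B"
  using v wa by (subst ip_commute) (simp add: ip_Dv l2_Dv)
 also have "(nn M (Dv T xi wa))^2 <= 4 * real CARD('d) * (nn M wa)^2"
 proof -
  have "(nn M (Dv T xi wa))^2 <= (SUM i:(UNIV::'d set). (2 * nn M wa)^2)"
  unfolding nn_Dv_sq[OF wa] using wa by (intro sum_mono power_mono nn_dxi_le) auto
  thus ?thesis by (simp add: power_mult_distrib)
 qed
 finally have e1: "2 * et * (nn M (Dv T xi v))^2 <= 2 * ip M wa ?B + th * (4 * real CARD('d) * (nn M wa)^2)"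
  using th(1) by (smt (verit) mult_left_mono)
 have "(nn M g)^2 = (nn M (%w. wa w + L *. ?B w))^2" by (simp add: wa_def)
 also have "... = (nn M wa)^2 + 2 * (L * ip M wa ?B) + L^2 * (nn M ?B)^2"
  using wa lB by (subst nn_add_sq) (auto simp: power_mult_distrib)
 finally have g2: "(nn M g)^2 = (nn M wa)^2 + 2 * (L * ip M wa ?B) + L^2 * (nn M ?B)^2" .
 have "L * (th * (4 * real CARD('d) * (nn M wa)^2)) = (4 * real CARD('d) * L * th) * (nn M wa)^2" by simp
 also have "... <= 1 * (nn M wa)^2" using th by (intro mult_right_mono) auto
 finally have "L * (2 * et * (nn M (Dv T xi v))^2) <= 2 * (L * ip M wa ?B) + (nn M wa)^2"
  using mult_left_mono[OF e1, of L] L_pos by (simp add: algebra_simps)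
 with g2 have m: "2 * et * L * (nn M (Dv T xi v))^2 + L^2 * (nn M ?B)^2 <= (nn M g)^2"
  by (simp add: algebra_simps)
 moreover have "0 <= 2 * et * L * (nn M (Dv T xi v))^2" "0 <= L^2 * (nn M ?B)^2" using et L_pos by auto
 ultimately have "(L * nn M ?B)^2 <= (nn M g)^2" and 2: "2 * et * L * (nn M (Dv T xi v))^2 <= (nn M g)^2"
  unfolding power_mult_distrib by linarith+
 thus 1: "L * nn M ?B <= nn M g" by (auto intro: power2_le_imp_le)
 show "2 * et * L * (nn M (Dv T xi v))^2 <= (nn M g)^2" by (rule 2)
 define x y where "x = nn M v" and "y = nn M g"
 have xy: "0 <= x" "0 <= y" by (auto simp: x_def y_def)
 have iB: "ip M v ?B = (nn M (Dv T xi v))^2" using v by (simp add: ip_Dv[symmetric] l2_Dv nn_sq_ip)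
 have "(nn M ?B)^2 <= 4 * real CARD('d) * (nn M (Dv T xi v))^2" using v by (intro nn_Ds_sq_le) auto
 hence "(th * L * L) * (nn M ?B)^2 <= (th * L * L) * (4 * real CARD('d) * (nn M (Dv T xi v))^2)"
  using th L_pos by (intro mult_left_mono) auto
 also have "... = (4 * real CARD('d) * L * th) * (L * (nn M (Dv T xi v))^2)" by simp
 also have "... <= 1 * (L * (nn M (Dv T xi v))^2)" using th L_pos by (intro mult_right_mono) auto
 finally have tB: "th * L^2 * (nn M ?B)^2 <= L * (nn M (Dv T xi v))^2" by (simp add: power2_eq_square)
 have "(nn M wa)^2 <= 2 * y^2 + 2 * L^2 * (nn M ?B)^2"
 proof -
  have "nn M wa <= y + L * nn M ?B"
  unfolding wa_def y_def using nn_triangle_diff[OF g l2_scaleR[OF lB, of L]] L_pos by simp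
  hence "(nn M wa)^2 <= (y + L * nn M ?B)^2" by (intro power_mono) auto
  also have "... <= 2 * y^2 + 2 * L^2 * (nn M ?B)^2"
  using sum_squares_bound[of y "L * nn M ?B"] by (simp add: power2_sum power_mult_distrib)
  finally show ?thesis .
 qed
 hence "th * (nn M wa)^2 <= 2 * th * y^2 + 2 * (L * (nn M (Dv T xi v))^2)"
  using mult_left_mono[OF _ th(1)] tB by (fastforce simp: algebra_simps)
 moreover have "2 * et * x^2 <= 2 * (ip M v g - L * (nn M (Dv T xi v))^2) + th * (nn M wa)^2"
  using Tm_en[OF T et(1)] v g lB unfolding wa_def x_def
  by (simp add: ip_diff_right l2_scaleR iB)
 moreover have "ip M v g <= x * y" using ip_le[OF v g] by (simp add: x_def y_def)
 ultimately have q: "et * x^2 <= x * y + th * y^2" by (simp add: algebra_simps)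
 have "et * x <= (1 + th) * y"
 \<comment> \<open>If the bound failed, then y \<le> x and so th y^2 \<le> th x y; the quadratic
   inequality \<open>q\<close> divided by x would contradict the assumption.\<close>
 proof (rule ccontr)
  assume n: "\<not> et * x <= (1 + th) * y"
  hence "th * y < et * x - y" by (simp add: algebra_simps)
  have "y <= (1 + th) * y" using th xy by (simp add: mult_left_mono algebra_simps)
  also have "... <= et * x" using n by simp
  also have "... <= x" using et xy by (simp add: mult_left_le_one_le)
  finally have "y <= x" .
  have "x > 0" using n th xy et by (cases "x = 0") auto
  hence "x * (th * y) < x * (et * x - y)" using \<open>th * y < et * x - y\<close> by simp
  moreover have "y * (th * y) <= x * (th * y)" using \<open>y <= x\<close> th xy by (intro mult_right_mono) auto
  ultimately show False using q by (simp add: algebra_simps power2_eq_square)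
 qed
 thus "et * nn M v <= (1 + th) * nn M g" by (simp add: x_def y_def)
qed

end

section \<open>How the reference problem depends on the frequency and on \<eta>\<close>

lemma phase_diff: "cmod (em x - em y) <= \<bar>x - y\<bar>"
proof -
 have "em x - em y =
  em y * (ei (y - x) - 1)"
  by (simp add: algebra_simps exp_add[symmetric])
 hence "cmod (em x - em y) = 2 * \<bar>sin ((y - x) / 2)\<bar>"
  using dist_exp_i_1[of "y - x"] by (simp add: norm_mult)
 also have "... <= \<bar>x - y\<bar>" using abs_sin_x_le_abs_x[of "(y - x) / 2"] by simp
 finally show ?thesis .
qed

lemma phase_diff': "cmod (ei x - ei y) <= \<bar>x - y\<bar>"
 using phase_diff[of "-x" "-y"] by simp

context prob_space
begin

definition PiV :: "('a => complex^'d::finite) => 'a => complex^'d" where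
 "PiV F w = F w - expectation F"

lemma l2_PiV [intro]: "l2 M F ==> l2 M (PiV F)"
 unfolding PiV_def[abs_def] by (intro l2_diff l2_const)

lemma nn_PiV: "l2 M F ==> nn M (PiV F) <= nn M F"
 unfolding PiV_def[abs_def] by (rule nn_center)

lemma expectation_nth: "integrable M F ==> expectation F $ i = expectation (%w. F w $ i)" for F :: "'a => complex^'d::finite"
 using integral_bounded_linear[OF bounded_linear_vec_nth, of M F i] by simp

lemma PiV_nth: "l2 M F ==> PiV F w $ i = Pi0 M (%w. F w $ i) w"
 by (simp add: PiV_def Pi0_def expectation_nth l2_integrable)

lemma PiV_diff: "l2 M F ==> l2 M G ==> PiV (%w. F w - G w) w = PiV F w - PiV G w"
 by (simp add: PiV_def l2_integrable)

lemma nn_PiV_diff: "l2 M F ==> l2 M G ==> nn M (%w. PiV F w - PiV G w) <= nn M (%w. F w - G w)"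
 using nn_PiV[of "%w. F w - G w"] PiV_diff[of F G] by (simp add: l2_diff cong: nn_cong)

lemma nn_vec_le_sum: "l2 M F ==> nn M F <= (SUM i:UNIV. nn M (%w. F w $ i))" for F :: "'a => complex^'d::finite"
proof (rule power2_le_imp_le)
 assume F: "l2 M F"
 have "(SUM i:(UNIV::'d set). (nn M (%w. F w $ i))^2) <= (SUM i:UNIV. nn M (%w. F w $ i) * (SUM i:UNIV. nn M (%w. F w $ i)))"
  by (intro sum_mono) (auto simp: power2_eq_square intro!: mult_left_mono member_le_sum)
 thus "(nn M F)^2 <= (SUM i:UNIV. nn M (%w. F w $ i))^2"
  unfolding nn_cart_sq[OF F] by (simp add: power2_eq_square sum_distrib_right)
qed (auto intro: sum_nonneg)

end

context space_shift
begin

lemma nn_dxi_xi_diff: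
 assumes v: "l2 M v"
 shows "nn M (%w. dxi T xi i v w - dxi T xi' i v w) <= \<bar>xi $ i - xi' $ i\<bar> * nn M v"
proof -
 have "(%w. dxi T xi i v w - dxi T xi' i v w) =
  (%w. (em (xi $ i) - em (xi' $ i)) * v (T (ue i) w))"
  by (simp add: dxi_def algebra_simps)
 hence "nn M (%w. dxi T xi i v w - dxi T xi' i v w) =
  cmod (em (xi $ i) - em (xi' $ i)) * nn M v"
  by (simp only: nn_mult nn_T[OF v])
 also have "... <= \<bar>xi $ i - xi' $ i\<bar> * nn M v" by (intro mult_right_mono phase_diff) simp
 finally show ?thesis .
qed

lemma nn_dxis_xi_diff:
 assumes v: "l2 M v"
 shows "nn M (%w. dxis T xi i v w - dxis T xi' i v w) <= \<bar>xi $ i - xi' $ i\<bar> * nn M v"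
proof -
 have "(%w. dxis T xi i v w - dxis T xi' i v w) =
  (%w. (ei (xi $ i) - ei (xi' $ i)) * v (T (- ue i) w))"
  by (simp add: dxis_def algebra_simps)
 hence "nn M (%w. dxis T xi i v w - dxis T xi' i v w) =
  cmod (ei (xi $ i) - ei (xi' $ i)) * nn M v"
  by (simp only: nn_mult nn_T[OF v])
 also have "... <= \<bar>xi $ i - xi' $ i\<bar> * nn M v" by (intro mult_right_mono phase_diff') simp
 finally show ?thesis .
qed

text \<open>The frequency is changed in one factor at a time, after commuting that factor to the
  outside. The cost is then a first difference of v rather than v itself, which matters because
  first differences obey better bounds in \<epsilon>.\<close>

lemma nn_dxi_dxis_xi_diff:
 assumes v: "l2 M v"
 shows "nn M (%w. dxi T xi i (dxis T xi k v) w - dxi T xi' i (dxis T xi' k v) w)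
  <= \<bar>xi $ i - xi' $ i\<bar> * nn M (dxi T xi k v) + \<bar>xi $ k - xi' $ k\<bar> * nn M (dxi T xi' i v)"
proof -
 have l: "l2 M (dxi T xi'' i (dxis T xi''' k v))" for xi'' xi''' using v by auto
 have "nn M (%w. dxi T xi' i (dxis T xi k v) w - dxi T xi' i (dxis T xi' k v) w)
  = nn M (%w. dxis T xi k (dxi T xi' i v) w - dxis T xi' k (dxi T xi' i v) w)"
  by (rule nn_cong) (simp add: dxi_dxis_commute)
 also have "... <= \<bar>xi $ k - xi' $ k\<bar> * nn M (dxi T xi' i v)" using v by (intro nn_dxis_xi_diff) auto
 finally show ?thesis
  using nn_triangle3[OF l[of xi xi] l[of xi' xi] l[of xi' xi']] nn_dxi_xi_diff[OF l2_dxis[OF v], of xi i xi k xi']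
  by (simp add: nn_dxis_eq[OF v])
qed

lemma Ds_PiV: "l2 M F ==> Ds T xi (PiV F) = Pi0 M (Ds T xi F)"
 by (rule ext) (simp add: PiV_def[abs_def] Ds_diff Ds_const Pi0_def expectation_Ds expectation_nth l2_integrable)

end

text \<open>A family that is Cauchy as \<epsilon> tends to 0. The iterates in
  \<open>corrector_small\<close> are handled in this form, without naming their limits.\<close>

definition (in space_shift) cauF :: "(real => 'w => complex^'d) => bool" where
 "cauF F \<longleftrightarrow> (ALL ep. 0 < ep & ep <= 1 --> l2 M (F ep)) &
  (ALL ka>0. EX ep0>0. ALL ep ep'. 0 < ep & ep <= ep' & ep' < ep0 & ep' <= 1 --> nn M (%w. F ep w - F ep' w) <= ka)"

context parab
begin

text \<open>For a general source the reference solution y at frequency \<epsilon> \<zeta> and \<eta>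
  = \<epsilon>^2 has only \<epsilon>^2 |y| and \<epsilon> |Dv y| bounded, by \<open>Req_H2\<close>.
  Nice sources gain one power of \<epsilon> in both quantities.\<close>

definition nice :: "real^'d => ('w => complex) => bool" where
 "nice ze ps \<longleftrightarrow> l2 M ps & expectation ps = 0 &
  (EX C>=0. ALL ep y. 0 < ep & ep <= 1 --> Req (ep^2) (ep *. ze) y ps -->
  ep * nn M y <= C & (ALL i. nn M (dxi T (ep *. ze) i y) <= C))"

lemma eps_sq: "0 < ep ==> ep <= 1 ==> 0 < ep^2 & ep^2 <= 1" for ep :: real
 by (simp add: power_le_one)

definition nice_const :: "real^'d => ('w => complex) => real => bool" where
 "nice_const ze ps C \<longleftrightarrow> C >= 0 &
  (ALL ep ep' y y' i k. 0 < ep --> ep <= ep' --> ep' <= 1 --> Req (ep^2) (ep *. ze) y ps --> Req (ep'^2) (ep' *. ze) y' ps -->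
  nn M (%w. dxi T (ep *. ze) i (dxis T (ep *. ze) k y) w - dxi T (ep' *. ze) i (dxis T (ep' *. ze) k y') w) <= C * ep') &
  (ALL ep y k. 0 < ep --> ep <= 1 --> Req (ep^2) (ep *. ze) y ps --> nn M (dxis T (ep *. ze) k y) <= C)"

text \<open>The solution y' for \<epsilon>' solves the problem for \<epsilon> up to an error s
  caused by the change of \<eta> and \<xi>. The bounds for nice sources make s of size
  O(\<epsilon>'), and the second-difference estimate of \<open>Req_H2\<close> for y - y' turns this
  into a rate for the second differences.\<close>

lemma nice_cauchy:
 assumes "nice ze ps" shows "EX C. nice_const ze ps C"
proof -
 obtain C where C0: "C >= 0" and C: "!!ep y. 0 < ep ==> ep <= 1 ==> Req (ep^2) (ep *. ze) y ps ==>
  ep * nn M y <= C & (ALL i. nn M (dxi T (ep *. ze) i y) <= C)"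
  using assms by (auto simp: nice_def)
 define Z where "Z = norm ze"
 have Z0: "Z >= 0" by (simp add: Z_def)
 define K where "K = Z * (C * (1 + Z)) + Z * C"
 have K0: "K >= 0" using C0 Z0 by (simp add: K_def)
 define C1 where "C1 = 3 * C + L * (real CARD('d) * K)"
 have C10: "C1 >= 0" using C0 K0 L_pos by (simp add: C1_def)
 have main: "nn M (%w. dxi T (ep *. ze) i (dxis T (ep *. ze) k y) w - dxi T (ep' *. ze) i (dxis T (ep' *. ze) k y') w)
  <= (C1 / L + K) * ep'"
  if e: "0 < ep" "ep <= ep'" "ep' <= 1" and y: "Req (ep^2) (ep *. ze) y ps" and y': "Req (ep'^2) (ep' *. ze) y' ps"
  for ep ep' y y' i k
 proof -
  have e': "0 < ep'" "ep <= 1" using e by auto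
  define xi xi' where "xi = ep *. ze" and "xi' = ep' *. ze"
  note ly = Req_l2(1)[OF y] and ly' = Req_l2(1)[OF y']
  note C' = C[OF e'(1) e(3) y', folded xi'_def]
  have dz: "\<bar>xi $ j - xi' $ j\<bar> <= ep' * Z" for j
  proof -
  have "xi $ j - xi' $ j = - ((ep' - ep) * ze $ j)" by (simp add: xi_def xi'_def algebra_simps)
  hence "\<bar>xi $ j - xi' $ j\<bar> = (ep' - ep) * \<bar>ze $ j\<bar>" using e by (simp add: abs_mult)
  also have "... <= ep' * Z" unfolding Z_def using e component_le_norm_cart[of ze j] by (intro mult_mono) auto
  finally show ?thesis .
  qed
  have d1: "nn M (dxi T xi j y') <= C * (1 + Z)" for j
  proof -
  have "nn M (dxi T xi j y') <= nn M (dxi T xi' j y') + nn M (%w. dxi T xi j y' w - dxi T xi' j y' w)"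
  by (rule nn_triangle_sub) (use ly' in auto)
  also have "... <= C + (ep' * Z) * nn M y'"
  using C' by (intro add_mono order_trans[OF nn_dxi_xi_diff[OF ly']] mult_right_mono dz) auto
  also have "... = C + Z * (ep' * nn M y')" by simp
  also have "... <= C + Z * C" using C' Z0 by (intro add_mono mult_left_mono) auto
  finally show ?thesis by (simp add: algebra_simps)
  qed
  have G: "nn M (%w. dxi T xi j (dxis T xi m y') w - dxi T xi' j (dxis T xi' m y') w) <= K * ep'" for j m
  proof -
  have "nn M (%w. dxi T xi j (dxis T xi m y') w - dxi T xi' j (dxis T xi' m y') w)
  <= (ep' * Z) * (C * (1 + Z)) + (ep' * Z) * C"
  by (rule order_trans[OF nn_dxi_dxis_xi_diff[OF ly']], intro add_mono mult_mono dz d1) (use C' e' Z0 in auto)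
  thus ?thesis by (simp add: K_def algebra_simps)
  qed
  \<comment> \<open>Changing \<eta> from \<epsilon>'^2 to \<epsilon>^2 costs at most 3 \<epsilon>'^2
    |y'|, which is O(\<epsilon>') since \<epsilon>' |y'| is bounded.\<close>
  obtain r where r: "l2 M r" "nn M r <= 3 * \<bar>ep'^2 - ep^2\<bar> * nn M y'"
  "Tm (ep^2) y' (%w. (ps w - L *. Ds T xi' (Dv T xi' y') w) + r w)"
  using Tm_shift[OF y'[unfolded Req_def], of "ep^2"] eps_sq e e' unfolding xi'_def by blast
  have "nn M r <= 3 * C * ep'"
  proof -
  have "\<bar>ep'^2 - ep^2\<bar> <= ep' * ep'" using e e' by (simp add: power2_eq_square mult_mono)
  hence "3 * \<bar>ep'^2 - ep^2\<bar> * nn M y' <= 3 * (ep' * ep') * nn M y'" by (intro mult_right_mono) auto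
  also have "... = 3 * ep' * (ep' * nn M y')" by simp
  also have "... <= 3 * ep' * C" using C' e' by (intro mult_left_mono) auto
  finally show ?thesis using r(2) by (simp add: mult_ac)
  qed
  define s where "s = (%w. r w + L *. (Ds T xi (Dv T xi y') w - Ds T xi' (Dv T xi' y') w))"
  have "nn M (%w. Ds T xi (Dv T xi y') w - Ds T xi' (Dv T xi' y') w)
  = nn M (%w. SUM j:UNIV. dxi T xi j (dxis T xi j y') w - dxi T xi' j (dxis T xi' j y') w)"
  by (rule nn_cong) (simp add: Ds_def sum_subtractf dxi_dxis_commute)
  also have "... <= (SUM j:(UNIV::'d set). K * ep')"
  by (intro order_trans[OF nn_sum_le] sum_mono G) (use ly' in auto)
  finally have "nn M (%w. Ds T xi (Dv T xi y') w - Ds T xi' (Dv T xi' y') w) <= real CARD('d) * K * ep'" by simp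
  moreover have ls: "l2 M (%w. Ds T xi (Dv T xi y') w - Ds T xi' (Dv T xi' y') w)" using ly' by auto
  ultimately have "nn M s <= 3 * C * ep' + L * (real CARD('d) * K * ep')"
  unfolding s_def using L_pos \<open>nn M r <= 3 * C * ep'\<close>
  by (intro order_trans[OF nn_triangle[OF r(1) l2_scaleR[OF ls]]] add_mono) auto
  hence ns: "nn M s <= C1 * ep'" by (simp add: C1_def algebra_simps)
  have "Req (ep^2) xi y' (%w. ps w + s w)"
  using r(3) unfolding Req_def s_def by (simp add: algebra_simps)
  from Req_diff[OF y[folded xi_def] this] have R: "Req (ep^2) xi (%w. y w - y' w) (%w. - s w)" by simp
  note lR = Req_l2(1)[OF R]
  have "L * nn M (dxi T xi i (dxis T xi k (%w. y w - y' w))) <= L * nn M (Ds T xi (Dv T xi (%w. y w - y' w)))"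
  using L_pos lR by (intro mult_left_mono nn_dxi_dxis_le) auto
  also have "... <= nn M s" using Req_H2(1)[OF R] eps_sq[OF e(1) e'(2)] by simp
  also note ns
  finally have "nn M (dxi T xi i (dxis T xi k (%w. y w - y' w))) <= C1 / L * ep'"
  using L_pos by (simp add: field_simps)
  moreover have "dxi T xi i (dxis T xi k (%w. y w - y' w)) = (%w. dxi T xi i (dxis T xi k y) w - dxi T xi i (dxis T xi k y') w)"
  by (simp add: dxis_diff[abs_def] dxi_diff[abs_def])
  ultimately have "nn M (%w. dxi T xi i (dxis T xi k y) w - dxi T xi i (dxis T xi k y') w) <= C1 / L * ep'" by simp
  moreover have l: "l2 M (dxi T xi'' i (dxis T xi'' k y))" "l2 M (dxi T xi'' i (dxis T xi'' k y'))" for xi'' using ly ly' by auto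
  ultimately show ?thesis
  using nn_triangle3[OF l(1)[of xi] l(2)[of xi] l(2)[of xi']] G[of i k] by (simp add: xi_def xi'_def distrib_right)
 qed
 show ?thesis
  unfolding nice_const_def
 proof (intro exI[of _ "C1 / L + K + C"] conjI allI impI)
  show "0 <= C1 / L + K + C" using C10 L_pos K0 C0 by simp
  show "nn M (%w. dxi T (ep *. ze) i (dxis T (ep *. ze) k y) w - dxi T (ep' *. ze) i (dxis T (ep' *. ze) k y') w)
  <= (C1 / L + K + C) * ep'"
  if "0 < ep" "ep <= ep'" "ep' <= 1" "Req (ep^2) (ep *. ze) y ps" "Req (ep'^2) (ep' *. ze) y' ps"
  for ep ep' y y' i k
  using main[OF that, of i k] that mult_nonneg_nonneg[OF C0, of ep'] by (simp add: distrib_right)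
  show "nn M (dxis T (ep *. ze) k y) <= C1 / L + K + C" if "0 < ep" "ep <= 1" "Req (ep^2) (ep *. ze) y ps" for ep y k
  proof -
  have "nn M (dxis T (ep *. ze) k y) <= C" using C[OF that] by (simp add: nn_dxis_eq Req_l2(1)[OF that(3)])
  moreover have "0 <= C1 / L" using C10 L_pos by simp
  ultimately show ?thesis using K0 by linarith
  qed
 qed
qed

text \<open>The components of the centred F are approximated by nice functions \<open>ps k\<close>.
  For the approximation a solution is explicit: \<open>z\<close> is L times the sum of adjoint
  differences of the solutions \<open>Y k\<close> for the sources \<open>ps k\<close>. Its gradient
  consists of second differences, which are Cauchy by \<open>nice_const\<close>, and its norm is
  bounded, so \<epsilon> |z| tends to 0. The approximation error passes through
  \<open>Req_energy\<close> uniformly in \<epsilon>.\<close>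

lemma key_fixed:
 assumes dense: "!!fi ka. l2 M fi ==> expectation fi = 0 ==> 0 < ka ==> EX ps. nice ze ps & nn M (%w. fi w - ps w) <= ka"
  and F: "l2 M F" and ka: "0 < ka"
 obtains ep0 where "0 < ep0"
  "!!ep ep' v v'. 0 < ep ==> ep <= ep' ==> ep' < ep0 ==> ep' <= 1 ==>
  Req (ep^2) (ep *. ze) v (%w. L *. Ds T (ep *. ze) (PiV F) w) ==>
  Req (ep'^2) (ep' *. ze) v' (%w. L *. Ds T (ep' *. ze) (PiV F) w) ==>
  nn M (%w. Dv T (ep *. ze) v w - Dv T (ep' *. ze) v' w) <= ka & ep * nn M v <= ka"
proof -
 define d where "d = real CARD('d)"
 have d0: "d > 0" by (simp add: d_def)
 \<comment> \<open>Small enough that both the gradient error ka1 and the error sqrt L ka1 in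
   \<epsilon> |v| stay below ka / 3.\<close>
 define ka1 where "ka1 = ka / (3 * (1 + sqrt L))"
 have sL: "0 < 1 + sqrt L" using L_pos by (simp add: add_pos_nonneg)
 have ka1: "ka1 > 0" using ka sL by (simp add: ka1_def)
 have k1: "ka1 <= ka / 3" "sqrt L * ka1 <= ka / 3"
  using ka sL L_pos by (simp_all add: ka1_def field_simps)
 have "EX ps. nice ze ps & nn M (%w. PiV F w $ k - ps w) <= ka1 / d" for k
 proof (rule dense)
  show "l2 M (%w. PiV F w $ k)" using F by auto
  show "expectation (%w. PiV F w $ k) = 0" using F by (simp add: PiV_nth expectation_Pi0 l2_nth cong: Bochner_Integration.integral_cong)
  show "0 < ka1 / d" using ka1 d0 by simp
 qed
 then obtain ps where ps: "!!k. nice ze (ps k)" "!!k. nn M (%w. PiV F w $ k - ps k w) <= ka1 / d" by metis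
 have lps: "l2 M (ps k)" and eps: "expectation (ps k) = 0" for k using ps(1)[of k] by (auto simp: nice_def)
 define \<Psi> where "\<Psi> = (%w. (\<chi> k. ps k w))"
 have l\<Psi>: "l2 M \<Psi>" unfolding \<Psi>_def by (intro l2_vec lps)
 have n\<Psi>: "nn M (%w. PiV F w - \<Psi> w) <= ka1"
 proof -
  have "nn M (%w. PiV F w - \<Psi> w) <= (SUM k:UNIV. nn M (%w. (PiV F w - \<Psi> w) $ k))"
  using F l\<Psi> by (intro nn_vec_le_sum) auto
  also have "... <= (SUM k:(UNIV::'d set). ka1 / d)" by (intro sum_mono) (use ps(2) in \<open>simp add: \<Psi>_def\<close>)
  finally show ?thesis using d0 by (simp add: d_def)
 qed
 obtain C where C: "!!k. nice_const ze (ps k) (C k)" using nice_cauchy[OF ps(1)] by metis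
 have C0: "C k >= 0" for k using C[of k] by (simp add: nice_const_def)
 have C1: "nn M (%w. dxi T (ep *. ze) i (dxis T (ep *. ze) k y) w - dxi T (ep' *. ze) i (dxis T (ep' *. ze) k y') w) <= C k * ep'"
  if "0 < ep" "ep <= ep'" "ep' <= 1" "Req (ep^2) (ep *. ze) y (ps k)" "Req (ep'^2) (ep' *. ze) y' (ps k)" for k ep ep' y y' i
  using C[of k] that unfolding nice_const_def by (elim conjE) simp
 have C2: "nn M (dxis T (ep *. ze) k y) <= C k" if "0 < ep" "ep <= 1" "Req (ep^2) (ep *. ze) y (ps k)" for k ep y
  using C[of k] that unfolding nice_const_def by (elim conjE) simp
 define Cs where "Cs = (SUM k:UNIV. C k)"
 have Cs0: "Cs >= 0" unfolding Cs_def by (intro sum_nonneg C0)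
 define Y where "Y k ep = (SOME y. Req (ep^2) (ep *. ze) y (ps k))" for k ep
 have Y: "Req (ep^2) (ep *. ze) (Y k ep) (ps k)" if e: "0 < ep" "ep <= 1" for k ep
 proof -
  obtain v where "Req (ep^2) (ep *. ze) v (ps k)"
  using Req_ex[OF lps[of k] eps[of k] conjunct1[OF eps_sq[OF e]] conjunct2[OF eps_sq[OF e]]] by blast
  thus ?thesis unfolding Y_def by (rule someI[of "%y. Req (ep^2) (ep *. ze) y (ps k)"])
 qed
 define z where "z ep = (%w. L *. (SUM k:UNIV. dxis T (ep *. ze) k (Y k ep) w))" for ep
 have z: "Req (ep^2) (ep *. ze) (z ep) (%w. L *. Ds T (ep *. ze) \<Psi> w)" if "0 < ep" "ep <= 1" for ep
  unfolding z_def \<Psi>_def Ds_def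
  using eps_sq[OF that] by (intro Req_scaleR Req_sum) (auto intro!: Req_dxis Y that)
 have comp: "nn M (%w. Dv T (ep *. ze) v w - Dv T (ep *. ze) (z ep) w) <= ka1 & ep * nn M v <= ep * nn M (z ep) + sqrt L * ka1"
  if e: "0 < ep" "ep <= 1" and v: "Req (ep^2) (ep *. ze) v (%w. L *. Ds T (ep *. ze) (PiV F) w)" for ep v
 proof -
  note lv = Req_l2(1)[OF v] and lz = Req_l2(1)[OF z[OF e]]
  have "Req (ep^2) (ep *. ze) (%w. v w - z ep w) (%w. L *. Ds T (ep *. ze) (%w. PiV F w - \<Psi> w) w)"
  using Req_diff[OF v z[OF e]] by (simp add: Ds_diff scaleR_diff_right)
  note en = Req_energy[OF this l2_diff[OF l2_PiV[OF F] l\<Psi>] conjunct1[OF eps_sq[OF e]]]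
  have "(ep * nn M (%w. v w - z ep w))^2 <= L * (nn M (%w. PiV F w - \<Psi> w))^2"
  using en(2) zero_le_power2[of "ep * nn M (%w. v w - z ep w)"] unfolding power_mult_distrib by linarith
  also have "... <= L * ka1^2" using n\<Psi> L_pos by (intro mult_left_mono power_mono) auto
  also have "... = (sqrt L * ka1)^2" using L_pos by (simp add: power_mult_distrib)
  finally have "ep * nn M (%w. v w - z ep w) <= sqrt L * ka1"
  by (rule power2_le_imp_le) (use L_pos ka1 in auto)
  moreover have "ep * nn M v <= ep * (nn M (z ep) + nn M (%w. v w - z ep w))"
  using e by (intro mult_left_mono nn_triangle_sub lv lz) auto
  ultimately show ?thesis using en(1) n\<Psi> by (simp add: Dv_diff[abs_def] distrib_left)
 qed
 have nz: "ep * nn M (z ep) <= L * Cs * ep" if e: "0 < ep" "ep <= 1" for ep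
 proof -
  have "nn M (z ep) = L * nn M (%w. SUM k:UNIV. dxis T (ep *. ze) k (Y k ep) w)"
  unfolding z_def using L_pos by (subst nn_scaleR) simp
  also have "... <= L * Cs" unfolding Cs_def
  using L_pos by (intro mult_left_mono order_trans[OF nn_sum_le] sum_mono C2[OF e] Y[OF e]) (auto intro: l2_dxis Req_l2(1)[OF Y[OF e]])
  finally show ?thesis using e by simp
 qed
 have zz: "nn M (%w. Dv T (ep *. ze) (z ep) w - Dv T (ep' *. ze) (z ep') w) <= d * L * Cs * ep'"
  if e: "0 < ep" "ep <= ep'" "ep' <= 1" for ep ep'
 proof -
  have e': "0 < ep'" "ep <= 1" using e by auto
  note lz = Req_l2(1)[OF z[OF e(1) e'(2)]] Req_l2(1)[OF z[OF e'(1) e(3)]]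
  note lY = Req_l2(1)[OF Y[OF e(1) e'(2)]] Req_l2(1)[OF Y[OF e'(1) e(3)]]
  have "nn M (%w. Dv T (ep *. ze) (z ep) w - Dv T (ep' *. ze) (z ep') w)
  <= (SUM i:UNIV. nn M (%w. (Dv T (ep *. ze) (z ep) w - Dv T (ep' *. ze) (z ep') w) $ i))"
  by (intro nn_vec_le_sum l2_diff l2_Dv lz)
  also have "... <= (SUM i:(UNIV::'d set). L * (Cs * ep'))"
  proof (rule sum_mono)
  fix i :: 'd
  have "(%w. (Dv T (ep *. ze) (z ep) w - Dv T (ep' *. ze) (z ep') w) $ i) =
  (%w. L *. (SUM k:UNIV. dxi T (ep *. ze) i (dxis T (ep *. ze) k (Y k ep)) w - dxi T (ep' *. ze) i (dxis T (ep' *. ze) k (Y k ep')) w))"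
  by (simp add: z_def dxi_scaleR dxi_sum sum_subtractf scaleR_diff_right)
  hence "nn M (%w. (Dv T (ep *. ze) (z ep) w - Dv T (ep' *. ze) (z ep') w) $ i) =
  L * nn M (%w. SUM k:UNIV. dxi T (ep *. ze) i (dxis T (ep *. ze) k (Y k ep)) w - dxi T (ep' *. ze) i (dxis T (ep' *. ze) k (Y k ep')) w)"
  using L_pos by (simp only: nn_scaleR)
  also have "... <= L * (SUM k:UNIV. C k * ep')"
  using L_pos lY by (intro mult_left_mono order_trans[OF nn_sum_le] sum_mono C1[OF e] Y e e') (auto intro!: l2_diff l2_dxi l2_dxis)
  finally show "nn M (%w. (Dv T (ep *. ze) (z ep) w - Dv T (ep' *. ze) (z ep') w) $ i) <= L * (Cs * ep')"
  by (simp add: Cs_def sum_distrib_right)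
  qed
  finally show ?thesis by (simp add: d_def mult_ac)
 qed
 define ep0 where "ep0 = ka / (3 * ((1 + d) * (L * Cs) + 1))"
 have LC: "0 <= L * Cs" using L_pos Cs0 by simp
 have pos: "0 < (1 + d) * (L * Cs) + 1" using d0 LC by (simp add: add_nonneg_pos)
 have ep0: "0 < ep0" using ka pos by (simp add: ep0_def)
 have small: "d * L * Cs * ep <= ka / 3" "L * Cs * ep <= ka / 3" if "0 < ep" "ep < ep0" for ep
 proof -
  have "((1 + d) * (L * Cs) + 1) * ep <= ka / 3"
  using that pos by (simp add: ep0_def field_simps)
  moreover have "0 <= d * L * Cs * ep" "0 <= L * Cs * ep" using that d0 L_pos Cs0 by auto
  ultimately show "d * L * Cs * ep <= ka / 3" "L * Cs * ep <= ka / 3" using that by (auto simp: algebra_simps)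
 qed
 show ?thesis
 proof (rule that[OF ep0], intro conjI)
  fix ep ep' v v'
  assume e: "0 < ep" "ep <= ep'" "ep' < ep0" "ep' <= 1"
  and v: "Req (ep^2) (ep *. ze) v (%w. L *. Ds T (ep *. ze) (PiV F) w)"
  and v': "Req (ep'^2) (ep' *. ze) v' (%w. L *. Ds T (ep' *. ze) (PiV F) w)"
  have e': "0 < ep'" "ep <= 1" "ep < ep0" using e by auto
  note l1 = l2_Dv[OF Req_l2(1)[OF v], of "ep *. ze"] and l2 = l2_Dv[OF Req_l2(1)[OF z[OF e(1) e'(2)]], of "ep *. ze"]
  and l3 = l2_Dv[OF Req_l2(1)[OF z[OF e'(1) e(4)]], of "ep' *. ze"] and l4 = l2_Dv[OF Req_l2(1)[OF v'], of "ep' *. ze"]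
  have a: "nn M (%w. Dv T (ep *. ze) v w - Dv T (ep *. ze) (z ep) w) <= ka / 3"
  using comp[OF e(1) e'(2) v] k1 by auto
  have b: "nn M (%w. Dv T (ep' *. ze) (z ep') w - Dv T (ep' *. ze) v' w) <= ka / 3"
  using comp[OF e'(1) e(4) v'] k1 by (subst nn_minus_commute) auto
  have c: "nn M (%w. Dv T (ep *. ze) (z ep) w - Dv T (ep' *. ze) (z ep') w) <= ka / 3"
  using zz[OF e(1,2,4)] small(1)[OF e'(1) e(3)] by simp
  show "nn M (%w. Dv T (ep *. ze) v w - Dv T (ep' *. ze) v' w) <= ka"
  using nn_triangle3[OF l1 l2 l4] nn_triangle3[OF l2 l3 l4] a b c by linarith
  show "ep * nn M v <= ka" using comp[OF e(1) e'(2) v] nz[OF e(1) e'(2)] small(2)[OF e(1) e'(3)] k1 ka by linarith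
 qed
qed

end

section \<open>Smallness of the corrector\<close>

context parab
begin

lemma sol_ex:
 assumes "l2 M F" "0 < ep" "ep <= 1"
 obtains v where "Req (ep^2) xi v (%w. L *. Ds T xi (PiV F) w)"
proof (rule Req_ex)
 show "l2 M (%w. L *. Ds T xi (PiV F) w)" using assms by (intro l2_scaleR l2_Ds l2_PiV)
 show "expectation (%w. L *. Ds T xi (PiV F) w) = 0"
  using assms by (simp add: Ds_PiV expectation_Pi0 l2_Ds)
 show "0 < ep^2" "ep^2 <= 1" using eps_sq[OF assms(2,3)] by auto
qed

lemma sol_diff:
 assumes v: "Req (ep^2) xi v (%w. L *. Ds T xi (PiV F) w)" and wa: "Req (ep^2) xi wa (%w. L *. Ds T xi (PiV G) w)"
  and l: "l2 M F" "l2 M G" and e: "0 < ep"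
 shows "nn M (%w. Dv T xi v w - Dv T xi wa w) <= nn M (%w. F w - G w)"
  "ep * nn M v <= ep * nn M wa + sqrt L * nn M (%w. F w - G w)"
proof -
 note lv = Req_l2(1)[OF v] and lw = Req_l2(1)[OF wa]
 have "Req (ep^2) xi (%w. v w - wa w) (%w. L *. Ds T xi (%w. PiV F w - PiV G w) w)"
  using Req_diff[OF v wa] by (simp add: Ds_diff scaleR_diff_right)
 note en = Req_energy[OF this l2_diff[OF l2_PiV l2_PiV, OF l] zero_less_power[OF e]]
 have n: "nn M (%w. PiV F w - PiV G w) <= nn M (%w. F w - G w)" by (rule nn_PiV_diff[OF l])
 thus "nn M (%w. Dv T xi v w - Dv T xi wa w) <= nn M (%w. F w - G w)"
  using en(1) e by (simp add: Dv_diff[abs_def])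
 have "(ep * nn M (%w. v w - wa w))^2 <= L * (nn M (%w. PiV F w - PiV G w))^2"
  using en(2) zero_le_power2[of "ep * nn M (%w. v w - wa w)"] unfolding power_mult_distrib by linarith
 also have "... <= L * (nn M (%w. F w - G w))^2" using n L_pos by (intro mult_left_mono power_mono) auto
 also have "... = (sqrt L * nn M (%w. F w - G w))^2" using L_pos by (simp add: power_mult_distrib)
 finally have "ep * nn M (%w. v w - wa w) <= sqrt L * nn M (%w. F w - G w)"
  by (rule power2_le_imp_le) (use L_pos in auto)
 moreover have "ep * nn M v <= ep * (nn M wa + nn M (%w. v w - wa w))"
  using e by (intro mult_left_mono nn_triangle_sub lv lw) auto
 ultimately show "ep * nn M v <= ep * nn M wa + sqrt L * nn M (%w. F w - G w)"
  by (simp add: distrib_left)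
qed

text \<open>The corrector equation with a general flux source F. Taking the j-th column of the
  coefficient for F, as in \<open>colC\<close>, gives the component \<Phi>_j.\<close>

definition cor :: "('w => real^'d^'d) => ('w => complex^'d) => real => real^'d => ('w => complex) => bool" where
 "cor a F et xi ph \<longleftrightarrow> Tm et ph (%w. - Pi0 M (Ds T xi (%w. cmv (a w) (Dv T xi ph w) + F w)) w)"

context
 fixes ze :: "real^'d"
 assumes dense: "!!fi ka. l2 M fi ==> expectation fi = 0 ==> 0 < ka ==> EX ps. nice ze ps & nn M (%w. fi w - ps w) <= ka"
begin

lemma key_family:
 assumes F: "cauF F"
  and V: "!!ep. 0 < ep ==> ep <= 1 ==> Req (ep^2) (ep *. ze) (V ep) (%w. L *. Ds T (ep *. ze) (PiV (F ep)) w)"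
  and ka: "0 < ka"
 shows "EX ep0>0. ALL ep ep'. 0 < ep & ep <= ep' & ep' < ep0 & ep' <= 1 -->
  nn M (%w. Dv T (ep *. ze) (V ep) w - Dv T (ep' *. ze) (V ep') w) <= ka & ep * nn M (V ep) <= ka"
proof -
 define ka1 where "ka1 = ka / (3 * (1 + sqrt L))"
 have sL: "0 < 1 + sqrt L" using L_pos by (simp add: add_pos_nonneg)
 have ka1: "ka1 > 0" using ka sL by (simp add: ka1_def)
 have k1: "ka1 <= ka / 3" "sqrt L * ka1 <= ka / 3"
  using ka sL L_pos by (simp_all add: ka1_def field_simps)
 have lF: "l2 M (F ep)" if "0 < ep" "ep <= 1" for ep using F that by (auto simp: cauF_def)
 have "EX ep1>0. ALL ep ep'. 0 < ep & ep <= ep' & ep' < ep1 & ep' <= 1 --> nn M (%w. F ep w - F ep' w) <= ka1"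
  using F ka1 unfolding cauF_def by (elim conjE allE[of _ ka1]) simp
 then obtain ep1 where e1: "ep1 > 0" and "ALL ep ep'. 0 < ep & ep <= ep' & ep' < ep1 & ep' <= 1 --> nn M (%w. F ep w - F ep' w) <= ka1"
  by (elim exE conjE)
 hence e1': "nn M (%w. F ep w - F ep' w) <= ka1" if "0 < ep" "ep <= ep'" "ep' < ep1" "ep' <= 1" for ep ep'
  using that by simp
 define e2 where "e2 = min (ep1 / 2) (1 / 2)"
 have e2: "0 < e2" "e2 < ep1" "e2 <= 1" using e1 by (auto simp: e2_def)
 note lF2 = lF[OF e2(1,3)]
 have k3: "0 < ka / 3" using ka by simp
 obtain ep3 where e3: "0 < ep3"
  "!!ep ep' v v'. 0 < ep ==> ep <= ep' ==> ep' < ep3 ==> ep' <= 1 ==>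
  Req (ep^2) (ep *. ze) v (%w. L *. Ds T (ep *. ze) (PiV (F e2)) w) ==>
  Req (ep'^2) (ep' *. ze) v' (%w. L *. Ds T (ep' *. ze) (PiV (F e2)) w) ==>
  nn M (%w. Dv T (ep *. ze) v w - Dv T (ep' *. ze) v' w) <= ka / 3 & ep * nn M v <= ka / 3"
  using key_fixed[OF dense lF2 k3] by blast
 show ?thesis
 proof (intro exI[of _ "min e2 ep3"] conjI allI impI)
  show "0 < min e2 ep3" using e2 e3 by simp
  fix ep ep' assume a: "0 < ep & ep <= ep' & ep' < min e2 ep3 & ep' <= 1"
  hence e: "0 < ep" "ep <= ep'" "ep' < ep3" "ep' <= 1" "0 < ep'" "ep <= 1" "ep' <= e2" "ep <= e2" by auto
  obtain v where v: "Req (ep^2) (ep *. ze) v (%w. L *. Ds T (ep *. ze) (PiV (F e2)) w)" using sol_ex[OF lF2 e(1,6)] by blast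
  obtain v' where v': "Req (ep'^2) (ep' *. ze) v' (%w. L *. Ds T (ep' *. ze) (PiV (F e2)) w)" using sol_ex[OF lF2 e(5,4)] by blast
  note VV = V[OF e(1,6)] V[OF e(5,4)]
  note l = l2_Dv[OF Req_l2(1)[OF VV(1)], of "ep *. ze"] l2_Dv[OF Req_l2(1)[OF v], of "ep *. ze"]
  l2_Dv[OF Req_l2(1)[OF v'], of "ep' *. ze"] l2_Dv[OF Req_l2(1)[OF VV(2)], of "ep' *. ze"]
  note d1 = sol_diff[OF VV(1) v lF[OF e(1,6)] lF2 e(1)] and d2 = sol_diff[OF VV(2) v' lF[OF e(5,4)] lF2 e(5)]
  have n1: "nn M (%w. F ep w - F e2 w) <= ka1" "nn M (%w. F ep' w - F e2 w) <= ka1" using e1' e e2 by auto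
  have n2: "sqrt L * nn M (%w. F ep w - F e2 w) <= sqrt L * ka1" using n1 L_pos by (intro mult_left_mono) auto
  note k = e3(2)[OF e(1-4) v v']
  have "nn M (%w. Dv T (ep' *. ze) v' w - Dv T (ep' *. ze) (V ep') w) <= ka / 3"
  by (subst nn_minus_commute) (use d2(1) n1(2) k1 in linarith)
  thus "nn M (%w. Dv T (ep *. ze) (V ep) w - Dv T (ep' *. ze) (V ep') w) <= ka"
  using nn_triangle3[OF l(1,2,4)] nn_triangle3[OF l(2,3,4)] d1(1) n1 k k1 by linarith
  show "ep * nn M (V ep) <= ka" using d1(2) n2 k k1 ka by linarith
 qed
qed

text \<open>Writing a = L - (L - a), the corrector solves the reference problem with source L Ds
  (PiV X), where X = ((L - a) Dv \<phi> - F) / L depends on Dv \<phi> with Lipschitz constant r =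
  sqrt (1 - l/L) < 1. Iterates started from 0 approximate X with error r^n C0 uniformly in
  \<epsilon>, and each of them is a Cauchy family by \<open>key_family\<close>. Hence \<epsilon>
  |\<phi>| lies within sqrt L r^n C0 of a quantity that tends to 0.\<close>

lemma corrector_small:
 assumes a: "coeff_ok M l L a" "0 < l" "l <= L" and F: "l2 M F" and ka: "0 < ka"
 shows "EX ep0>0. ALL ep ph. 0 < ep & ep < ep0 & ep <= 1 --> cor a F (ep^2) (ep *. ze) ph --> ep * nn M ph <= ka"
proof -
 have l0: "0 <= l" using a by simp
 note lc = l2_cmv[OF a(1) l0 L_pos]
 define X where "X G = (%w. (1 / L) *. (L *. G w - cmv (a w) (G w) - F w))" for G
 define r where "r = sqrt (L * (L - l)) / L"
 have r0: "0 <= r" using a L_pos by (simp add: r_def)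
 have r1: "r < 1"
 proof -
  have "sqrt (L * (L - l)) < sqrt (L * L)" using a L_pos by (intro real_sqrt_less_mono) simp
  thus ?thesis using L_pos by (simp add: r_def)
 qed
 have lX: "l2 M (X G)" if "l2 M G" for G unfolding X_def by (intro l2_scaleR l2_diff lc that F)
 have XX: "nn M (%w. X G w - X H w) <= r * nn M (%w. G w - H w)" if G: "l2 M G" "l2 M H" for G H
 proof -
  have "(%w. X G w - X H w) = (%w. (1 / L) *. (L *. (G w - H w) - cmv (a w) (G w - H w)))"
  by (simp add: X_def cmv_diff algebra_simps)
  hence "nn M (%w. X G w - X H w) = (1 / L) * nn M (%w. L *. (G w - H w) - cmv (a w) (G w - H w))"
  using L_pos by (simp only: nn_scaleR) simp
  also have "... <= (1 / L) * (sqrt (L * (L - l)) * nn M (%w. G w - H w))"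
  using L_pos by (intro mult_left_mono nn_cmv_defect[OF a(1) l0 L_pos l2_diff[OF G] a(3)]) auto
  finally show ?thesis by (simp add: r_def)
 qed
 have X0: "nn M (X (%w. 0)) = nn M F / L"
 proof -
  have "cmv A 0 = 0" for A :: "real^'d^'d" by (simp add: cmv_def vec_eq_iff)
  hence "X (%w. 0) = (%w. (- 1 / L) *. F w)" by (simp add: X_def)
  thus ?thesis using L_pos by (simp only: nn_scaleR) simp
 qed
 have XReq: "Req (ep^2) xi ph (%w. L *. Ds T xi (PiV (X (Dv T xi ph))) w)" if c: "cor a F (ep^2) xi ph" and e: "0 < ep" for ep xi ph
 proof -
  have lph: "l2 M ph" using c Tm_l2 by (auto simp: cor_def)
  define G where "G = (%w. cmv (a w) (Dv T xi ph w) + F w)"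
  have lG: "l2 M G" unfolding G_def by (intro l2_add lc l2_Dv lph F)
  have c': "Tm (ep^2) ph (%w. - Pi0 M (Ds T xi G) w)" using c by (simp add: cor_def G_def)
  have "expectation (%w. - Pi0 M (Ds T xi G) w) = 0" by (simp add: expectation_Pi0 l2_Ds lG)
  hence "expectation ph = 0" using Tm_mean[OF c'] e by simp
  hence "expectation (Ds T xi (Dv T xi ph)) = 0"
  using lph by (simp add: expectation_Ds l2_Dv expectation_dxi)
  hence p: "Pi0 M (Ds T xi (Dv T xi ph)) = Ds T xi (Dv T xi ph)" by (rule Pi0_id)
  have XG: "X (Dv T xi ph) = (%w. Dv T xi ph w - (1 / L) *. G w)"
  using L_pos by (simp add: X_def G_def fun_eq_iff scaleR_diff_right scaleR_add_right)
  have "L *. Ds T xi (PiV (X (Dv T xi ph))) w - L *. Ds T xi (Dv T xi ph) w = - Pi0 M (Ds T xi G) w" for w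
  proof -
  have "Ds T xi (PiV (X (Dv T xi ph))) w = Pi0 M (Ds T xi (X (Dv T xi ph))) w"
  by (simp add: Ds_PiV[OF lX[OF l2_Dv[OF lph]]])
  also have "Ds T xi (X (Dv T xi ph)) = (%w. Ds T xi (Dv T xi ph) w - (1 / L) *. Ds T xi G w)"
  unfolding XG by (simp add: Ds_diff Ds_scaleR fun_eq_iff)
  also have "Pi0 M ... w = Pi0 M (Ds T xi (Dv T xi ph)) w - Pi0 M (%w. (1 / L) *. Ds T xi G w) w"
  by (intro Pi0_diff l2_Ds l2_Dv l2_scaleR lph lG)
  also have "Pi0 M (%w. (1 / L) *. Ds T xi G w) w = (1 / L) *. Pi0 M (Ds T xi G) w"
  by (simp add: Pi0_def scaleR_diff_right)
  finally show ?thesis using L_pos by (simp add: p scaleR_diff_right)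
  qed
  thus ?thesis using c' by (simp add: Req_def)
 qed
 \<comment> \<open>Comes from |X| \<le> |F| / L + r |Dv ph| together with |Dv ph| \<le> |X|, the
   latter by \<open>Req_energy\<close>.\<close>
 define C0 where "C0 = nn M F / (L * (1 - r))"
 have C00: "C0 >= 0" using L_pos r1 by (simp add: C0_def)
 have bd: "nn M (X (Dv T xi ph)) <= C0" if c: "cor a F (ep^2) xi ph" and e: "0 < ep" for ep xi ph
 proof -
  have lph: "l2 M ph" using c Tm_l2 by (auto simp: cor_def)
  note lD = l2_Dv[OF lph, of xi]
  have "nn M (Dv T xi ph) <= nn M (PiV (X (Dv T xi ph)))"
  by (rule Req_energy(1)[OF XReq[OF c e] l2_PiV[OF lX[OF lD]]]) (use e in simp)
  also have "... <= nn M (X (Dv T xi ph))" by (rule nn_PiV[OF lX[OF lD]])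
  finally have 1: "nn M (Dv T xi ph) <= nn M (X (Dv T xi ph))" .
  have "nn M (X (Dv T xi ph)) <= nn M F / L + r * nn M (Dv T xi ph)"
  using nn_triangle_sub[OF lX[OF lD] lX[OF l2_zero]] XX[OF lD l2_zero] X0 by simp
  also have "r * nn M (Dv T xi ph) <= r * nn M (X (Dv T xi ph))" using 1 r0 by (rule mult_left_mono)
  finally have "(1 - r) * nn M (X (Dv T xi ph)) <= nn M F / L" by (simp add: algebra_simps)
  thus ?thesis using L_pos r1 by (simp add: C0_def field_simps)
 qed
 have iter: "EX Xn. cauF Xn & (ALL ep ph. 0 < ep --> ep <= 1 --> cor a F (ep^2) (ep *. ze) ph -->
  nn M (%w. X (Dv T (ep *. ze) ph) w - Xn ep w) <= r ^ n * C0)" for n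
 proof (induction n)
  case 0
  show ?case
  by (rule exI[of _ "%_ _. 0"]) (use bd in \<open>auto simp: cauF_def\<close>)
 next
  case (Suc n)
  then obtain Xn where Xn: "cauF Xn" "!!ep ph. 0 < ep ==> ep <= 1 ==> cor a F (ep^2) (ep *. ze) ph ==>
  nn M (%w. X (Dv T (ep *. ze) ph) w - Xn ep w) <= r ^ n * C0" by blast
  have lXn: "l2 M (Xn ep)" if "0 < ep" "ep <= 1" for ep using Xn(1) that by (auto simp: cauF_def)
  have "ALL ep. EX v. 0 < ep & ep <= 1 --> Req (ep^2) (ep *. ze) v (%w. L *. Ds T (ep *. ze) (PiV (Xn ep)) w)"
  using sol_ex[OF lXn] by metis
  then obtain V where V: "!!ep. 0 < ep ==> ep <= 1 ==> Req (ep^2) (ep *. ze) (V ep) (%w. L *. Ds T (ep *. ze) (PiV (Xn ep)) w)"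
  by metis
  have lV: "l2 M (Dv T xi (V ep))" if "0 < ep" "ep <= 1" for ep xi by (rule l2_Dv[OF Req_l2(1)[OF V[OF that]]])
  define Y where "Y ep = X (Dv T (ep *. ze) (V ep))" for ep
  have "cauF Y"
  unfolding cauF_def
  proof (intro conjI allI impI)
  fix ep :: real assume "0 < ep & ep <= 1" thus "l2 M (Y ep)" unfolding Y_def by (intro lX lV) auto
  next
  fix ka' :: real assume k: "ka' > 0"
  obtain ep0 where e0: "ep0 > 0" "!!ep ep'. 0 < ep & ep <= ep' & ep' < ep0 & ep' <= 1 ==>
  nn M (%w. Dv T (ep *. ze) (V ep) w - Dv T (ep' *. ze) (V ep') w) <= ka'"
  using key_family[OF Xn(1) V k] by blast
  show "EX ep0>0. ALL ep ep'. 0 < ep & ep <= ep' & ep' < ep0 & ep' <= 1 --> nn M (%w. Y ep w - Y ep' w) <= ka'"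
  proof (intro exI[of _ ep0] conjI e0 allI impI)
  fix ep ep' :: real assume e: "0 < ep & ep <= ep' & ep' < ep0 & ep' <= 1"
  let ?n = "nn M (%w. Dv T (ep *. ze) (V ep) w - Dv T (ep' *. ze) (V ep') w)"
  have "nn M (%w. Y ep w - Y ep' w) <= r * ?n"
  unfolding Y_def using e by (intro XX lV) auto
  also have "... <= 1 * ka'" using e0(2)[OF e] r0 r1 by (intro mult_mono) auto
  finally show "nn M (%w. Y ep w - Y ep' w) <= ka'" by simp
  qed
  qed
  moreover have "nn M (%w. X (Dv T (ep *. ze) ph) w - Y ep w) <= r ^ Suc n * C0"
  if e: "0 < ep" "ep <= 1" and c: "cor a F (ep^2) (ep *. ze) ph" for ep ph
  proof -
  have lph: "l2 M ph" using c Tm_l2 by (auto simp: cor_def)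
  have "nn M (%w. X (Dv T (ep *. ze) ph) w - Y ep w) <= r * nn M (%w. Dv T (ep *. ze) ph w - Dv T (ep *. ze) (V ep) w)"
  unfolding Y_def by (intro XX lV e l2_Dv lph)
  also have "... <= r * (r ^ n * C0)"
  using r0 by (intro mult_left_mono order_trans[OF sol_diff(1)[OF XReq[OF c e(1)] V[OF e] lX[OF l2_Dv[OF lph]] lXn[OF e] e(1)] Xn(2)[OF e c]])
  finally show ?thesis by simp
  qed
  ultimately show ?case by blast
 qed
 have "(%n. sqrt L * (r ^ n * C0)) \<longlonglongrightarrow> sqrt L * (0 * C0)"
  by (intro tendsto_intros LIMSEQ_power_zero) (use r0 r1 in simp)
 hence "eventually (%n. sqrt L * (r ^ n * C0) < ka / 2) sequentially"
  by (rule order_tendstoD) (use ka in simp)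
 then obtain n where n: "sqrt L * (r ^ n * C0) < ka / 2" by (auto simp: eventually_sequentially)
 obtain Xn where Xn: "cauF Xn" "!!ep ph. 0 < ep ==> ep <= 1 ==> cor a F (ep^2) (ep *. ze) ph ==>
  nn M (%w. X (Dv T (ep *. ze) ph) w - Xn ep w) <= r ^ n * C0" using iter[of n] by blast
 have lXn: "l2 M (Xn ep)" if "0 < ep" "ep <= 1" for ep using Xn(1) that by (auto simp: cauF_def)
 have "ALL ep. EX v. 0 < ep & ep <= 1 --> Req (ep^2) (ep *. ze) v (%w. L *. Ds T (ep *. ze) (PiV (Xn ep)) w)"
  using sol_ex[OF lXn] by metis
 then obtain V where V: "!!ep. 0 < ep ==> ep <= 1 ==> Req (ep^2) (ep *. ze) (V ep) (%w. L *. Ds T (ep *. ze) (PiV (Xn ep)) w)"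
  by metis
 have k2: "0 < ka / 2" using ka by simp
 obtain ep0 where e0: "ep0 > 0" "!!ep ep'. 0 < ep & ep <= ep' & ep' < ep0 & ep' <= 1 ==> ep * nn M (V ep) <= ka / 2"
  using key_family[OF Xn(1) V k2] by blast
 show ?thesis
 proof (intro exI[of _ ep0] conjI e0 allI impI)
  fix ep ph assume "0 < ep & ep < ep0 & ep <= 1" and c: "cor a F (ep^2) (ep *. ze) ph"
  hence e: "0 < ep" "ep <= 1" "ep < ep0" by auto
  have lph: "l2 M ph" using c Tm_l2 by (auto simp: cor_def)
  have "sqrt L * nn M (%w. X (Dv T (ep *. ze) ph) w - Xn ep w) <= sqrt L * (r ^ n * C0)"
  using L_pos by (intro mult_left_mono Xn(2)[OF e(1,2) c]) auto
  thus "ep * nn M ph <= ka"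
  using sol_diff(2)[OF XReq[OF c e(1)] V[OF e(1,2)] lX[OF l2_Dv[OF lph]] lXn[OF e(1,2)] e(1)] e0(2)[of ep ep] e n
  by simp
 qed
qed

lemma corrector_ex:
 assumes a: "coeff_ok M l L a" "0 < l" "l <= L" and F: "l2 M F" and et: "0 < et" "et <= 1"
 shows "EX ph. cor a F et xi ph"
proof -
 have l0: "0 <= l" using a by simp
 have g: "l2 M (%w. - Pi0 M (Ds T xi F) w)" "expectation (%w. - Pi0 M (Ds T xi F) w) = 0"
  using F by (auto simp: expectation_Pi0 l2_Ds)
 obtain v where v: "Tm et v (%w. - Pi0 M (Ds T xi F) w - Pi0 M (Ds T xi (%w. cmv (a w) (Dv T xi v w))) w)"
  using existence[OF a(1) l0 a(3) g et] by blast
 have lv: "l2 M v" using v Tm_l2 by auto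
 have "- Pi0 M (Ds T xi (%w. cmv (a w) (Dv T xi v w) + F w)) w =
  - Pi0 M (Ds T xi F) w - Pi0 M (Ds T xi (%w. cmv (a w) (Dv T xi v w))) w" for w
  unfolding Ds_add[abs_def] using F lv by (subst Pi0_add) (auto intro!: l2_Ds l2_cmv[OF a(1) l0 L_pos] l2_Dv)
 hence "cor a F et xi v" using v by (simp add: cor_def)
 thus ?thesis by blast
qed

end

text \<open>The mean of g = ev + Dv P is ev, so |ev| is at most the norm of g. The Dirichlet energy
  E of g is the real part of the expected divergence of the flux, plus the product of Dv P with the
  flux. The energy inequality for P bounds that product by E / 2, where the half is the loss of
  explicit time stepping; hence the factor 2.\<close>

lemma positivity:
 assumes a: "coeff_ok M l L a" "0 < l" "l <= L" and et: "0 < et"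
  and P: "Tm et P (%w. - Pi0 M (Ds T xi (%w. cmv (a w) (ev xi + Dv T xi P w))) w)"
 shows "l * (norm (ev xi))^2 <= 2 * Re (expectation (Ds T xi (%w. cmv (a w) (ev xi + Dv T xi P w))))"
  "expectation P = 0"
proof -
 have l0: "0 <= l" using a by simp
 have lP: "l2 M P" using P Tm_l2 by auto
 define g where "g = (%w. ev xi + Dv T xi P w)"
 define G where "G = (%w. cmv (a w) (g w))"
 have lg: "l2 M g" unfolding g_def using lP by auto
 have lG: "l2 M G" unfolding G_def by (rule l2_cmv[OF a(1) l0 L_pos lg])
 have P': "Tm et P (%w. - Pi0 M (Ds T xi G) w)" using P by (simp add: G_def g_def)
 show EP: "expectation P = 0"
  by (rule Tm_mean[OF P' et]) (simp add: expectation_Pi0 l2_Ds lG)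
 define E where "E = ip M g G"
 have G2: "(nn M G)^2 <= L * E" unfolding E_def G_def by (rule nn_cmv_sq[OF a(1) l0 L_pos lg a(3)])
 have low: "l * (nn M g)^2 <= E" unfolding E_def G_def by (rule ip_cmv_lower[OF a(1) l0 L_pos lg a(3)])
 have E0: "0 <= E" using low l0 by (meson order_trans mult_nonneg_nonneg zero_le_power2)
 have Q: "Re (expectation (Ds T xi G)) = expectation G \<bullet> ev xi"
  by (simp add: expectation_Ds[OF lG] inner_vec_def inner_complex_def expectation_nth l2_integrable[OF lG] algebra_simps)
 have "ip M (%w. ev xi) G = expectation G \<bullet> ev xi" by (subst ip_commute) (rule ip_const[OF lG])
 hence E': "E = Re (expectation (Ds T xi G)) + ip M (Dv T xi P) G"
  unfolding E_def g_def using lP lG by (subst ip_add_left) (auto simp: Q)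
 have "0 <= 2 * et * (nn M P)^2" using et by simp
 also have "... <= - 2 * ip M P (Pi0 M (Ds T xi G)) + th * (nn M (Pi0 M (Ds T xi G)))^2"
  using Tm_en[OF P' et] by simp
 also have "ip M P (Pi0 M (Ds T xi G)) = ip M (Dv T xi P) G"
  using lP lG by (simp add: ip_Pi0 l2_Ds Pi0_id[OF EP] ip_Dv)
 also have "th * (nn M (Pi0 M (Ds T xi G)))^2 <= th * (4 * real CARD('d) * (L * E))"
 proof (intro mult_left_mono th)
  have "(nn M (Pi0 M (Ds T xi G)))^2 <= (nn M (Ds T xi G))^2" by (intro power_mono nn_Pi0 l2_Ds lG) simp
  also have "... <= 4 * real CARD('d) * (nn M G)^2" by (rule nn_Ds_sq_le[OF lG])
  also have "... <= 4 * real CARD('d) * (L * E)" using G2 by (intro mult_left_mono) auto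
  finally show "(nn M (Pi0 M (Ds T xi G)))^2 <= 4 * real CARD('d) * (L * E)" .
 qed
 also have "th * (4 * real CARD('d) * (L * E)) = (4 * real CARD('d) * L * th) * E" by simp
 also have "... <= 1 * E" using th E0 by (intro mult_right_mono) auto
 finally have "E <= 2 * Re (expectation (Ds T xi G))" using E' by simp
 moreover have "norm (ev xi) <= nn M g"
 proof -
  have "expectation (Dv T xi P) = 0"
  using lP by (simp add: vec_eq_iff expectation_nth l2_integrable l2_Dv expectation_dxi EP)
  hence "expectation g = ev xi"
  unfolding g_def using l2_integrable[OF l2_Dv[OF lP, of xi]] by (simp add: prob_space)
  thus ?thesis using norm_expectation_le[OF lg] by simp
 qed
 hence "l * (norm (ev xi))^2 <= l * (nn M g)^2" using l0 by (intro mult_left_mono power_mono) auto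
 ultimately show "l * (norm (ev xi))^2 <= 2 * Re (expectation (Ds T xi (%w. cmv (a w) (ev xi + Dv T xi P w))))"
  using low by (simp add: G_def g_def)
qed

end

section \<open>Ergodicity: density of coboundaries\<close>

context prob_space
begin

text \<open>Von Neumann's argument: the element of minimal norm in the closure of \<open>\<phi> + R\<close> is orthogonal to
 \<open>R\<close>, hence invariant.\<close>

lemma dense_coboundaries:
 fixes U :: "'i => 'a => 'a" and R :: "('a => complex) => bool"
 assumes U: "!!t. t : I ==> mpres M (U t)"
  and inv: "!!P :: 'a => complex. l2 M P ==> expectation P = 0 ==> (!!t. t : I ==> nn M (%w. P (U t w) - P w) = 0) ==> nn M P = 0"
  and R_l2: "!!f. R f ==> l2 M f & expectation f = 0"
  and R_add: "!!f g. R f ==> R g ==> R (%w. f w + g w)"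
  and R_scale: "!!f r. R f ==> R (%w. r *. f w)"
  and R_zero: "R (%w. 0)"
  and R_gen: "!!fi t. l2 M fi ==> expectation fi = 0 ==> t : I ==> R (%w. fi (U t w) - fi w)"
  and fi: "l2 M fi" "expectation fi = 0" and ka: "0 < ka"
 shows "EX ps. R ps & nn M (%w. fi w - ps w) <= ka"
proof -
 define S where "S = {(nn M (%w. fi w - r w))^2 | r. R r}"
 have S: "S ~= {}" "bdd_below S" using R_zero by (auto simp: S_def intro!: bdd_belowI[of _ 0])
 define m where "m = Inf S"
 have m_le: "m <= (nn M (%w. fi w - r w))^2" if "R r" for r
  unfolding m_def using that S(2) by (intro cInf_lower) (auto simp: S_def)
 define de :: "nat => real" where "de n = 1 / (real n + 1)" for n
 have d: "0 < de n" "n <= k ==> de k <= de n" for n k by (auto simp: de_def frac_le)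
 have "EX r. R r & (nn M (%w. fi w - r w))^2 < m + de n" for n
 proof -
  have "m < m + de n" using d by simp
  then obtain x where "x : S" "x < m + de n" using cInf_lessD[OF S(1)] unfolding m_def by blast
  thus ?thesis by (auto simp: S_def)
 qed
 then obtain r where r: "!!n. R (r n)" "!!n. (nn M (%w. fi w - r n w))^2 < m + de n" by metis
 define s where "s n = (%w. fi w - r n w)" for n
 have lr: "l2 M (r n)" for n using R_l2[OF r(1)] by auto
 have ls: "l2 M (s n)" for n unfolding s_def by (intro l2_diff fi lr)
 \<comment> \<open>Parallelogram identity: the midpoint of s n and s k again has squared norm at
   least m, so the squared distance is at most 4 de n.\<close>
 define b where "b n = 2 * sqrt (de n)" for n
 have cau: "nn M (%w. s n w - s k w) <= b n" if "n <= k" for n k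
 proof (rule power2_le_imp_le)
  have "R (%w. (1/2) *. (r n w + r k w))" by (intro R_scale R_add r)
  hence "m <= (nn M (%w. fi w - (1/2) *. (r n w + r k w)))^2" by (rule m_le)
  also have "(%w. fi w - (1/2) *. (r n w + r k w)) = (%w. (1/2) *. (s n w + s k w))"
  by (simp add: s_def fun_eq_iff scaleR_conv_of_real field_simps)
  also have "(nn M ...)^2 = (1/4) * ((nn M (s n))^2 + 2 * ip M (s n) (s k) + (nn M (s k))^2)"
  unfolding nn_scaleR by (simp add: power_mult_distrib nn_add_sq ls power_divide)
  finally have "4 * m <= (nn M (s n))^2 + 2 * ip M (s n) (s k) + (nn M (s k))^2" by simp
  moreover have "(nn M (s n))^2 < m + de n" "(nn M (s k))^2 < m + de n"
  using r(2)[of n] r(2)[of k] d(2)[OF that] by (auto simp: s_def)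
  ultimately have "(nn M (s n))^2 - 2 * ip M (s n) (s k) + (nn M (s k))^2 <= 4 * de n" by linarith
  thus "(nn M (%w. s n w - s k w))^2 <= (b n)^2"
  using d(1)[of n] by (simp add: nn_diff_sq ls b_def power_mult_distrib)
 qed (use d(1) in \<open>auto simp: b_def less_imp_le\<close>)
 have dlim: "de \<longlonglongrightarrow> 0"
  using LIMSEQ_inverse_real_of_nat by (simp add: de_def[abs_def] inverse_eq_divide add.commute)
 have b: "b \<longlonglongrightarrow> 0"
 proof -
  have "(%n. 2 * sqrt (de n)) \<longlonglongrightarrow> 2 * sqrt 0" by (intro tendsto_intros dlim)
  thus ?thesis by (simp add: b_def[abs_def])
 qed
 obtain P where P: "l2 M P" "!!n. nn M (%w. s n w - P w) <= b n"
  using l2_complete[of s b] ls cau b by blast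
 have EP: "expectation P = 0"
 proof -
  have "norm (expectation P) <= b n" for n
  proof -
  have "expectation (s n) = 0" unfolding s_def using fi R_l2[OF r(1)[of n]] by (simp add: l2_integrable)
  hence "norm (expectation P) = norm (expectation (%w. s n w - P w))" using P(1) ls by (simp add: l2_integrable)
  also have "... <= b n" using norm_expectation_le[OF l2_diff[OF ls P(1)]] P(2) order_trans by blast
  finally show ?thesis .
  qed
  hence "norm (expectation P) <= 0" using LIMSEQ_le_const[OF b] by blast
  thus ?thesis by simp
 qed
 have up: "(nn M P)^2 <= m"
 proof -
  have "nn M P <= sqrt (m + de n) + b n" for n
  proof -
  have "nn M P <= nn M (s n) + nn M (%w. P w - s n w)" by (rule nn_triangle_sub[OF P(1) ls])
  moreover have "nn M (s n) <= sqrt (m + de n)" using r(2)[of n] by (simp add: s_def real_le_rsqrt less_imp_le)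
  moreover have "nn M (%w. P w - s n w) <= b n" using P(2)[of n] by (simp add: nn_minus_commute)
  ultimately show ?thesis by linarith
  qed
  moreover have "(%n. sqrt (m + de n) + b n) \<longlonglongrightarrow> sqrt (m + 0) + 0"
  by (intro tendsto_intros b dlim)
  ultimately have "nn M P <= sqrt m" by (intro LIMSEQ_le_const[where X = "%n. sqrt (m + de n) + b n"]) auto
  moreover have "0 <= m" unfolding m_def using S by (intro cInf_greatest) (auto simp: S_def)
  ultimately show ?thesis using power_mono[of "nn M P" "sqrt m" 2] by simp
 qed
 have low: "m <= (nn M (%w. P w - f w))^2" if f: "R f" for f
 proof -
  have lf: "l2 M f" using R_l2[OF f] by auto
  have "sqrt m <= nn M (%w. P w - f w) + b n" for n
  proof -
  have "m <= (nn M (%w. fi w - (r n w + f w)))^2" by (intro m_le R_add r f)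
  hence "sqrt m <= nn M (%w. s n w - f w)" by (simp add: s_def real_le_lsqrt algebra_simps)
  also have "... <= nn M (%w. s n w - P w) + nn M (%w. P w - f w)" by (rule nn_triangle3[OF ls P(1) lf])
  finally show ?thesis using P(2)[of n] by linarith
  qed
  moreover have "(%n. nn M (%w. P w - f w) + b n) \<longlonglongrightarrow> nn M (%w. P w - f w) + 0"
  by (intro tendsto_intros b)
  ultimately have "sqrt m <= nn M (%w. P w - f w)"
  by (intro LIMSEQ_le_const[where X = "%n. nn M (%w. P w - f w) + b n"]) auto
  thus ?thesis by (simp add: sqrt_le_D)
 qed
 have orth: "ip M P f = 0" if f: "R f" for f
 proof -
  have lf: "l2 M f" using R_l2[OF f] by auto
  have q: "0 <= - 2 * \<tau> * ip M P f + \<tau>^2 * (nn M f)^2" for \<tau>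
  proof -
  have "(nn M P)^2 <= (nn M (%w. P w - \<tau> *. f w))^2" using up low[OF R_scale[OF f, of \<tau>]] by linarith
  also have "... = (nn M P)^2 - 2 * (\<tau> * ip M P f) + \<tau>^2 * (nn M f)^2"
  using P(1) lf by (subst nn_diff_sq) (auto simp: power_mult_distrib)
  finally show ?thesis by simp
  qed
  \<comment> \<open>The optimal step would divide by the squared norm of f; adding 1 keeps the
    denominator positive, and the squared distance still decreases unless the product of P and f is
    0.\<close>
  define N where "N = (nn M f)^2 + 1"
  have N: "N > 0" by (simp add: N_def add_nonneg_pos)
  have "0 <= - 2 * (ip M P f / N) * ip M P f + (ip M P f / N)^2 * (nn M f)^2" by (rule q)
  also have "... <= - 2 * (ip M P f / N) * ip M P f + (ip M P f / N)^2 * N" by (simp add: N_def mult_left_mono)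
  also have "... = - ((ip M P f)^2) / N" using N by (simp add: power2_eq_square field_simps)
  finally have "(ip M P f)^2 <= 0" using N by (simp add: field_simps)
  thus ?thesis by simp
 qed
 have "nn M P = 0"
 proof (rule inv[OF P(1) EP])
  fix t assume t: "t : I"
  have lU: "l2 M (%w. P (U t w))" by (rule l2_comp[OF P(1) U[OF t]])
  \<comment> \<open>Orthogonality to the increment of P, together with the equality of the norms of
    P and P (U t), forces P (U t) = P.\<close>
  have "ip M P (%w. P (U t w) - P w) = 0" by (rule orth[OF R_gen[OF P(1) EP t]])
  hence "ip M P (%w. P (U t w)) = (nn M P)^2" using P(1) lU by (simp add: ip_diff_right nn_sq_ip)
  hence "(nn M (%w. P (U t w) - P w))^2 = 0"
  using P(1) lU by (simp add: nn_diff_sq nn_comp[OF P(1) U[OF t]] ip_commute[of M "%w. P (U t w)"])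
  thus "nn M (%w. P (U t w) - P w) = 0" by simp
 qed
 hence sn: "nn M (s n) <= b n" for n
  using nn_triangle_sub[OF ls P(1), of n] P(2)[of n] by simp
 obtain n where "b n < ka" using order_tendstoD(2)[OF b ka] by (auto simp: eventually_sequentially)
 thus ?thesis using sn[of n] r(1)[of n] unfolding s_def by (meson less_imp_le order_trans)
qed

text \<open>The level set at the mean suffices: g minus its mean has one sign almost everywhere and
  integral 0.\<close>

lemma zero_one_imp_const:
 fixes g :: "'a => real"
 assumes g: "integrable M g" and "measure M {w : space M. g w > expectation g} = 0 \<or> measure M {w : space M. g w > expectation g} = 1"
 shows "AE w in M. g w = expectation g"
proof -
 have [measurable]: "g : borel_measurable M" using g by auto
 have i: "(\<integral>w. g w - expectation g \<partial>M) = 0" using g by (simp add: prob_space)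
 from assms(2) show ?thesis
 proof
  assume "measure M {w : space M. g w > expectation g} = 1"
  hence pos: "AE w in M. g w > expectation g" using AE_prob_1[of "{w : space M. g w > expectation g}"] by auto
  have "AE w in M. g w - expectation g = 0"
  using i by (subst (asm) integral_nonneg_eq_0_iff_AE) (use pos g in \<open>auto elim: eventually_mono\<close>)
  thus ?thesis by eventually_elim simp
 next
  assume "measure M {w : space M. g w > expectation g} = 0"
  hence "AE w in M. w \<notin> {w : space M. g w > expectation g}"
  using prob_eq_0[of "{w : space M. g w > expectation g}"] by simp
  hence neg: "AE w in M. 0 <= expectation g - g w" using AE_space by eventually_elim auto
  have "(\<integral>w. expectation g - g w \<partial>M) = 0" using g by (simp add: prob_space)
  hence "AE w in M. expectation g - g w = 0"
  by (subst (asm) integral_nonneg_eq_0_iff_AE) (use neg g in auto)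
  thus ?thesis by eventually_elim simp
 qed
qed

text \<open>\<open>ergodic_map\<close> speaks of strictly invariant sets, while g is invariant only
  almost everywhere. The set A of points whose forward orbit exceeds the level c infinitely often is
  strictly invariant, even if f is not invertible, and differs from the level set of g by a null
  set.\<close>

lemma ergodic_map_zero_one:
 assumes f: "ergodic_map M f" and [measurable]: "g : borel_measurable M" and inv: "AE w in M. g (f w) = g w"
 shows "measure M {w : space M. g w > (c::real)} = 0 \<or> measure M {w : space M. g w > c} = 1"
proof -
 have mp: "mpres M f" using f by (simp add: ergodic_map_def)
 hence [measurable]: "f : measurable M M" by (simp add: mpres_def)
 have fs: "f w : space M" if "w : space M" for w using measurable_space[OF \<open>f : measurable M M\<close> that] .
 have [measurable]: "(f ^^ n) : measurable M M" for n by (induction n) (auto intro: measurable_compose simp: o_def)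
 have "AE w in M. g ((f ^^ n) w) = g w" for n
 proof (induction n)
  case (Suc n)
  have "AE w in M. g ((f ^^ n) (f w)) = g (f w)" by (rule mpres_AE[OF mp Suc])
  with inv show ?case by eventually_elim (simp add: funpow_swap1)
 qed simp
 hence all: "AE w in M. ALL n. g ((f ^^ n) w) = g w" by (simp add: AE_all_countable)
 define A where "A = {w : space M. ALL N. EX n>=N. g ((f ^^ n) w) > c}"
 have A: "A : sets M" unfolding A_def by measurable
 have shift: "(ALL N. EX n>=N. g ((f ^^ n) (f w)) > c) \<longleftrightarrow> (ALL N. EX n>=N. g ((f ^^ n) w) > c)" for w
 proof -
  have "(EX n>=N. g ((f ^^ n) (f w)) > c) \<longleftrightarrow> (EX n>=Suc N. g ((f ^^ n) w) > c)" for N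
  proof -
  have "(EX n>=Suc N. g ((f ^^ n) w) > c) \<longleftrightarrow> (EX n>=N. g ((f ^^ Suc n) w) > c)"
  by (metis Suc_le_D Suc_le_mono)
  thus ?thesis by (simp add: funpow_swap1)
  qed
  thus ?thesis by (metis Suc_leD)
 qed
 have "f -` A \<inter> space M = A" unfolding A_def using shift fs by auto
 hence "measure M A = 0 \<or> measure M A = 1" using f A by (simp add: ergodic_map_def)
 moreover have "measure M A = measure M {w : space M. g w > c}"
  using all by (intro measure_eq_AE A) (auto simp: A_def elim!: eventually_mono)
 ultimately show ?thesis by simp
qed

text \<open>The strictly invariant substitute for the level set is the set of w with g (S s w) > c
  for Lebesgue-almost every s; translation invariance of Lebesgue measure makes it invariant under
  every S t. Joint measurability makes it measurable and allows the exchange of null sets in s and w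
  that identifies it with the level set almost everywhere.\<close>

lemma ergodic_flow_zero_one:
 fixes S :: "real => 'a => 'a"
 assumes f: "ergodic_flow M S" and [measurable]: "g : borel_measurable M" and inv: "!!t. AE w in M. g (S t w) = g w"
  and S_plus: "!!t s w. w : space M ==> S (t + s) w = S t (S s w)"
  and S_meas[measurable]: "(%(t, w). S t w) : measurable (lborel \<Otimes>\<^sub>M M) M"
 shows "measure M {w : space M. g w > (c::real)} = 0 \<or> measure M {w : space M. g w > c} = 1"
proof -
 interpret pair_sigma_finite lborel M by standard
 have mp: "mpres M (S t)" for t using f by (simp add: ergodic_flow_def)
 hence [measurable]: "S t : measurable M M" for t by (simp add: mpres_def)
 have Ss: "S t w : space M" if "w : space M" for t w using measurable_space[OF \<open>S t : measurable M M\<close> that] .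
 define A where "A = {w : space M. AE s in lborel. g (S s w) > c}"
 have gm [measurable]: "(%x. g (S (snd x) (fst x))) : borel_measurable (M \<Otimes>\<^sub>M lborel)"
  using measurable_compose[OF measurable_compose[OF measurable_pair_swap' S_meas] \<open>g : borel_measurable M\<close>]
  by (simp add: case_prod_beta)
 have gs: "(%s. g (S s w)) : borel_measurable lborel" if "w : space M" for w
  using measurable_compose[OF measurable_Pair1'[OF that] gm] by simp
 have A_eq: "A = {w : space M. emeasure lborel {s : space lborel. \<not> g (S s w) > c} = 0}"
 proof -
  have "(AE s in lborel. g (S s w) > c) \<longleftrightarrow> emeasure lborel {s : space lborel. \<not> g (S s w) > c} = 0" if wa: "w : space M" for w
  proof -
  note [measurable] = gs[OF wa]
  have "{s : space lborel. \<not> g (S s w) > c} : sets lborel" by measurable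
  thus ?thesis by (subst AE_iff_null) (auto simp: null_sets_def)
  qed
  thus ?thesis unfolding A_def by auto
 qed
 have [measurable]: "(%w. emeasure lborel {s : space lborel. \<not> g (S s w) > c}) : borel_measurable M"
 proof (rule lborel.measurable_emeasure)
  have "{x : space (M \<Otimes>\<^sub>M lborel). \<not> g (S (snd x) (fst x)) > c} : sets (M \<Otimes>\<^sub>M lborel)" by measurable
  thus "{x : space (M \<Otimes>\<^sub>M lborel). snd x : {s : space lborel. \<not> g (S s (fst x)) > c}} : sets (M \<Otimes>\<^sub>M lborel)" by simp
 qed auto
 have A: "A : sets M" unfolding A_eq by measurable
 have shift: "(AE s in lborel. g (S s (S t w)) > c) \<longleftrightarrow> (AE s in lborel. g (S s w) > c)" if wa: "w : space M" for w t
 proof -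
  have "(AE s in lborel. g (S s w) > c) \<longleftrightarrow> (AE s in distr lborel borel ((+) t). g (S s w) > c)"
  unfolding lborel_distr_plus ..
  also have "... \<longleftrightarrow> (AE s in lborel. g (S (t + s) w) > c)"
  using gs[OF wa] by (subst AE_distr_iff) auto
  also have "... \<longleftrightarrow> (AE s in lborel. g (S s (S t w)) > c)"
  using S_plus[OF wa] by (simp add: add.commute[of t])
  finally show ?thesis by simp
 qed
 have "S t -` A \<inter> space M = A" for t
 proof (rule set_eqI)
  fix w show "w : S t -` A \<inter> space M \<longleftrightarrow> w : A"
  unfolding A_def using shift[of w t] Ss[of w t] by blast
 qed
 hence "measure M A = 0 \<or> measure M A = 1" using f A by (simp add: ergodic_flow_def)
 moreover have "measure M A = measure M {w : space M. g w > c}"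
 proof (rule measure_eq_AE)
  have "AE s in lborel. AE w in M. g (S s w) = g w" using inv by simp
  hence "AE w in M. AE s in lborel. g (S s w) = g w"
  proof (rule AE_commute[THEN iffD1, rotated])
  have [measurable]: "(%x. g (S (fst x) (snd x))) : borel_measurable (lborel \<Otimes>\<^sub>M M)"
  using measurable_compose[OF S_meas \<open>g : borel_measurable M\<close>] by (simp add: case_prod_beta)
  show "{x : space (lborel \<Otimes>\<^sub>M M). g (S (fst x) (snd x)) = g (snd x)} : sets (lborel \<Otimes>\<^sub>M M)" by measurable
  qed
  with AE_space show "AE w in M. (w : A) = (w : {w : space M. g w > c})"
  proof eventually_elim
  case (elim w)
  have "(AE s in lborel. g (S s w) > c) \<longleftrightarrow> (AE s in (lborel::real measure). g w > c)"
  using elim(2) by (intro eventually_subst) (auto elim: eventually_mono)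
  also have "... \<longleftrightarrow> g w > c" by (subst eventually_const) (auto simp: ae_filter_eq_bot_iff)
  finally show ?case using elim(1) by (simp add: A_def)
  qed
 qed (use A in auto)
 ultimately show ?thesis by simp
qed

lemma invariant_imp_zero:
 fixes P :: "'a => complex" and U :: "'i => 'a => 'a"
 assumes P: "l2 M P" "expectation P = 0"
  and zo: "!!g c. g : borel_measurable M ==> (!!t. t : I ==> AE w in M. g (U t w) = g w) ==>
  measure M {w : space M. g w > (c::real)} = 0 \<or> measure M {w : space M. g w > c} = 1"
  and U: "!!t. t : I ==> mpres M (U t)"
  and inv: "!!t. t : I ==> nn M (%w. P (U t w) - P w) = 0"
 shows "nn M P = 0"
proof -
 have [measurable]: "P : borel_measurable M" using P(1) by (rule l2_meas)
 have ae: "AE w in M. P (U t w) - P w = 0" if "t : I" for t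
  by (rule nn_zero_AE[OF l2_diff[OF l2_comp[OF P(1) U[OF that]] P(1)] inv[OF that]])
 have ip: "integrable M P" using P(1) by (rule l2_integrable)
 have re: "AE w in M. Re (P w) = expectation (%w. Re (P w))"
 proof (rule zero_one_imp_const)
  show "integrable M (%w. Re (P w))" using ip by simp
  show "measure M {w : space M. Re (P w) > expectation (%w. Re (P w))} = 0 \<or> measure M {w : space M. Re (P w) > expectation (%w. Re (P w))} = 1"
  proof (rule zo)
  fix t assume "t : I" from ae[OF this] show "AE w in M. Re (P (U t w)) = Re (P w)" by eventually_elim simp
  qed simp
 qed
 have im: "AE w in M. Im (P w) = expectation (%w. Im (P w))"
 proof (rule zero_one_imp_const)
  show "integrable M (%w. Im (P w))" using ip by simp
  show "measure M {w : space M. Im (P w) > expectation (%w. Im (P w))} = 0 \<or> measure M {w : space M. Im (P w) > expectation (%w. Im (P w))} = 1"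
  proof (rule zo)
  fix t assume "t : I" from ae[OF this] show "AE w in M. Im (P (U t w)) = Im (P w)" by eventually_elim simp
  qed simp
 qed
 have "expectation (%w. Re (P w)) = 0" "expectation (%w. Im (P w)) = 0" using P(2) ip by simp_all
 with re im have "AE w in M. P w = 0" by (auto simp: complex_eq_iff elim: eventually_elim2)
 hence "nn M P = nn M (%_. 0 :: complex)" by (intro nn_cong_AE) auto
 thus ?thesis by simp
qed

end

section \<open>Nice functions are dense\<close>

context parab
begin

lemma Req_dxi: "Req et xi v g ==> Req et xi (%w. v (T x w) - v w) (%w. g (T x w) - g w)"
proof -
 assume r: "Req et xi v g"
 note v = Req_l2(1)[OF r] and g = Req_l2(2)[OF r]
 have "Req et xi (%w. v (T x w)) (%w. g (T x w))"
  unfolding Req_def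
 proof (rule Tm_AE[OF Tm_T[OF r[unfolded Req_def], of x]])
  show "l2 M (%w. g (T x w) - L *. Ds T xi (Dv T xi (%w. v (T x w))) w)"
  by (intro l2_diff l2_scaleR l2_Ds l2_Dv l2_T v g)
  show "AE w in M. g (T x w) - L *. Ds T xi (Dv T xi v) (T x w) = g (T x w) - L *. Ds T xi (Dv T xi (%w. v (T x w))) w"
  by (rule AE_I2) (simp add: Ds_def dxis_def dxi_def T_commute[of _ _ x] T_space)
 qed
 from Req_diff[OF this r] show ?thesis .
qed

text \<open>Uniqueness up to null sets, from the last bound of \<open>Req_H2\<close> with source 0.
  Stated as inequalities because that is how bounds are transferred between solutions.\<close>

lemma Req_null:
 assumes y: "Req et xi y g" and y': "Req et xi y' g" and et: "0 < et" "et <= 1"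
 shows "nn M y <= nn M y'" "nn M (dxi T xi i y) <= nn M (dxi T xi i y')"
proof -
 note ly = Req_l2(1)[OF y] and ly' = Req_l2(1)[OF y']
 have R: "Req et xi (%w. y w - y' w) (%w. 0)" using Req_diff[OF y y'] by simp
 have n: "nn M (%w. y w - y' w) <= 0" using Req_H2(3)[OF R et] et by (simp add: mult_le_0_iff)
 thus "nn M y <= nn M y'" using nn_triangle_sub[OF ly ly'] by simp
 have "nn M (dxi T xi i (%w. y w - y' w)) <= 0"
  using nn_dxi_le[OF l2_diff[OF ly ly'], of xi i] n by simp
 hence "nn M (%w. dxi T xi i y w - dxi T xi i y' w) <= 0" by (simp add: dxi_diff[abs_def])
 thus "nn M (dxi T xi i y) <= nn M (dxi T xi i y')"
  using nn_triangle_sub[OF l2_dxi[OF ly, of xi i] l2_dxi[OF ly', of xi i]] by simp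
qed

text \<open>By uniqueness it is enough to bound one solution for each \<epsilon>.\<close>

lemma niceI:
 assumes ps: "l2 M ps" "expectation ps = 0" and C: "0 <= C"
  and ex: "!!ep. 0 < ep ==> ep <= 1 ==> EX y. Req (ep^2) (ep *. ze) y ps & ep * nn M y <= C & (ALL i. nn M (dxi T (ep *. ze) i y) <= C)"
 shows "nice ze ps"
 unfolding nice_def
proof (intro conjI ps exI[of _ C] C allI impI)
 fix ep y i assume e: "0 < ep & ep <= 1" and y: "Req (ep^2) (ep *. ze) y ps"
 from e have ee: "0 < ep^2" "ep^2 <= 1" using eps_sq[of ep] by auto
 obtain y' where y': "Req (ep^2) (ep *. ze) y' ps" "ep * nn M y' <= C" "!!i. nn M (dxi T (ep *. ze) i y') <= C"
  using ex e by blast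
 show "ep * nn M y <= C"
  using mult_left_mono[OF Req_null(1)[OF y y'(1) ee] less_imp_le[OF conjunct1[OF e]]] y'(2) by linarith
 show "nn M (dxi T (ep *. ze) i y) <= C"
  using Req_null(2)[OF y y'(1) ee, of i] y'(3)[of i] by simp
qed

lemma niceE:
 assumes "nice ze ps"
 obtains C where "0 <= C" "!!ep. 0 < ep ==> ep <= 1 ==> EX y. Req (ep^2) (ep *. ze) y ps & ep * nn M y <= C & (ALL i. nn M (dxi T (ep *. ze) i y) <= C)"
proof -
 obtain C where C: "0 <= C" and b: "ALL ep y. 0 < ep & ep <= 1 --> Req (ep^2) (ep *. ze) y ps -->
  ep * nn M y <= C & (ALL i. nn M (dxi T (ep *. ze) i y) <= C)" and ps: "l2 M ps" "expectation ps = 0"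
  using assms by (auto simp: nice_def)
 show ?thesis
 proof (rule that[OF C])
  fix ep :: real assume e: "0 < ep" "ep <= 1"
  obtain y where "Req (ep^2) (ep *. ze) y ps"
  using Req_ex[OF ps conjunct1[OF eps_sq[OF e]] conjunct2[OF eps_sq[OF e]]] by blast
  thus "EX y. Req (ep^2) (ep *. ze) y ps & ep * nn M y <= C & (ALL i. nn M (dxi T (ep *. ze) i y) <= C)"
  using b e by blast
 qed
qed

lemma Req_add: "Req et xi v g ==> Req et xi v' g' ==> Req et xi (%w. v w + v' w) (%w. g w + g' w)"
 unfolding Req_def by (drule (1) Tm_add) (simp add: Dv_add[abs_def] Ds_add[abs_def] algebra_simps)

lemma nice_add: "nice ze f ==> nice ze g ==> nice ze (%w. f w + g w)"
proof -
 assume f: "nice ze f" and g: "nice ze g"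
 obtain C where C: "0 <= C" "!!ep. 0 < ep ==> ep <= 1 ==> EX y. Req (ep^2) (ep *. ze) y f & ep * nn M y <= C & (ALL i. nn M (dxi T (ep *. ze) i y) <= C)"
  using niceE[OF f] by blast
 obtain C' where C': "0 <= C'" "!!ep. 0 < ep ==> ep <= 1 ==> EX y. Req (ep^2) (ep *. ze) y g & ep * nn M y <= C' & (ALL i. nn M (dxi T (ep *. ze) i y) <= C')"
  using niceE[OF g] by blast
 have fg: "l2 M f" "l2 M g" "expectation f = 0" "expectation g = 0" using f g by (auto simp: nice_def)
 show ?thesis
 proof (rule niceI[of _ "C + C'"])
  show "l2 M (%w. f w + g w)" "expectation (%w. f w + g w) = 0" "0 <= C + C'"
  using fg C(1) C'(1) by (auto simp: l2_integrable)
  fix ep :: real assume e: "0 < ep" "ep <= 1"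
  obtain y where y: "Req (ep^2) (ep *. ze) y f" "ep * nn M y <= C" "!!i. nn M (dxi T (ep *. ze) i y) <= C" using C(2)[OF e] by blast
  obtain y' where y': "Req (ep^2) (ep *. ze) y' g" "ep * nn M y' <= C'" "!!i. nn M (dxi T (ep *. ze) i y') <= C'" using C'(2)[OF e] by blast
  note ly = Req_l2(1)[OF y(1)] and ly' = Req_l2(1)[OF y'(1)]
  have "ep * nn M (%w. y w + y' w) <= C + C'"
  using mult_left_mono[OF nn_triangle[OF ly ly'] less_imp_le[OF e(1)]] y(2) y'(2) by (simp only: distrib_left)
  moreover have "nn M (dxi T (ep *. ze) i (%w. y w + y' w)) <= C + C'" for i
  using nn_triangle[OF l2_dxi[OF ly, of "ep *. ze" i] l2_dxi[OF ly', of "ep *. ze" i]] y(3)[of i] y'(3)[of i] by (simp add: dxi_add[abs_def])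
  ultimately show "EX y. Req (ep^2) (ep *. ze) y (%w. f w + g w) & ep * nn M y <= C + C' & (ALL i. nn M (dxi T (ep *. ze) i y) <= C + C')"
  using Req_add[OF y(1) y'(1)] by blast
 qed
qed

lemma nice_scaleR: "nice ze f ==> nice ze (%w. r *. f w)"
proof -
 assume f: "nice ze f"
 obtain C where C: "0 <= C" "!!ep. 0 < ep ==> ep <= 1 ==> EX y. Req (ep^2) (ep *. ze) y f & ep * nn M y <= C & (ALL i. nn M (dxi T (ep *. ze) i y) <= C)"
  using niceE[OF f] by blast
 have lf: "l2 M f" "expectation f = 0" using f by (auto simp: nice_def)
 show ?thesis
 proof (rule niceI[of _ "\<bar>r\<bar> * C"])
  show "l2 M (%w. r *. f w)" "expectation (%w. r *. f w) = 0" "0 <= \<bar>r\<bar> * C" using lf C(1) by auto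
  fix ep :: real assume e: "0 < ep" "ep <= 1"
  obtain y where y: "Req (ep^2) (ep *. ze) y f" "ep * nn M y <= C" "!!i. nn M (dxi T (ep *. ze) i y) <= C" using C(2)[OF e] by blast
  have "ep * nn M (%w. r *. y w) <= \<bar>r\<bar> * C" unfolding nn_scaleR
  using mult_left_mono[OF y(2), of "\<bar>r\<bar>"] by (simp add: mult_ac)
  moreover have "nn M (dxi T (ep *. ze) i (%w. r *. y w)) <= \<bar>r\<bar> * C" for i
  unfolding dxi_scaleR[abs_def] nn_scaleR by (intro mult_left_mono y) simp
  ultimately show "EX y. Req (ep^2) (ep *. ze) y (%w. r *. f w) & ep * nn M y <= \<bar>r\<bar> * C & (ALL i. nn M (dxi T (ep *. ze) i y) <= \<bar>r\<bar> * C)"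
  using Req_scaleR[OF y(1), of r] by blast
 qed
qed

lemma Req_grad: "Req et xi v g ==> 0 < et ==> et <= 1 ==> sqrt et * nn M (Dv T xi v) <= nn M g / sqrt L"
proof -
 assume R: "Req et xi v g" and et: "0 < et" "et <= 1"
 have "0 <= et * L * (nn M (Dv T xi v))^2" using et L_pos by simp
 hence "et * L * (nn M (Dv T xi v))^2 <= (nn M g)^2" using Req_H2(2)[OF R et] by linarith
 hence "(sqrt L * (sqrt et * nn M (Dv T xi v)))^2 <= (nn M g)^2"
  using et L_pos by (simp add: power_mult_distrib mult_ac)
 hence "sqrt L * (sqrt et * nn M (Dv T xi v)) <= nn M g" by (rule power2_le_imp_le) simp
 thus ?thesis using L_pos by (simp add: pos_le_divide_eq mult.commute)
qed

text \<open>If wa solves the reference problem for fi, the plain difference of wa solves it for the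
  coboundary. \<open>Req_H2\<close> bounds twisted differences of wa one order better than wa
  itself. Passing from the twisted to the plain difference costs |\<xi>| = O(\<epsilon>) times the
  undifferenced function, which is one order worse, so the gain survives.\<close>

lemma nice_space:
 assumes fi: "l2 M fi" "expectation fi = 0"
 shows "nice ze (%w. fi (T (ue j) w) - fi w)"
proof -
 define Z N where "Z = norm ze" and "N = nn M fi"
 define C where "C = N / sqrt L + Z * ((1 + th) * N) + (N / L + Z * (N / sqrt L))"
 have Z0: "Z >= 0" "N >= 0" by (auto simp: Z_def N_def)
 have p: "0 <= N / sqrt L" "0 <= Z * ((1 + th) * N)" "0 <= N / L" "0 <= Z * (N / sqrt L)"
  using Z0 L_pos th by auto
 show ?thesis
 proof (rule niceI[of _ C])
  show "l2 M (%w. fi (T (ue j) w) - fi w)" by (intro l2_diff l2_T fi)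
  show "expectation (%w. fi (T (ue j) w) - fi w) = 0" using fi l2_T[OF fi(1)] by (simp add: l2_integrable expectation_T)
  show "0 <= C" using p by (simp add: C_def)
  fix ep :: real assume e: "0 < ep" "ep <= 1"
  define xi where "xi = ep *. ze"
  have ee: "0 < ep^2" "ep^2 <= 1" using eps_sq[OF e] by auto
  have x: "\<bar>0 - xi $ j\<bar> <= ep * Z" using e component_le_norm_cart[of ze j] by (simp add: xi_def Z_def abs_mult)
  obtain wa where wa: "Req (ep^2) xi wa fi" using Req_ex[OF fi ee] by blast
  note lw = Req_l2(1)[OF wa]
  have D: "ep * nn M (Dv T xi wa) <= N / sqrt L" using Req_grad[OF wa ee] e by (simp add: N_def)
  have W: "ep * (ep * nn M wa) <= (1 + th) * N" using Req_H2(3)[OF wa ee] by (simp add: N_def power2_eq_square mult.assoc)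
  have Dj: "ep * nn M (dxi T xi i wa) <= N / sqrt L" for i
  using mult_left_mono[OF nn_dxi_le_Dv[OF lw, of xi i] less_imp_le[OF e(1)]] D by linarith
  define y where "y = (%w. wa (T (ue j) w) - wa w)"
  have y_eq: "y = dxi T 0 j wa" by (simp add: y_def dxi_def fun_eq_iff)
  have "nn M y <= nn M (dxi T xi j wa) + nn M (%w. dxi T 0 j wa w - dxi T xi j wa w)"
  unfolding y_eq by (intro nn_triangle_sub l2_dxi lw)
  also have "... <= nn M (dxi T xi j wa) + (ep * Z) * nn M wa"
  using nn_dxi_xi_diff[OF lw, of 0 j xi] mult_right_mono[OF x, of "nn M wa"] by simp
  finally have "ep * nn M y <= ep * nn M (dxi T xi j wa) + Z * (ep * (ep * nn M wa))"
  using mult_left_mono[of "nn M y" _ ep] e by (fastforce simp: algebra_simps)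
  also have "... <= N / sqrt L + Z * ((1 + th) * N)" using Z0 by (intro add_mono Dj mult_left_mono W)
  finally have 1: "ep * nn M y <= C" using p by (simp add: C_def)
  have 2: "nn M (dxi T xi i y) <= C" for i
  proof -
  have "nn M (dxi T xi i (dxi T 0 j wa)) = nn M (dxi T 0 j (dxi T xi i wa))" by (rule nn_cong) (rule dxi_commute)
  also have "... <= nn M (dxi T xi j (dxi T xi i wa)) + nn M (%w. dxi T 0 j (dxi T xi i wa) w - dxi T xi j (dxi T xi i wa) w)"
  by (intro nn_triangle_sub l2_dxi lw)
  also have "nn M (dxi T xi j (dxi T xi i wa)) <= N / L"
  using order_trans[OF mult_left_mono[OF nn_dxi_dxi_le[OF lw, of xi j i] less_imp_le[OF L_pos]] Req_H2(1)[OF wa ee]] L_pos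
  by (simp add: N_def field_simps)
  also have "nn M (%w. dxi T 0 j (dxi T xi i wa) w - dxi T xi j (dxi T xi i wa) w) <= \<bar>0 - xi $ j\<bar> * nn M (dxi T xi i wa)"
  using nn_dxi_xi_diff[OF l2_dxi[OF lw, of xi i], of 0 j xi] by simp
  also have "... <= (ep * Z) * nn M (dxi T xi i wa)" by (intro mult_right_mono x) simp
  also have "... = Z * (ep * nn M (dxi T xi i wa))" by simp
  also have "... <= Z * (N / sqrt L)" using Z0 by (intro mult_left_mono Dj)
  finally show ?thesis unfolding y_eq C_def using p by linarith
  qed
  show "EX y. Req (ep^2) (ep *. ze) y (%w. fi (T (ue j) w) - fi w) & ep * nn M y <= C & (ALL i. nn M (dxi T (ep *. ze) i y) <= C)"
  using Req_dxi[OF wa, of "ue j"] 1 2 unfolding y_def xi_def by blast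
 qed
qed

text \<open>The primitive rh nearly solves the problem itself, since its time part is ps up to
  O(\<eta>). Two corrections remain in y = rh - y2 - z: y2 removes the elliptic term L Ds (Dv rh),
  which is in divergence form and falls under \<open>Req_energy\<close>; z removes the remainder,
  whose size \<epsilon>^2 offsets the loss of two powers in \<open>Req_H2\<close>.\<close>

lemma nice_time:
 assumes ps: "l2 M ps" "expectation ps = 0" and rh: "expectation rh = 0" and C: "0 <= C"
  and r: "!!et. 0 < et ==> et <= 1 ==> EX r. l2 M r & nn M r <= C * et & Tm et rh (%w. ps w + r w)"
 shows "nice ze ps"
proof -
 have lrh: "l2 M rh" using r[of 1] Tm_l2 by auto
 define D where "D = (SUM i:(UNIV::'d set). 2 * nn M rh)"
 have D0: "D >= 0" by (simp add: D_def sum_nonneg)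
 define C' where "C' = nn M rh + sqrt L * D + (1 + th) * C + (2 * nn M rh + D + C / sqrt L)"
 have p: "0 <= nn M rh" "0 <= sqrt L * D" "0 <= (1 + th) * C" "0 <= C / sqrt L" using D0 L_pos th C by auto
 show ?thesis
 proof (rule niceI[of _ C', OF ps])
  show "0 <= C'" using p D0 by (simp add: C'_def)
  fix ep :: real assume e: "0 < ep" "ep <= 1"
  define xi where "xi = ep *. ze"
  have ee: "0 < ep^2" "ep^2 <= 1" using eps_sq[OF e] by auto
  have e2: "ep^2 <= ep" using e by (simp add: power2_eq_square mult_left_le_one_le)
  obtain r0 where r0: "l2 M r0" "nn M r0 <= C * ep^2" "Tm (ep^2) rh (%w. ps w + r0 w)" using r[OF ee] by blast
  have nD: "nn M (Dv T xi rh) <= D"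
  using nn_vec_le_sum[OF l2_Dv[OF lrh], of xi] sum_mono[of UNIV "%i. nn M (dxi T xi i rh)" "%i. 2 * nn M rh"] nn_dxi_le[OF lrh, of xi]
  by (simp add: D_def)
  \<comment> \<open>rh has mean zero, hence so does its twisted gradient, and the centring in
    \<open>sol_ex\<close> does not change the source.\<close>
  have piv: "PiV (Dv T xi rh) = Dv T xi rh"
  using lrh by (simp add: fun_eq_iff vec_eq_iff PiV_nth l2_Dv Pi0_def expectation_dxi rh)
  obtain y2 where y2: "Req (ep^2) xi y2 (%w. L *. Ds T xi (Dv T xi rh) w)"
  using sol_ex[OF l2_Dv[OF lrh] e, of xi xi] unfolding piv by blast
  note ly2 = Req_l2(1)[OF y2]
  have y2D: "nn M (Dv T xi y2) <= D" using Req_energy(1)[OF y2 l2_Dv[OF lrh] ee(1)] nD by simp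
  have "(ep * nn M y2)^2 <= L * (nn M (Dv T xi rh))^2"
  using Req_energy(2)[OF y2 l2_Dv[OF lrh] ee(1)] zero_le_power2[of "ep * nn M y2"] unfolding power_mult_distrib by linarith
  also have "... <= (sqrt L * D)^2" using nD L_pos by (simp add: power_mult_distrib mult_left_mono power_mono)
  finally have y2N: "ep * nn M y2 <= sqrt L * D" by (rule power2_le_imp_le) (use p in simp)
  have R1: "Req (ep^2) xi rh (%w. ps w + r0 w + L *. Ds T xi (Dv T xi rh) w)" using r0(3) by (simp add: Req_def)
  obtain y where y: "Req (ep^2) xi y ps" using Req_ex[OF ps ee] by blast
  note ly = Req_l2(1)[OF y]
  define z where "z = (%w. rh w - y2 w - y w)"
  have z: "Req (ep^2) xi z r0" unfolding z_def using Req_diff[OF Req_diff[OF R1 y2] y] by simp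
  note lz = Req_l2(1)[OF z]
  have "ep^2 * nn M z <= (1 + th) * (C * ep^2)"
  by (rule order_trans[OF Req_H2(3)[OF z ee] mult_left_mono[OF r0(2)]]) (use th in simp)
  hence "ep^2 * nn M z <= ep^2 * ((1 + th) * C)" by (simp add: mult_ac)
  hence zN: "nn M z <= (1 + th) * C" using ee by (simp add: mult_le_cancel_left)
  have "ep * nn M (Dv T xi z) <= C * ep^2 / sqrt L"
  using Req_grad[OF z ee] divide_right_mono[OF r0(2), of "sqrt L"] e L_pos by simp
  also have "... <= ep * (C / sqrt L)" using mult_right_mono[OF e2, of "C / sqrt L"] p by (simp add: mult_ac)
  finally have zD: "nn M (Dv T xi z) <= C / sqrt L" using e by (simp add: mult_le_cancel_left del: times_divide_eq_right)
  have y_eq: "y = (%w. rh w - y2 w - z w)" by (simp add: z_def)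
  have "nn M y <= nn M rh + nn M y2 + nn M z"
  unfolding y_eq using nn_triangle_diff[OF l2_diff[OF lrh ly2] lz] nn_triangle_diff[OF lrh ly2] by simp
  hence "ep * nn M y <= ep * nn M rh + ep * nn M y2 + ep * nn M z"
  using mult_left_mono[of "nn M y" _ ep] e by (fastforce simp: algebra_simps)
  also have "... <= nn M rh + sqrt L * D + (1 + th) * C"
  using e zN by (intro add_mono y2N order_trans[OF mult_left_le_one_le zN]) (auto simp: mult_left_le_one_le)
  finally have 1: "ep * nn M y <= C'" unfolding C'_def using p D0 by linarith
  have 2: "nn M (dxi T xi i y) <= C'" for i
  proof -
  have "nn M (dxi T xi i y) <= nn M (dxi T xi i rh) + nn M (dxi T xi i y2) + nn M (dxi T xi i z)"
  unfolding y_eq dxi_diff[abs_def]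
  using nn_triangle_diff[OF l2_diff[OF l2_dxi[OF lrh, of xi i] l2_dxi[OF ly2, of xi i]] l2_dxi[OF lz, of xi i]]
  nn_triangle_diff[OF l2_dxi[OF lrh, of xi i] l2_dxi[OF ly2, of xi i]] by simp
  also have "... <= 2 * nn M rh + D + C / sqrt L"
  using nn_dxi_le[OF lrh, of xi i] nn_dxi_le_Dv[OF ly2, of xi i] y2D nn_dxi_le_Dv[OF lz, of xi i] zD by linarith
  finally show ?thesis unfolding C'_def using p by linarith
  qed
  show "EX y. Req (ep^2) (ep *. ze) y ps & ep * nn M y <= C' & (ALL i. nn M (dxi T (ep *. ze) i y) <= C')"
  using y 1 2 unfolding xi_def by blast
 qed
qed

text \<open>The real index of U serves flows as well as a single map, the latter with a one-point
  index set.\<close>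

lemma dense_nice:
 fixes U :: "real => 'w => 'w"
 assumes U: "!!t. t : I ==> mpres M (U t)"
  and gen: "!!fi t. l2 M fi ==> expectation fi = 0 ==> t : I ==> nice ze (%w. fi (U t w) - fi w)"
  and zo: "!!g c. g : borel_measurable M ==> (!!t. t : I ==> AE w in M. g (U t w) = g w) ==>
  measure M {w : space M. g w > (c::real)} = 0 \<or> measure M {w : space M. g w > c} = 1"
  and fi: "l2 M fi" "expectation fi = 0" and ka: "0 < ka"
 shows "EX ps. nice ze ps & nn M (%w. fi w - ps w) <= ka"
proof (rule dense_coboundaries[where R = "nice ze", OF U _ _ nice_add nice_scaleR _ gen fi ka])
 show "nn M P = 0" if "l2 M P" "expectation P = 0" "!!t. t : I ==> nn M (%w. P (U t w) - P w) = 0"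
  for P :: "'w => complex"
  by (rule invariant_imp_zero[OF that(1,2) zo U that(3)])
 show "l2 M f & expectation f = 0" if "nice ze f" for f using that by (simp add: nice_def)
 show "nice ze (%w. 0)" using nice_scaleR[OF nice_space[of "%_. 0"], of ze 0] by simp
qed

end

section \<open>The cell function and its eigenvalue at small frequency\<close>

lemma ev_le: "cmod (ev xi $ j) <= \<bar>xi $ j\<bar>"
 using phase_diff[of "xi $ j" 0] by (simp add: ev_def)

lemma ev_lim: "((%ep. ev (ep *. ze) $ j / cr ep) \<longlongrightarrow> - \<i> * cr (ze $ j)) (at_right 0)"
proof (cases "ze $ j = 0")
 case True
 thus ?thesis by (simp add: ev_def)
next
 case False
 define wa where "wa = - \<i> * cr (ze $ j)"
 have wa: "wa ~= 0" using False by (simp add: wa_def)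
 have "((%ep. wa * cr ep) \<longlongrightarrow> wa * cr 0) (at_right 0)" by (intro tendsto_intros)
 hence "filterlim (%ep. wa * cr ep) (at 0) (at_right 0)"
  using wa by (simp add: filterlim_at eventually_at_right_less[THEN eventually_mono])
 hence "((%ep. (exp (wa * cr ep) - 1) / (wa * cr ep)) \<longlongrightarrow> 1) (at_right 0)"
  by (rule filterlim_compose[OF lim_exp_minus_1])
 hence "((%ep. wa * ((exp (wa * cr ep) - 1) / (wa * cr ep))) \<longlongrightarrow> wa * 1) (at_right 0)"
  by (intro tendsto_intros)
 thus ?thesis using wa by (simp add: ev_def wa_def mult_ac)
qed

definition colC :: "('w => real^'d::finite^'d) => 'd => 'w => complex^'d" where
 "colC a j w = (\<chi> i. cr (a w $ i $ j))"

lemma colC_cmv: "colC a j w = cmv (a w) (axis j 1)"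
 by (simp add: colC_def cmv_def vec_eq_iff axis_def if_distrib cong: if_cong)

context parab
begin

text \<open>Up to \<open>(\<rho> - exp (\<epsilon>\<^sup>2)) P\<close>, the function \<open>1 + P\<close> is an eigenfunction of the plane-wave evolution with
 eigenvalue \<open>\<rho> = 1 - Q\<close> (discrete time) respectively with rate \<open>Q\<close> (continuous time).\<close>

definition cell :: "('w => real^'d^'d) => real => real^'d => ('w => complex) => complex => bool" where
 "cell a et xi P Q \<longleftrightarrow> Tm et P (%w. - Pi0 M (Ds T xi (%w. cmv (a w) (ev xi + Dv T xi P w))) w) &
  expectation P = 0 & Q = expectation (Ds T xi (%w. cmv (a w) (ev xi + Dv T xi P w)))"

text \<open>P is the combination of the correctors with coefficients ev_j = O(\<epsilon>), so its
  norm is controlled by \<epsilon> |\<phi>_j|, which \<open>corrector_small\<close> makes small. The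
  same combination turns Q into the sesquilinear form of q at ev. By \<open>is_ahom\<close> the
  entries of q are within \<open>de\<close> of those of A, and ev / \<epsilon> tends to -i \<zeta>,
  which produces the quadratic form of A.\<close>

lemma cell_small:
 assumes dense: "!!fi ka. l2 M fi ==> expectation fi = 0 ==> 0 < ka ==> EX ps. nice ze ps & nn M (%w. fi w - ps w) <= ka"
  and a: "coeff_ok M l L a" "0 < l" "l <= L"
  and ah: "is_ahom M T a PhiEq A"
  and PhiEq: "!!xi et ph. 0 < et ==> et <= 1 ==> (!!j. cor a (colC a j) et xi (ph j)) ==> PhiEq xi (cr et) ph"
  and ka: "0 < ka"
 shows "\<forall>\<^sub>F ep in at_right 0. EX P Q. cell a (ep^2) (ep *. ze) P Q & nn M P <= ka &
  cmod (Q - cr (ep^2 * (ze \<bullet> (A *v ze)))) <= ka * ep^2"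
proof -
 have l0: "0 <= l" using a by simp
 define d Z where "d = real CARD('d)" and "Z = norm ze"
 have Z0: "Z >= 0" and d0: "d > 0" by (auto simp: Z_def d_def)
 have lcol: "l2 M (colC a j)" for j unfolding colC_cmv[abs_def] by (rule l2_cmv[OF a(1) l0 L_pos l2_const])
 define ka1 where "ka1 = ka / (d * Z + 1)"
 have ka1: "0 < ka1" using ka d0 Z0 by (simp add: ka1_def add_nonneg_pos)
 have k1: "d * Z * ka1 <= ka"
 proof -
  have pos: "0 < d * Z + 1" using d0 Z0 by (simp add: add_nonneg_pos)
  have "d * Z * ka1 = ka * (d * Z / (d * Z + 1))" by (simp add: ka1_def)
  also have "... <= ka * 1" using ka pos by (intro mult_left_mono) (auto simp: pos_divide_le_eq)
  finally show ?thesis by simp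
 qed
 have "ALL j. EX ep0>0. ALL ep ph. 0 < ep & ep < ep0 & ep <= 1 --> cor a (colC a j) (ep^2) (ep *. ze) ph --> ep * nn M ph <= ka1"
  using corrector_small[OF dense a lcol ka1] by blast
 then obtain e0 where e0: "!!j. e0 j > 0" "!!j ep ph. 0 < ep ==> ep < e0 j ==> ep <= 1 ==> cor a (colC a j) (ep^2) (ep *. ze) ph ==> ep * nn M ph <= ka1"
  unfolding choice_iff by blast
 \<comment> \<open>The double sum over the entries of q - A is at most d^2 Z^2 de \<epsilon>^2,
   which should use half of the allowance ka; the summand 1 covers \<zeta> = 0.\<close>
 define de where "de = ka / (2 * (d * d * Z * Z + 1))"
 have dpos: "0 < d * d * Z * Z + 1" using d0 Z0 by (intro add_nonneg_pos) auto
 have de: "0 < de" using ka dpos by (simp add: de_def)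
 have dk: "d * d * Z * Z * de <= ka / 2"
 proof -
  have "d * d * Z * Z * de = ka / 2 * (d * d * Z * Z / (d * d * Z * Z + 1))" by (simp add: de_def)
  also have "... <= ka / 2 * 1" using ka dpos by (intro mult_left_mono) (auto simp: pos_divide_le_eq)
  finally show ?thesis by simp
 qed
 from ah de obtain r where r: "0 < r" "!!xi et ph i j. 0 < Re et ==> norm xi + cmod et < r ==> PhiEq xi et ph ==>
  cmod (qmat M T a xi ph i j - cr (A $ i $ j)) < de"
  unfolding is_ahom_def by meson
 define E where "E ep = (SUM i:UNIV. SUM j:UNIV. cnj (ev (ep *. ze) $ i) * ev (ep *. ze) $ j * cr (A $ i $ j))" for ep
 have "((%ep. E ep / cr (ep^2)) \<longlongrightarrow> cr (ze \<bullet> (A *v ze))) (at_right 0)"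
 proof -
  have "((%ep. SUM i:UNIV. SUM j:UNIV. cnj (ev (ep *. ze) $ i / cr ep) * (ev (ep *. ze) $ j / cr ep) * cr (A $ i $ j))
  \<longlongrightarrow> (SUM i:UNIV. SUM j:UNIV. cnj (- \<i> * cr (ze $ i)) * (- \<i> * cr (ze $ j)) * cr (A $ i $ j))) (at_right 0)"
  by (intro tendsto_intros tendsto_cnj ev_lim)
  moreover have "(SUM i:UNIV. SUM j:UNIV. cnj (- \<i> * cr (ze $ i)) * (- \<i> * cr (ze $ j)) * cr (A $ i $ j))
  = cr (ze \<bullet> (A *v ze))"
  by (simp add: inner_vec_def matrix_vector_mult_def sum_distrib_left mult_ac)
  moreover have "E ep / cr (ep^2) = (SUM i:UNIV. SUM j:UNIV. cnj (ev (ep *. ze) $ i / cr ep) * (ev (ep *. ze) $ j / cr ep) * cr (A $ i $ j))" for ep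
  by (simp add: E_def sum_divide_distrib power2_eq_square)
  ultimately show ?thesis by simp
 qed
 hence evE: "\<forall>\<^sub>F ep in at_right 0. cmod (E ep / cr (ep^2) - cr (ze \<bullet> (A *v ze))) < ka / 2"
  unfolding dist_norm[symmetric] by (rule tendstoD) (use ka in simp)
 define m where "m = min 1 (min (Min (range e0)) (r / (Z + 1)))"
 have m: "0 < m" using e0(1) r(1) Z0 by (simp add: m_def add_nonneg_pos)
 have evm: "\<forall>\<^sub>F ep in at_right 0. 0 < ep & ep < m"
  using eventually_at_right[of 0 m "%ep. 0 < ep & ep < m"] m by (auto intro!: exI[of _ m])
 from evE evm show ?thesis
 proof eventually_elim
  case (elim ep)
  hence e: "0 < ep" "ep <= 1" "ep < r / (Z + 1)" "ep < Min (range e0)" by (auto simp: m_def)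
  have ej: "ep < e0 j" for j using e(4) by (auto simp: Min_gr_iff)
  define xi where "xi = ep *. ze"
  have ee: "0 < ep^2" "ep^2 <= 1" using eps_sq[OF e(1,2)] by auto
  have "ALL j. EX ph. cor a (colC a j) (ep^2) xi ph" using corrector_ex[OF dense a lcol ee] by blast
  then obtain ph where ph: "!!j. cor a (colC a j) (ep^2) xi (ph j)" by metis
  have lph: "l2 M (ph j)" for j using ph[of j] Tm_l2 by (auto simp: cor_def)
  have nph: "ep * nn M (ph j) <= ka1" for j using e0(2)[OF e(1) ej e(2)] ph[of j] unfolding xi_def by blast
  define e' where "e' = ev xi"
  have e'_le: "cmod (e' $ j) <= ep * Z" for j
  using order_trans[OF ev_le, of xi j "ep * Z"] e component_le_norm_cart[of ze j] by (simp add: e'_def xi_def Z_def abs_mult)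
  define P where "P = (%w. SUM j:UNIV. e' $ j * ph j w)"
  define G where "G j = (%w. cmv (a w) (Dv T xi (ph j) w) + colC a j w)" for j
  have lG: "l2 M (G j)" for j unfolding G_def by (intro l2_add l2_cmv[OF a(1) l0 L_pos] l2_Dv lph lcol)
  define H where "H = (%w. cmv (a w) (e' + Dv T xi P w))"
  have HG: "H w $ i = (SUM j:UNIV. e' $ j * G j w $ i)" for w i
  proof -
  have "(SUM j:UNIV. e' $ j * G j w $ i) = (SUM j:UNIV. SUM k:UNIV. e' $ j * (cr (a w $ i $ k) * dxi T xi k (ph j) w)) + (SUM j:UNIV. e' $ j * cr (a w $ i $ j))"
  by (simp add: G_def colC_def cmv_def distrib_left sum.distrib sum_distrib_left)
  also have "(SUM j:UNIV. SUM k:UNIV. e' $ j * (cr (a w $ i $ k) * dxi T xi k (ph j) w)) = (SUM k:UNIV. cr (a w $ i $ k) * dxi T xi k P w)"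
  unfolding P_def dxi_sum by (subst sum.swap) (simp add: dxi_mult sum_distrib_left mult_ac)
  finally show ?thesis by (simp add: H_def cmv_def distrib_left sum.distrib mult_ac)
  qed
  have lP: "l2 M P" unfolding P_def by (intro l2_sum l2_mult lph)
  have DsH: "Ds T xi H w = (SUM j:UNIV. e' $ j * Ds T xi (G j) w)" for w
  unfolding Ds_def HG dxis_sum by (subst sum.swap) (simp add: dxis_mult sum_distrib_left)
  have PDs: "- Pi0 M (Ds T xi H) w = (SUM j:UNIV. e' $ j * - Pi0 M (Ds T xi (G j)) w)" for w
  proof -
  have "expectation (Ds T xi H) = (SUM j:UNIV. e' $ j * expectation (Ds T xi (G j)))"
  unfolding DsH[abs_def] using lG
  by (subst Bochner_Integration.integral_sum) (auto intro!: l2_integrable l2_mult l2_Ds)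
  thus ?thesis by (simp add: Pi0_def DsH sum_subtractf sum_negf algebra_simps sum_distrib_left)
  qed
  have TmP: "Tm (ep^2) P (%w. - Pi0 M (Ds T xi H) w)"
  unfolding PDs P_def using ph by (intro Tm_sum Tm_mult ee finite) (simp add: cor_def G_def)
  have EP: "expectation P = 0" by (rule positivity(2)[OF a ee(1) TmP[unfolded H_def e'_def]])
  define Q where "Q = expectation (Ds T xi H)"
  have lH: "l2 M H" unfolding H_def by (intro l2_cmv[OF a(1) l0 L_pos] l2_add l2_const l2_Dv lP)
  have Eq: "expectation (%w. G j w $ i) = qmat M T a xi ph i j" for i j
  proof -
  have *: "G j w $ i = aDPhi T a xi ph i j w + ac a i j w" for w
  by (simp add: G_def cmv_def colC_def aDPhi_def ac_def)
  have "l2 M (%w. cmv (a w) (Dv T xi (ph j) w) $ i)" by (intro l2_nth l2_cmv[OF a(1) l0 L_pos] l2_Dv lph)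
  hence 1: "integrable M (aDPhi T a xi ph i j)"
  by (rule l2_integrable[THEN back_subst[of "integrable M"]]) (simp add: cmv_def aDPhi_def ac_def fun_eq_iff)
  have 2: "integrable M (ac a i j)"
  by (rule l2_integrable[OF l2_nth[OF lcol[of j], of i], THEN back_subst[of "integrable M"]]) (simp add: colC_def ac_def fun_eq_iff)
  show ?thesis unfolding * qmat_def using 1 2 by simp
  qed
  have Qq: "Q = (SUM i:UNIV. SUM j:UNIV. cnj (e' $ i) * e' $ j * qmat M T a xi ph i j)"
  unfolding Q_def expectation_Ds[OF lH] e'_def[symmetric] HG
  proof (intro sum.cong refl)
  fix i
  have "expectation (%w. SUM j:UNIV. e' $ j * G j w $ i) = (SUM j:UNIV. e' $ j * qmat M T a xi ph i j)"
  unfolding Eq[symmetric] using lG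
  by (subst Bochner_Integration.integral_sum) (auto intro!: l2_integrable l2_mult l2_nth)
  thus "cnj (e' $ i) * expectation (%w. SUM j:UNIV. e' $ j * G j w $ i) = (SUM j:UNIV. cnj (e' $ i) * e' $ j * qmat M T a xi ph i j)"
  by (simp add: sum_distrib_left mult.assoc)
  qed
  have cellP: "cell a (ep^2) xi P Q"
  unfolding cell_def using TmP EP by (simp add: H_def e'_def Q_def)
  have nP: "nn M P <= ka"
  proof -
  have "nn M P <= (SUM j:UNIV. nn M (%w. e' $ j * ph j w))" unfolding P_def by (intro nn_sum_le l2_mult lph finite)
  also have "... <= (SUM j:(UNIV::'d set). Z * ka1)"
  proof (rule sum_mono)
  fix j
  have "nn M (%w. e' $ j * ph j w) <= (ep * Z) * nn M (ph j)" unfolding nn_mult by (intro mult_right_mono e'_le) simp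
  also have "... = Z * (ep * nn M (ph j))" by simp
  also have "... <= Z * ka1" using Z0 by (intro mult_left_mono nph)
  finally show "nn M (%w. e' $ j * ph j w) <= Z * ka1" .
  qed
  also have "... = d * Z * ka1" by (simp add: d_def)
  finally show ?thesis using k1 by simp
  qed
  have PE: "PhiEq xi (cr (ep^2)) ph" by (rule PhiEq[OF ee ph])
  have nr: "norm xi + cmod (cr (ep^2)) < r"
  proof -
  have "norm xi + cmod (cr (ep^2)) = ep * Z + ep^2" using e by (simp add: xi_def Z_def norm_power)
  also have "... <= ep * (Z + 1)" using e by (simp add: power2_eq_square distrib_left mult_left_le)
  also have "... < r" using e(3) Z0 by (simp add: pos_less_divide_eq add_nonneg_pos)
  finally show ?thesis .
  qed
  have "cmod (Q - E ep) <= (SUM i:(UNIV::'d set). SUM j:(UNIV::'d set). (ep * Z) * (ep * Z) * de)"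
  proof -
  have "Q - E ep = (SUM i:UNIV. SUM j:UNIV. cnj (e' $ i) * e' $ j * (qmat M T a xi ph i j - cr (A $ i $ j)))"
  by (simp add: Qq E_def xi_def[symmetric] e'_def[symmetric] sum_subtractf right_diff_distrib)
  also have "cmod ... <= (SUM i:(UNIV::'d set). SUM j:(UNIV::'d set). (ep * Z) * (ep * Z) * de)"
  proof (intro order_trans[OF norm_sum] sum_mono)
  fix i j
  have "cmod (qmat M T a xi ph i j - cr (A $ i $ j)) <= de"
  using r(2)[OF _ nr PE, of i j] ee by simp
  thus "cmod (cnj (e' $ i) * e' $ j * (qmat M T a xi ph i j - cr (A $ i $ j))) <= (ep * Z) * (ep * Z) * de"
  unfolding norm_mult complex_mod_cnj using e Z0 by (intro mult_mono e'_le) auto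
  qed
  finally show ?thesis .
  qed
  also have "... = (d * d * Z * Z * de) * ep^2" by (simp add: d_def power2_eq_square mult_ac)
  also have "... <= ka / 2 * ep^2" by (intro mult_right_mono dk) simp
  finally have QE: "cmod (Q - E ep) <= ka / 2 * ep^2" .
  have "cmod (E ep - cr (ep^2 * (ze \<bullet> (A *v ze)))) = ep^2 * cmod (E ep / cr (ep^2) - cr (ze \<bullet> (A *v ze)))"
  proof -
  have "E ep - cr (ep^2 * (ze \<bullet> (A *v ze))) = cr (ep^2) * (E ep / cr (ep^2) - cr (ze \<bullet> (A *v ze)))"
  using e by (simp add: right_diff_distrib)
  thus ?thesis by (simp only: norm_mult norm_of_real) simp
  qed
  also have "... <= ep^2 * (ka / 2)" using elim(1) by (intro mult_left_mono) auto
  finally have "cmod (Q - cr (ep^2 * (ze \<bullet> (A *v ze)))) <= ka * ep^2"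
  using QE norm_triangle_ineq[of "Q - E ep" "E ep - cr (ep^2 * (ze \<bullet> (A *v ze)))"] by (simp add: mult.commute)
  thus ?case using cellP nP unfolding xi_def by blast
 qed
qed

text \<open>\<open>positivity\<close> divided by \<epsilon>^2, in the limit. A is known only through
  \<open>is_ahom\<close>, so this is where the positivity comes from on which the heat equation and
  the decay of the multiplier rely. The constant l / 2 is enough for both.\<close>

lemma ahom_coercive:
 assumes dense: "!!fi ka. l2 M fi ==> expectation fi = 0 ==> 0 < ka ==> EX ps. nice ze ps & nn M (%w. fi w - ps w) <= ka"
  and a: "coeff_ok M l L a" "0 < l" "l <= L"
  and ah: "is_ahom M T a PhiEq A"
  and PhiEq: "!!xi et ph. 0 < et ==> et <= 1 ==> (!!j. cor a (colC a j) et xi (ph j)) ==> PhiEq xi (cr et) ph"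
 shows "l * (norm ze)^2 <= 2 * (ze \<bullet> (A *v ze))"
proof (rule field_le_epsilon)
 fix ka :: real assume "0 < ka"
 hence k: "0 < ka / 2" by simp
 have pos: "\<forall>\<^sub>F ep in at_right 0. 0 < (ep::real)" by (simp add: eventually_at_right_less)
 have "\<forall>\<^sub>F ep in at_right 0. EX P Q. cell a (ep^2) (ep *. ze) P Q & nn M P <= ka / 2 &
  cmod (Q - cr (ep^2 * (ze \<bullet> (A *v ze)))) <= ka / 2 * ep^2"
  by (rule cell_small[OF dense a ah PhiEq k])
 hence "\<forall>\<^sub>F ep in at_right 0. l * (SUM j:UNIV. (cmod (ev (ep *. ze) $ j / cr ep))^2) <= 2 * (ze \<bullet> (A *v ze)) + ka"
  using pos
 proof eventually_elim
  case (elim ep)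
  then obtain P Q where c: "cell a (ep^2) (ep *. ze) P Q" and q: "cmod (Q - cr (ep^2 * (ze \<bullet> (A *v ze)))) <= ka / 2 * ep^2" by blast
  have e2: "0 < ep^2" using elim by simp
  have "l * (norm (ev (ep *. ze)))^2 <= 2 * Re Q"
  using c positivity(1)[OF a e2] unfolding cell_def by blast
  also have "... <= 2 * (ep^2 * (ze \<bullet> (A *v ze)) + ka / 2 * ep^2)"
  using complex_Re_le_cmod[of "Q - cr (ep^2 * (ze \<bullet> (A *v ze)))"] q by simp
  finally have "l * (norm (ev (ep *. ze)))^2 / ep^2 <= 2 * (ze \<bullet> (A *v ze)) + ka"
  using e2 by (simp add: pos_divide_le_eq algebra_simps)
  moreover have "l * (SUM j:UNIV. (cmod (ev (ep *. ze) $ j / cr ep))^2) = l * (norm (ev (ep *. ze)))^2 / ep^2"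
  by (simp add: l2_cart_norm2 norm_divide power_divide sum_divide_distrib[symmetric])
  ultimately show ?case by simp
 qed
 moreover have "((%ep. l * (SUM j:UNIV. (cmod (ev (ep *. ze) $ j / cr ep))^2)) \<longlongrightarrow>
  l * (SUM j:UNIV. (cmod (- \<i> * cr (ze $ j)))^2)) (at_right 0)"
  by (intro tendsto_intros ev_lim)
 ultimately have "l * (SUM j:UNIV. (cmod (- \<i> * cr (ze $ j)))^2) <= 2 * (ze \<bullet> (A *v ze)) + ka"
  by (intro tendsto_upperbound) auto
 thus "l * (norm ze)^2 <= 2 * (ze \<bullet> (A *v ze)) + ka"
  by (simp add: norm_mult norm_vec_def L2_set_def sum_nonneg)
qed

end

section \<open>Explicit time steps and powers of the eigenvalue\<close>

context space_shift
begin

text \<open>In the expanded square the cross term contributes -2 E, while the squared norm of the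
  increment is at most 4 d L E \<le> E.\<close>

lemma step_contraction:
 assumes al: "coeff_ok M l L al" "0 <= l" "l <= L" "0 < L" "4 * real CARD('d) * L <= 1" and v: "l2 M v"
 shows "nn M (%w. v w - Ds T xi (%w. cmv (al w) (Dv T xi v w)) w) <= nn M v"
proof (rule power2_le_imp_le)
 define G where "G = (%w. cmv (al w) (Dv T xi v w))"
 define E where "E = ip M (Dv T xi v) G"
 have lG: "l2 M G" unfolding G_def by (intro l2_cmv[OF al(1,2,4)] l2_Dv v)
 have G2: "(nn M G)^2 <= L * E" unfolding E_def G_def by (rule nn_cmv_sq[OF al(1,2,4) l2_Dv[OF v] al(3)])
 have "l * (nn M (Dv T xi v))^2 <= E" unfolding E_def G_def by (rule ip_cmv_lower[OF al(1,2,4) l2_Dv[OF v] al(3)])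
 hence E0: "0 <= E" using al(2) by (meson order_trans mult_nonneg_nonneg zero_le_power2)
 have "(nn M (Ds T xi G))^2 <= 4 * real CARD('d) * (L * E)"
  by (rule order_trans[OF nn_Ds_sq_le[OF lG]]) (intro mult_left_mono G2, simp)
 also have "... = (4 * real CARD('d) * L) * E" by simp
 also have "... <= 1 * E" using al(5) E0 by (intro mult_right_mono)
 finally have "(nn M (%w. v w - Ds T xi G w))^2 <= (nn M v)^2"
  using v lG E0 by (simp add: nn_diff_sq l2_Ds ip_Dv[symmetric] E_def)
 thus "(nn M (%w. v w - Ds T xi (%w. cmv (al w) (Dv T xi v w)) w))^2 <= (nn M v)^2"
  by (simp add: G_def)
qed simp

lemma corrector_rhs:
 assumes al: "coeff_ok M l L a" "0 <= l" "0 < L" and ph: "!!j. l2 M (ph j)"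
 shows "- Pi0 M (Ds T xi (%w. cmv (a w) (Dv T xi (ph j) w) + colC a j w)) w
  = - Pi0 M (divs T xi (ac a) j) w - Pi0 M (divs T xi (aDPhi T a xi ph) j) w"
proof -
 have 1: "Ds T xi (%w. cmv (a w) (Dv T xi (ph j) w)) = divs T xi (aDPhi T a xi ph) j"
  by (simp add: fun_eq_iff Ds_def divs_def cmv_def aDPhi_def[abs_def] ac_def)
 have 2: "Ds T xi (colC a j) = divs T xi (ac a) j"
  by (simp add: fun_eq_iff Ds_def divs_def colC_def ac_def[abs_def])
 have "l2 M (colC a j)" unfolding colC_cmv[abs_def] by (rule l2_cmv[OF al l2_const])
 thus ?thesis unfolding Ds_add[abs_def] 1[symmetric] 2[symmetric]
  by (subst Pi0_add) (auto intro!: l2_Ds l2_cmv[OF al] l2_Dv ph)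
qed

end

text \<open>Telescoping with |rh| \<le> 1. The geometric series in s makes the bound independent of
  n, hence uniform in time.\<close>

lemma power_diff_bound:
 fixes rh :: complex and s :: real
 assumes "cmod rh <= 1" "0 <= s" "s < 1"
 shows "cmod (rh ^ n - cr s ^ n) <= cmod (rh - cr s) / (1 - s)"
proof -
 have "cmod (rh ^ n - cr s ^ n) <= cmod (rh - cr s) * (\<Sum>k<n. s ^ k)"
 proof (induction n)
  case (Suc n)
  have "rh ^ Suc n - cr s ^ Suc n = rh * (rh ^ n - cr s ^ n) + (rh - cr s) * cr s ^ n"
  by (simp add: algebra_simps)
  hence "cmod (rh ^ Suc n - cr s ^ Suc n) <= cmod rh * cmod (rh ^ n - cr s ^ n) + cmod (rh - cr s) * s ^ n"
  using assms(2) norm_triangle_ineq[of "rh * (rh ^ n - cr s ^ n)" "(rh - cr s) * cr s ^ n"]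
  by (simp add: norm_mult norm_power)
  also have "... <= 1 * cmod (rh ^ n - cr s ^ n) + cmod (rh - cr s) * s ^ n"
  using assms by (intro add_mono mult_right_mono) auto
  finally show ?case using Suc by (simp add: distrib_left)
 qed simp
 also have "... <= cmod (rh - cr s) * (1 / (1 - s))"
 proof (rule mult_left_mono)
  have "(\<Sum>k<n. s ^ k) = (1 - s ^ n) / (1 - s)" using assms by (simp add: sum_gp_strict)
  also have "... <= 1 / (1 - s)" using assms by (intro divide_right_mono) auto
  finally show "(\<Sum>k<n. s ^ k) <= 1 / (1 - s)" .
 qed simp
 finally show ?thesis by simp
qed

lemma exp_minus_le_quad: "0 <= x ==> x <= 1 ==> \<bar>exp (- x) - (1 - x)\<bar> <= x^2" for x :: real
proof -
 assume x: "0 <= x" "x <= 1"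
 have "1 - x <= exp (- x)" using exp_ge_add_one_self[of "-x"] by simp
 moreover have "exp (- x) <= 1 - x + x^2"
 proof -
  have "exp (- x) * (1 + x) <= exp (- x) * exp x" by (intro mult_left_mono exp_ge_add_one_self) simp
  hence "exp (- x) * (1 + x) <= 1" by (simp add: exp_minus)
  also have "1 <= (1 - x + x^2) * (1 + x)" using x by (simp add: algebra_simps power2_eq_square)
  finally show ?thesis using x by (simp add: mult_le_cancel_right)
 qed
 ultimately show ?thesis by simp
qed

text \<open>Shared by the discrete equation (h = 1) and the Euler scheme (small h). W is the
  expected multiplier after N steps, x stands for \<epsilon>^2, mu for the quadratic form of A at
  \<zeta>, and B bounds the residual of the approximate eigenfunction in one step. The gap 1 - |1 -
  h Q| is at least h x mu / 2, whereas B and h times the error of Q carry an additional small factor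
  ka; summed over all steps the error is therefore O(ka) for every N.\<close>

lemma eigenvalue_power_bound:
 fixes Q W :: complex
 assumes mu: "0 < mu" and x: "0 < x" and Q: "cmod (Q - cr (x * mu)) <= ka * x" and ka: "ka <= mu / 4"
  and h: "0 < h" "h * (x * mu) <= 8 / 25"
  and W: "cmod (1 - cr h * Q) < 1 ==> cmod (W - (1 - cr h * Q) ^ N) <= ka + B / (1 - cmod (1 - cr h * Q))"
  and B: "0 <= B" "B <= h * (x * (ka * R))"
 shows "cmod (W - cr (1 - h * (x * mu)) ^ N) <= ka * (1 + 2 * R / mu + 1 / mu)"
proof -
 define rh where "rh = 1 - cr h * Q"
 have xm: "0 < x * mu" and hx: "0 < h * (x * mu)" using x mu h by auto
 have kx: "ka * x <= x * mu / 4" using mult_right_mono[OF ka, of x] x by (simp add: mult.commute)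
 have "\<bar>Re Q - x * mu\<bar> <= ka * x" using order_trans[OF abs_Re_le_cmod Q] by simp
 hence ReQ: "3 / 4 * (x * mu) <= Re Q" using kx by linarith
 have "cmod (cr (x * mu)) = x * mu" unfolding norm_of_real using xm by simp
 hence nQ: "cmod Q <= 5 / 4 * (x * mu)" using norm_triangle_sub[of Q "cr (x * mu)"] Q kx by linarith
 \<comment> \<open>With y = h x mu, the bounds Re Q \<ge> 3/4 x mu and |Q| \<le> 5/4 x mu give
   |rh|^2 \<le> 1 - 3/2 y + 25/16 y^2. The restriction y \<le> 8/25 makes the last term at most y /
   2, so that |rh|^2 \<le> 1 - y.\<close>
 have r1: "cmod rh <= 1 - h * (x * mu) / 2"
 proof (rule power2_le_imp_le)
  have "(cmod rh)^2 = 1 - 2 * (h * Re Q) + h^2 * (cmod Q)^2"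
  unfolding cmod_power2 by (simp add: rh_def power2_eq_square algebra_simps)
  also have "... <= 1 - 2 * (h * (3 / 4 * (x * mu))) + h^2 * (5 / 4 * (x * mu))^2"
  using ReQ nQ h(1) by (intro add_mono diff_mono mult_left_mono power_mono) auto
  also have "h^2 * (5 / 4 * (x * mu))^2 = 25 / 16 * (h * (x * mu)) * (h * (x * mu))" by (simp add: power2_eq_square)
  also have "... <= 25 / 16 * (8 / 25) * (h * (x * mu))" using h(2) hx by (intro mult_right_mono) linarith+
  also have "1 - 2 * (h * (3 / 4 * (x * mu))) + 25 / 16 * (8 / 25) * (h * (x * mu)) <= (1 - h * (x * mu) / 2)^2"
  proof -
  have "(1 - y / 2)^2 = 1 - y + (y / 2)^2" for y :: real by (simp add: power2_eq_square algebra_simps)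
  thus ?thesis using zero_le_power2[of "h * (x * mu) / 2"] by simp
  qed
  finally show "(cmod rh)^2 <= (1 - h * (x * mu) / 2)^2" by simp
  show "0 <= 1 - h * (x * mu) / 2" using h(2) by simp
 qed
 hence r2: "cmod rh < 1" using hx by linarith
 have "cmod (W - rh ^ N) <= ka + B / (1 - cmod rh)" using W r2 unfolding rh_def by blast
 also have "... <= ka + (h * (x * (ka * R))) / (h * (x * mu) / 2)"
  using r1 hx B by (intro add_mono frac_le) auto
 also have "... = ka + ka * (2 * R / mu)" using h(1) x mu by (simp add: field_simps)
 finally have E1: "cmod (W - rh ^ N) <= ka + ka * (2 * R / mu)" .
 have "cmod (rh ^ N - cr (1 - h * (x * mu)) ^ N) <= cmod (rh - cr (1 - h * (x * mu))) / (1 - (1 - h * (x * mu)))"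
  by (rule power_diff_bound) (use r2 h(2) hx in auto)
 also have "rh - cr (1 - h * (x * mu)) = - (cr h * (Q - cr (x * mu)))"
  by (simp add: rh_def algebra_simps)
 also have "cmod ... = h * cmod (Q - cr (x * mu))"
  unfolding norm_minus_cancel norm_mult norm_of_real using h(1) by simp
 also have "h * cmod (Q - cr (x * mu)) / (1 - (1 - h * (x * mu))) <= h * (ka * x) / (1 - (1 - h * (x * mu)))"
  using Q hx h(1) by (intro divide_right_mono mult_left_mono) auto
 also have "... = ka * (1 / mu)" using h(1) x mu by (simp add: field_simps)
 finally have E2: "cmod (rh ^ N - cr (1 - h * (x * mu)) ^ N) <= ka * (1 / mu)" .
 have "cmod (W - cr (1 - h * (x * mu)) ^ N) <= (ka + ka * (2 * R / mu)) + ka * (1 / mu)"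
  using norm_triangle_ineq[of "W - rh ^ N" "rh ^ N - cr (1 - h * (x * mu)) ^ N"] E1 E2 by simp
 thus ?thesis by (simp only: distrib_left mult_1_right)
qed

section \<open>The random medium and discrete time\<close>

locale environment = space_shift M T for M :: "'w measure" and T :: "int^'d::finite => 'w => 'w" +
 fixes S :: "'t::ab_group_add => 'w => 'w" and a :: "'w => real^'d^'d" and l L :: real
 assumes groups: "translation_groups M T S" and a: "coeff_ok M l L a" and lL: "0 < l" "l <= L"
begin

lemma L_pos: "0 < L" using lL by simp

lemma S_mpres: "mpres M (S t)" using groups by (simp add: translation_groups_def)

lemma S_measurable [measurable]: "S t : measurable M M" using S_mpres by (simp add: mpres_def)

lemma S_space: "w : space M ==> S t w : space M"
 using measurable_space[OF S_measurable] .

lemma S_plus: "w : space M ==> S (t + s) w = S t (S s w)" and S_0: "w : space M ==> S 0 w = w"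
 and S_T: "w : space M ==> S t (T x w) = T x (S t w)"
 using groups by (simp_all add: translation_groups_def)

lemma l2_S: "l2 M f ==> l2 M (%w. f (S t w))" by (rule l2_comp[OF _ S_mpres])
lemma nn_S: "l2 M f ==> nn M (%w. f (S t w)) = nn M f" by (rule nn_comp[OF _ S_mpres])

lemma coeff_ok_S: "coeff_ok M l L (%w. a (S t w))"
 using a S_space by (auto simp: coeff_ok_def intro: measurable_compose[OF S_measurable])

end

locale disc = environment M T S a l L for M :: "'w measure" and T :: "int^'d::finite => 'w => 'w"
  and S :: "int => 'w => 'w" and a l L +
 assumes stab: "4 * real CARD('d) * L <= 1"
begin

definition TmD :: "real => ('w => complex) => ('w => complex) => bool" where
 "TmD et ps g \<longleftrightarrow> l2 M ps & l2 M g & (AE w in M. g w = cr (exp et) * ps (S 1 w) - ps w)"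

lemma exp_lip: "0 < x ==> x <= 1 ==> 0 < y ==> y <= 1 ==> \<bar>exp x - exp y\<bar> <= 3 * \<bar>x - y\<bar>" for x y :: real
proof -
 have *: "exp v - exp u <= 3 * (v - u)" if "u <= v" "v <= 1" for u v :: real
 proof -
  have "exp v * (1 + (u - v)) <= exp v * exp (u - v)" by (intro mult_left_mono exp_ge_add_one_self) simp
  hence "exp v - exp u <= exp v * (v - u)" by (simp add: exp_diff algebra_simps)
  also have "... <= 3 * (v - u)" using that exp_le order_trans[of "exp v" "exp 1" 3] by (intro mult_right_mono) auto
  finally show ?thesis .
 qed
 assume "0 < x" "x <= 1" "0 < y" "y <= 1"
 thus ?thesis using *[of x y] *[of y x] by (cases "x <= y") (auto simp: abs_if)
qed

sublocale parab M T TmD L 1 1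
proof
 show "0 < L" by (rule L_pos)
 show "4 * real CARD('d) * L * 1 <= 1" "2 * real CARD('d) * L <= 1" using stab L_pos by (simp, simp)
 fix et ps g assume Tm: "TmD et ps g"
 show "l2 M ps" "l2 M g" using Tm by (auto simp: TmD_def)
 show "TmD et ps g'" if "l2 M g'" "AE w in M. g w = g' w" for g'
 proof -
  have "AE w in M. g' w = cr (exp et) * ps (S 1 w) - ps w"
  using Tm that(2) unfolding TmD_def by (auto elim: eventually_elim2)
  thus ?thesis using Tm that(1) by (simp add: TmD_def)
 qed
 show "TmD et (%w. ps w + k * ps' w) (%w. g w + k * g' w)" if Tm': "TmD et ps' g'" for ps' g' k
 proof -
  have "AE w in M. g w = cr (exp et) * ps (S 1 w) - ps w"
  "AE w in M. g' w = cr (exp et) * ps' (S 1 w) - ps' w" using Tm Tm' by (auto simp: TmD_def)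
  hence "AE w in M. g w + k * g' w = cr (exp et) * (ps (S 1 w) + k * ps' (S 1 w)) - (ps w + k * ps' w)"
  proof eventually_elim
  case (elim w)
  show ?case unfolding elim by (simp add: algebra_simps)
  qed
  thus ?thesis using Tm Tm' by (auto simp: TmD_def)
 qed
 show "TmD et (%w. ps (T x w)) (%w. g (T x w))" for x
 proof -
  have "AE w in M. g (T x w) = cr (exp et) * ps (S 1 (T x w)) - ps (T x w)"
  using mpres_AE[OF T_mpres, of "%w. g w = cr (exp et) * ps (S 1 w) - ps w" x] Tm by (simp add: TmD_def)
  with AE_space have "AE w in M. g (T x w) = cr (exp et) * ps (T x (S 1 w)) - ps (T x w)"
  by eventually_elim (simp add: S_T)
  thus ?thesis using Tm by (auto simp: TmD_def l2_T)
 qed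
 show "EX r. l2 M r & nn M r <= 3 * \<bar>et - et'\<bar> * nn M ps & TmD et' ps (%w. g w + r w)"
  if "0 < et" "et <= 1" "0 < et'" "et' <= 1" for et'
 proof (intro exI[of _ "%w. cr (exp et' - exp et) * ps (S 1 w)"] conjI)
  have l: "l2 M ps" using Tm by (simp add: TmD_def)
  show r: "l2 M (%w. cr (exp et' - exp et) * ps (S 1 w))" by (intro l2_mult l2_S l)
  show "nn M (%w. cr (exp et' - exp et) * ps (S 1 w)) <= 3 * \<bar>et - et'\<bar> * nn M ps"
  unfolding nn_mult nn_S[OF l] norm_of_real using exp_lip[of et' et] that by (intro mult_right_mono) (auto simp: abs_minus_commute)
  have "AE w in M. g w = cr (exp et) * ps (S 1 w) - ps w" using Tm by (simp add: TmD_def)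
  hence "AE w in M. g w + cr (exp et' - exp et) * ps (S 1 w) = cr (exp et') * ps (S 1 w) - ps w"
  by eventually_elim (simp add: algebra_simps)
  thus "TmD et' ps (%w. g w + cr (exp et' - exp et) * ps (S 1 w))"
  using Tm r by (auto simp: TmD_def)
 qed
 show "2 * et * (nn M ps)^2 <= 2 * ip M ps g + 1 * (nn M g)^2" if "0 < et"
 proof -
  have l: "l2 M ps" "l2 M g" and ae: "AE w in M. g w = cr (exp et) * ps (S 1 w) - ps w" using Tm by (auto simp: TmD_def)
  have lS: "l2 M (%w. cr (exp et) * ps (S 1 w))" by (intro l2_mult l2_S l)
  \<comment> \<open>ps + g is e^\<eta> times a time shift of ps, and the shift preserves the norm.
    Expanding the left side produces the full square of g; hence th = 1.\<close>
  have "nn M (%w. ps w + g w) = nn M (%w. cr (exp et) * ps (S 1 w))"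
  using ae by (intro nn_cong_AE l2_meas lS l2_add l) auto
  also have "... = exp et * nn M ps" by (simp add: nn_S[OF l(1)])
  finally have "(exp et)^2 * (nn M ps)^2 = (nn M ps)^2 + 2 * ip M ps g + (nn M g)^2"
  using nn_add_sq[OF l] by (simp add: power_mult_distrib)
  moreover have "(1 + 2 * et) * (nn M ps)^2 <= (exp et)^2 * (nn M ps)^2"
  using exp_ge_add_one_self[of "2 * et"] by (intro mult_right_mono) (auto simp: exp_double[symmetric])
  ultimately show ?thesis by (simp add: algebra_simps)
 qed
 show "expectation ps = 0" if "0 < et" "expectation g = 0"
 proof -
  have l: "l2 M ps" "l2 M g" and ae: "AE w in M. g w = cr (exp et) * ps (S 1 w) - ps w" using Tm by (auto simp: TmD_def)
  have "expectation g = expectation (%w. cr (exp et) * ps (S 1 w) - ps w)"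
  using ae l by (intro integral_cong_AE) (auto intro!: l2_meas l2_diff l2_mult l2_S)
  also have "... = cr (exp et) * expectation (%w. ps (S 1 w)) - expectation ps"
  using l2_integrable[OF l(1)] l2_integrable[OF l2_S[OF l(1), of 1]] by simp
  also have "... = (cr (exp et) - 1) * expectation ps"
  using mpres_integral[OF S_mpres l2_meas[OF l(1)], of 1] by (simp add: algebra_simps)
  finally have "cr (exp et - 1) * expectation ps = 0" using that(2) by simp
  thus ?thesis using that(1) by (simp only: mult_eq_0_iff of_real_eq_0_iff) auto
 qed
next
 fix et :: real and h :: "'w => complex" assume h: "l2 M h"
 \<comment> \<open>With c = 1 the summand -v cancels, and only the shift and the factor e^\<eta>
   have to be undone.\<close>
 define v where "v = (%w. cr (exp (- et)) * h (S (- 1) w))"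
 have lv: "l2 M v" unfolding v_def by (intro l2_mult l2_S h)
 have "cr (exp et) * v (S 1 w) = h w" if "w : space M" for w
 proof -
  have "S (- 1) (S 1 w) = w" using S_plus[OF that, of "-1" 1] S_0[OF that] by simp
  thus ?thesis by (simp add: v_def of_real_mult[symmetric] exp_minus_inverse mult.assoc[symmetric] del: of_real_mult)
 qed
 hence "TmD et v (%w. h w - 1 *. v w)"
  unfolding TmD_def using h lv by (auto intro!: AE_I2)
 thus "EX v. TmD et v (%w. h w - 1 *. v w)" by blast
qed simp_all

lemma PhiEq_disc:
 assumes et: "0 < et" and ph: "!!j. cor a (colC a j) et xi (ph j)"
 shows "Phi_eq_disc M T S a xi (cr et) ph"
 unfolding Phi_eq_disc_def L2_iff_l2
proof (intro conjI allI)
 have l: "l2 M (ph j)" for j using ph[of j] by (simp add: cor_def TmD_def)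
 show "l2 M (ph j)" for j by (rule l)
 fix j
 have l0: "0 <= l" using lL by simp
 have "AE w in M. - Pi0 M (Ds T xi (%w. cmv (a w) (Dv T xi (ph j) w) + colC a j w)) w
  = cr (exp et) * ph j (S 1 w) - ph j w"
  using ph[of j] by (simp add: cor_def TmD_def)
 thus "AE w in M. exp (cr et) * ph j (S 1 w) - ph j w + Pi0 M (divs T xi (aDPhi T a xi ph) j) w
  = - Pi0 M (divs T xi (ac a) j) w"
 proof eventually_elim
  case (elim w)
  thus ?case using corrector_rhs[where ph=ph and j=j and w=w and xi=xi, OF a l0 L_pos l] by (simp add: exp_of_real[symmetric] algebra_simps)
 qed
qed

lemma dense_disc:
 assumes erg: "(EX j. ergodic_map M (T (ue j))) \<or> ergodic_map M (S 1)"
  and fi: "l2 M fi" "expectation fi = 0" "0 < ka"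
 shows "EX ps. nice ze ps & nn M (%w. fi w - ps w) <= ka"
 using erg
proof
 assume "EX j. ergodic_map M (T (ue j))"
 then obtain j where j: "ergodic_map M (T (ue j))" by blast
 show ?thesis
 proof (rule dense_nice[where I = "{0}" and U = "%_. T (ue j)", OF _ _ _ fi])
  show "measure M {w : space M. g w > c} = 0 \<or> measure M {w : space M. g w > c} = 1"
  if "g : borel_measurable M" "!!t. t : {0::real} ==> AE w in M. g (T (ue j) w) = g w" for g :: "'w => real" and c
  using ergodic_map_zero_one[OF j that(1) that(2)[OF singletonI]] by simp
 qed (auto intro: T_mpres nice_space)
next
 assume e: "ergodic_map M (S 1)"
 show ?thesis
 proof (rule dense_nice[where I = "{0}" and U = "%_. S 1", OF _ _ _ fi])
  show "measure M {w : space M. g w > c} = 0 \<or> measure M {w : space M. g w > c} = 1"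
  if "g : borel_measurable M" "!!t. t : {0::real} ==> AE w in M. g (S 1 w) = g w" for g :: "'w => real" and c
  using ergodic_map_zero_one[OF e that(1) that(2)[OF singletonI]] by simp
  fix fi :: "'w => complex" assume fi: "l2 M fi" "expectation fi = 0"
  have lS: "l2 M (%w. fi (S 1 w))" by (rule l2_S[OF fi(1)])
  show "nice ze (%w. fi (S 1 w) - fi w)"
  proof (rule nice_time[OF _ _ fi(2), where C = "3 * nn M fi"])
  show "l2 M (%w. fi (S 1 w) - fi w)" by (intro l2_diff lS fi)
  show "expectation (%w. fi (S 1 w) - fi w) = 0"
  using l2_integrable[OF fi(1)] l2_integrable[OF lS] mpres_integral[OF S_mpres l2_meas[OF fi(1)], of 1] by simp
  fix et :: real assume et: "0 < et" "et <= 1"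
  show "EX r. l2 M r & nn M r <= 3 * nn M fi * et & TmD et fi (%w. fi (S 1 w) - fi w + r w)"
  proof (intro exI[of _ "%w. cr (exp et - 1) * fi (S 1 w)"] conjI)
  show r: "l2 M (%w. cr (exp et - 1) * fi (S 1 w))" by (intro l2_mult lS)
  have "exp et - 1 <= 3 * et"
  proof -
  have "exp et * (1 + - et) <= exp et * exp (- et)" by (intro mult_left_mono exp_ge_add_one_self) simp
  hence "exp et - 1 <= exp et * et" by (simp add: exp_minus algebra_simps)
  also have "... <= 3 * et" using et exp_le order_trans[of "exp et" "exp 1" 3] by (intro mult_right_mono) auto
  finally show ?thesis .
  qed
  hence "\<bar>exp et - 1\<bar> <= 3 * et" using et by simp
  hence "\<bar>exp et - 1\<bar> * nn M fi <= 3 * et * nn M fi" by (intro mult_right_mono) auto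
  thus "nn M (%w. cr (exp et - 1) * fi (S 1 w)) <= 3 * nn M fi * et"
  unfolding nn_mult nn_S[OF fi(1)] norm_of_real by (simp add: mult_ac)
  show "TmD et fi (%w. fi (S 1 w) - fi w + cr (exp et - 1) * fi (S 1 w))"
  unfolding TmD_def using fi lS r by (auto simp: algebra_simps)
  qed
  qed simp
 qed (auto intro: S_mpres)
qed

text \<open>The solution that starts from the plane wave with frequency xi is that plane wave times
  \<open>wd\<close> at the translated environment, by \<open>wd_lattice\<close>. Its expectation is
  the Fourier multiplier of the averaged evolution.\<close>

primrec wd :: "real^'d => nat => 'w => complex" where
 "wd xi 0 = (%w. 1)"
| "wd xi (Suc n) = (%w. wd xi n w - Ds T xi (%w. cmv (a (S (int n) w)) (Dv T xi (wd xi n) w)) w)"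

lemma l2_wd: "l2 M (wd xi n)" and nn_wd: "nn M (wd xi n) <= 1"
proof (induction n)
 case (Suc n)
 { case 1 show ?case using Suc lL by (auto intro!: l2_diff l2_Ds l2_cmv[OF coeff_ok_S _ L_pos] l2_Dv) }
 { case 2
  have "nn M (wd xi (Suc n)) <= nn M (wd xi n)"
  using Suc lL stab by (auto intro!: step_contraction[OF coeff_ok_S _ _ L_pos])
  thus ?case using Suc by simp }
qed auto

text \<open>rh^n (1 + P), transported by the time shift, is an approximate solution with error
  |rh|^n r in step n. The steps contract in L2, so the errors add up to at most r / (1 - |rh|), and
  the mismatch |P| at time 0 does not grow. Since P has mean zero, the expectation of the
  approximate solution is exactly rh^n.\<close>

lemma wd_approx:
 assumes P: "l2 M P" "expectation P = 0" and rh: "cmod rh < 1"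
  and r: "nn M (%w. (1 + P w) - Ds T xi (%w. cmv (a w) (Dv T xi (%w. 1 + P w) w)) w - rh * (1 + P (S 1 w))) <= r"
 shows "cmod (expectation (wd xi n) - rh ^ n) <= nn M P + r / (1 - cmod rh)"
proof -
 let ?r = "%w. (1 + P w) - Ds T xi (%w. cmv (a w) (Dv T xi (%w. 1 + P w) w)) w - rh * (1 + P (S 1 w))"
 have l0: "0 <= l" using lL by simp
 have lr: "l2 M ?r" by (intro l2_diff l2_add l2_mult l2_const l2_S P l2_Ds l2_cmv[OF a l0 L_pos] l2_Dv)
 have r0: "0 <= r" by (rule order_trans[OF nn_nonneg r])
 define ps where "ps n = (%w. rh ^ n * (1 + P (S (int n) w)))" for n
 have lps: "l2 M (ps n)" for n unfolding ps_def by (intro l2_mult l2_add l2_const l2_S P)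
 have step: "ps n w - Ds T xi (%w. cmv (a (S (int n) w)) (Dv T xi (ps n) w)) w = ps (Suc n) w + rh ^ n * ?r (S (int n) w)"
  if wa: "w : space M" for n w
 proof -
  have D: "Dv T xi (ps n) w' = rh ^ n *s Dv T xi (%w. 1 + P w) (S (int n) w')" if "w' : space M" for w'
  using that by (simp add: vec_eq_iff Dv_def ps_def dxi_def S_T algebra_simps)
  have cm: "cmv A (k *s F) = k *s cmv A F" for A :: "real^'d^'d" and k F
  by (simp add: cmv_def vec_eq_iff sum_distrib_left mult_ac)
  have "Ds T xi (%w. cmv (a (S (int n) w)) (Dv T xi (ps n) w)) w
  = Ds T xi (%w. rh ^ n *s cmv (a (S (int n) w)) (Dv T xi (%w. 1 + P w) (S (int n) w))) w"
  by (rule Ds_cong[OF _ wa]) (simp only: D cm)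
  also have "... = rh ^ n * Ds T xi (%w. cmv (a w) (Dv T xi (%w. 1 + P w) w)) (S (int n) w)"
  using wa by (simp add: Ds_def dxis_def S_T sum_distrib_left right_diff_distrib mult_ac)
  finally show ?thesis using S_plus[OF wa, of 1 "int n"] by (simp add: ps_def algebra_simps)
 qed
 have b: "nn M (%w. wd xi n w - ps n w) <= nn M P + r * (\<Sum>k<n. cmod rh ^ k)" for n
 proof (induction n)
  case 0
  have "nn M (%w. wd xi 0 w - ps 0 w) = nn M (%w. - P w)" by (rule nn_cong) (simp add: ps_def S_0)
  thus ?case by simp
 next
  case (Suc n)
  let ?y = "%w. wd xi n w - ps n w"
  have ly: "l2 M ?y" by (intro l2_diff l2_wd lps)
  let ?s = "%w. ?y w - Ds T xi (%w. cmv (a (S (int n) w)) (Dv T xi ?y w)) w"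
  have ls: "l2 M ?s" by (intro l2_diff ly l2_Ds l2_cmv[OF coeff_ok_S l0 L_pos] l2_Dv)
  have lrS: "l2 M (%w. rh ^ n * ?r (S (int n) w))" by (intro l2_mult l2_S[OF lr])
  have "nn M (%w. wd xi (Suc n) w - ps (Suc n) w) = nn M (%w. ?s w + rh ^ n * ?r (S (int n) w))"
  proof (rule nn_cong)
  fix w assume wa: "w : space M"
  have e: "rh ^ n * ?r (S (int n) w) = ps n w - Ds T xi (%w. cmv (a (S (int n) w)) (Dv T xi (ps n) w)) w - ps (Suc n) w"
  unfolding step[OF wa] by simp
  show "wd xi (Suc n) w - ps (Suc n) w = ?s w + rh ^ n * ?r (S (int n) w)"
  unfolding e by (simp add: Dv_diff cmv_diff Ds_diff)
  qed
  also have "... <= nn M ?s + nn M (%w. rh ^ n * ?r (S (int n) w))" by (rule nn_triangle[OF ls lrS])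
  also have "nn M ?s <= nn M ?y" using lL stab by (intro step_contraction[OF coeff_ok_S _ _ L_pos _ ly]) auto
  also have "nn M (%w. rh ^ n * ?r (S (int n) w)) = cmod rh ^ n * nn M ?r" unfolding nn_mult nn_S[OF lr] by (simp add: norm_power)
  also have "... <= cmod rh ^ n * r" by (intro mult_left_mono r) simp
  finally show ?case using Suc by (simp add: algebra_simps)
 qed
 have "cmod (expectation (wd xi n) - rh ^ n) = cmod (expectation (%w. wd xi n w - ps n w))"
 proof -
  have "expectation (ps n) = rh ^ n"
  unfolding ps_def using l2_integrable[OF l2_S[OF P(1), of "int n"]] mpres_integral[OF S_mpres l2_meas[OF P(1)], of "int n"] P(2)
  by (simp add: prob_space)
  thus ?thesis using l2_integrable[OF l2_wd, of xi n] l2_integrable[OF lps, of n] by simp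
 qed
 also have "... <= nn M (%w. wd xi n w - ps n w)" by (intro norm_expectation_le l2_diff l2_wd lps)
 also note b[of n]
 also have "nn M P + r * (\<Sum>k<n. cmod rh ^ k) <= nn M P + r * (1 / (1 - cmod rh))"
 proof -
  have "(\<Sum>k<n. cmod rh ^ k) = (1 - cmod rh ^ n) / (1 - cmod rh)" using rh by (simp add: sum_gp_strict)
  also have "... <= 1 / (1 - cmod rh)" using rh by (intro divide_right_mono) auto
  finally show ?thesis using r0 by (intro mult_left_mono add_left_mono)
 qed
 finally show ?thesis by simp
qed

text \<open>\<epsilon> is chosen before n: every error is measured against the spectral gap and not
  against elapsed time, so short and long times need no separate treatment.\<close>

lemma plane_wave_limit:
 assumes erg: "(EX j. ergodic_map M (T (ue j))) \<or> ergodic_map M (S 1)"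
  and ah: "is_ahom M T a (Phi_eq_disc M T S a) A" and ze: "ze ~= 0" and de: "0 < de"
 shows "\<forall>\<^sub>F ep in at_right 0. ALL n. cmod (expectation (wd (ep *. ze) n) - cr (exp (- (ep^2 * real n) * (ze \<bullet> (A *v ze))))) <= de"
proof -
 define mu where "mu = ze \<bullet> (A *v ze)"
 have "l * (norm ze)^2 <= 2 * mu" unfolding mu_def
  by (rule ahom_coercive[OF dense_disc[OF erg] a lL ah PhiEq_disc])
 moreover have "0 < l * (norm ze)^2" using lL ze by simp
 ultimately have mu: "0 < mu" by linarith
 \<comment> \<open>The factor in front of P in the residual is e^x - (1 - Q), of modulus at most
   (e^x - 1) + x mu + ka x, where e^x - 1 \<le> 3 x and ka \<le> mu.\<close>
 define R where "R = 3 + 2 * mu"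
 define Z where "Z = 1 + 2 * R / mu + 1 / mu"
 have Z: "0 < Z" using mu by (simp add: Z_def R_def add_pos_pos)
 define ka where "ka = min (mu / 4) (de / (2 * Z))"
 have ka: "0 < ka" "ka <= mu / 4" using mu Z de by (simp_all add: ka_def)
 have kaZ: "ka * Z <= de / 2"
 proof -
  have "ka * Z <= de / (2 * Z) * Z" using Z by (intro mult_right_mono) (auto simp: ka_def)
  thus ?thesis using Z by simp
 qed
 \<comment> \<open>8/25 is the step restriction of \<open>eigenvalue_power_bound\<close>; de / (8
   mu) keeps the passage from 1 - x mu to exp (- x mu) within de / 4.\<close>
 define m where "m = min 1 (min (8 / (25 * mu)) (de / (8 * mu)))"
 have m: "0 < m" using mu de by (simp add: m_def)
 have "\<forall>\<^sub>F ep in at_right (0::real). 0 < ep & ep^2 < m"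
 proof -
  have "((%ep::real. ep^2) \<longlongrightarrow> 0^2) (at_right 0)" by (intro tendsto_intros)
  hence "\<forall>\<^sub>F ep in at_right (0::real). ep^2 < m" by (rule order_tendstoD) (use m in simp)
  thus ?thesis using eventually_at_right_less[of "0::real"] by eventually_elim simp
 qed
 moreover have "\<forall>\<^sub>F ep in at_right 0. EX P Q. cell a (ep^2) (ep *. ze) P Q & nn M P <= ka &
  cmod (Q - cr (ep^2 * (ze \<bullet> (A *v ze)))) <= ka * ep^2"
  by (rule cell_small[OF dense_disc[OF erg] a lL ah PhiEq_disc ka(1)])
 ultimately show ?thesis
 proof eventually_elim
  case (elim ep)
  define x where "x = ep^2"
  obtain P Q where c: "cell a x (ep *. ze) P Q" and nP: "nn M P <= ka"
  and Q: "cmod (Q - cr (x * mu)) <= ka * x" using elim(2) unfolding mu_def x_def by blast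
  have x: "0 < x" "x < m" using elim by (auto simp: x_def)
  have xm: "x < 1" "x * mu <= 8 / 25" "x * mu * 8 < de" using x mu by (auto simp: m_def field_simps)
  have e1: "exp x - 1 <= 3 * x"
  proof -
  have "exp x * (1 + - x) <= exp x * exp (- x)" by (intro mult_left_mono exp_ge_add_one_self) simp
  hence "exp x - 1 <= exp x * x" by (simp add: exp_minus algebra_simps)
  also have "... <= 3 * x" using x xm exp_le order_trans[of "exp x" "exp 1" 3] by (intro mult_right_mono) auto
  finally show ?thesis .
  qed
  define B where "B = cmod (cr (exp x) - (1 - Q)) * nn M P"
  have "cmod (cr (exp x) - (1 - Q)) <= cmod (cr (exp x - 1 + x * mu)) + cmod (Q - cr (x * mu))"
  using norm_triangle_ineq[of "cr (exp x - 1 + x * mu)" "Q - cr (x * mu)"] by (simp add: algebra_simps)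
  also have "... <= (exp x - 1 + x * mu) + ka * x"
  unfolding norm_of_real using Q x mu by (intro add_mono) auto
  also have "... <= x * R"
  proof -
  have "ka * x <= mu * x" using ka mu x by (intro mult_right_mono) auto
  thus ?thesis using e1 by (simp add: R_def algebra_simps)
  qed
  finally have "B <= (x * R) * ka" unfolding B_def using nP x mu by (intro mult_mono) (auto simp: R_def)
  hence B: "0 <= B" "B <= 1 * (x * (ka * R))" by (simp_all add: B_def mult_ac)
  have E1: "cmod (expectation (wd (ep *. ze) n) - cr (1 - 1 * (x * mu)) ^ n) <= de / 2" for n
  proof (rule order_trans[OF _ kaZ], unfold Z_def, rule eigenvalue_power_bound[OF mu x(1) Q ka(2) zero_less_one _ _ B])
  show "1 * (x * mu) <= 8 / 25" using xm by simp
  define K where "K = Ds T (ep *. ze) (%w. cmv (a w) (ev (ep *. ze) + Dv T (ep *. ze) P w))"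
  have lP: "l2 M P" and EP: "expectation P = 0" and QK: "Q = expectation K"
  and ae: "AE w in M. - Pi0 M K w = cr (exp x) * P (S 1 w) - P w"
  using c by (auto simp: cell_def TmD_def K_def)
  have Dv1: "Dv T (ep *. ze) (%w. 1 + P w) w = ev (ep *. ze) + Dv T (ep *. ze) P w" for w
  by (simp add: vec_eq_iff dxi_def ev_def algebra_simps)
  have l0: "0 <= l" using lL by simp
  have lK: "l2 M K" unfolding K_def by (intro l2_Ds l2_cmv[OF a l0 L_pos] l2_add l2_const l2_Dv lP)
  let ?r = "%w. (1 + P w) - K w - (1 - Q) * (1 + P (S 1 w))"
  have "AE w in M. ?r w = (cr (exp x) - (1 - Q)) * P (S 1 w)"
  using ae
  proof eventually_elim
  case (elim w)
  hence "K w = Q - (cr (exp x) * P (S 1 w) - P w)" by (simp add: Pi0_def QK algebra_simps)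
  thus ?case by (simp add: algebra_simps)
  qed
  hence "nn M ?r = nn M (%w. (cr (exp x) - (1 - Q)) * P (S 1 w))"
  by (rule nn_cong_AE[rotated 2]) (rule l2_meas, intro l2_diff l2_mult l2_add l2_const lP lK l2_S[OF lP])+
  hence r: "nn M ?r <= B" unfolding nn_mult nn_S[OF lP] B_def by simp
  assume "cmod (1 - cr 1 * Q) < 1"
  hence "cmod (expectation (wd (ep *. ze) n) - (1 - Q) ^ n) <= nn M P + B / (1 - cmod (1 - Q))"
  by (intro wd_approx[OF lP EP]) (use r in \<open>simp_all add: Dv1 K_def\<close>)
  thus "cmod (expectation (wd (ep *. ze) n) - (1 - cr 1 * Q) ^ n) <= ka + B / (1 - cmod (1 - cr 1 * Q))"
  using nP by simp
  qed
  define s where "s = exp (- (x * mu))"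
  have q: "\<bar>s - (1 - x * mu)\<bar> <= (x * mu)^2" unfolding s_def using x xm mu by (intro exp_minus_le_quad) auto
  have s1: "s < 1" "0 <= s" using x mu by (auto simp: s_def)
  have "(x * mu)^2 <= x * mu * (1 / 2)"
  using x mu xm unfolding power2_eq_square by (intro mult_left_mono) auto
  hence s2: "x * mu / 2 <= 1 - s" using q by linarith
  have "cmod (cr (1 - x * mu) - cr s) <= (x * mu) * (de / 8)"
  proof -
  have "(x * mu)^2 <= (x * mu) * (de / 8)" unfolding power2_eq_square using x mu xm by (intro mult_left_mono) auto
  thus ?thesis using q unfolding of_real_diff[symmetric] norm_of_real by linarith
  qed
  also have "... = de / 4 * (x * mu / 2)" by simp
  also have "... <= de / 4 * (1 - s)" using s2 de by (intro mult_left_mono) auto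
  finally have "cmod (cr (1 - x * mu) - cr s) / (1 - s) <= de / 4" using s1 by (simp add: pos_divide_le_eq)
  moreover have "cmod (cr (1 - x * mu)) <= 1" unfolding norm_of_real using x mu xm by simp
  ultimately have E2: "cmod (cr (1 - x * mu) ^ n - cr s ^ n) <= de / 4" for n
  using power_diff_bound[of "cr (1 - x * mu)" s n] s1 by linarith
  have s3: "cr s ^ n = cr (exp (- (ep^2 * real n) * mu))" for n
  unfolding s_def of_real_power[symmetric] exp_of_nat_mult[symmetric] by (simp add: x_def mult_ac)
  show ?case
  proof
  fix n
  have "cmod (expectation (wd (ep *. ze) n) - cr s ^ n) <= de / 2 + de / 4"
  using norm_triangle_ineq[of "expectation (wd (ep *. ze) n) - cr (1 - x * mu) ^ n" "cr (1 - x * mu) ^ n - cr s ^ n"] E1[of n] E2[of n] by simp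
  thus "cmod (expectation (wd (ep *. ze) n) - cr (exp (- (ep^2 * real n) * (ze \<bullet> (A *v ze))))) <= de"
  using de unfolding s3 mu_def by simp
  qed
 qed
qed

end

section \<open>Integration over time and strong continuity of the flow\<close>

lemma translation_L1:
 fixes \<gamma> :: "real => real"
 assumes [measurable]: "\<gamma> : borel_measurable borel" and K: "!!x. \<bar>\<gamma> x\<bar> <= K"
  and h: "h \<longlonglongrightarrow> 0"
 shows "(%n. \<integral>r. indicator {0..1} r * \<bar>\<gamma> (r + h n) - \<gamma> r\<bar> \<partial>lborel) \<longlonglongrightarrow> 0"
proof -
 have K0: "0 <= K" using K[of 0] by linarith
 have "\<gamma> : borel_measurable lebesgue" using measurable_completion[of \<gamma> lborel borel] by simp
 hence "\<gamma> measurable_on UNIV"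
  by (rule lebesgue_measurable_imp_measurable_on) auto
 then obtain N g where N: "negligible N" and g: "!!n. continuous_on UNIV (g n)" "!!x. x \<notin> N ==> (%n. g n x) \<longlonglongrightarrow> \<gamma> x"
  by (auto simp: measurable_on_def)
 \<comment> \<open>Almost everywhere \<gamma> is a limit of continuous functions; clipping them to
   [-K, K] supplies a dominating function. The window [-1, 2] used below contains every translate of
   [0, 1] by less than 1.\<close>
 define c where "c n x = max (- K) (min K (g n x))" for n and x :: real
 have cc: "continuous_on UNIV (c n)" for n unfolding c_def by (intro continuous_intros g)
 have [measurable]: "c n : borel_measurable borel" for n by (rule borel_measurable_continuous_onI[OF cc])
 have cb: "\<bar>c n x\<bar> <= K" for n x using K0 by (auto simp: c_def)
 have iI: "integrable lborel (%r::real. indicator {-1..2} r * (C::real))" for C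
  by (intro integrable_mult_left) simp
 have iI1: "integrable lborel (%r::real. indicator {0..1} r * (C::real))" for C
  by (intro integrable_mult_left) simp
 have b1: "indicator {-1..2} r * \<bar>\<gamma> r - c n r\<bar> <= indicator {-1..2} r * (2 * K)" for n r
  using K[of r] cb[of n r] by (auto simp: indicator_def abs_le_iff)
 have i1: "integrable lborel (%r. indicator {-1..2} r * \<bar>\<gamma> r - c n r\<bar>)" for n
  by (rule Bochner_Integration.integrable_bound[OF iI[of "2 * K"]]) (use b1 K0 in \<open>auto simp: indicator_def split: if_splits\<close>)
 have "(%n. \<integral>r. indicator {-1..2} r * \<bar>\<gamma> r - c n r\<bar> \<partial>lborel) \<longlonglongrightarrow> (\<integral>r. 0 \<partial>(lborel :: real measure))"
 proof (rule integral_dominated_convergence[OF _ _ iI[of "2 * K"]])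
  have "AE x in lborel. x \<notin> N"
  using AE_not_in[OF N[unfolded negligible_iff_null_sets]] unfolding AE_completion_iff .
  thus "AE x in lborel. (%n. indicator {-1..2} x * \<bar>\<gamma> x - c n x\<bar>) \<longlonglongrightarrow> 0"
  proof eventually_elim
  case (elim x)
  have "(%n. c n x) \<longlonglongrightarrow> max (- K) (min K (\<gamma> x))" unfolding c_def by (intro tendsto_intros g elim)
  also have "max (- K) (min K (\<gamma> x)) = \<gamma> x" using K[of x] by (auto simp: abs_le_iff)
  finally have "(%n. indicator {-1..2} x * \<bar>\<gamma> x - c n x\<bar>) \<longlonglongrightarrow> indicator {-1..2} x * \<bar>\<gamma> x - \<gamma> x\<bar>"
  by (intro tendsto_intros)
  thus ?case by simp
  qed
 qed (use b1 in \<open>auto simp: indicator_def split: if_splits\<close>)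
 hence lim1: "(%n. \<integral>r. indicator {-1..2} r * \<bar>\<gamma> r - c n r\<bar> \<partial>lborel) \<longlonglongrightarrow> 0" by simp
 show ?thesis
 proof (rule LIMSEQ_I)
  fix e :: real assume e: "0 < e"
  obtain m where m: "(\<integral>r. indicator {-1..2} r * \<bar>\<gamma> r - c m r\<bar> \<partial>lborel) < e / 3"
  using order_tendstoD(2)[OF lim1, of "e / 3"] e by (auto simp: eventually_sequentially)
  have bc: "indicator {0..1} r * \<bar>c m (r + t) - c m r\<bar> <= indicator {0..1} r * (2 * K)" for r t
  using cb[of m r] cb[of m "r + t"] by (auto simp: indicator_def abs_le_iff)
  have "(%n. \<integral>r. indicator {0..1} r * \<bar>c m (r + h n) - c m r\<bar> \<partial>lborel) \<longlonglongrightarrow> (\<integral>r. 0 \<partial>(lborel :: real measure))"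
  proof (rule integral_dominated_convergence[OF _ _ iI1[of "2 * K"]])
  show "AE x in lborel. (%n. indicator {0..1} x * \<bar>c m (x + h n) - c m x\<bar>) \<longlonglongrightarrow> 0"
  proof (rule AE_I2)
  fix x :: real
  have "(%n. c m (x + h n)) \<longlonglongrightarrow> c m (x + 0)"
  by (rule continuous_on_tendsto_compose[OF cc tendsto_add[OF tendsto_const h]]) auto
  hence "(%n. indicator {0..1} x * \<bar>c m (x + h n) - c m x\<bar>) \<longlonglongrightarrow> indicator {0..1} x * \<bar>c m (x + 0) - c m x\<bar>"
  by (intro tendsto_intros)
  thus "(%n. indicator {0..1} x * \<bar>c m (x + h n) - c m x\<bar>) \<longlonglongrightarrow> 0" by simp
  qed
  qed (use bc in \<open>auto simp: indicator_def split: if_splits\<close>)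
  hence "(%n. \<integral>r. indicator {0..1} r * \<bar>c m (r + h n) - c m r\<bar> \<partial>lborel) \<longlonglongrightarrow> 0" by simp
  hence "\<forall>\<^sub>F n in sequentially. (\<integral>r. indicator {0..1} r * \<bar>c m (r + h n) - c m r\<bar> \<partial>lborel) < e / 3"
  by (rule order_tendstoD) (use e in simp)
  moreover have "\<forall>\<^sub>F n in sequentially. \<bar>h n\<bar> < 1" using tendstoD[OF h, of 1] by simp
  ultimately have "\<forall>\<^sub>F n in sequentially. (\<integral>r. indicator {0..1} r * \<bar>\<gamma> (r + h n) - \<gamma> r\<bar> \<partial>lborel) < e"
  proof eventually_elim
  case (elim n)
  let ?G = "%r. indicator {-1..2} r * \<bar>\<gamma> r - c m r\<bar>"
  let ?C = "%r. indicator {0..1} r * \<bar>c m (r + h n) - c m r\<bar>"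
  have iG: "integrable lborel (%r. ?G (h n + 1 * r))" using lborel_integrable_real_affine[OF i1[of m], of 1 "h n"] by simp
  have eG: "(\<integral>r. ?G (h n + 1 * r) \<partial>lborel) = (\<integral>r. ?G r \<partial>lborel)"
  using lborel_integral_real_affine[of 1 ?G "h n"] by simp
  have iC: "integrable lborel ?C"
  by (rule Bochner_Integration.integrable_bound[OF iI1[of "2 * K"]]) (use bc K0 in \<open>auto simp: indicator_def split: if_splits\<close>)
  have "(\<integral>r. indicator {0..1} r * \<bar>\<gamma> (r + h n) - \<gamma> r\<bar> \<partial>lborel) <= (\<integral>r. ?G (h n + 1 * r) + ?C r + ?G r \<partial>lborel)"
  proof (rule integral_mono')
  show "integrable lborel (%r. ?G (h n + 1 * r) + ?C r + ?G r)" by (intro Bochner_Integration.integrable_add iG iC i1)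
  show "indicator {0..1} r * \<bar>\<gamma> (r + h n) - \<gamma> r\<bar> <= ?G (h n + 1 * r) + ?C r + ?G r" for r
  using elim(2) by (auto simp: indicator_def add.commute)
  qed (auto simp: indicator_def)
  also have "... = (\<integral>r. ?G r \<partial>lborel) + (\<integral>r. ?C r \<partial>lborel) + (\<integral>r. ?G r \<partial>lborel)"
  using eG iG iC i1[of m] by simp
  finally show ?case using m elim(1) by linarith
  qed
  then obtain n0 where n0: "!!n. n >= n0 ==> (\<integral>r. indicator {0..1} r * \<bar>\<gamma> (r + h n) - \<gamma> r\<bar> \<partial>lborel) < e"
  by (auto simp: eventually_sequentially)
  have "0 <= (\<integral>r. indicator {0..1} r * \<bar>\<gamma> (r + h n) - \<gamma> r\<bar> \<partial>lborel)" for n by (rule integral_nonneg_AE) simp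
  thus "EX no. ALL n>=no. norm ((\<integral>r. indicator {0..1} r * \<bar>\<gamma> (r + h n) - \<gamma> r\<bar> \<partial>lborel) - 0) < e"
  using n0 by (intro exI[of _ n0]) simp
 qed
qed

context prob_space
begin

text \<open>Cauchy-Schwarz in s for fixed w, then Tonelli. The measure is kept abstract because both
  intervals and the exponential law are inserted for it.\<close>

lemma minkowski_integral:
 fixes F :: "real => 'a => complex"
 assumes fm: "finite_measure mu" and sb: "sets mu = sets borel"
  and F: "(%x. F (fst x) (snd x)) : borel_measurable (borel \<Otimes>\<^sub>M M)"
  and l: "!!s. l2 M (F s)" and C: "AE s in mu. nn M (F s) <= C" "0 <= C"
 shows "l2 M (%w. \<integral>s. F s w \<partial>mu)" "nn M (%w. \<integral>s. F s w \<partial>mu) <= measure mu UNIV * C"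
  "AE w in M. integrable mu (%s. F s w)"
proof -
 interpret mu: finite_measure mu by (rule fm)
 interpret pair_sigma_finite mu M by standard
 have sp: "space mu = UNIV" using sets_eq_imp_space_eq[OF sb] by simp
 have F'[measurable]: "(%x. F (fst x) (snd x)) : borel_measurable (mu \<Otimes>\<^sub>M M)"
  using F by (simp add: sb cong: measurable_cong_sets sets_pair_measure_cong)
 have F2[measurable]: "(%x. F (snd x) (fst x)) : borel_measurable (M \<Otimes>\<^sub>M mu)"
  using measurable_compose[OF measurable_pair_swap' F'] by (simp add: case_prod_beta)
 have Fw[measurable]: "(%s. F s w) : borel_measurable mu" if "w : space M" for w
  using measurable_compose[OF measurable_Pair1'[OF that] F2] by simp
 have m: "(%w. \<integral>s. F s w \<partial>mu) : borel_measurable M"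
  using mu.borel_measurable_lebesgue_integral[of "%w s. F s w" M] F2 by (simp add: case_prod_beta)
 define J where "J w = (\<integral>\<^sup>+s. ennreal ((cmod (F s w))^2) \<partial>mu)" for w
 have [measurable]: "J : borel_measurable M" unfolding J_def
  using mu.borel_measurable_nn_integral[of "%w s. ennreal ((cmod (F s w))^2)" M] by simp
 have "(\<integral>\<^sup>+w. J w \<partial>M) = (\<integral>\<^sup>+s. \<integral>\<^sup>+w. ennreal ((cmod (F s w))^2) \<partial>M \<partial>mu)"
  unfolding J_def using Fubini'[of "%s w. ennreal ((cmod (F s w))^2)"] by (simp add: case_prod_beta)
 also have "... <= (\<integral>\<^sup>+s. ennreal (C^2) \<partial>mu)"
 proof (rule nn_integral_mono_AE)
  show "AE s in mu. (\<integral>\<^sup>+w. ennreal ((cmod (F s w))^2) \<partial>M) <= ennreal (C^2)" using C(1)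
  proof eventually_elim
  case (elim s)
  have "(\<integral>\<^sup>+w. ennreal ((cmod (F s w))^2) \<partial>M) = ennreal ((nn M (F s))^2)"
  unfolding nn_sq using l[of s] by (intro nn_integral_eq_integral) (auto simp: l2_def)
  also have "... <= ennreal (C^2)" using elim by (intro ennreal_leI power_mono) auto
  finally show ?case .
  qed
 qed
 also have "... = ennreal (C^2 * measure mu UNIV)" by (simp add: sp mu.emeasure_eq_measure ennreal_mult)
 finally have J: "(\<integral>\<^sup>+w. J w \<partial>M) <= ennreal (C^2 * measure mu UNIV)" .
 hence Jfin: "AE w in M. J w ~= \<infinity>"
  by (intro nn_integral_PInf_AE) (auto simp: top_unique)
 have pt: "integrable mu (%s. F s w) & ennreal ((cmod (\<integral>s. F s w \<partial>mu))^2) <= ennreal (measure mu UNIV) * J w"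
  if wa: "w : space M" and fin: "J w ~= \<infinity>" for w
 proof -
  note [measurable] = Fw[OF wa]
  have i2: "integrable mu (%s. (cmod (F s w))^2)"
  using fin unfolding J_def by (intro integrableI_bounded) (auto simp: less_top)
  have l1: "l2 mu (%s. cmod (F s w))" "l2 mu (%s. 1 :: real)" using i2 by (auto simp: l2_def)
  have in1: "integrable mu (%s. cmod (F s w))" using integrable_ip[OF l1] by simp
  hence in2: "integrable mu (%s. F s w)" by (simp add: integrable_norm_iff)
  have "cmod (\<integral>s. F s w \<partial>mu) <= (\<integral>s. cmod (F s w) \<partial>mu)" by (rule integral_norm_bound)
  also have "... = ip mu (%s. cmod (F s w)) (%s. 1)" by (simp add: ip_def)
  also have "... <= nn mu (%s. cmod (F s w)) * nn mu (%s. 1 :: real)" using ip_le[OF l1] by linarith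
  finally have "(cmod (\<integral>s. F s w \<partial>mu))^2 <= (nn mu (%s. cmod (F s w)) * nn mu (%s. 1 :: real))^2" by (intro power_mono) auto
  also have "... = measure mu UNIV * (\<integral>s. (cmod (F s w))^2 \<partial>mu)" by (simp add: power_mult_distrib nn_sq sp)
  finally have "ennreal ((cmod (\<integral>s. F s w \<partial>mu))^2) <= ennreal (measure mu UNIV * (\<integral>s. (cmod (F s w))^2 \<partial>mu))" by (rule ennreal_leI)
  also have "... = ennreal (measure mu UNIV) * J w"
  unfolding J_def using i2 by (simp add: ennreal_mult nn_integral_eq_integral)
  finally show ?thesis using in2 by simp
 qed
 show "AE w in M. integrable mu (%s. F s w)" using Jfin AE_space by eventually_elim (use pt in auto)
 have "(\<integral>\<^sup>+w. ennreal ((cmod (\<integral>s. F s w \<partial>mu))^2) \<partial>M) <= (\<integral>\<^sup>+w. ennreal (measure mu UNIV) * J w \<partial>M)"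
  by (rule nn_integral_mono_AE) (use Jfin AE_space in eventually_elim, use pt in auto)
 also have "... = ennreal (measure mu UNIV) * (\<integral>\<^sup>+w. J w \<partial>M)" by (rule nn_integral_cmult) measurable
 also have "... <= ennreal (measure mu UNIV) * ennreal (C^2 * measure mu UNIV)" using J by (intro mult_left_mono) auto
 also have "... = ennreal (measure mu UNIV * (C^2 * measure mu UNIV))" by (rule ennreal_mult'[symmetric]) simp
 also have "... = ennreal ((measure mu UNIV * C)^2)" by (simp add: power2_eq_square mult_ac)
 finally have nI: "(\<integral>\<^sup>+w. ennreal ((cmod (\<integral>s. F s w \<partial>mu))^2) \<partial>M) <= ennreal ((measure mu UNIV * C)^2)" .
 thus l2I: "l2 M (%w. \<integral>s. F s w \<partial>mu)"
  unfolding l2_def using m by (auto intro!: integrableI_bounded le_less_trans[OF nI])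
 have "ennreal ((nn M (%w. \<integral>s. F s w \<partial>mu))^2) <= ennreal ((measure mu UNIV * C)^2)"
  unfolding nn_sq using nI l2I by (subst nn_integral_eq_integral[symmetric]) (auto simp: l2_def)
 hence "(nn M (%w. \<integral>s. F s w \<partial>mu))^2 <= (measure mu UNIV * C)^2" by simp
 thus "nn M (%w. \<integral>s. F s w \<partial>mu) <= measure mu UNIV * C"
  by (rule power2_le_imp_le) (use C(2) in simp)
qed

lemma clip_approx:
 fixes f :: "'a => real"
 assumes f: "l2 M f"
 shows "(%k. nn M (%w. f w - max (- real k) (min (real k) (f w)))) \<longlonglongrightarrow> 0"
proof -
 have [measurable]: "f : borel_measurable M" using f by (rule l2_meas)
 have "(%k. \<integral>w. (norm (f w - max (- real k) (min (real k) (f w))))^2 \<partial>M) \<longlonglongrightarrow> (\<integral>w. 0 \<partial>M)"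
 proof (rule integral_dominated_convergence[OF _ _ l2_sq[OF f]])
  show "AE w in M. (%k. (norm (f w - max (- real k) (min (real k) (f w))))^2) \<longlonglongrightarrow> 0"
  proof (rule AE_I2)
  fix w
  obtain k0 where k0: "\<bar>f w\<bar> <= real k0" using real_arch_simple by blast
  have "\<forall>\<^sub>F k in sequentially. (norm (f w - max (- real k) (min (real k) (f w))))^2 = 0"
  proof (rule eventually_sequentiallyI[of k0])
  fix k assume "k0 <= k"
  hence "\<bar>f w\<bar> <= real k" using k0 by simp
  thus "(norm (f w - max (- real k) (min (real k) (f w))))^2 = 0" by (simp add: abs_le_iff)
  qed
  thus "(%k. (norm (f w - max (- real k) (min (real k) (f w))))^2) \<longlonglongrightarrow> 0" by (rule tendsto_eventually)
  qed
  show "AE w in M. norm ((norm (f w - max (- real k) (min (real k) (f w))))^2) <= (norm (f w))^2" for k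
  by (rule AE_I2) (auto simp: max_def min_def abs_le_square_iff[symmetric])
 qed auto
 hence "(%k. sqrt (\<integral>w. (norm (f w - max (- real k) (min (real k) (f w))))^2 \<partial>M)) \<longlonglongrightarrow> sqrt 0" by (intro tendsto_intros) simp
 thus ?thesis by (simp add: nn_def)
qed

end

text \<open>Lebesgue measure on an interval, as a finite measure on the whole line to which
  \<open>minkowski_integral\<close> applies.\<close>

definition iv :: "real => real => real measure" where
 "iv a b = density lborel (%s. ennreal (indicator {a..b} s))"

lemma sets_iv [simp]: "sets (iv a b) = sets borel" and space_iv [simp]: "space (iv a b) = UNIV"
 by (simp_all add: iv_def)

lemma measure_iv: "a <= b ==> measure (iv a b) UNIV = b - a"
proof -
 assume "a <= b"
 have "emeasure (iv a b) UNIV = (\<integral>\<^sup>+s. indicator {a..b} s \<partial>lborel)"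
  unfolding iv_def by (subst emeasure_density) (simp_all add: ennreal_indicator)
 also have "... = ennreal (b - a)" using \<open>a <= b\<close> by simp
 finally show ?thesis using \<open>a <= b\<close> by (simp add: measure_def)
qed

lemma finite_measure_iv: "finite_measure (iv a b)"
proof
 have "emeasure (iv a b) UNIV = (\<integral>\<^sup>+s. indicator {a..b} s \<partial>lborel)"
  unfolding iv_def by (subst emeasure_density) (simp_all add: ennreal_indicator)
 thus "emeasure (iv a b) (space (iv a b)) ~= \<infinity>" by (simp add: emeasure_lborel_Icc_eq)
qed

lemma AE_iv: "(!!s. a <= s ==> s <= b ==> P s) ==> AE s in iv a b. P s"
 unfolding iv_def by (subst AE_density) (auto simp: indicator_def intro!: AE_I2)

lemma integral_iv: "f : borel_measurable borel ==> (\<integral>s. f s \<partial>iv a b) = (\<integral>s. indicator {a..b} s *. f s \<partial>lborel)"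
 for f :: "real => complex"
 unfolding iv_def by (subst integral_density) auto

lemma integrable_iv: "f : borel_measurable borel ==> integrable (iv a b) f \<longleftrightarrow> integrable lborel (%s. indicator {a..b} s *. f s)"
 for f :: "real => complex"
 unfolding iv_def by (subst integrable_density) auto

locale cont = environment M T S a l L for M :: "'w measure" and T :: "int^'d::finite => 'w => 'w"
  and S :: "real => 'w => 'w" and a l L +
 assumes S_joint: "(%(t, w). S t w) : measurable (lborel \<Otimes>\<^sub>M M) M"
begin

lemma S_joint' [measurable]: "(%x. S (fst x) (snd x)) : measurable (borel \<Otimes>\<^sub>M M) M"
 using S_joint by (simp add: case_prod_beta cong: measurable_cong_sets sets_pair_measure_cong)

lemma S_joint2 [measurable (raw)]: "f : borel_measurable N ==> g : measurable N M ==> (%x. S (f x) (g x)) : measurable N M"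
 using measurable_compose[OF measurable_Pair[of f N borel g M] S_joint'] by simp

lemma S_minus [simp]: "w : space M ==> S (- t) (S t w) = w" "w : space M ==> S t (S (- t) w) = w"
 using S_plus[of w "- t" t] S_plus[of w t "- t"] S_0 by auto

text \<open>Joint measurability is the only regularity of the flow in time. By invariance the L1
  modulus \<open>e n\<close> is the same along the orbit at every time r, hence equals the
  expectation of its average \<open>X n\<close> over r in [0, 1]. On each orbit
  \<open>translation_L1\<close> applies, and dominated convergence returns to M. Boundedness then
  passes from L1 to L2.\<close>

lemma strong_cont_bounded:
 fixes f :: "'w => real"
 assumes [measurable]: "f : borel_measurable M" and K: "!!w. \<bar>f w\<bar> <= K" and h: "h \<longlonglongrightarrow> 0"
 shows "(%n. nn M (%w. f (S (h n) w) - f w)) \<longlonglongrightarrow> 0"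
proof -
 interpret pair_sigma_finite lborel M by standard
 have K0: "0 <= K" using K[of undefined] by linarith
 define X where "X n w = (\<integral>r. indicator {0..1} r * \<bar>f (S (r + h n) w) - f (S r w)\<bar> \<partial>lborel)" for n w
 define e where "e n = (\<integral>w. \<bar>f (S (h n) w) - f w\<bar> \<partial>M)" for n
 have bd: "\<bar>f w - f w'\<bar> <= 2 * K" for w w' using K[of w] K[of w'] by (simp add: abs_le_iff)
 have eM: "(\<integral>w. \<bar>f (S (r + h n) w) - f (S r w)\<bar> \<partial>M) = e n" for r n
 proof -
  have "(\<integral>w. \<bar>f (S (r + h n) w) - f (S r w)\<bar> \<partial>M) = (\<integral>w. \<bar>f (S (h n) (S r w)) - f (S r w)\<bar> \<partial>M)"
  by (intro Bochner_Integration.integral_cong) (auto simp: S_plus add.commute[of r])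
  also have "... = e n" unfolding e_def using mpres_integral[OF S_mpres, of "%w. \<bar>f (S (h n) w) - f w\<bar>" r] by simp
  finally show ?thesis .
 qed
 have meas: "(%x. indicator {0..1} (fst x) * \<bar>f (S (fst x + h n) (snd x)) - f (S (fst x) (snd x))\<bar>) : borel_measurable (lborel \<Otimes>\<^sub>M M)" for n
  by measurable
 have ib: "integrable M (%w. \<bar>f (S (r + h n) w) - f (S r w)\<bar>)" for r n
  by (rule integrable_const_bound[of _ "2 * K"]) (use bd in auto)
 have eX: "e n = (\<integral>w. X n w \<partial>M)" for n
 proof -
  have "integrable (lborel \<Otimes>\<^sub>M M) (%(r, w). indicator {0..1} r * \<bar>f (S (r + h n) w) - f (S r w)\<bar>)"
  proof (rule Fubini_integrable)
  show "(%(r, w). indicator {0..1} r * \<bar>f (S (r + h n) w) - f (S r w)\<bar>) : borel_measurable (lborel \<Otimes>\<^sub>M M)"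
  using meas[of n] by (simp add: case_prod_beta)
  show "integrable lborel (%x. \<integral>y. norm (case (x, y) of (r, w) => indicator {0..1} r * \<bar>f (S (r + h n) w) - f (S r w)\<bar>) \<partial>M)"
  by (simp add: abs_mult eM)
  show "AE x in lborel. integrable M (%y. case (x, y) of (r, w) => indicator {0..1} r * \<bar>f (S (r + h n) w) - f (S r w)\<bar>)"
  by (rule AE_I2) (simp add: ib)
  qed
  from Fubini_integral[OF this] show ?thesis by (simp add: X_def eM)
 qed
 have "(%n. \<integral>w. X n w \<partial>M) \<longlonglongrightarrow> (\<integral>w. 0 \<partial>M)"
 proof (rule integral_dominated_convergence[where w = "%_. 2 * K"])
  show "X n : borel_measurable M" for n
  unfolding X_def
  using lborel.borel_measurable_lebesgue_integral[of "%w r. indicator {0..1} r * \<bar>f (S (r + h n) w) - f (S r w)\<bar>" M] by simp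
  show "AE w in M. (%n. X n w) \<longlonglongrightarrow> 0"
  proof (rule AE_I2)
  fix w assume wa: "w : space M"
  have "(%r. f (S r w)) : borel_measurable borel" using wa by measurable
  from translation_L1[OF this K h] show "(%n. X n w) \<longlonglongrightarrow> 0" by (simp add: X_def)
  qed
  show "AE w in M. norm (X n w) <= 2 * K" for n
  proof (rule AE_I2)
  fix w
  have i: "integrable lborel (%r::real. indicator {0..1} r * (2 * K))" by (intro integrable_mult_left) simp
  have "X n w <= (\<integral>r. indicator {0..1} r * (2 * K) \<partial>(lborel :: real measure))"
  unfolding X_def by (rule integral_mono'[OF i]) (use K0 in \<open>auto simp: indicator_def bd\<close>)
  moreover have "0 <= X n w" unfolding X_def by (rule integral_nonneg_AE) simp
  ultimately show "norm (X n w) <= 2 * K" by simp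
  qed
 qed auto
 hence e0: "e \<longlonglongrightarrow> 0" by (simp add: eX[symmetric])
 have "nn M (%w. f (S (h n) w) - f w) <= sqrt (2 * K * e n)" for n
  unfolding nn_def e_def integral_mult_right_zero[symmetric]
 proof (rule real_sqrt_le_mono, rule integral_mono')
  show "integrable M (%w. 2 * K * \<bar>f (S (h n) w) - f w\<bar>)"
  by (rule integrable_mult_right, rule integrable_const_bound[of _ "2 * K"]) (use bd in auto)
  show "(norm (f (S (h n) w) - f w))^2 <= 2 * K * \<bar>f (S (h n) w) - f w\<bar>" for w
  using mult_right_mono[OF bd[of "S (h n) w" w] abs_ge_zero[of "f (S (h n) w) - f w"]]
  by (simp only: power2_eq_square real_norm_def)
 qed (use K0 in auto)
 hence ev: "\<forall>\<^sub>F n in sequentially. nn M (%w. f (S (h n) w) - f w) <= sqrt (2 * K * e n)" by simp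
 have "(%n. sqrt (2 * K * e n)) \<longlonglongrightarrow> sqrt (2 * K * 0)" by (intro tendsto_intros e0)
 hence lim: "(%n. sqrt (2 * K * e n)) \<longlonglongrightarrow> 0" by simp
 show ?thesis by (rule tendsto_sandwich[OF _ ev tendsto_const lim]) simp
qed

lemma strong_cont_real:
 fixes f :: "'w => real"
 assumes f: "l2 M f" and h: "h \<longlonglongrightarrow> 0"
 shows "(%n. nn M (%w. f (S (h n) w) - f w)) \<longlonglongrightarrow> 0"
proof (rule LIMSEQ_I)
 fix e :: real assume e: "0 < e"
 have [measurable]: "f : borel_measurable M" using f by (rule l2_meas)
 obtain k where k: "nn M (%w. f w - max (- real k) (min (real k) (f w))) < e / 3"
  using order_tendstoD(2)[OF clip_approx[OF f], of "e / 3"] e by (auto simp: eventually_sequentially)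
 define g where "g = (%w. max (- real k) (min (real k) (f w)))"
 have k': "nn M (%w. f w - g w) < e / 3" using k by (simp add: g_def)
 have gm: "g : borel_measurable M" unfolding g_def by measurable
 have gb: "\<bar>g w\<bar> <= real k" for w by (auto simp: g_def)
 have lg: "l2 M g" by (rule nn_bounded(1)[OF gm]) (use gb in auto)
 have "\<forall>\<^sub>F n in sequentially. nn M (%w. g (S (h n) w) - g w) < e / 3"
  by (rule order_tendstoD(2)[OF strong_cont_bounded[OF gm gb h]]) (use e in simp)
 then obtain n0 where n0: "!!n. n >= n0 ==> nn M (%w. g (S (h n) w) - g w) < e / 3" by (auto simp: eventually_sequentially)
 show "EX no. ALL n>=no. norm (nn M (%w. f (S (h n) w) - f w) - 0) < e"
 proof (intro exI[of _ n0] allI impI)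
  fix n assume "n0 <= n"
  have l: "l2 M (%w. f (S (h n) w))" "l2 M (%w. g (S (h n) w))" by (intro l2_S f lg)+
  have "nn M (%w. f (S (h n) w) - g (S (h n) w)) = nn M (%w. f w - g w)" by (rule nn_S[OF l2_diff[OF f lg]])
  hence "nn M (%w. f (S (h n) w) - f w) < e"
  using nn_triangle3[OF l(1) l(2) f] nn_triangle3[OF l(2) lg f] k' n0[OF \<open>n0 <= n\<close>] nn_minus_commute[of M f g]
  by linarith
  thus "norm (nn M (%w. f (S (h n) w) - f w) - 0) < e" by simp
 qed
qed

lemma strong_cont:
 fixes f :: "'w => complex"
 assumes f: "l2 M f" and ka: "0 < ka"
 obtains de where "0 < de" "!!t. \<bar>t\<bar> <= de ==> nn M (%w. f (S t w) - f w) <= ka"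
proof -
 have [measurable]: "f : borel_measurable M" using f by (rule l2_meas)
 have lR: "l2 M (%w. Re (f w))" by (rule l2_bound[OF f, where C = 1]) (auto simp: abs_Re_le_cmod)
 have lI: "l2 M (%w. Im (f w))" by (rule l2_bound[OF f, where C = 1]) (auto simp: abs_Im_le_cmod)
 have seq: "(%n. nn M (%w. f (S (h n) w) - f w)) \<longlonglongrightarrow> 0" if h: "h \<longlonglongrightarrow> 0" for h
 proof (rule tendsto_sandwich[of "%_. 0", OF _ _ tendsto_const])
  have "(%n. nn M (%w. Re (f (S (h n) w)) - Re (f w)) + nn M (%w. Im (f (S (h n) w)) - Im (f w))) \<longlonglongrightarrow> 0 + 0"
  by (intro tendsto_add strong_cont_real lR lI h)
  thus "(%n. nn M (%w. Re (f (S (h n) w)) - Re (f w)) + nn M (%w. Im (f (S (h n) w)) - Im (f w))) \<longlonglongrightarrow> 0" by simp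
  have "nn M (%w. f (S (h n) w) - f w) <= nn M (%w. Re (f (S (h n) w)) - Re (f w)) + nn M (%w. Im (f (S (h n) w)) - Im (f w))" for n
  proof -
  have l1: "l2 M (%w. Re (f (S (h n) w)) - Re (f w))" "l2 M (%w. Im (f (S (h n) w)) - Im (f w))"
  using l2_S[OF lR] l2_S[OF lI] lR lI by auto
  have "(nn M (%w. f (S (h n) w) - f w))^2 = (nn M (%w. Re (f (S (h n) w)) - Re (f w)))^2 + (nn M (%w. Im (f (S (h n) w)) - Im (f w)))^2"
  unfolding nn_sq using l2_sq[OF l1(1)] l2_sq[OF l1(2)] by (simp add: cmod_power2)
  also have "... <= (nn M (%w. Re (f (S (h n) w)) - Re (f w)) + nn M (%w. Im (f (S (h n) w)) - Im (f w)))^2"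
  by (simp add: power2_sum)
  finally show ?thesis by (rule power2_le_imp_le) simp
  qed
  thus "\<forall>\<^sub>F n in sequentially. nn M (%w. f (S (h n) w) - f w) <= nn M (%w. Re (f (S (h n) w)) - Re (f w)) + nn M (%w. Im (f (S (h n) w)) - Im (f w))"
  by (intro always_eventually) auto
 qed simp
 have "((%t. nn M (%w. f (S t w) - f w)) \<longlongrightarrow> 0) (at 0)"
  unfolding tendsto_at_iff_sequentially o_def using seq by blast
 hence "\<forall>\<^sub>F t in at 0. nn M (%w. f (S t w) - f w) < ka" by (rule order_tendstoD) (rule ka)
 then obtain d where d: "0 < d" "!!t. t ~= 0 ==> \<bar>t\<bar> < d ==> nn M (%w. f (S t w) - f w) < ka"
  by (auto simp: eventually_at dist_norm)
 have z: "nn M (%w. f (S 0 w) - f w) = nn M (%w. 0 :: complex)" by (rule nn_cong) (simp add: S_0)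
 show ?thesis
 proof (rule that[of "d / 2"])
  show "0 < d / 2" using d by simp
  show "nn M (%w. f (S t w) - f w) <= ka" if "\<bar>t\<bar> <= d / 2" for t
  using d(1) d(2)[of t] that z ka by (cases "t = 0") (auto intro: less_imp_le)
 qed
qed

lemma l2_quot: "l2 M f ==> l2 M (%w. f w / c)" and nn_quot: "nn M (%w. f w / c) = nn M f / cmod c" for f :: "'w => complex"
 using l2_mult[of M f "inverse c"] nn_mult[of M "inverse c" f] by (simp_all add: divide_inverse mult.commute norm_inverse)

text \<open>The quotient at -h is the quotient at h composed with S (-h), so the left limit follows
  from the right one and from strong continuity at g.\<close>

lemma has_gen_right:
 assumes ps: "l2 M ps" and g: "l2 M g"
  and lim: "((%h. nn M (%w. (ps (S h w) - ps w) / cr h - g w)) \<longlongrightarrow> 0) (at_right 0)"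
 shows "has_gen M S ps g"
 unfolding has_gen_def L2_iff_l2 L2norm_eq_nn
proof (intro conjI ps g)
 let ?q = "%h. nn M (%w. (ps (S h w) - ps w) / cr h - g w)"
 have lq: "l2 M (%w. (ps (S h w) - ps w) / cr h)" for h by (intro l2_quot l2_diff l2_S ps)
 have refl: "?q (- h) <= ?q h + nn M (%w. g (S (- h) w) - g w)" for h
 proof -
  have "(ps (S (- h) w) - ps w) / cr (- h) = (ps (S h (S (- h) w)) - ps (S (- h) w)) / cr h" if "w : space M" for w
  using that by (simp add: minus_divide_left)
  hence "?q (- h) = nn M (%w. (ps (S h (S (- h) w)) - ps (S (- h) w)) / cr h - g w)"
  by (intro nn_cong) simp
  also have "... <= nn M (%w. (ps (S h (S (- h) w)) - ps (S (- h) w)) / cr h - g (S (- h) w)) + nn M (%w. g (S (- h) w) - g w)"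
  by (rule nn_triangle3[OF l2_S[OF lq, of h "- h"] l2_S[OF g] g])
  also have "nn M (%w. (ps (S h (S (- h) w)) - ps (S (- h) w)) / cr h - g (S (- h) w)) = ?q h"
  using nn_S[OF l2_diff[OF lq g], of h "- h"] by simp
  finally show ?thesis .
 qed
 show "(?q \<longlongrightarrow> 0) (at 0)"
 proof (rule tendstoI)
  fix e :: real assume e: "0 < e"
  hence "\<forall>\<^sub>F h in at_right 0. ?q h < e / 2" by (intro order_tendstoD(2)[OF lim]) simp
  then obtain b where b: "b > 0" "!!h. 0 < h ==> h < b ==> ?q h < e / 2" unfolding eventually_at_right_field by (elim exE conjE) auto
  have "0 < e / 4" using e by simp
  then obtain de where de: "0 < de" "!!t. \<bar>t\<bar> <= de ==> nn M (%w. g (S t w) - g w) <= e / 4" using strong_cont[OF g] by blast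
  have "?q h < e" if "h ~= 0" "\<bar>h\<bar> < min b de" for h
  proof (cases "h > 0")
  case True thus ?thesis using b(2)[of h] that e by simp
  next
  case False
  thus ?thesis using refl[of "- h"] b(2)[of "- h"] de(2)[of h] that e by simp
  qed
  thus "\<forall>\<^sub>F h in at 0. dist (?q h) 0 < e"
  unfolding eventually_at using b de by (intro exI[of _ "min b de"]) (auto simp: dist_norm)
 qed
qed

end

context cont
begin

text \<open>Minkowski for the deviation of a weighted orbit average from its value at time 0.
  \<open>si\<close> is 1 or -1 in the applications and sets the direction of time; \<open>k\<close>
  is the weight.\<close>

lemma iv_average:
 fixes fi :: "'w => complex" and k :: "real => real"
 assumes fi: "l2 M fi" and k: "k : borel_measurable borel" and ab: "a' <= b"
  and C: "!!s. a' <= s ==> s <= b ==> nn M (%w. k s *. fi (S (si * s) w) - fi w) <= C" "0 <= C"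
 defines "B \<equiv> (%w. \<integral>s. k s *. fi (S (si * s) w) \<partial>iv a' b)"
 shows "l2 M B" "nn M (%w. B w - (b - a') *. fi w) <= (b - a') * C"
  "AE w in M. integrable (iv a' b) (%s. k s *. fi (S (si * s) w))"
proof -
 note [measurable] = l2_meas[OF fi] k
 interpret iv: finite_measure "iv a' b" by (rule finite_measure_iv)
 let ?F = "%s w. k s *. fi (S (si * s) w)"
 have lF: "l2 M (?F s)" for s by (intro l2_scaleR l2_S fi)
 have mF: "(%x. ?F (fst x) (snd x)) : borel_measurable (borel \<Otimes>\<^sub>M M)" by measurable
 have bF: "AE s in iv a' b. nn M (?F s) <= nn M fi + C"
 proof (rule AE_iv)
  fix s assume "a' <= s" "s <= b"
  thus "nn M (?F s) <= nn M fi + C" using nn_triangle_sub[OF lF fi, of s] C(1)[of s] by linarith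
 qed
 have bF0: "0 <= nn M fi + C" using C(2) by simp
 note mink = minkowski_integral[where F = ?F, OF finite_measure_iv sets_iv mF lF bF bF0]
 show lB: "l2 M B" unfolding B_def by (rule mink(1))
 show ae: "AE w in M. integrable (iv a' b) (%s. ?F s w)" by (rule mink(3))
 let ?G = "%s w. ?F s w - fi w"
 have lG: "l2 M (?G s)" for s by (intro l2_diff lF fi)
 have mG: "(%x. ?G (fst x) (snd x)) : borel_measurable (borel \<Otimes>\<^sub>M M)" by measurable
 have bG: "AE s in iv a' b. nn M (?G s) <= C" by (rule AE_iv) (rule C(1))
 note minkG = minkowski_integral[where F = ?G, OF finite_measure_iv sets_iv mG lG bG C(2)]
 have "AE w in M. B w - (b - a') *. fi w = (\<integral>s. ?G s w \<partial>iv a' b)"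
  using ae
 proof eventually_elim
  case (elim w)
  thus ?case unfolding B_def using ab by (subst Bochner_Integration.integral_diff) (auto simp: measure_iv)
 qed
 hence "nn M (%w. B w - (b - a') *. fi w) = nn M (%w. \<integral>s. ?G s w \<partial>iv a' b)"
  by (intro nn_cong_AE l2_meas l2_diff lB l2_scaleR fi minkG(1))
 also have "... <= (b - a') * C" using minkG(2) ab by (simp add: measure_iv)
 finally show "nn M (%w. B w - (b - a') *. fi w) <= (b - a') * C" .
qed

text \<open>The increment of B t along the flow by h equals the increment of B h along the flow by
  t, because both are differences of orbit integrals over the same intervals; and B h is h fi up to
  o(h). It exhibits the time coboundaries as elements of the range of the generator, as
  \<open>nice_time\<close> requires.\<close>

lemma has_gen_integral:
 assumes fi: "l2 M fi" and t: "0 < t"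
 shows "has_gen M S (%w. \<integral>s. fi (S s w) \<partial>iv 0 t) (%w. fi (S t w) - fi w)"
proof (rule has_gen_right)
 note [measurable] = l2_meas[OF fi]
 define B where "B h w = (\<integral>s. fi (S s w) \<partial>iv 0 h)" for h w
 have triv: "nn M (%w. fi (S s w) - fi w) <= 2 * nn M fi" for s
  using nn_triangle_diff[OF l2_S[OF fi] fi, of s] nn_S[OF fi, of s] by simp
 have av: "l2 M (B h)" "AE w in M. integrable (iv 0 h) (%s. fi (S s w))" if "0 <= h" for h
  unfolding B_def using iv_average[OF fi, of "%_. 1" 0 h 1 "2 * nn M fi"] that triv by simp_all
 have av2: "nn M (%w. B h w - h *. fi w) <= h * C"
  if "0 <= h" "!!s. 0 <= s ==> s <= h ==> nn M (%w. fi (S s w) - fi w) <= C" "0 <= C" for h C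
  unfolding B_def using iv_average(2)[OF fi, of "%_. 1" 0 h 1 C] that by simp
 show "l2 M (%w. \<integral>s. fi (S s w) \<partial>iv 0 t)" using av(1)[of t] t by (simp add: B_def[abs_def])
 show "l2 M (%w. fi (S t w) - fi w)" by (intro l2_diff l2_S fi)
 have key: "AE w in M. B t (S h w) - B t w = B h (S t w) - B h w" if h: "0 < h" for h
 proof -
  have "AE w in M. integrable (iv 0 (t + h)) (%s. fi (S s w))" by (rule av(2)) (use t h in simp)
  with AE_space show ?thesis
  proof eventually_elim
  case (elim w)
  define q where "q s = fi (S s w)" for s
  have [measurable]: "q : borel_measurable borel" unfolding q_def using elim(1) by measurable
  have iq: "integrable lborel (%s. indicator {0..t+h} s *. q s)"
  using elim(2) by (simp add: integrable_iv q_def[symmetric])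
  have sub: "integrable lborel (%s. indicator {a..b} s *. q s)" if "0 <= a" "b <= t + h" for a b
  by (rule Bochner_Integration.integrable_bound[OF iq]) (use that in \<open>auto simp: indicator_def\<close>)
  have shift: "(\<integral>s. indicator {0..b} s *. fi (S s (S a w)) \<partial>lborel) = (\<integral>s. indicator {a..a+b} s *. q s \<partial>lborel)" for a b
  proof -
  have "(\<integral>s. indicator {a..a+b} s *. q s \<partial>lborel) = (\<integral>s. indicator {a..a+b} (a + 1 * s) *. q (a + 1 * s) \<partial>lborel)"
  using lborel_integral_real_affine[of 1 "%s. indicator {a..a+b} s *. q s" a] by simp
  also have "... = (\<integral>s. indicator {0..b} s *. fi (S s (S a w)) \<partial>lborel)"
  by (intro Bochner_Integration.integral_cong) (auto simp: indicator_def q_def S_plus[OF elim(1), symmetric] add.commute)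
  finally show ?thesis by simp
  qed
  have m1: "(%s. fi (S s (S a w))) : borel_measurable borel" for a using S_space[OF elim(1), of a] by measurable
  have "(\<integral>s. indicator {h..h+t} s *. q s \<partial>lborel) + (\<integral>s. indicator {0..h} s *. q s \<partial>lborel)
  = (\<integral>s. indicator {h..h+t} s *. q s + indicator {0..h} s *. q s \<partial>lborel)"
  using h t by (intro Bochner_Integration.integral_add[symmetric] sub) auto
  also have "... = (\<integral>s. indicator {t..t+h} s *. q s + indicator {0..t} s *. q s \<partial>lborel)"
  proof (rule integral_cong_AE)
  have "AE s in lborel. s ~= h" "AE s in lborel. s ~= t" by (auto intro: AE_lborel_singleton)
  thus "AE s in lborel. indicator {h..h+t} s *. q s + indicator {0..h} s *. q s = indicator {t..t+h} s *. q s + indicator {0..t} s *. q s"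
  by eventually_elim (use h t in \<open>auto simp: indicator_def\<close>)
  qed measurable
  also have "... = (\<integral>s. indicator {t..t+h} s *. q s \<partial>lborel) + (\<integral>s. indicator {0..t} s *. q s \<partial>lborel)"
  using h t by (intro Bochner_Integration.integral_add sub) auto
  finally show ?case unfolding B_def using m1[of 0] elim(1)
  by (simp add: integral_iv m1 shift q_def[symmetric] algebra_simps)
  qed
 qed
 have bound: "nn M (%w. (B t (S h w) - B t w) / cr h - (fi (S t w) - fi w)) <= 2 * C"
  if h: "0 < h" and C: "!!s. 0 <= s ==> s <= h ==> nn M (%w. fi (S s w) - fi w) <= C" "0 <= C" for h C
 proof -
  let ?D = "%w. B h w - h *. fi w"
  have lD: "l2 M ?D" using h by (intro l2_diff av l2_scaleR fi) auto
  have nD: "nn M ?D <= h * C" using h C by (intro av2) auto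
  have "AE w in M. (B t (S h w) - B t w) / cr h - (fi (S t w) - fi w) = (?D (S t w) - ?D w) / cr h"
  using key[OF h] by eventually_elim (use h in \<open>simp add: field_simps scaleR_conv_of_real\<close>)
  hence "nn M (%w. (B t (S h w) - B t w) / cr h - (fi (S t w) - fi w)) = nn M (%w. (?D (S t w) - ?D w) / cr h)"
  using t by (intro nn_cong_AE l2_meas l2_diff l2_quot l2_S[OF lD] lD l2_S[OF av(1)] av(1) l2_S[OF fi] fi) auto
  also have "... = nn M (%w. ?D (S t w) - ?D w) / h" using h by (simp add: nn_quot)
  also have "... <= (h * C + h * C) / h"
  proof (rule divide_right_mono)
  show "nn M (%w. ?D (S t w) - ?D w) <= h * C + h * C"
  using nn_triangle_diff[OF l2_S[OF lD] lD, of t] nn_S[OF lD, of t] nD by linarith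
  qed (use h in simp)
  finally show ?thesis using h by simp
 qed
 show "((%h. nn M (%w. ((\<integral>s. fi (S s (S h w)) \<partial>iv 0 t) - (\<integral>s. fi (S s w) \<partial>iv 0 t)) / cr h - (fi (S t w) - fi w))) \<longlongrightarrow> 0) (at_right 0)"
  unfolding B_def[symmetric]
 proof (rule tendstoI)
  fix e :: real assume e: "0 < e"
  hence e4: "0 < e / 4" by simp
  obtain de where de: "0 < de" "!!s. \<bar>s\<bar> <= de ==> nn M (%w. fi (S s w) - fi w) <= e / 4" using strong_cont[OF fi e4] by blast
  have "nn M (%w. (B t (S h w) - B t w) / cr h - (fi (S t w) - fi w)) < e" if "0 < h" "h < de" for h
  proof -
  have "nn M (%w. (B t (S h w) - B t w) / cr h - (fi (S t w) - fi w)) <= 2 * (e / 4)"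
  by (rule bound[OF that(1)]) (use de(2) that e in auto)
  thus ?thesis using e by simp
  qed
  thus "\<forall>\<^sub>F h in at_right 0. dist (nn M (%w. (B t (S h w) - B t w) / cr h - (fi (S t w) - fi w))) 0 < e"
  unfolding eventually_at_right_field using de(1) by (intro exI[of _ de]) simp
 qed
qed

text \<open>v is the integral of e^(-c s) h (S (-s)) over s \<ge> 0; multiplied by c the weight is
  the exponential law, a probability measure to which \<open>minkowski_integral\<close> applies. The
  flow acts by v (S t) = e^(-c t) v + W t with W t = t h + o(t), and the derivative at t = 0 can be
  read off.\<close>

lemma resolvent:
 assumes h: "l2 M h" and c: "0 < c"
 shows "EX v. l2 M v & has_gen M S v (%w. h w - c *. v w)"
proof -
 note [measurable] = l2_meas[OF h]
 define E where "E = density lborel (exponential_density c)"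
 have E: "prob_space E" unfolding E_def by (rule prob_space_exponential_density[OF c])
 then interpret E: prob_space E .
 have sE: "sets E = sets borel" by (simp add: E_def)
 have lF: "l2 M (%w. h (S (- s) w))" for s by (intro l2_S h)
 have mF: "(%x. h (S (- fst x) (snd x))) : borel_measurable (borel \<Otimes>\<^sub>M M)" by measurable
 have bF: "AE s in E. nn M (%w. h (S (- s) w)) <= nn M h" by (simp add: nn_S[OF h])
 note mink = minkowski_integral[where F = "%s w. h (S (- s) w)", OF E.finite_measure_axioms sE mF lF bF nn_nonneg]
 define v where "v = (%w. (1 / c) *. (\<integral>s. h (S (- s) w) \<partial>E))"
 have lv: "l2 M v" unfolding v_def by (intro l2_scaleR mink(1))
 define g where "g w s = exp (- c * s) *. h (S (- s) w)" for w s
 have gm [measurable]: "g w : borel_measurable borel" if "w : space M" for w unfolding g_def using that by measurable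
 have Em: "(\<integral>s. q s \<partial>E) = (\<integral>s. exponential_density c s *. q s \<partial>lborel)" "integrable E q \<longleftrightarrow> integrable lborel (%s. exponential_density c s *. q s)"
  if "q : borel_measurable borel" for q :: "real => complex"
  unfolding E_def using that c by (auto simp: integral_density integrable_density exponential_density_nonneg)
 have ed: "exponential_density c s *. h (S (- s) w) = c *. (indicator {0..} s *. g w s)" for s w
  by (simp add: exponential_density_def g_def indicator_def mult.commute)
 have hm: "(%s. h (S (- s) w)) : borel_measurable borel" if "w : space M" for w using that by measurable
 have v_eq: "v w = (\<integral>s. indicator {0..} s *. g w s \<partial>lborel)" if "w : space M" for w
  unfolding v_def Em(1)[OF hm[OF that]] ed integral_scaleR_right using c by simp
 define W where "W t w = (\<integral>s. exp (- c * (t + s)) *. h (S (- 1 * s) w) \<partial>iv (- t) 0)" for t w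
 have Wb: "nn M (%w. exp (- c * (t + s)) *. h (S (- 1 * s) w) - h w) <= c * t * nn M h + C"
  if t: "0 < t" and s: "- t <= s" "s <= 0" and C: "!!s. \<bar>s\<bar> <= t ==> nn M (%w. h (S s w) - h w) <= C" for t s C
 proof -
  let ?k = "exp (- c * (t + s))"
  have l1: "l2 M (%w. ?k *. (h (S (- s) w) - h w))" "l2 M (%w. (?k - 1) *. h w)" by (intro l2_scaleR l2_diff lF h)+
  have k1: "?k <= 1" using c s by simp
  have k2: "\<bar>?k - 1\<bar> <= c * t"
  proof -
  have "1 - ?k <= c * (t + s)" using exp_ge_add_one_self[of "- c * (t + s)"] by simp
  also have "... <= c * t" using c s by (intro mult_left_mono) auto
  finally show ?thesis using k1 by simp
  qed
  have "nn M (%w. ?k *. h (S (- 1 * s) w) - h w) = nn M (%w. ?k *. (h (S (- s) w) - h w) + (?k - 1) *. h w)"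
  by (simp add: algebra_simps)
  also have "... <= nn M (%w. ?k *. (h (S (- s) w) - h w)) + nn M (%w. (?k - 1) *. h w)" by (rule nn_triangle[OF l1])
  also have "... = ?k * nn M (%w. h (S (- s) w) - h w) + \<bar>?k - 1\<bar> * nn M h" unfolding nn_scaleR by simp
  also have "... <= 1 * C + c * t * nn M h"
  using k1 k2 C[of "- s"] s by (intro add_mono mult_mono mult_right_mono) auto
  finally show ?thesis by simp
 qed
 have triv: "nn M (%w. h (S s w) - h w) <= 2 * nn M h" for s
  using nn_triangle_diff[OF l2_S[OF h] h, of s] nn_S[OF h, of s] by simp
 have km: "(%s. exp (- c * (t + s))) : borel_measurable borel" for t by measurable
 have Wav: "l2 M (W t)" "AE w in M. integrable (iv (- t) 0) (%s. exp (- c * (t + s)) *. h (S (- 1 * s) w))" if t: "0 < t" for t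
  unfolding W_def using iv_average(1,3)[OF h km, of "-t" 0 t "-1" "c * t * nn M h + 2 * nn M h"] Wb[OF t, of _ "2 * nn M h"] triv c t
  by simp_all
 have key: "AE w in M. v (S t w) = exp (- c * t) *. v w + W t w" if t: "0 < t" for t
  using AE_space mink(3) Wav(2)[OF t]
 proof eventually_elim
  case (elim w)
  note wa = elim(1)
  note [measurable] = gm[OF wa]
  have i1: "integrable lborel (%s. indicator {0..} s *. g w s)"
  proof -
  have "integrable lborel (%s. (1 / c) *. (c *. (indicator {0..} s *. g w s)))"
  using elim(2) unfolding Em(2)[OF hm[OF wa]] ed by (rule integrable_scaleR_right)
  thus ?thesis using c by simp
  qed
  have i2: "integrable lborel (%s. indicator {-t..0} s *. g w s)"
  proof -
  have "integrable (iv (- t) 0) (%s. exp (c * t) *. (exp (- c * (t + s)) *. h (S (- 1 * s) w)))"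
  using elim(3) by (rule integrable_scaleR_right)
  also have "(%s. exp (c * t) *. (exp (- c * (t + s)) *. h (S (- 1 * s) w))) = g w"
  by (simp add: g_def fun_eq_iff exp_add[symmetric] algebra_simps)
  finally show ?thesis by (simp add: integrable_iv)
  qed
  have W_eq: "W t w = exp (- c * t) *. (\<integral>s. indicator {-t..0} s *. g w s \<partial>lborel)"
  proof -
  have "W t w = (\<integral>s. exp (- c * t) *. g w s \<partial>iv (- t) 0)"
  unfolding W_def by (intro Bochner_Integration.integral_cong) (auto simp: g_def exp_add[symmetric] algebra_simps)
  thus ?thesis by (simp add: integral_iv)
  qed
  have "v (S t w) = (\<integral>s. indicator {0..} s *. g (S t w) s \<partial>lborel)" by (rule v_eq[OF S_space[OF wa]])
  also have "... = (\<integral>s. indicator {0..} (t + 1 * s) *. g (S t w) (t + 1 * s) \<partial>lborel)"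
  using lborel_integral_real_affine[of 1 "%s. indicator {0..} s *. g (S t w) s" t] by simp
  also have "... = (\<integral>s. exp (- c * t) *. (indicator {-t..} s *. g w s) \<partial>lborel)"
  by (intro Bochner_Integration.integral_cong)
  (auto simp: indicator_def g_def S_plus[OF wa, symmetric] exp_add[symmetric] algebra_simps)
  also have "... = (\<integral>s. exp (- c * t) *. (indicator {0..} s *. g w s + indicator {-t..0} s *. g w s) \<partial>lborel)"
  proof (rule integral_cong_AE)
  have "AE s in lborel. s ~= (0::real)" by (rule AE_lborel_singleton)
  thus "AE s in lborel. exp (- c * t) *. (indicator {-t..} s *. g w s) = exp (- c * t) *. (indicator {0..} s *. g w s + indicator {-t..0} s *. g w s)"
  by eventually_elim (use t in \<open>auto simp: indicator_def\<close>)
  qed measurable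
  also have "... = exp (- c * t) *. v w + W t w"
  unfolding integral_scaleR_right Bochner_Integration.integral_add[OF i1 i2] v_eq[OF wa] W_eq by (rule scaleR_add_right)
  finally show ?case .
 qed
 have bound: "nn M (%w. (v (S t w) - v w) / cr t - (h w - c *. v w)) <= c^2 * t * nn M v + c * t * nn M h + C"
  if t: "0 < t" "c * t <= 1" and C: "!!s. \<bar>s\<bar> <= t ==> nn M (%w. h (S s w) - h w) <= C" for t C
 proof -
  have C0: "0 <= C" by (rule order_trans[OF nn_nonneg C[of 0]]) (use t in simp)
  let ?D = "%w. W t w - t *. h w"
  have lD: "l2 M ?D" by (intro l2_diff Wav(1) t l2_scaleR h)
  have nD: "nn M ?D <= t * (c * t * nn M h + C)"
  unfolding W_def using iv_average(2)[OF h km, of "-t" 0 t "-1" "c * t * nn M h + C"] Wb[OF t(1), of _ C] C c t C0 by simp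
  \<comment> \<open>The deviation of the difference quotient of e^(-c t) at 0 from the derivative
    -c; it is O(t) by \<open>exp_minus_le_quad\<close>.\<close>
  define p where "p = (exp (- c * t) - 1) / t + c"
  have p: "\<bar>p\<bar> <= c^2 * t"
  proof -
  have "\<bar>exp (- (c * t)) - (1 - c * t)\<bar> <= (c * t)^2" using c t by (intro exp_minus_le_quad) auto
  moreover have "\<bar>p\<bar> = \<bar>exp (- (c * t)) - (1 - c * t)\<bar> / t" using t by (simp add: p_def field_simps)
  ultimately show ?thesis using t by (simp add: divide_le_eq power2_eq_square mult_ac)
  qed
  have lpv: "l2 M (%w. p *. v w)" by (intro l2_scaleR lv)
  have lDt: "l2 M (%w. ?D w / cr t)" by (intro l2_quot lD)
  have "AE w in M. (v (S t w) - v w) / cr t - (h w - c *. v w) = p *. v w + ?D w / cr t"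
  using key[OF t(1)]
  proof eventually_elim
  case (elim w)
  show ?case unfolding elim p_def using t by (simp add: field_simps scaleR_conv_of_real)
  qed
  hence "nn M (%w. (v (S t w) - v w) / cr t - (h w - c *. v w)) = nn M (%w. p *. v w + ?D w / cr t)"
  by (intro nn_cong_AE l2_meas l2_diff l2_quot l2_S[OF lv] lv h l2_scaleR l2_add lpv lDt)
  also have "... <= nn M (%w. p *. v w) + nn M (%w. ?D w / cr t)" by (rule nn_triangle[OF lpv lDt])
  also have "... = \<bar>p\<bar> * nn M v + nn M ?D / t" unfolding nn_scaleR nn_quot using t by simp
  also have "... <= c^2 * t * nn M v + (t * (c * t * nn M h + C)) / t"
  using p nD t by (intro add_mono mult_right_mono divide_right_mono) auto
  finally show ?thesis using t by simp
 qed
 have "has_gen M S v (%w. h w - c *. v w)"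
 proof (rule has_gen_right[OF lv l2_diff[OF h l2_scaleR[OF lv]]], rule tendstoI)
  fix e :: real assume e: "0 < e"
  hence e2: "0 < e / 2" by simp
  obtain de where de: "0 < de" "!!s. \<bar>s\<bar> <= de ==> nn M (%w. h (S s w) - h w) <= e / 2" using strong_cont[OF h e2] by blast
  define K where "K = c^2 * nn M v + c * nn M h + 1"
  have K: "0 < K" using c by (simp add: K_def add_nonneg_pos)
  define b where "b = min de (min (1 / c) (e / (2 * K)))"
  have b: "0 < b" using de c e K by (simp add: b_def)
  have "nn M (%w. (v (S t w) - v w) / cr t - (h w - c *. v w)) < e" if t: "0 < t" "t < b" for t
  proof -
  have ct: "c * t <= 1" using t c by (simp add: b_def field_simps)
  have Kt: "K * t < e / 2" using t K by (simp add: b_def field_simps)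
  have "nn M (%w. (v (S t w) - v w) / cr t - (h w - c *. v w)) <= c^2 * t * nn M v + c * t * nn M h + e / 2"
  by (rule bound[OF t(1) ct]) (use de(2) t in \<open>simp add: b_def\<close>)
  also have "c^2 * t * nn M v + c * t * nn M h <= K * t" using t by (simp add: K_def algebra_simps)
  finally show ?thesis using Kt by linarith
  qed
  thus "\<forall>\<^sub>F t in at_right 0. dist (nn M (%w. (v (S t w) - v w) / cr t - (h w - c *. v w))) 0 < e"
  unfolding eventually_at_right_field using b by (intro exI[of _ b]) simp
 qed
 thus ?thesis using lv by blast
qed

end

section \<open>The generator and the abstract problem in continuous time\<close>

context cont
begin

lemma has_gen_iff: "has_gen M S ps g \<longleftrightarrow> l2 M ps & l2 M g &
  ((%h. nn M (%w. (ps (S h w) - ps w) / cr h - g w)) \<longlongrightarrow> 0) (at 0)"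
 unfolding has_gen_def L2_iff_l2 L2norm_eq_nn ..

lemma l2_dq: "l2 M ps ==> l2 M (%w. (ps (S h w) - ps w) / cr h)"
 by (intro l2_quot l2_diff l2_S)

lemma has_gen_lin:
 assumes "has_gen M S ps g" "has_gen M S ps' g'"
 shows "has_gen M S (%w. ps w + k * ps' w) (%w. g w + k * g' w)"
proof -
 note a = assms[unfolded has_gen_iff]
 have l: "l2 M ps" "l2 M g" "l2 M ps'" "l2 M g'" using a by auto
 let ?q = "%h. nn M (%w. (ps (S h w) - ps w) / cr h - g w)"
 let ?q' = "%h. nn M (%w. (ps' (S h w) - ps' w) / cr h - g' w)"
 have b: "nn M (%w. ((ps (S h w) + k * ps' (S h w)) - (ps w + k * ps' w)) / cr h - (g w + k * g' w)) <= ?q h + cmod k * ?q' h" for h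
 proof -
  have "nn M (%w. ((ps (S h w) + k * ps' (S h w)) - (ps w + k * ps' w)) / cr h - (g w + k * g' w))
  = nn M (%w. ((ps (S h w) - ps w) / cr h - g w) + k * ((ps' (S h w) - ps' w) / cr h - g' w))"
  by (rule nn_cong) (simp add: diff_divide_distrib add_divide_distrib algebra_simps)
  also have "... <= ?q h + nn M (%w. k * ((ps' (S h w) - ps' w) / cr h - g' w))"
  by (intro nn_triangle l2_diff l2_mult l2_dq l)
  finally show ?thesis by simp
 qed
 have "((%h. ?q h + cmod k * ?q' h) \<longlongrightarrow> 0 + cmod k * 0) (at 0)" using a by (intro tendsto_intros) auto
 hence lim: "((%h. ?q h + cmod k * ?q' h) \<longlongrightarrow> 0) (at 0)" by simp
 show ?thesis unfolding has_gen_iff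
  by (intro conjI l2_add l2_mult l tendsto_sandwich[OF _ _ tendsto_const lim] always_eventually allI b) simp
qed

lemma has_gen_T:
 assumes "has_gen M S ps g" shows "has_gen M S (%w. ps (T x w)) (%w. g (T x w))"
proof -
 note a = assms[unfolded has_gen_iff]
 have l: "l2 M ps" "l2 M g" using a by auto
 have "nn M (%w. (ps (T x (S h w)) - ps (T x w)) / cr h - g (T x w))
  = nn M (%w. (ps (S h w) - ps w) / cr h - g w)" for h
  using nn_T[OF l2_diff[OF l2_dq[OF l(1), of h] l(2)], of x] by (subst nn_T[OF l2_diff[OF l2_dq[OF l(1), of h] l(2)], of x, symmetric]) (intro nn_cong, simp add: S_T)
 thus ?thesis using a unfolding has_gen_iff by (simp add: l2_T)
qed

text \<open>A scheme for limits in estimates: \<open>b\<close> is the estimate as a function of h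
  and of the distance q between the difference quotient and g.\<close>

lemma has_gen_bound:
 assumes g: "has_gen M S ps g"
  and b: "!!h. h ~= 0 ==> X <= b h (nn M (%w. (ps (S h w) - ps w) / cr h - g w))"
  and lim: "!!q. (q \<longlongrightarrow> 0) (at (0::real)) ==> ((%h. b h (q h)) \<longlongrightarrow> 0) (at 0)"
 shows "X <= (0::real)"
proof (rule tendsto_lowerbound)
 show "((%h. b h (nn M (%w. (ps (S h w) - ps w) / cr h - g w))) \<longlongrightarrow> 0) (at 0)"
  using g unfolding has_gen_iff by (intro lim) auto
 show "\<forall>\<^sub>F h in at 0. X <= b h (nn M (%w. (ps (S h w) - ps w) / cr h - g w))"
  unfolding eventually_at_filter using b by (intro always_eventually) auto
qed simp

text \<open>The flow is isometric, so the product of ps with its increment is -1/2 times the squared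
  norm of that increment, hence of second order in h. This is skew-symmetry of the generator and the
  reason for th = 0.\<close>

lemma has_gen_ip:
 assumes "has_gen M S ps g" shows "ip M ps g = 0"
proof -
 have l: "l2 M ps" "l2 M g" using assms unfolding has_gen_iff by auto
 have "\<bar>ip M ps g\<bar> <= 0"
 proof (rule has_gen_bound[OF assms, where b = "%h q. \<bar>h\<bar> / 2 * (q + nn M g)^2 + nn M ps * q"])
  fix h :: real assume h: "h ~= 0"
  let ?q = "%w. (ps (S h w) - ps w) / cr h"
  have lq: "l2 M ?q" by (rule l2_dq[OF l(1)])
  have q: "?q = (%w. (1 / h) *. (ps (S h w) - ps w))" by (simp add: scaleR_conv_of_real fun_eq_iff)
  have "(nn M (%w. ps (S h w) - ps w))^2 = (nn M ps)^2 - 2 * ip M (%w. ps (S h w)) ps + (nn M ps)^2"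
  unfolding nn_diff_sq[OF l2_S[OF l(1)] l(1)] nn_S[OF l(1)] ..
  moreover have "ip M ps (%w. ps (S h w) - ps w) = ip M (%w. ps (S h w)) ps - (nn M ps)^2"
  unfolding ip_diff_right[OF l2_S[OF l(1)] l(1) l(1)] by (simp add: nn_sq_ip ip_commute)
  ultimately have e: "ip M ps (%w. ps (S h w) - ps w) = - ((nn M (%w. ps (S h w) - ps w))^2) / 2" by simp
  have n: "nn M ?q = nn M (%w. ps (S h w) - ps w) / \<bar>h\<bar>" unfolding q nn_scaleR by simp
  have e1: "ip M ps ?q = - (h / 2) * (nn M ?q)^2"
  unfolding n unfolding q ip_scaleR_right e using h by (simp add: field_simps power2_eq_square)
  have "nn M ?q <= nn M (%w. ?q w - g w) + nn M g" using nn_triangle_sub[OF lq l(2)] by simp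
  hence "(nn M ?q)^2 <= (nn M (%w. ?q w - g w) + nn M g)^2" by (intro power_mono) auto
  hence e2: "\<bar>ip M ps ?q\<bar> <= \<bar>h\<bar> / 2 * (nn M (%w. ?q w - g w) + nn M g)^2"
  unfolding e1 abs_mult by (simp add: mult_left_mono)
  have "\<bar>ip M ps (%w. ?q w - g w)\<bar> <= nn M ps * nn M (%w. ?q w - g w)" by (intro ip_le l l2_diff lq)
  thus "\<bar>ip M ps g\<bar> <= \<bar>h\<bar> / 2 * (nn M (%w. ?q w - g w) + nn M g)^2 + nn M ps * nn M (%w. ?q w - g w)"
  using e2 unfolding ip_diff_right[OF lq l(2) l(1)] by linarith
 next
  fix q :: "real => real" assume q: "(q \<longlongrightarrow> 0) (at 0)"
  have "((%h. \<bar>h\<bar> / 2 * (q h + nn M g)^2 + nn M ps * q h) \<longlongrightarrow> \<bar>0\<bar> / 2 * (0 + nn M g)^2 + nn M ps * 0) (at 0)"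
  by (intro tendsto_intros q) simp
  thus "((%h. \<bar>h\<bar> / 2 * (q h + nn M g)^2 + nn M ps * q h) \<longlongrightarrow> 0) (at 0)" by simp
 qed
 thus ?thesis by simp
qed

lemma expectation_S: "l2 M f ==> expectation (%w. f (S t w)) = expectation f" for f :: "'w => complex"
 by (rule mpres_integral[OF S_mpres l2_meas])

lemma has_gen_mean:
 assumes "has_gen M S ps g" shows "expectation g = 0"
proof -
 have l: "l2 M ps" "l2 M g" using assms unfolding has_gen_iff by auto
 have "cmod (expectation g) <= 0"
 proof (rule has_gen_bound[OF assms, where b = "%h q. q"])
  fix h :: real
  let ?q = "%w. (ps (S h w) - ps w) / cr h"
  have "expectation ?q = 0"
  using l2_integrable[OF l(1)] l2_integrable[OF l2_S[OF l(1), of h]] expectation_S[OF l(1), of h] by simp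
  hence "expectation (%w. ?q w - g w) = - expectation g"
  by (subst Bochner_Integration.integral_diff) (auto intro!: l2_integrable l l2_dq simp del: integral_divide_zero)
  thus "cmod (expectation g) <= nn M (%w. ?q w - g w)"
  using norm_expectation_le[OF l2_diff[OF l2_dq[OF l(1), of h] l(2)]] by simp
 qed
 thus ?thesis by simp
qed

definition TmC :: "real => ('w => complex) => ('w => complex) => bool" where
 "TmC et ps g \<longleftrightarrow> l2 M g & (EX g0. has_gen M S ps g0 & (AE w in M. g w = cr et * ps w + g0 w))"

sublocale parab M T TmC L 0 "2 * real CARD('d) * L"
proof
 show "0 < L" "0 < 2 * real CARD('d) * L" using L_pos by auto
 fix et ps g assume Tm: "TmC et ps g"
 then obtain g0 where g0: "has_gen M S ps g0" and ae: "AE w in M. g w = cr et * ps w + g0 w" and lg: "l2 M g"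
  by (auto simp: TmC_def)
 have l: "l2 M ps" "l2 M g0" using g0 unfolding has_gen_iff by auto
 have lr: "l2 M (%w. cr et * ps w + g0 w)" by (intro l2_add l2_mult l)
 show "l2 M ps" "l2 M g" by (fact l lg)+
 show "TmC et ps g'" if "l2 M g'" "AE w in M. g w = g' w" for g'
 proof -
  have "AE w in M. g' w = cr et * ps w + g0 w" using ae that(2) by eventually_elim simp
  thus ?thesis using g0 that(1) unfolding TmC_def by blast
 qed
 show "TmC et (%w. ps w + k * ps' w) (%w. g w + k * g' w)" if Tm': "TmC et ps' g'" for ps' g' k
 proof -
  obtain g0' where g0': "has_gen M S ps' g0'" and ae': "AE w in M. g' w = cr et * ps' w + g0' w" and lg': "l2 M g'"
  using Tm' by (auto simp: TmC_def)
  have "AE w in M. g w + k * g' w = cr et * (ps w + k * ps' w) + (g0 w + k * g0' w)"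
  using ae ae' by eventually_elim (simp add: algebra_simps)
  thus ?thesis unfolding TmC_def using has_gen_lin[OF g0 g0', of k] lg lg' by (auto intro: l2_add l2_mult)
 qed
 show "TmC et (%w. ps (T x w)) (%w. g (T x w))" for x
  unfolding TmC_def using has_gen_T[OF g0, of x] mpres_AE[OF T_mpres ae, of x] l2_T[OF lg] by blast
 show "EX r. l2 M r & nn M r <= 3 * \<bar>et - et'\<bar> * nn M ps & TmC et' ps (%w. g w + r w)" for et'
 proof (intro exI[of _ "%w. cr (et' - et) * ps w"] conjI)
  show r: "l2 M (%w. cr (et' - et) * ps w)" by (intro l2_mult l)
  show "nn M (%w. cr (et' - et) * ps w) <= 3 * \<bar>et - et'\<bar> * nn M ps"
  unfolding nn_mult norm_of_real by (intro mult_right_mono) (auto simp: abs_minus_commute)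
  have "AE w in M. g w + cr (et' - et) * ps w = cr et' * ps w + g0 w"
  using ae by eventually_elim (simp add: algebra_simps)
  thus "TmC et' ps (%w. g w + cr (et' - et) * ps w)"
  unfolding TmC_def using g0 l2_add[OF lg r] by blast
 qed
 show "2 * et * (nn M ps)^2 <= 2 * ip M ps g + 0 * (nn M g)^2"
 proof -
  have "ip M ps g = ip M ps (%w. cr et * ps w + g0 w)"
  unfolding ip_def using ae l2_meas[OF l(1)] l2_meas[OF l(2)] l2_meas[OF lg]
  by (intro integral_cong_AE borel_measurable_inner borel_measurable_add borel_measurable_times) auto
  also have "... = ip M ps (%w. et *. ps w) + ip M ps g0"
  unfolding scaleR_conv_of_real by (intro ip_add_right l l2_mult)
  also have "... = et * (nn M ps)^2" by (simp add: has_gen_ip[OF g0] nn_sq_ip)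
  finally show ?thesis by simp
 qed
 show "expectation ps = 0" if "0 < et" "expectation g = 0"
 proof -
  have "expectation g = expectation (%w. cr et * ps w + g0 w)"
  by (intro integral_cong_AE l2_meas lg lr ae)
  also have "... = cr et * expectation ps"
  using l2_integrable[OF l(1)] l2_integrable[OF l(2)] has_gen_mean[OF g0] by simp
  finally show ?thesis using that by simp
 qed
next
 fix et :: real and h :: "'w => complex" assume et: "0 < et" and h: "l2 M h"
 have c: "0 < 2 * real CARD('d) * L + et" using L_pos et by (simp add: add_nonneg_pos)
 obtain v where v: "l2 M v" "has_gen M S v (%w. h w - (2 * real CARD('d) * L + et) *. v w)" using resolvent[OF h c] by blast
 have "TmC et v (%w. h w - (2 * real CARD('d) * L) *. v w)"
  unfolding TmC_def using v by (intro conjI l2_diff h l2_scaleR exI[of _ "%w. h w - (2 * real CARD('d) * L + et) *. v w"])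
  (auto simp: scaleR_add_left scaleR_conv_of_real algebra_simps)
 thus "EX v. TmC et v (%w. h w - (2 * real CARD('d) * L) *. v w)" by blast
qed simp_all

lemma PhiEq_cont:
 assumes ph: "!!j. cor a (colC a j) et xi (ph j)"
 shows "Phi_eq_cont M T S a xi (cr et) ph"
 unfolding Phi_eq_cont_def L2_iff_l2
proof (intro conjI allI)
 have l: "l2 M (ph j)" for j using ph[of j] by (auto simp: cor_def TmC_def has_gen_iff)
 show "l2 M (ph j)" for j by (rule l)
 fix j
 have l0: "0 <= l" using lL by simp
 obtain g0 where g0: "has_gen M S (ph j) g0"
  "AE w in M. - Pi0 M (Ds T xi (%w. cmv (a w) (Dv T xi (ph j) w) + colC a j w)) w = cr et * ph j w + g0 w"
  using ph[of j] by (auto simp: cor_def TmC_def)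
 have "AE w in M. cr et * ph j w + g0 w + Pi0 M (divs T xi (aDPhi T a xi ph) j) w = - Pi0 M (divs T xi (ac a) j) w"
  using g0(2)
 proof eventually_elim
  case (elim w)
  thus ?case using corrector_rhs[where ph=ph and j=j and w=w and xi=xi, OF a l0 L_pos l] by (simp add: algebra_simps)
 qed
 thus "EX g. has_gen M S (ph j) g & (AE w in M. cr et * ph j w + g w + Pi0 M (divs T xi (aDPhi T a xi ph) j) w = - Pi0 M (divs T xi (ac a) j) w)"
  using g0(1) by blast
qed

lemma dense_cont:
 assumes erg: "(EX j. ergodic_map M (T (ue j))) \<or> ergodic_flow M S"
  and fi: "l2 M fi" "expectation fi = 0" "0 < ka"
 shows "EX ps. nice ze ps & nn M (%w. fi w - ps w) <= ka"
 using erg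
proof
 assume "EX j. ergodic_map M (T (ue j))"
 then obtain j where j: "ergodic_map M (T (ue j))" by blast
 show ?thesis
 proof (rule dense_nice[where I = "{0}" and U = "%_. T (ue j)", OF _ _ _ fi])
  show "measure M {w : space M. g w > c} = 0 \<or> measure M {w : space M. g w > c} = 1"
  if "g : borel_measurable M" "!!t. t : {0::real} ==> AE w in M. g (T (ue j) w) = g w" for g :: "'w => real" and c
  using ergodic_map_zero_one[OF j that(1) that(2)[OF singletonI]] by simp
 qed (auto intro: T_mpres nice_space)
next
 assume e: "ergodic_flow M S"
 show ?thesis
 proof (rule dense_nice[where I = "{0<..}" and U = S, OF _ _ _ fi])
  show "measure M {w : space M. g w > c} = 0 \<or> measure M {w : space M. g w > c} = 1"
  if g: "g : borel_measurable M" and inv: "!!t. t : {0<..} ==> AE w in M. g (S t w) = g w" for g :: "'w => real" and c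
  proof (rule ergodic_flow_zero_one[OF e g _ S_plus S_joint])
  fix t :: real
  consider "0 < t" | "t = 0" | "t < 0" by linarith
  thus "AE w in M. g (S t w) = g w"
  proof cases
  case 1 thus ?thesis using inv[of t] by simp
  next
  case 2 thus ?thesis using S_0 by (auto intro!: AE_I2)
  next
  case 3
  hence "AE w in M. g (S (- t) (S t w)) = g (S t w)" using mpres_AE[OF S_mpres inv[of "- t"], of t] by simp
  with AE_space show ?thesis by eventually_elim simp
  qed
  qed
  fix fi :: "'w => complex" and t :: real assume fi: "l2 M fi" and t: "t : {0<..}"
  define B where "B = (%w. \<integral>s. fi (S s w) \<partial>iv 0 t)"
  have hB: "has_gen M S B (%w. fi (S t w) - fi w)" unfolding B_def by (rule has_gen_integral[OF fi]) (use t in simp)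
  hence lB: "l2 M B" by (simp add: has_gen_iff)
  \<comment> \<open>\<open>nice_time\<close> asks for a primitive of mean zero. Constants lie in the
    kernel of the generator, so B can be centred.\<close>
  have "has_gen M S (%w. expectation B) (%w. 0)" unfolding has_gen_iff by (simp add: nn_def)
  from has_gen_lin[OF hB this, of "-1"] have h0: "has_gen M S (Pi0 M B) (%w. fi (S t w) - fi w)" by (simp add: Pi0_def[abs_def])
  have l0: "l2 M (Pi0 M B)" by (rule l2_Pi0[OF lB])
  show "nice ze (%w. fi (S t w) - fi w)"
  proof (rule nice_time[OF _ has_gen_mean[OF hB] expectation_Pi0[OF lB], where C = "nn M (Pi0 M B)"])
  show lfi: "l2 M (%w. fi (S t w) - fi w)" by (intro l2_diff l2_S fi)
  fix et :: real assume et: "0 < et" "et <= 1"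
  show "EX r. l2 M r & nn M r <= nn M (Pi0 M B) * et & TmC et (Pi0 M B) (%w. fi (S t w) - fi w + r w)"
  unfolding TmC_def using h0 lfi et l0
  by (intro exI[of _ "%w. cr et * Pi0 M B w"] conjI exI[of _ "%w. fi (S t w) - fi w"]) auto
  qed simp
 qed (auto intro: S_mpres)
qed

end

section \<open>The Euler scheme with time-averaged coefficients\<close>

lemma nn_le_sum_nth: "l2 M F ==> nn M F <= (SUM i:UNIV. nn M (%w. F w $ i))" for F :: "'w => complex^'d::finite"
proof -
 assume "l2 M F"
 hence "nn M F = L2_set (%i. nn M (%w. F w $ i)) UNIV"
  by (simp add: L2_set_def nn_cart_sq[symmetric])
 thus ?thesis by (simp add: L2_set_le_sum)
qed

lemma nn_nth_le: "l2 M F ==> nn M (%w. F w $ i) <= nn M F" for F :: "'w => complex^'d::finite"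
 using nn_mono_AE[of M F "%w. F w $ i" 1] l2_meas[OF l2_nth, of M F i] by (simp add: Finite_Cartesian_Product.norm_nth_le)

lemma nn_cmv_le:
 assumes "coeff_ok M l L al" "0 <= l" "l <= L" "0 < L" "l2 M F"
 shows "nn M (%w. cmv (al w) (F w)) <= L * nn M F"
proof (cases "nn M (%w. cmv (al w) (F w)) = 0")
 case False
 let ?n = "nn M (%w. cmv (al w) (F w))"
 have p: "0 < ?n" using False nn_nonneg[of M "%w. cmv (al w) (F w)"] by linarith
 have "?n^2 <= L * ip M F (%w. cmv (al w) (F w))" by (rule nn_cmv_sq[OF assms(1,2,4,5,3)])
 also have "... <= L * (nn M F * ?n)"
  using ip_le[OF assms(5) l2_cmv[OF assms(1,2,4,5)]] assms(4) by (intro mult_left_mono) auto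
 finally show ?thesis using p by (simp add: power2_eq_square mult.assoc[symmetric])
qed (use assms in simp)

lemma ellip_entry: "ellip l L A ==> 0 <= l ==> 0 < L ==> \<bar>A $ i $ j\<bar> <= L"
proof -
 assume e: "ellip l L A" "0 <= l" "0 < L"
 let ?F = "axis j 1 :: complex^'a"
 have "(norm (cmv A ?F))^2 <= L * (?F \<bullet> cmv A ?F)" by (rule ellip_norm[OF e])
 also have "... <= L * (L * (norm ?F)^2)" using ellip_upper[OF e, of ?F] e(3) by (intro mult_left_mono) auto
 finally have "(norm (cmv A ?F))^2 <= L^2" by (simp add: power2_eq_square)
 hence "norm (cmv A ?F) <= L" by (rule power2_le_imp_le) (use e in simp)
 moreover have "cmv A ?F $ i = cr (A $ i $ j)"
  by (simp add: cmv_def axis_def if_distrib cong: if_cong)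
 ultimately show ?thesis using Finite_Cartesian_Product.norm_nth_le[of "cmv A ?F" i] by simp
qed

context cont
begin

text \<open>An integral over the step rather than a sample at a grid point: along an orbit the
  coefficient is only measurable in s. The step length h is contained as a factor.\<close>

definition abar :: "real => 'w => real^'d^'d" where
 "abar h w = (\<chi> i j. \<integral>s. a (S s w) $ i $ j \<partial>iv 0 h)"

lemma a_meas [measurable]: "a : borel_measurable M" using a by (simp add: coeff_ok_def)

lemma a_entry_meas: "(%x. a (S (fst x) (snd x)) $ i $ j) : borel_measurable (borel \<Otimes>\<^sub>M M)"
 by (rule measurable_compose[OF _ borel_measurable_mat_nth]) measurable

lemma a_entry_meas1: "w : space M ==> (%s. a (S s w) $ i $ j) : borel_measurable borel"
 by (rule measurable_compose[OF _ borel_measurable_mat_nth]) measurable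

lemma a_entry: "w : space M ==> \<bar>a (S s w) $ i $ j\<bar> <= L"
 using a lL L_pos S_space[of w s] by (intro ellip_entry[of l]) (auto simp: coeff_ok_ellip)

lemma a_entry_integrable: "w : space M ==> integrable (iv c h) (%s. a (S s w) $ i $ j)"
 by (rule finite_measure.integrable_const_bound[OF finite_measure_iv, of _ L])
  (use a_entry_meas1[of w i j] in \<open>auto simp: a_entry cong: measurable_cong_sets\<close>)

lemma coeff_ok_abar:
 assumes h: "0 <= h" shows "coeff_ok M (l * h) (L * h) (abar h)"
 unfolding coeff_ok_def
proof (intro conjI ballI allI)
 have sf: "sigma_finite_measure (iv 0 h)"
  using finite_measure_iv by (simp add: finite_measure_def)
 have "(%w. \<integral>s. a (S s w) $ i $ j \<partial>iv 0 h) : borel_measurable M" for i j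
 proof (rule sigma_finite_measure.borel_measurable_lebesgue_integral[OF sf])
  have "(%p. a (S (snd p) (fst p)) $ i $ j) : borel_measurable (M \<Otimes>\<^sub>M borel)"
  using measurable_compose[OF measurable_pair_swap' a_entry_meas[of i j]] by (simp add: case_prod_beta)
  thus "(%(w, s). a (S s w) $ i $ j) : borel_measurable (M \<Otimes>\<^sub>M iv 0 h)"
  by (simp add: case_prod_beta cong: measurable_cong_sets sets_pair_measure_cong)
 qed
 thus "abar h : borel_measurable M" unfolding abar_def[abs_def] by (intro measurable_vec_lambda)
 fix w assume wa: "w : space M"
 have t: "transpose (a (S s w)) = a (S s w)" for s using a S_space[OF wa] by (simp add: coeff_ok_def)
 have "a (S s w) $ i $ j = a (S s w) $ j $ i" for s i j using arg_cong[OF t, of "%B. B $ j $ i" s] by (simp add: transpose_def)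
 thus "transpose (abar h w) = abar h w" by (simp add: transpose_def abar_def vec_eq_iff)
 fix x :: "real^'d"
 note ie = a_entry_integrable[OF wa]
 have ix: "integrable (iv 0 h) (%s. x \<bullet> (a (S s w) *v x))"
  unfolding inner_vec_def matrix_vector_mult_def by (simp add: ie)
 have q: "x \<bullet> (abar h w *v x) = (\<integral>s. x \<bullet> (a (S s w) *v x) \<partial>iv 0 h)"
  by (simp add: inner_vec_def matrix_vector_mult_def abar_def ie)
 interpret iv: finite_measure "iv 0 h" by (rule finite_measure_iv)
 have "(\<integral>s. l * (x \<bullet> x) \<partial>iv 0 h) <= x \<bullet> (abar h w *v x)"
  unfolding q using a S_space[OF wa] by (intro integral_mono ix) (auto simp: coeff_ok_def)
 thus "l * h * (x \<bullet> x) <= x \<bullet> (abar h w *v x)" using measure_iv[OF h] by (simp add: mult_ac)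
 have "x \<bullet> (abar h w *v x) <= (\<integral>s. L * (x \<bullet> x) \<partial>iv 0 h)"
  unfolding q using a S_space[OF wa] by (intro integral_mono ix) (auto simp: coeff_ok_def)
 thus "x \<bullet> (abar h w *v x) <= L * h * (x \<bullet> x)" using measure_iv[OF h] by (simp add: mult_ac)
qed

text \<open>For a small step the Euler scheme is itself a discrete medium, with ellipticity bounds l
  h and L h, so contraction and Fourier representation are inherited from \<open>disc\<close>.
  Ergodicity of the flow does not in general pass to the map S h, so the eigenvalue analysis is done
  separately in \<open>euler_plane_wave_limit\<close>.\<close>

lemma disc_euler:
 assumes h: "0 < h" "4 * real CARD('d) * (L * h) <= 1"
 shows "disc M T (%n::int. S (real_of_int n * h)) (abar h) (l * h) (L * h)"
proof (intro disc.intro environment.intro space_shift_axioms environment_axioms.intro disc_axioms.intro h(2))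
 show "translation_groups M T (%n::int. S (real_of_int n * h))"
  using groups unfolding translation_groups_def by (simp add: distrib_right)
 show "coeff_ok M (l * h) (L * h) (abar h)" using h by (intro coeff_ok_abar) simp
 show "0 < l * h" "l * h <= L * h" using h lL by auto
qed

lemma strong_cont_vec:
 fixes F :: "'w => complex^'d"
 assumes F: "l2 M F" and ka: "0 < ka"
 shows "EX de>0. ALL t. \<bar>t\<bar> <= de --> nn M (%w. F (S t w) - F w) <= ka"
proof -
 have k: "0 < ka / real CARD('d)" using ka by simp
 have "ALL i. EX de. 0 < de & (ALL t. \<bar>t\<bar> <= de --> nn M (%w. F (S t w) $ i - F w $ i) <= ka / real CARD('d))"
 proof
  fix i show "EX de. 0 < de & (ALL t. \<bar>t\<bar> <= de --> nn M (%w. F (S t w) $ i - F w $ i) <= ka / real CARD('d))"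
  using strong_cont[OF l2_nth[OF F] k, of i] by blast
 qed
 then obtain de where "ALL i. 0 < de i & (ALL t. \<bar>t\<bar> <= de i --> nn M (%w. F (S t w) $ i - F w $ i) <= ka / real CARD('d))"
  by (rule choice[THEN exE])
 hence de: "!!i. 0 < de i" "!!i t. \<bar>t\<bar> <= de i ==> nn M (%w. F (S t w) $ i - F w $ i) <= ka / real CARD('d)" by blast+
 show ?thesis
 proof (intro exI[of _ "Min (range de)"] conjI allI impI)
  show "0 < Min (range de)" using de(1) by simp
  fix t assume "\<bar>t\<bar> <= Min (range de)"
  hence t: "\<bar>t\<bar> <= de i" for i by simp
  have "nn M (%w. F (S t w) - F w) <= (SUM i:UNIV. nn M (%w. (F (S t w) - F w) $ i))"
  by (intro nn_le_sum_nth l2_diff l2_S F)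
  also have "... <= (SUM i:(UNIV::'d set). ka / real CARD('d))" using de(2)[OF t] by (intro sum_mono) simp
  finally show "nn M (%w. F (S t w) - F w) <= ka" by simp
 qed
qed

text \<open>With B = a G, the difference of a (S s) G and a G is a (S s) (G - G (S s)) plus B (S s)
  - B. Both summands are small by strong continuity at the L2 functions G and B, whatever the
  regularity of a in time; averaging over s keeps the bound.\<close>

lemma abar_approx:
 assumes G: "l2 M G" and ka: "0 < ka"
 shows "EX de>0. ALL h. 0 < h & h <= de -->
  nn M (%w. cmv (abar h w) (G w) - h *. cmv (a w) (G w)) <= h * ka"
proof -
 have l0: "0 <= l" using lL by simp
 define B where "B = (%w. cmv (a w) (G w))"
 have lB: "l2 M B" unfolding B_def by (rule l2_cmv[OF a l0 L_pos G])
 define k where "k = ka / real CARD('d)"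
 have k: "0 < k" using ka by (simp add: k_def)
 have k1: "0 < k / (2 * L)" "0 < k / 2" using k L_pos by auto
 obtain de1 where de1: "0 < de1" "!!t. \<bar>t\<bar> <= de1 ==> nn M (%w. G (S t w) - G w) <= k / (2 * L)" using strong_cont_vec[OF G k1(1)] by blast
 obtain de2 where de2: "0 < de2" "!!t. \<bar>t\<bar> <= de2 ==> nn M (%w. B (S t w) - B w) <= k / 2" using strong_cont_vec[OF lB k1(2)] by blast
 have lC: "l2 M (%w. cmv (a (S s w)) (F w))" if "l2 M F" for F s by (rule l2_cmv[OF coeff_ok_S l0 L_pos that])
 have diff: "nn M (%w. cmv (a (S s w)) (G w) - B w) <= k" if s: "\<bar>s\<bar> <= de1" "\<bar>s\<bar> <= de2" for s
 proof -
  have "nn M (%w. cmv (a (S s w)) (G w) - B w) <= nn M (%w. cmv (a (S s w)) (G w) - B (S s w)) + nn M (%w. B (S s w) - B w)"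
  by (intro nn_triangle3 lC G l2_S lB)
  also have "nn M (%w. cmv (a (S s w)) (G w) - B (S s w)) = nn M (%w. cmv (a (S s w)) (G w - G (S s w)))"
  by (simp add: B_def cmv_diff)
  also have "... <= L * nn M (%w. G w - G (S s w))" using lL L_pos by (intro nn_cmv_le[OF coeff_ok_S l0] l2_diff G l2_S) auto
  also have "... <= L * (k / (2 * L))" using de1(2)[OF s(1)] L_pos by (intro mult_left_mono) (auto simp: nn_minus_commute[of M G])
  also have "... = k / 2" using L_pos by simp
  finally show ?thesis using de2(2)[OF s(2)] by simp
 qed
 have comp: "nn M (%w. (cmv (abar h w) (G w) - h *. B w) $ i) <= h * k" if h: "0 < h" "h <= de1" "h <= de2" for h i
 proof -
  let ?F = "%s w. (cmv (a (S s w)) (G w) - B w) $ i"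
  have [measurable]: "(%w. G w $ j) : borel_measurable M" "(%w. B w $ j) : borel_measurable M" for j
  using l2_meas[OF l2_nth[OF G]] l2_meas[OF l2_nth[OF lB]] by auto
  note [measurable] = a_entry_meas
  have mF: "(%x. ?F (fst x) (snd x)) : borel_measurable (borel \<Otimes>\<^sub>M M)" by (simp add: cmv_def)
  have lF: "l2 M (?F s)" for s by (intro l2_nth l2_diff lC G lB)
  have bF: "AE s in iv 0 h. nn M (?F s) <= k"
  proof (rule AE_iv)
  fix s assume s: "0 <= s" "s <= h"
  have "nn M (?F s) <= nn M (%w. cmv (a (S s w)) (G w) - B w)" by (intro nn_nth_le l2_diff lC G lB)
  thus "nn M (?F s) <= k" using diff[of s] s h by simp
  qed
  note mink = minkowski_integral[where F = ?F, OF finite_measure_iv sets_iv mF lF bF less_imp_le[OF k]]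
  interpret iv: finite_measure "iv 0 h" by (rule finite_measure_iv)
  have "nn M (%w. (cmv (abar h w) (G w) - h *. B w) $ i) = nn M (%w. \<integral>s. ?F s w \<partial>iv 0 h)"
  proof (rule nn_cong)
  fix w assume wa: "w : space M"
  note ie = a_entry_integrable[OF wa]
  have ie': "integrable (iv 0 h) (%s. cr (a (S s w) $ i $ j) * G w $ j)" for j
  using ie by (intro integrable_mult_left) simp
  have "(\<integral>s. ?F s w \<partial>iv 0 h) = (\<integral>s. (SUM j:UNIV. cr (a (S s w) $ i $ j) * G w $ j) \<partial>iv 0 h) - (\<integral>s. B w $ i \<partial>iv 0 h)"
  by (simp add: cmv_def, subst Bochner_Integration.integral_diff) (auto simp: ie')
  also have "... = (SUM j:UNIV. cr (\<integral>s. a (S s w) $ i $ j \<partial>iv 0 h) * G w $ j) - h *. B w $ i"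
  using measure_iv[of 0 h] h by (simp add: Bochner_Integration.integral_sum[OF ie'] integral_complex_of_real[symmetric] del: integral_complex_of_real)
  finally show "(cmv (abar h w) (G w) - h *. B w) $ i = (\<integral>s. ?F s w \<partial>iv 0 h)" by (simp add: cmv_def abar_def)
  qed
  also have "... <= h * k" using mink(2) measure_iv[of 0 h] h by simp
  finally show ?thesis .
 qed
 show ?thesis
 proof (intro exI[of _ "min de1 de2"] conjI allI impI)
  show "0 < min de1 de2" using de1 de2 by simp
  fix h assume h: "0 < h & h <= min de1 de2"
  have l: "l2 M (%w. cmv (abar h w) (G w) - h *. B w)"
  using h lL by (intro l2_diff l2_scaleR lB l2_cmv[OF coeff_ok_abar _ _ G]) auto
  have "nn M (%w. cmv (abar h w) (G w) - h *. B w) <= (SUM i:(UNIV::'d set). h * k)"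
  using h by (intro order_trans[OF nn_le_sum_nth[OF l]] sum_mono comp) auto
  thus "nn M (%w. cmv (abar h w) (G w) - h *. cmv (a w) (G w)) <= h * ka" by (simp add: B_def k_def)
 qed
qed

end

context space_shift
begin

lemma nn_Ds_le: "l2 M F ==> nn M (Ds T xi F) <= 2 * real CARD('d) * nn M F"
proof (rule power2_le_imp_le)
 assume F: "l2 M F"
 have e: "(2 * c * n)^2 = 4 * (c * c) * n^2" for c n :: real by (simp add: power2_eq_square)
 have "(1::real) <= real CARD('d)" using zero_less_card_finite[where 'a='d] by linarith
 hence "real CARD('d) * 1 <= real CARD('d) * real CARD('d)" by (intro mult_left_mono) auto
 hence "4 * real CARD('d) * (nn M F)^2 <= 4 * (real CARD('d) * real CARD('d)) * (nn M F)^2" by (intro mult_right_mono) auto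
 thus "(nn M (Ds T xi F))^2 <= (2 * real CARD('d) * nn M F)^2"
  using nn_Ds_sq_le[OF F, of xi] unfolding e by (rule order_trans[rotated])
qed simp

end

context cont
begin

text \<open>The cell function of the continuous equation is an approximate eigenfunction of one
  Euler step: P (S h) is P plus h times its generator up to o(h), and the cell equation eliminates
  the generator. At first order only h (\<eta> + Q) P is left; everything of order o(h) is collected
  in ka.\<close>

lemma euler_step:
 assumes c: "cell a et xi P Q" and ka: "0 < ka"
 shows "EX de>0. ALL h. 0 < h & h <= de -->
  nn M (%w. (1 + P w) - Ds T xi (%w. cmv (abar h w) (Dv T xi (%w. 1 + P w) w)) w - (1 - cr h * Q) * (1 + P (S h w)))
  <= h * (cmod (cr et + Q) * nn M P + ka)"
proof -
 have l0: "0 <= l" using lL by simp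
 define G where "G = Dv T xi (%w. 1 + P w)"
 define K where "K = Ds T xi (%w. cmv (a w) (G w))"
 have G': "ev xi + Dv T xi P w = G w" for w by (simp add: G_def vec_eq_iff Dv_def dxi_def ev_def algebra_simps)
 obtain g0 where g0: "has_gen M S P g0" and ae: "AE w in M. - Pi0 M K w = cr et * P w + g0 w" and QK: "Q = expectation K"
  using c unfolding cell_def TmC_def G' K_def by blast
 have l: "l2 M P" "l2 M g0" using g0 unfolding has_gen_iff by auto
 have lG: "l2 M G" unfolding G_def by (intro l2_Dv l2_add l2_const l)
 define d where "d = real CARD('d)"
 have d: "0 < d" by (simp add: d_def)
 obtain de1 where de1: "0 < de1" "!!h. 0 < h ==> h <= de1 ==> nn M (%w. cmv (abar h w) (G w) - h *. cmv (a w) (G w)) <= h * (ka / (4 * d))"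
  using abar_approx[OF lG, of "ka / (4 * d)"] ka d by auto
 have "\<forall>\<^sub>F h in at 0. nn M (%w. (P (S h w) - P w) / cr h - g0 w) < ka / 8"
  using g0 ka unfolding has_gen_iff by (intro order_tendstoD(2)[of _ 0]) auto
 then obtain de2 where de2: "0 < de2" "!!h. h ~= 0 ==> \<bar>h\<bar> < de2 ==> nn M (%w. (P (S h w) - P w) / cr h - g0 w) < ka / 8"
  by (auto simp: eventually_at dist_norm)
 define q where "q = cmod Q"
 have q: "0 <= q" by (simp add: q_def)
 \<comment> \<open>1 / (q + 1) gives |1 - h Q| \<le> 2, and the last entry bounds the term with h^2
   Q by h ka / 4. The shares of ka are 1/2 for the coefficient average, 1/4 for this term, and 1/4
   for the difference quotient.\<close>
 define de where "de = min (min de1 (de2 / 2)) (min (1 / (q + 1)) (ka / (4 * (q * nn M g0 + 1))))"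
 have qn: "0 < q * nn M g0 + 1" using q by (intro add_nonneg_pos mult_nonneg_nonneg) auto
 have de: "0 < de" unfolding de_def using de1 de2 q ka qn by auto
 show ?thesis
 proof (intro exI[of _ de] conjI allI impI de)
  fix h assume "0 < h & h <= de"
  hence h: "0 < h" "h <= de1" "\<bar>h\<bar> < de2" "h <= 1 / (q + 1)" "h <= ka / (4 * (q * nn M g0 + 1))"
  using de2(1) by (auto simp: de_def)
  have hq: "h * q <= 1" using h(1,4) q by (simp add: field_simps)
  have hg: "h * (q * nn M g0) <= ka / 4"
  proof -
  have "h * (q * nn M g0 + 1) <= ka / (4 * (q * nn M g0 + 1)) * (q * nn M g0 + 1)" using h(5) qn by (intro mult_right_mono) auto
  also have "... = ka / 4"
  proof -
  have "ka / (4 * X) * X = ka / 4" if "0 < X" for X using that by simp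
  from this[OF qn] show ?thesis .
  qed
  finally show ?thesis using h(1) by (simp add: distrib_left)
  qed
  define rh where "rh = 1 - cr h * Q"
  have rh: "cmod rh <= 2" unfolding rh_def using norm_triangle_ineq4[of 1 "cr h * Q"] hq h(1) by (simp add: norm_mult q_def)
  define E2 where "E2 = Ds T xi (%w. cmv (abar h w) (G w) - h *. cmv (a w) (G w))"
  define e1 where "e1 = (%w. (P (S h w) - P w) / cr h - g0 w)"
  have lA: "l2 M (%w. cmv (abar h w) (G w))" using h L_pos l0 by (intro l2_cmv[OF coeff_ok_abar _ _ lG]) auto
  have lB: "l2 M (%w. h *. cmv (a w) (G w))" by (intro l2_scaleR l2_cmv[OF a l0 L_pos lG])
  have lE2: "l2 M E2" unfolding E2_def by (intro l2_Ds l2_diff lA lB)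
  have le1: "l2 M e1" unfolding e1_def by (intro l2_diff l2_dq l)
  have E2b: "nn M E2 <= h * (ka / 2)"
  proof -
  have "nn M E2 <= 2 * d * nn M (%w. cmv (abar h w) (G w) - h *. cmv (a w) (G w))"
  unfolding E2_def d_def by (intro nn_Ds_le l2_diff lA lB)
  also have "... <= 2 * d * (h * (ka / (4 * d)))" using de1(2)[OF h(1,2)] d by (intro mult_left_mono) auto
  also have "... = h * (ka / 2)" using d by (simp add: field_simps)
  finally show ?thesis .
  qed
  have e1b: "nn M e1 <= ka / 8" unfolding e1_def using de2(2)[of h] h by simp
  let ?X = "%w. cr h * (cr et + Q) * P w" and ?Y = "%w. (cr h)^2 * Q * g0 w" and ?Z = "%w. rh * cr h * e1 w"
  let ?r = "%w. (1 + P w) - Ds T xi (%w. cmv (abar h w) (G w)) w - rh * (1 + P (S h w))"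
  have lX: "l2 M ?X" "l2 M ?Y" "l2 M ?Z" by (intro l2_mult l le1)+
  have lDs: "l2 M (Ds T xi (%w. cmv (abar h w) (G w)))" by (rule l2_Ds[OF lA])
  have lS: "l2 M (%w. P (S h w))" by (rule l2_S[OF l(1)])
  have l1: "l2 M (%w. 1 + P w)" "l2 M (%w. 1 + P (S h w))" by (rule l2_add[OF l2_const l(1)], rule l2_add[OF l2_const lS])
  have lr: "l2 M ?r" by (rule l2_diff[OF l2_diff[OF l1(1) lDs] l2_mult[OF l1(2)]])
  have lXYZ: "l2 M (%w. ?X w + ?Y w - (E2 w + ?Z w))" by (rule l2_diff[OF l2_add[OF lX(1,2)] l2_add[OF lE2 lX(3)]])
  have "AE w in M. ?r w = ?X w + ?Y w - (E2 w + ?Z w)"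
  using ae
  proof eventually_elim
  case (elim w)
  have k: "K w = Q - cr et * P w - g0 w" using elim by (simp add: Pi0_def QK algebra_simps)
  have 1: "Ds T xi (%w. cmv (abar h w) (G w)) w = E2 w + cr h * K w"
  unfolding E2_def Ds_diff Ds_scaleR K_def by (simp add: scaleR_conv_of_real)
  have 2: "P (S h w) = P w + cr h * (g0 w + e1 w)" using h(1) by (simp add: e1_def)
  have id: "(1 + p) - (E + h * (q - et * p - g)) - (1 - h * q) * (1 + (p + h * (g + e)))
  = h * (et + q) * p + h^2 * q * g - (E + (1 - h * q) * h * e)" for p E q et g e h :: complex
  by (simp add: algebra_simps power2_eq_square)
  show ?case unfolding 1 2 k rh_def by (rule id)
  qed
  hence "nn M ?r = nn M (%w. ?X w + ?Y w - (E2 w + ?Z w))"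
  by (rule nn_cong_AE[OF l2_meas[OF lr] l2_meas[OF lXYZ]])
  also have "... <= (nn M ?X + nn M ?Y) + (nn M E2 + nn M ?Z)"
  by (intro order_trans[OF nn_triangle_diff] add_mono nn_triangle l2_add lX lE2)
  also have "nn M ?X = h * (cmod (cr et + Q) * nn M P)" unfolding nn_mult using h(1) by (simp add: norm_mult)
  also have "nn M ?Y = h * (h * (q * nn M g0))" unfolding nn_mult using h(1) by (simp add: norm_mult q_def power2_eq_square)
  also have "... <= h * (ka / 4)" using hg h(1) by (intro mult_left_mono) auto
  also have "nn M ?Z = h * (cmod rh * nn M e1)" unfolding nn_mult using h(1) by (simp add: norm_mult)
  also have "... <= h * (2 * (ka / 8))" using rh e1b h(1) by (intro mult_left_mono mult_mono) auto
  also note E2b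
  finally have "nn M ?r <= h * (cmod (cr et + Q) * nn M P + ka)" by (simp add: algebra_simps)
  thus "nn M (%w. (1 + P w) - Ds T xi (%w. cmv (abar h w) (Dv T xi (%w. 1 + P w) w)) w - (1 - cr h * Q) * (1 + P (S h w)))
  <= h * (cmod (cr et + Q) * nn M P + ka)" by (simp add: G_def rh_def)
 qed
qed

abbreviation euler_wd :: "real => real^'d => nat => 'w => complex" where
 "euler_wd h \<equiv> disc.wd T (%n. S (real_of_int n * h)) (abar h)"

text \<open>The threshold for \<epsilon> is uniform in t, while the number of Euler steps may have
  to grow with t and with 1 / \<epsilon>. The tolerance ka' handed to \<open>euler_step\<close> can
  therefore be as small as a multiple of \<epsilon>^2.\<close>

lemma euler_plane_wave_limit:
 assumes erg: "(EX j. ergodic_map M (T (ue j))) \<or> ergodic_flow M S"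
  and ah: "is_ahom M T a (Phi_eq_cont M T S a) A" and ze: "ze ~= 0" and de: "0 < de"
 shows "\<forall>\<^sub>F ep in at_right 0. ALL t>0. \<forall>\<^sub>F N in sequentially.
  cmod (expectation (euler_wd (t / real N) (ep *. ze) N) - cr (exp (- (ep^2 * t) * (ze \<bullet> (A *v ze))))) <= de"
proof -
 define mu where "mu = ze \<bullet> (A *v ze)"
 have "l * (norm ze)^2 <= 2 * mu" unfolding mu_def
  by (rule ahom_coercive[OF dense_cont[OF erg] a lL ah PhiEq_cont])
 moreover have "0 < l * (norm ze)^2" using lL ze by simp
 ultimately have mu: "0 < mu" by linarith
 \<comment> \<open>|\<epsilon>^2 + Q| is at most x (1 + 5/4 mu), and ka' = ka mu x / 2 contributes
   the remaining mu / 2.\<close>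
 define R where "R = 1 + 7 / 4 * mu"
 define Z where "Z = 1 + 2 * R / mu + 1 / mu"
 have Z: "0 < Z" using mu by (simp add: Z_def R_def add_pos_pos)
 define ka where "ka = min (mu / 4) (de / (2 * Z))"
 have ka: "0 < ka" "ka <= mu / 4" using mu Z de by (simp_all add: ka_def)
 have kaZ: "ka * Z <= de / 2"
 proof -
  have "ka * Z <= de / (2 * Z) * Z" using Z by (intro mult_right_mono) (auto simp: ka_def)
  thus ?thesis using Z by simp
 qed
 have "\<forall>\<^sub>F ep in at_right (0::real). 0 < ep" by (simp add: eventually_at_right_less)
 moreover have "\<forall>\<^sub>F ep in at_right 0. EX P Q. cell a (ep^2) (ep *. ze) P Q & nn M P <= ka &
  cmod (Q - cr (ep^2 * (ze \<bullet> (A *v ze)))) <= ka * ep^2"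
  by (rule cell_small[OF dense_cont[OF erg] a lL ah PhiEq_cont ka(1)])
 ultimately show ?thesis
 proof eventually_elim
  case (elim ep)
  then obtain P Q where c: "cell a (ep^2) (ep *. ze) P Q" and nP: "nn M P <= ka"
  and Q: "cmod (Q - cr (ep^2 * mu)) <= ka * ep^2" unfolding mu_def by blast
  define x where "x = ep^2"
  have x: "0 < x" using elim by (simp add: x_def)
  have Q': "cmod (Q - cr (x * mu)) <= ka * x" using Q by (simp add: x_def)
  have kx: "ka * x <= x * mu / 4" using mult_right_mono[OF ka(2), of x] x by (simp add: mult.commute)
  have xm: "0 < x * mu" using x mu by simp
  have "cmod (cr (x * mu)) = x * mu" unfolding norm_of_real using xm by simp
  hence nQ: "cmod Q <= 5 / 4 * (x * mu)" using norm_triangle_sub[of Q "cr (x * mu)"] Q' kx by linarith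
  define ka' where "ka' = ka * mu * x / 2"
  have ka': "0 < ka'" using ka mu x by (simp add: ka'_def)
  obtain h0 where h0: "0 < h0" "!!h. 0 < h ==> h <= h0 ==>
  nn M (%w. (1 + P w) - Ds T (ep *. ze) (%w. cmv (abar h w) (Dv T (ep *. ze) (%w. 1 + P w) w)) w - (1 - cr h * Q) * (1 + P (S h w)))
  <= h * (cmod (cr (ep^2) + Q) * nn M P + ka')"
  using euler_step[OF c ka'] by auto
  have lP: "l2 M P" and EP: "expectation P = 0" using c by (auto simp: cell_def TmC_def has_gen_iff)
  have main: "cmod (expectation (euler_wd h (ep *. ze) N) - cr (1 - h * (x * mu)) ^ N) <= de / 2"
  if h: "0 < h" "h <= h0" "4 * real CARD('d) * (L * h) <= 1" "h * (x * mu) <= 8 / 25" for h N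
  proof -
  interpret D: disc M T "%n::int. S (real_of_int n * h)" "abar h" "l * h" "L * h" by (rule disc_euler[OF h(1,3)])
  define B where "B = h * (cmod (cr (ep^2) + Q) * nn M P + ka')"
  have B0: "0 <= B" using h(1) ka' by (simp add: B_def)
  have "cmod (cr (ep^2) + Q) <= x + 5 / 4 * (x * mu)"
  using norm_triangle_ineq[of "cr x" Q] nQ x unfolding x_def[symmetric] by simp
  hence "cmod (cr (ep^2) + Q) * nn M P <= (x + 5 / 4 * (x * mu)) * ka"
  using nP xm x by (intro mult_mono) auto
  hence "B <= h * ((x + 5 / 4 * (x * mu)) * ka + ka')" unfolding B_def using h(1) by (intro mult_left_mono add_right_mono) auto
  also have "... = h * (x * (ka * R))" by (simp add: ka'_def R_def algebra_simps)
  finally have B: "B <= h * (x * (ka * R))" .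
  have "cmod (expectation (euler_wd h (ep *. ze) N) - cr (1 - h * (x * mu)) ^ N) <= ka * Z"
  unfolding Z_def
  proof (rule eigenvalue_power_bound[OF mu x Q' ka(2) h(1,4) _ B0 B])
  assume "cmod (1 - cr h * Q) < 1"
  hence "cmod (expectation (euler_wd h (ep *. ze) N) - (1 - cr h * Q) ^ N) <= nn M P + B / (1 - cmod (1 - cr h * Q))"
  by (rule D.wd_approx[OF lP EP]) (use h0(2)[OF h(1,2)] in \<open>simp add: B_def\<close>)
  thus "cmod (expectation (euler_wd h (ep *. ze) N) - (1 - cr h * Q) ^ N) <= ka + B / (1 - cmod (1 - cr h * Q))"
  using nP by simp
  qed
  thus ?thesis using kaZ by linarith
  qed
  show ?case
  proof (intro allI impI)
  fix t :: real assume t: "0 < t"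
  have tn: "(%N. c * (t / real N)) \<longlonglongrightarrow> 0" for c
  proof -
  have "(%N. (c * t) / real N) \<longlonglongrightarrow> 0" by (rule lim_const_over_n)
  thus ?thesis by simp
  qed
  have ev1: "\<forall>\<^sub>F N in sequentially. c * (t / real N) < b" if "0 < b" for b c using order_tendstoD(2)[OF tn that] .
  have "(%N. (1 + (- (t * (x * mu))) / real N) ^ N) \<longlonglongrightarrow> exp (- (t * (x * mu)))" by (rule tendsto_exp_limit_sequentially)
  hence "\<forall>\<^sub>F N in sequentially. dist ((1 + (- (t * (x * mu))) / real N) ^ N) (exp (- (t * (x * mu)))) < de / 3"
  using de by (intro tendstoD) auto
  moreover have "\<forall>\<^sub>F N in sequentially. x * mu * (t / real N) < 8 / 25" by (rule ev1) simp
  moreover note ev1[OF h0(1), of 1] ev1[of 1 "4 * real CARD('d) * L", OF zero_less_one] eventually_gt_at_top[of "0::nat"]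
  ultimately show "\<forall>\<^sub>F N in sequentially. cmod (expectation (euler_wd (t / real N) (ep *. ze) N) - cr (exp (- (ep^2 * t) * (ze \<bullet> (A *v ze))))) <= de"
  proof eventually_elim
  case (elim N)
  have "cmod (expectation (euler_wd (t / real N) (ep *. ze) N) - cr (1 - t / real N * (x * mu)) ^ N) <= de / 2"
  proof (rule main)
  show "0 < t / real N" using t elim(5) by simp
  show "t / real N <= h0" using elim(3) by simp
  show "4 * real CARD('d) * (L * (t / real N)) <= 1" using elim(4) by (simp add: mult_ac)
  show "t / real N * (x * mu) <= 8 / 25" using elim(2) by (simp add: mult_ac)
  qed
  moreover have "cmod (cr (1 - t / real N * (x * mu)) ^ N - cr (exp (- (ep^2 * t) * (ze \<bullet> (A *v ze))))) <= de / 3"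
  unfolding of_real_power[symmetric] of_real_diff[symmetric] norm_of_real mu_def[symmetric] x_def[symmetric]
  using elim(1) by (simp add: dist_real_def mult_ac)
  ultimately show ?case
  using norm_triangle_ineq[of "expectation (euler_wd (t / real N) (ep *. ze) N) - cr (1 - t / real N * (x * mu)) ^ N"
  "cr (1 - t / real N * (x * mu)) ^ N - cr (exp (- (ep^2 * t) * (ze \<bullet> (A *v ze))))"] de by simp
  qed
  qed
 qed
qed

end

section \<open>Fourier representation of solutions on the lattice\<close>

context disc
begin

lemma continuous_wd: "continuous_on UNIV (%ze. wd (ep *. ze) n w)"
proof (induction n arbitrary: w)
 case (Suc n)
 show ?case
  by (simp only: wd.simps Ds_def dxis_def cmv_def Dv_def dxi_def vec_lambda_beta) (intro continuous_intros Suc)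
qed simp

lemma measurable_wd: "(%p. wd (ep *. fst p) n (snd p)) : borel_measurable (borel \<Otimes>\<^sub>M M)"
proof (induction n)
 case (Suc n)
 define W where "W = (%p. wd (ep *. fst p) n (snd p))"
 define al where "al i k w = a w $ i $ k" for i k w
 have [measurable]: "W : borel_measurable (borel \<Otimes>\<^sub>M M)" unfolding W_def by (rule Suc)
 have [measurable]: "a : borel_measurable M" using a by (simp add: coeff_ok_def)
 have [measurable]: "al i k : borel_measurable M" for i k
  unfolding al_def by (rule measurable_compose[OF _ borel_measurable_mat_nth]) measurable
 have [measurable]: "(%ze::real^'d. ze $ i) : borel_measurable borel" for i by (intro borel_measurable_continuous_onI continuous_intros)
 have W: "wd (ep *. fst p) n w = W (fst p, w)" for p w by (simp add: W_def)
 have [measurable]: "(%p::(real^'d) \<times> 'w. ei (ep * fst p $ i)) : borel_measurable (borel \<Otimes>\<^sub>M M)"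
  "(%p::(real^'d) \<times> 'w. em (ep * fst p $ i)) : borel_measurable (borel \<Otimes>\<^sub>M M)" for i
  by measurable
 show ?case
  unfolding wd.simps Ds_def dxis_def cmv_def Dv_def dxi_def vec_lambda_beta W al_def[symmetric] vector_scaleR_component real_scaleR_def
  by measurable
qed simp

lemma measurable_expectation_wd: "(%ze. expectation (wd (ep *. ze) n)) : borel_measurable borel"
proof -
 have "(%(ze, w). wd (ep *. ze) n w) : borel_measurable (borel \<Otimes>\<^sub>M M)" using measurable_wd by (simp add: case_prod_beta)
 thus ?thesis by (rule borel_measurable_lebesgue_integral)
qed

lemma cmod_expectation_wd: "cmod (expectation (wd xi n)) <= 1"
 by (rule order_trans[OF norm_expectation_le[OF l2_wd] nn_wd])

text \<open>Translating by a unit vector multiplies the plane wave by just the phase that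
  \<open>dxi\<close> and \<open>dxis\<close> contain. The twisted recursion therefore becomes the
  recursion of the lattice equation.\<close>

lemma wd_lattice:
 fixes xi :: "real^'d" and n :: nat and x :: "int^'d"
 assumes wa: "w : space M"
 defines "v \<equiv> %y. em (xi \<bullet> rvec y) * wd xi n (T y w)"
  and "A \<equiv> %y. a (T y (S (int n) w))"
 shows "em (xi \<bullet> rvec x) * wd xi (Suc n) (T x w) =
  v x - (SUM i:UNIV. (SUM j:UNIV. cr (A (x - ue i) $ i $ j) * (v (x - ue i + ue j) - v (x - ue i)))
  - (SUM j:UNIV. cr (A x $ i $ j) * (v (x + ue j) - v x)))"
proof -
 define e where "e y = em (xi \<bullet> rvec y)" for y
 have r: "xi \<bullet> rvec (y + ue j) = xi \<bullet> rvec y + xi $ j" "xi \<bullet> rvec (y - ue j) = xi \<bullet> rvec y - xi $ j" for y j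
 proof -
  have "rvec (y + ue j) = rvec y + axis j 1" "rvec (y - ue j) = rvec y - axis j 1"
  by (simp_all add: rvec_def ue_def axis_def vec_eq_iff)
  thus "xi \<bullet> rvec (y + ue j) = xi \<bullet> rvec y + xi $ j" "xi \<bullet> rvec (y - ue j) = xi \<bullet> rvec y - xi $ j"
  by (simp_all add: inner_add_right inner_diff_right inner_axis)
 qed
 have e1: "e (y + ue j) = e y * em (xi $ j)" for y j
  unfolding e_def r by (simp add: exp_add[symmetric] algebra_simps)
 have e2: "e (y - ue j) = e y * ei (xi $ j)" for y j
  unfolding e_def r by (simp add: exp_add[symmetric] algebra_simps)
 define F where "F = (%w. cmv (a (S (int n) w)) (Dv T xi (wd xi n) w))"
 have Tp: "T x (T y w) = T (x + y) w" for x y using T_plus[OF wa] by simp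
 have Tw: "T y w : space M" for y using T_space[OF wa] .
 have key: "e y * F (T y w) $ i = (SUM j:UNIV. cr (A y $ i $ j) * (v (y + ue j) - v y))" for y i
  unfolding F_def cmv_def Dv_def dxi_def A_def v_def e_def[symmetric] e1 S_T[OF wa] Tp vec_lambda_beta sum_distrib_left
  by (intro sum.cong refl) (simp add: algebra_simps)
 have "e x * Ds T xi F (T x w) = (SUM i:UNIV. e (x - ue i) * F (T (x - ue i) w) $ i - e x * F (T x w) $ i)"
  unfolding Ds_def dxis_def e2 Tp sum_distrib_left by (intro sum.cong refl) (simp add: algebra_simps)
 hence "e x * Ds T xi F (T x w) = (SUM i:UNIV. (SUM j:UNIV. cr (A (x - ue i) $ i $ j) * (v (x - ue i + ue j) - v (x - ue i)))
  - (SUM j:UNIV. cr (A x $ i $ j) * (v (x + ue j) - v x)))"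
  unfolding key .
 thus ?thesis unfolding wd.simps F_def[symmetric] right_diff_distrib by (simp only: v_def e_def)
qed

context
 fixes p q :: "real^'d" and c :: "real^'d => complex" and ep :: real and h :: "int^'d => real"
 assumes c: "continuous_on UNIV c"
  and h: "!!x. cr (h x) = (\<integral>ze. indicator (cbox p q) ze *. (c ze * em ((ep *. ze) \<bullet> rvec x)) \<partial>lborel)"
begin

text \<open>A time step is linear and involves finitely many lattice sites, so it commutes with the
  integral over frequencies. Continuity in \<zeta> over a compact box supplies
  integrability.\<close>

lemma dsol_fourier:
 assumes wa: "w : space M"
 shows "cr (dsol T S a h w n x) =
  (\<integral>ze. indicator (cbox p q) ze *. (c ze * (em ((ep *. ze) \<bullet> rvec x) * wd (ep *. ze) n (T x w))) \<partial>lborel)"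
proof (induction n arbitrary: x)
 case 0
 thus ?case by (simp add: h)
next
 case (Suc n)
 define v where "v y ze = em ((ep *. ze) \<bullet> rvec y) * wd (ep *. ze) n (T y w)" for y ze
 define G where "G y ze = indicator (cbox p q) ze *. (c ze * v y ze)" for y ze
 have IH: "cr (dsol T S a h w n y) = (\<integral>ze. G y ze \<partial>lborel)" for y unfolding G_def v_def by (rule Suc)
 have iG: "integrable lborel (G y)" for y
 proof -
  have "continuous_on UNIV (%ze. c ze * v y ze)" unfolding v_def by (intro continuous_intros c continuous_wd)
  thus ?thesis unfolding G_def[abs_def] by (intro borel_integrable_compact compact_cbox) (rule continuous_on_subset, auto)
 qed
 define A where "A y = a (T y (S (int n) w))" for y
 have "indicator (cbox p q) ze *. (c ze * (em ((ep *. ze) \<bullet> rvec x) * wd (ep *. ze) (Suc n) (T x w))) =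
  G x ze - (SUM i:UNIV. (SUM j:UNIV. cr (A (x - ue i) $ i $ j) * (G (x - ue i + ue j) ze - G (x - ue i) ze))
  - (SUM j:UNIV. cr (A x $ i $ j) * (G (x + ue j) ze - G x ze)))" for ze
  unfolding wd_lattice[OF wa] v_def[symmetric] A_def[symmetric]
  by (cases "ze : cbox p q") (simp_all add: G_def right_diff_distrib sum_distrib_left mult_ac)
 hence "(\<integral>ze. indicator (cbox p q) ze *. (c ze * (em ((ep *. ze) \<bullet> rvec x) * wd (ep *. ze) (Suc n) (T x w))) \<partial>lborel)
  = (\<integral>ze. G x ze - (SUM i:UNIV. (SUM j:UNIV. cr (A (x - ue i) $ i $ j) * (G (x - ue i + ue j) ze - G (x - ue i) ze))
  - (SUM j:UNIV. cr (A x $ i $ j) * (G (x + ue j) ze - G x ze))) \<partial>lborel)"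
  by (intro Bochner_Integration.integral_cong refl)
 also have "... = (\<integral>ze. G x ze \<partial>lborel) - (SUM i:UNIV. (SUM j:UNIV. cr (A (x - ue i) $ i $ j) * ((\<integral>ze. G (x - ue i + ue j) ze \<partial>lborel) - (\<integral>ze. G (x - ue i) ze \<partial>lborel)))
  - (SUM j:UNIV. cr (A x $ i $ j) * ((\<integral>ze. G (x + ue j) ze \<partial>lborel) - (\<integral>ze. G x ze \<partial>lborel))))"
  by (simp add: iG Bochner_Integration.integrable_diff Bochner_Integration.integrable_sum integrable_mult_right)
 also have "... = cr (dsol T S a h w (Suc n) x)"
  unfolding IH[symmetric] by (simp add: Lop_def flux_def matrix_vector_mult_def A_def)
 finally show ?case ..
qed

text \<open>After Fubini the translation T x disappears by invariance of the measure, and the site x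
  survives only in the plane wave.\<close>

lemma expectation_dsol:
 "integrable M (%w. dsol T S a h w n x)"
 "cr (\<integral>w. dsol T S a h w n x \<partial>M) =
  (\<integral>ze. indicator (cbox p q) ze *. (c ze * (em ((ep *. ze) \<bullet> rvec x) * expectation (wd (ep *. ze) n))) \<partial>lborel)"
proof -
 interpret P: pair_sigma_finite lborel M by standard
 define f where "f = (%(ze, w). indicator (cbox p q) ze *. (c ze * (em ((ep *. ze) \<bullet> rvec x) * wd (ep *. ze) n (T x w))))"
 define W where "W = (%wa. wd (ep *. fst wa) n (snd wa))"
 have Wm: "W : borel_measurable (borel \<Otimes>\<^sub>M M)" unfolding W_def by (rule measurable_wd)
 have [measurable]: "W : borel_measurable (lborel \<Otimes>\<^sub>M M)" using Wm by (simp cong: measurable_cong_sets sets_pair_measure_cong)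
 have [measurable]: "c : borel_measurable borel" using c by (rule borel_measurable_continuous_onI)
 have [measurable]: "(%ze. em ((ep *. ze) \<bullet> rvec x)) : borel_measurable borel"
  by (intro borel_measurable_continuous_onI continuous_intros)
 have "f = (%wa. indicator (cbox p q) (fst wa) *. (c (fst wa) * (em ((ep *. fst wa) \<bullet> rvec x) * W (fst wa, T x (snd wa)))))"
  by (auto simp: f_def W_def fun_eq_iff)
 hence fm [measurable]: "f : borel_measurable (lborel \<Otimes>\<^sub>M M)" by simp
 have lT: "l2 M (%w. wd xi n (T x w))" and nT: "nn M (%w. wd xi n (T x w)) <= 1" for xi
  using nn_T[OF l2_wd, of xi n x] nn_wd[of xi n] by (auto intro: l2_T l2_wd)
 have If: "integrable (lborel \<Otimes>\<^sub>M M) f"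
 proof (rule P.Fubini_integrable[OF fm])
  have ic: "integrable lborel (%ze. indicator (cbox p q) ze *. c ze)"
  by (intro borel_integrable_compact compact_cbox continuous_on_subset[OF c]) auto
  show "integrable lborel (%ze. \<integral>w. norm (f (ze, w)) \<partial>M)"
  proof (rule Bochner_Integration.integrable_bound[OF ic])
  show "AE ze in lborel. norm (\<integral>w. norm (f (ze, w)) \<partial>M) <= norm (indicator (cbox p q) ze *. c ze)"
  proof (rule AE_I2)
  fix ze
  have "(\<integral>w. norm (f (ze, w)) \<partial>M) = norm (indicator (cbox p q) ze *. c ze) * expectation (%w. norm (wd (ep *. ze) n (T x w)))"
  by (simp add: f_def norm_mult)
  also have "... <= norm (indicator (cbox p q) ze *. c ze) * 1"
  using order_trans[OF expectation_norm_le_nn[OF lT] nT] by (intro mult_left_mono) auto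
  finally show "norm (\<integral>w. norm (f (ze, w)) \<partial>M) <= norm (indicator (cbox p q) ze *. c ze)" by simp
  qed
  qed measurable
  show "AE ze in lborel. integrable M (%w. f (ze, w))"
  unfolding f_def using l2_integrable[OF lT] by (intro AE_I2) simp
 qed
 have e: "cr (dsol T S a h w n x) = (\<integral>ze. f (ze, w) \<partial>lborel)" if "w : space M" for w
  unfolding f_def by (simp add: dsol_fourier[OF that])
 have "integrable M (%w. \<integral>ze. f (ze, w) \<partial>lborel)" using P.integrable_snd[of "%x y. f (x, y)"] If by simp
 hence ii: "integrable M (%w. cr (dsol T S a h w n x))"
  by (rule Bochner_Integration.integrable_cong[THEN iffD1, rotated -1]) (simp_all add: e)
 show "integrable M (%w. dsol T S a h w n x)" using integrable_bounded_linear[OF bounded_linear_Re ii] by simp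
 have "cr (\<integral>w. dsol T S a h w n x \<partial>M) = (\<integral>w. cr (dsol T S a h w n x) \<partial>M)" by simp
 also have "... = (\<integral>w. (\<integral>ze. f (ze, w) \<partial>lborel) \<partial>M)" by (intro Bochner_Integration.integral_cong refl e)
 also have "... = (\<integral>ze. (\<integral>w. f (ze, w) \<partial>M) \<partial>lborel)" using P.Fubini_integral[of "%x y. f (x, y)"] If by simp
 also have "... = (\<integral>ze. indicator (cbox p q) ze *. (c ze * (em ((ep *. ze) \<bullet> rvec x) * expectation (wd (ep *. ze) n))) \<partial>lborel)"
  by (simp add: f_def expectation_T[OF l2_wd])
 finally show "cr (\<integral>w. dsol T S a h w n x \<partial>M) =
  (\<integral>ze. indicator (cbox p q) ze *. (c ze * (em ((ep *. ze) \<bullet> rvec x) * expectation (wd (ep *. ze) n))) \<partial>lborel)" .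
qed

end

end

section \<open>Convergence of the Euler scheme to the continuous solution\<close>

lemma Lop_bound:
 fixes v :: "int^'d::finite => real"
 assumes A: "!!y i j. \<bar>A y $ i $ j\<bar> <= L" and v: "!!y. \<bar>v y\<bar> <= K"
 shows "\<bar>Lop A v x\<bar> <= 4 * (real CARD('d))^2 * L * K"
proof -
 have L0: "0 <= L" by (rule order_trans[OF abs_ge_zero A])
 have f: "\<bar>flux A v y $ i\<bar> <= real CARD('d) * (L * (2 * K))" for y i
 proof -
  have "\<bar>flux A v y $ i\<bar> <= (SUM j:UNIV. \<bar>A y $ i $ j * (v (y + ue j) - v y)\<bar>)"
  unfolding flux_def matrix_vector_mult_def by (simp add: sum_abs)
  also have "... <= (SUM j:(UNIV::'d set). L * (2 * K))"
  proof (rule sum_mono)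
  fix j
  have "\<bar>v (y + ue j) - v y\<bar> <= 2 * K" using v[of "y + ue j"] v[of y] by (simp add: abs_le_iff)
  thus "\<bar>A y $ i $ j * (v (y + ue j) - v y)\<bar> <= L * (2 * K)" unfolding abs_mult using A L0 by (intro mult_mono) auto
  qed
  finally show ?thesis by simp
 qed
 have "\<bar>Lop A v x\<bar> <= (SUM i:UNIV. \<bar>flux A v (x - ue i) $ i - flux A v x $ i\<bar>)" unfolding Lop_def by (rule sum_abs)
 also have "... <= (SUM i:(UNIV::'d set). 2 * (real CARD('d) * (L * (2 * K))))"
 proof (rule sum_mono)
  fix i show "\<bar>flux A v (x - ue i) $ i - flux A v x $ i\<bar> <= 2 * (real CARD('d) * (L * (2 * K)))"
  using f[of "x - ue i" i] f[of x i] by linarith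
 qed
 finally show ?thesis by (simp add: power2_eq_square mult_ac)
qed

lemma Lop_diff: "Lop A (%y. v y - wa y) x = Lop A v x - Lop A wa x"
 by (simp add: Lop_def flux_def matrix_vector_mult_def algebra_simps sum_subtractf sum.distrib)

context cont
begin

lemma abar_has_integral:
 assumes wa: "w : space M"
 shows "((%s. a (S s w) $ i $ j) has_integral abar h w $ i $ j) {0..h}"
proof -
 have m: "(%s. a (S s w) $ i $ j) : borel_measurable borel" by (rule a_entry_meas1[OF wa])
 have si: "set_integrable lborel {0..h} (%s. a (S s w) $ i $ j)"
  using a_entry_integrable[OF wa, of 0 h i j] unfolding set_integrable_def iv_def by (subst (asm) integrable_density) (auto simp: m)
 have "abar h w $ i $ j = set_lebesgue_integral lborel {0..h} (%s. a (S s w) $ i $ j)"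
  unfolding abar_def vec_lambda_beta set_lebesgue_integral_def iv_def by (subst integral_density) (auto simp: m)
 thus ?thesis using set_borel_integral_eq_integral[OF si] by (simp add: has_integral_iff)
qed

lemma abar_has_integral_shift:
 assumes wa: "w : space M"
 shows "((%s. a (S s w) $ i $ j) has_integral abar h (S t w) $ i $ j) {t..t + h}"
proof -
 have "((%s. a (S (1 *. s + - t) (S t w)) $ i $ j) has_integral (1 / \<bar>1\<bar> ^ DIM(real)) *. abar h (S t w) $ i $ j) ((%x. (1 / 1) *. x + - ((1 / 1) *. - t)) ` cbox 0 h)"
  by (rule has_integral_affinity) (use abar_has_integral[OF S_space[OF wa]] in auto)
 moreover have "S (1 *. s + - t) (S t w) = S s w" for s using S_plus[OF wa, of "s + - t" t] by simp
 ultimately show ?thesis by (simp add: image_add_atLeastAtMost' add.commute)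
qed

lemma Lop_has_integral:
 assumes wa: "w : space M"
 shows "((%s. Lop (%y. a (T y (S s w))) v x) has_integral Lop (%y. abar h (T y (S t w))) v x) {t..t + h}"
proof -
 have 1: "((%s. a (T y (S s w)) $ i $ j) has_integral abar h (T y (S t w)) $ i $ j) {t..t + h}" for y i j
  using abar_has_integral_shift[OF T_space[OF wa], of y i j h t] by (simp add: S_T[OF wa])
 show ?thesis
  unfolding Lop_def flux_def matrix_vector_mult_def vec_lambda_beta
  by (intro has_integral_sum has_integral_diff has_integral_mult_left finite 1)
qed

definition Kb :: real where "Kb = 4 * (real CARD('d))^2 * L"

lemma Kb_nonneg: "0 <= Kb" using L_pos by (simp add: Kb_def)

lemma Lop_a_bound: "w : space M ==> (!!y. \<bar>v y\<bar> <= K) ==> \<bar>Lop (%y. a (T y (S s w))) v x\<bar> <= Kb * K"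
 unfolding Kb_def
proof (rule Lop_bound)
 fix y i j assume wa: "w : space M"
 show "\<bar>a (T y (S s w)) $ i $ j\<bar> <= L" using a_entry[OF T_space[OF wa, of y], where s = s and i = i and j = j] by (simp add: S_T[OF wa])
qed

lemma Lop_abar_bound:
 assumes wa: "w : space M" and h: "0 < h" and v: "!!y. \<bar>v y\<bar> <= K"
 shows "\<bar>Lop (%y. abar h (T y (S s w))) v x\<bar> <= Kb * h * K"
proof -
 have "\<bar>abar h (T y (S s w)) $ i $ j\<bar> <= L * h" for y i j
  using coeff_ok_abar[of h] h lL L_pos T_space[OF S_space[OF wa, of s], of y]
  by (intro ellip_entry[of "l * h"]) (auto simp: coeff_ok_ellip)
 from Lop_bound[of "%y. abar h (T y (S s w))", OF this v] show ?thesis by (simp add: Kb_def mult_ac)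
qed

lemma csol_increment:
 assumes u: "is_csol M T S a h0 u" and wa: "w : space M" and t: "0 <= t" "t <= r"
 shows "((%s. Lop (%y. a (T y (S s w))) (%y. u y s w) x) has_integral (u x t w - u x r w)) {t..r}"
proof -
 let ?G = "%s. Lop (%y. a (T y (S s w))) (%y. u y s w) x"
 have I: "(?G has_integral (h0 x - u x r w)) {0..r}" if "0 <= r" for r using u wa that unfolding is_csol_def by blast
 have r0: "0 <= r" using t by simp
 have "?G integrable_on {t..r}"
  using integrable_on_subinterval[OF has_integral_integrable[OF I[OF r0]], of t r] t by auto
 then obtain i where i: "(?G has_integral i) {t..r}" by (auto simp: integrable_on_def)
 have "(?G has_integral (h0 x - u x t w + i)) {0..r}" by (rule has_integral_combine[OF t I[OF t(1)] i])
 hence "h0 x - u x t w + i = h0 x - u x r w" using I[OF r0] by (rule has_integral_unique)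
 hence "i = u x t w - u x r w" by simp
 thus ?thesis using i by simp
qed

lemma integral_bound_Icc:
 assumes "(f has_integral i) {p..q::real}" "p <= q" "!!s. p <= s ==> s <= q ==> \<bar>f s\<bar> <= B" "0 <= (B::real)"
 shows "\<bar>i\<bar> <= B * (q - p)"
 using has_integral_bound[of B f i p q] assms by (simp add: cbox_interval)

text \<open>\<open>abar\<close> integrates the coefficient exactly, so the only error comes from
  freezing u over the step. There u moves by at most Kb C h, and applying the operator over time h
  adds another factor Kb h.\<close>

lemma euler_local_error:
 assumes u: "is_csol M T S a h0 u" and wa: "w : space M" and C: "!!x t. 0 <= t ==> \<bar>u x t w\<bar> <= C" and t: "0 <= t" and h: "0 < h"
 shows "\<bar>u x (t + h) w - (u x t w - Lop (%y. abar h (T y (S t w))) (%y. u y t w) x)\<bar> <= Kb * (Kb * C * h) * h"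
proof -
 have C0: "0 <= C" by (rule order_trans[OF abs_ge_zero C[of 0]]) simp
 have inc: "\<bar>u y s w - u y t w\<bar> <= Kb * C * h" if s: "t <= s" "s <= t + h" for y s
 proof -
  have "\<bar>u y t w - u y s w\<bar> <= (Kb * C) * (s - t)"
  by (rule integral_bound_Icc[OF csol_increment[OF u wa t s(1)] s(1)]) (use t C C0 Kb_nonneg in \<open>auto intro!: Lop_a_bound[OF wa]\<close>)
  also have "... <= Kb * C * h" using s C0 Kb_nonneg by (intro mult_left_mono) auto
  finally show ?thesis by (simp add: abs_minus_commute)
 qed
 have th: "t <= t + h" using h by simp
 have "\<bar>(u x t w - u x (t + h) w) - Lop (%y. abar h (T y (S t w))) (%y. u y t w) x\<bar> <= Kb * (Kb * C * h) * ((t + h) - t)"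
 proof (rule integral_bound_Icc[OF has_integral_diff[OF csol_increment[OF u wa t th] Lop_has_integral[OF wa]] th])
  fix s assume s: "t <= s" "s <= t + h"
  show "\<bar>Lop (%y. a (T y (S s w))) (%y. u y s w) x - Lop (%y. a (T y (S s w))) (%y. u y t w) x\<bar> <= Kb * (Kb * C * h)"
  unfolding Lop_diff[symmetric] by (rule Lop_a_bound[OF wa inc[OF s]])
 qed (use C0 Kb_nonneg h in simp)
 thus ?thesis by (simp add: abs_minus_commute algebra_simps)
qed

abbreviation euler_dsol :: "real => (int^'d => real) => 'w => nat => int^'d => real" where
 "euler_dsol h \<equiv> dsol T (%n. S (real_of_int n * h)) (abar h)"

text \<open>Discrete Gronwall: each step adds the local error and amplifies the earlier one by at
  most 1 + Kb h.\<close>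

lemma euler_error:
 assumes u: "is_csol M T S a h0 u" and wa: "w : space M" and C: "!!x t. 0 <= t ==> \<bar>u x t w\<bar> <= C" and h: "0 < h"
 shows "\<bar>u x (real n * h) w - euler_dsol h h0 w n x\<bar> <= real n * (Kb * (Kb * C * h) * h) * (1 + Kb * h) ^ n"
proof (induction n arbitrary: x)
 case 0
 have "u x 0 w = h0 x" using u wa unfolding is_csol_def by blast
 thus ?case by simp
next
 case (Suc n)
 define E where "E = Kb * (Kb * C * h) * h"
 define q where "q = 1 + Kb * h"
 have q: "1 <= q" using Kb_nonneg h by (simp add: q_def)
 have C0: "0 <= C" by (rule order_trans[OF abs_ge_zero C[of 0]]) simp
 have E0: "0 <= E" using Kb_nonneg h C0 by (simp add: E_def)
 let ?d = "%y. u y (real n * h) w - euler_dsol h h0 w n y"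
 let ?A = "%y. abar h (T y (S (real n * h) w))"
 have b: "\<bar>?d y\<bar> <= real n * E * q ^ n" for y using Suc[of y] by (simp add: E_def q_def)
 have "\<bar>Lop ?A ?d x\<bar> <= Kb * h * (real n * E * q ^ n)" by (rule Lop_abar_bound[OF wa h b])
 hence L1: "\<bar>Lop ?A (%y. u y (real n * h) w) x - Lop ?A (euler_dsol h h0 w n) x\<bar> <= Kb * h * (real n * E * q ^ n)"
  unfolding Lop_diff .
 have loc: "\<bar>u x (real n * h + h) w - (u x (real n * h) w - Lop ?A (%y. u y (real n * h) w) x)\<bar> <= E"
  unfolding E_def using h by (intro euler_local_error[OF u wa C]) auto
 have "\<bar>u x (real n * h + h) w - (euler_dsol h h0 w n x - Lop ?A (euler_dsol h h0 w n) x)\<bar> <= E + real n * E * q ^ n + Kb * h * (real n * E * q ^ n)"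
  using loc L1 b[of x] by linarith
 also have "... = E * 1 + real n * E * q ^ Suc n" by (simp add: q_def algebra_simps)
 also have "... <= E * q ^ Suc n + real n * E * q ^ Suc n" using q E0 one_le_power[OF q, of "Suc n"] by (intro add_right_mono mult_left_mono)
 also have "... = real (Suc n) * E * q ^ Suc n" by (simp add: algebra_simps)
 finally show ?case by (simp add: E_def q_def algebra_simps)
qed

lemma one_plus_power_le: "0 <= K ==> 0 < t ==> 0 < N ==> (1 + K * (t / real N)) ^ N <= exp (K * t)" for K t :: real
proof -
 assume *: "0 <= K" "0 < t" "0 < N"
 have "(1 + K * (t / real N)) ^ N <= exp (K * (t / real N)) ^ N" using * exp_ge_add_one_self by (intro power_mono) auto
 also have "... = exp (K * t)" using * by (simp add: exp_of_nat_mult[symmetric])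
 finally show ?thesis .
qed

lemma euler_tendsto:
 assumes u: "is_csol M T S a h0 u" and wa: "w : space M" and t: "0 < t"
 shows "(%N. euler_dsol (t / real N) h0 w N x) \<longlonglongrightarrow> u x t w"
proof -
 obtain C where C: "!!x t. 0 <= t ==> \<bar>u x t w\<bar> <= C" using u wa unfolding is_csol_def by blast
 have C0: "0 <= C" by (rule order_trans[OF abs_ge_zero C[of 0]]) simp
 define R where "R = Kb * (Kb * C * t) * t * exp (Kb * t)"
 have "(%N. R / real N) \<longlonglongrightarrow> 0" by (rule lim_const_over_n)
 moreover have "\<forall>\<^sub>F N in sequentially. norm (euler_dsol (t / real N) h0 w N x - u x t w) <= R / real N"
  using eventually_gt_at_top[of "0::nat"]
 proof eventually_elim
  case (elim N)
  have h: "0 < t / real N" using t elim by simp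
  have e: "real N * (t / real N) = t" using elim by simp
  have "\<bar>u x t w - euler_dsol (t / real N) h0 w N x\<bar> <= real N * (Kb * (Kb * C * (t / real N)) * (t / real N)) * (1 + Kb * (t / real N)) ^ N"
  using euler_error[OF u wa C h, of x N] unfolding e by simp
  also have "... <= real N * (Kb * (Kb * C * (t / real N)) * (t / real N)) * exp (Kb * t)"
  using Kb_nonneg C0 t by (intro mult_left_mono one_plus_power_le elim) auto
  also have "... = R / real N" using elim by (simp add: R_def field_simps)
  finally show ?case by (simp add: abs_minus_commute)
 qed
 ultimately have "(%N. euler_dsol (t / real N) h0 w N x - u x t w) \<longlonglongrightarrow> 0" by (rule Lim_null_comparison[rotated])
 thus ?thesis by (rule LIM_zero_cancel)
qed

text \<open>Independent of w, in contrast to the error bound, whose constant C belongs to a single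
  w. It supplies the dominating function in \<open>expectation_csol\<close>.\<close>

lemma euler_dsol_bound:
 assumes wa: "w : space M" and h: "0 < h" and H: "!!x. \<bar>h0 x\<bar> <= H"
 shows "\<bar>euler_dsol h h0 w n x\<bar> <= H * (1 + Kb * h) ^ n"
proof (induction n arbitrary: x)
 case (Suc n)
 have "\<bar>Lop (%y. abar h (T y (S (real_of_int (int n) * h) w))) (euler_dsol h h0 w n) x\<bar> <= Kb * h * (H * (1 + Kb * h) ^ n)"
  by (rule Lop_abar_bound[OF wa h Suc])
 thus ?case using Suc[of x] by (simp add: algebra_simps abs_le_iff)
qed (use H in simp)

text \<open>Set to 0 when the step is too long for stability, so that the bound by 1 holds for every
  N. N = 0 is excluded explicitly, because t / 0 = 0 would pass the stability test.\<close>

definition euler_F :: "real => nat => real^'d => complex" where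
 "euler_F t N xi = (if 4 * real CARD('d) * (L * (t / real N)) <= 1 & 0 < N then expectation (euler_wd (t / real N) xi N) else 0)"

lemma eventually_stable: "\<forall>\<^sub>F N in sequentially. 4 * real CARD('d) * (L * (t / real N)) <= 1 & 0 < N"
proof -
 have "(%N. (4 * real CARD('d) * L * t) / real N) \<longlonglongrightarrow> 0" by (rule lim_const_over_n)
 hence "\<forall>\<^sub>F N in sequentially. (4 * real CARD('d) * L * t) / real N < 1" by (rule order_tendstoD) simp
 with eventually_gt_at_top[of "0::nat"] show ?thesis by eventually_elim (simp add: mult_ac)
qed

lemma euler_F_props:
 assumes t: "0 < t"
 shows "(%ze. euler_F t N (ep *. ze)) : borel_measurable borel" "cmod (euler_F t N xi) <= 1"
proof -
 have "(%ze. euler_F t N (ep *. ze)) : borel_measurable borel & cmod (euler_F t N xi) <= 1"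
 proof (cases "4 * real CARD('d) * (L * (t / real N)) <= 1 & 0 < N")
  case True
  hence h: "0 < t / real N" "4 * real CARD('d) * (L * (t / real N)) <= 1" using t by auto
  interpret D: disc M T "%n::int. S (real_of_int n * (t / real N))" "abar (t / real N)" "l * (t / real N)" "L * (t / real N)"
  by (rule disc_euler[OF h])
  show ?thesis
  unfolding euler_F_def using True D.measurable_expectation_wd D.cmod_expectation_wd by simp
 next
  case False
  thus ?thesis unfolding euler_F_def by (simp only: if_False) simp
 qed
 thus "(%ze. euler_F t N (ep *. ze)) : borel_measurable borel" "cmod (euler_F t N xi) <= 1" by auto
qed

text \<open>Dominated convergence for the Euler solutions, which converge for each w.
  \<open>is_csol\<close> does not mention measurability of u in w; it is obtained here from the
  approximations.\<close>

lemma expectation_csol: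
 assumes u: "is_csol M T S a h0 u" and H: "!!x. \<bar>h0 x\<bar> <= H" and t: "0 < t" and c: "continuous_on UNIV c"
  and rep: "!!x. cr (h0 x) = (\<integral>ze. indicator (cbox p q) ze *. (c ze * em ((ep *. ze) \<bullet> rvec x)) \<partial>lborel)"
 shows "(%N. \<integral>ze. indicator (cbox p q) ze *. (c ze * (em ((ep *. ze) \<bullet> rvec x) * euler_F t N (ep *. ze))) \<partial>lborel)
  \<longlonglongrightarrow> cr (\<integral>w. u x t w \<partial>M)"
proof -
 define G where "G N \<longleftrightarrow> 4 * real CARD('d) * (L * (t / real N)) <= 1 & 0 < N" for N :: nat
 have G: "\<forall>\<^sub>F N in sequentially. G N" unfolding G_def by (rule eventually_stable)
 define s where "s N w = (if G N then euler_dsol (t / real N) h0 w N x else 0)" for N w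
 have rep': "integrable M (%w. euler_dsol (t / real N) h0 w N x)"
  "cr (\<integral>w. euler_dsol (t / real N) h0 w N x \<partial>M) = (\<integral>ze. indicator (cbox p q) ze *. (c ze * (em ((ep *. ze) \<bullet> rvec x) * euler_F t N (ep *. ze))) \<partial>lborel)"
  if "G N" for N
 proof -
  have h: "0 < t / real N" "4 * real CARD('d) * (L * (t / real N)) <= 1" using that t by (auto simp: G_def)
  interpret D: disc M T "%n::int. S (real_of_int n * (t / real N))" "abar (t / real N)" "l * (t / real N)" "L * (t / real N)"
  by (rule disc_euler[OF h])
  show "integrable M (%w. euler_dsol (t / real N) h0 w N x)" by (rule D.expectation_dsol(1)[OF c rep])
  show "cr (\<integral>w. euler_dsol (t / real N) h0 w N x \<partial>M) = (\<integral>ze. indicator (cbox p q) ze *. (c ze * (em ((ep *. ze) \<bullet> rvec x) * euler_F t N (ep *. ze))) \<partial>lborel)"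
  unfolding D.expectation_dsol(2)[OF c rep] using that by (simp add: euler_F_def G_def)
 qed
 have sm: "s N : borel_measurable M" for N
  using borel_measurable_integrable[OF rep'(1), of N] by (cases "G N") (simp_all add: s_def[abs_def])
 have lim: "(%N. s N w) \<longlonglongrightarrow> u x t w" if wa: "w : space M" for w
 proof (rule Lim_transform_eventually[OF euler_tendsto[OF u wa t]])
  show "\<forall>\<^sub>F N in sequentially. euler_dsol (t / real N) h0 w N x = s N w" using G by eventually_elim (simp add: s_def)
 qed
 have H0: "0 <= H" by (rule order_trans[OF abs_ge_zero H])
 have "(%N. \<integral>w. s N w \<partial>M) \<longlonglongrightarrow> (\<integral>w. u x t w \<partial>M)"
 proof (rule integral_dominated_convergence[where w = "%_. H * exp (Kb * t)"])
  show "u x t : borel_measurable M" by (rule borel_measurable_LIMSEQ_real[OF lim sm])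
  show "AE w in M. (%N. s N w) \<longlonglongrightarrow> u x t w" by (rule AE_I2) (rule lim)
  show "AE w in M. norm (s N w) <= H * exp (Kb * t)" for N
  proof (rule AE_I2)
  fix w assume wa: "w : space M"
  show "norm (s N w) <= H * exp (Kb * t)"
  proof (cases "G N")
  case True
  hence N: "0 < N" by (simp add: G_def)
  hence "0 < t / real N" using t by simp
  from euler_dsol_bound[OF wa this H, where n = N and x = x] have "\<bar>s N w\<bar> <= H * (1 + Kb * (t / real N)) ^ N" using True by (simp add: s_def)
  also have "... <= H * exp (Kb * t)" using H0 by (intro mult_left_mono one_plus_power_le Kb_nonneg t N)
  finally show ?thesis by simp
  qed (use H0 in \<open>simp add: s_def\<close>)
  qed
 qed (simp_all add: sm)
 hence "(%N. cr (\<integral>w. s N w \<partial>M)) \<longlonglongrightarrow> cr (\<integral>w. u x t w \<partial>M)" by (intro tendsto_of_real)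
 thus ?thesis
 proof (rule Lim_transform_eventually)
  show "\<forall>\<^sub>F N in sequentially. cr (\<integral>w. s N w \<partial>M) = (\<integral>ze. indicator (cbox p q) ze *. (c ze * (em ((ep *. ze) \<bullet> rvec x) * euler_F t N (ep *. ze))) \<partial>lborel)"
  using G by eventually_elim (simp only: rep'(2)[symmetric] s_def if_True)
 qed
qed

end

section \<open>The maximum principle for the heat equation\<close>

lemma partial_along:
 fixes f :: "real^'d::finite => real"
 assumes "!!i y. ((%s. f (y + s *. axis i 1)) has_real_derivative f' i y) (at 0)"
 shows "((%s. f (y + s *. axis i 1)) has_real_derivative f' i (y + s *. axis i 1)) (at s)"
proof -
 have "((%r. f (y + (r + s) *. axis i 1)) has_real_derivative f' i (y + s *. axis i 1)) (at 0)"
  using assms[of "y + s *. axis i 1" i] by (simp add: scaleR_add_left add_ac)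
 thus ?thesis
  using DERIV_shift[of "%s. f (y + s *. axis i 1)" "f' i (y + s *. axis i 1)" 0 s] by simp
qed

text \<open>Coordinates are added one at a time, each time by the two-variable criterion with one
  continuous partial derivative. \<open>heat_sol\<close> and \<open>smooth_fun\<close> provide
  partial derivatives only, while derivatives along arbitrary directions are required at a
  maximum.\<close>

lemma has_derivative_of_partials:
 fixes fi :: "real^'d::finite => real"
 assumes d: "!!i y. ((%s. fi (y + s *. axis i 1)) has_real_derivative g i y) (at 0)"
  and c: "!!i. continuous_on UNIV (g i)"
 shows "(fi has_derivative (%h. SUM i:UNIV. h $ i * g i x)) (at x)"
proof -
 note sh = partial_along[OF d]
 have bl: "blinfun_apply (blinfun_scaleR_left r) = (*) r" for r :: real by (simp add: fun_eq_iff mult.commute)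
 have P: "((%h. fi (x + (SUM i:I. h $ i *. axis i 1))) has_derivative (%h. SUM i:I. h $ i * g i x)) (at 0)" if "finite I" for I :: "'d set"
  using that
 proof induction
  case (insert j I)
  let ?f = "%(h::real^'d) s. fi (x + (SUM i:I. h $ i *. axis i 1) + s *. axis j 1)"
  let ?gj = "%(h::real^'d) s. g j (x + (SUM i:I. h $ i *. axis i 1) + s *. axis j 1)"
  have cg: "continuous_on UNIV (%p::(real^'d) \<times> real. g j (x + (SUM i:I. fst p $ i *. axis i 1) + snd p *. axis j 1))"
  by (rule continuous_on_compose2[OF c[of j]]) (auto intro!: continuous_intros)
  have "((%(h, s). ?f h s) has_derivative (%(th, ts). (SUM i:I. th $ i * g i x) + blinfun_apply (blinfun_scaleR_left (?gj 0 0)) ts)) (at (0, 0) within UNIV \<times> UNIV)"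
  proof (rule has_derivative_partialsI)
  show "((%h. ?f h 0) has_derivative (%h. SUM i:I. h $ i * g i x)) (at 0 within UNIV)" using insert.IH by simp
  show "((%s. ?f h s) has_derivative blinfun_apply (blinfun_scaleR_left (?gj h s))) (at s within UNIV)" for h s
  unfolding bl has_field_derivative_def[symmetric] UNIV_I using sh[of "x + (SUM i:I. h $ i *. axis i 1)" j s] .
  have "continuous (at (0,0)) (%p. blinfun_scaleR_left (g j (x + (SUM i:I. fst p $ i *. axis i 1) + snd p *. axis j 1)))"
  by (intro bounded_linear.continuous[OF bounded_linear_blinfun_scaleR_left]) (use cg in \<open>simp add: continuous_on_eq_continuous_at\<close>)
  thus "continuous (at (0, 0) within UNIV \<times> UNIV) (%(h, s). blinfun_scaleR_left (?gj h s))"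
  unfolding case_prod_beta' UNIV_Times_UNIV .
  qed auto
  hence D: "((%(h, s). ?f h s) has_derivative (%(th, ts). (SUM i:I. th $ i * g i x) + ts * g j x)) (at (0, 0))"
  by simp
  have "((%h::real^'d. (h, h $ j)) has_derivative (%h. (h, h $ j))) (at 0)"
  by (intro has_derivative_Pair has_derivative_ident bounded_linear_imp_has_derivative bounded_linear_vec_nth)
  from has_derivative_compose[OF this, of "%(h, s). ?f h s" "%(th, ts). (SUM i:I. th $ i * g i x) + ts * g j x"] D
  show ?case using insert.hyps by (simp add: add_ac)
 qed (simp add: has_derivative_const)
 have e: "(SUM i:UNIV. h $ i *. axis i 1) = h" for h :: "real^'d"
  by (simp add: vec_eq_iff axis_def if_distrib cong: if_cong)
 have "((%h. fi (x + h)) has_derivative (%h. SUM i:UNIV. h $ i * g i x)) (at 0)" using P[of UNIV] by (simp add: e)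
 moreover have "((%y. y - x) has_derivative (%h. h)) (at x)" by (auto intro!: derivative_eq_intros)
 ultimately show ?thesis using has_derivative_compose[of "%y. y - x" "%h. h" x UNIV "%h. fi (x + h)"] by simp
qed

text \<open>The second-order increment over a square of side s equals s^2 times either mixed
  derivative at some nearby point, by the mean value theorem in both orders. If the two differed at
  x, continuity would be violated for small s.\<close>

lemma mixed_partials:
 fixes fi :: "real^'d::finite => real"
 assumes d: "!!i y. ((%s. fi (y + s *. axis i 1)) has_real_derivative g i y) (at 0)"
  and d2: "!!i j y. ((%s. g j (y + s *. axis i 1)) has_real_derivative H i j y) (at 0)"
  and c: "!!i j. continuous_on UNIV (H i j)"
 shows "H i j x = H j i x"
proof (rule ccontr)
 note sh = partial_along
 have P: "EX p. dist p x <= 2 * s & fi (x + s *. axis i 1 + s *. axis j 1) - fi (x + s *. axis i 1) - (fi (x + s *. axis j 1) - fi x) = s * (s * H i j p)"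
  if s: "0 < s" for s i j
 proof -
  have "EX z>0. z < s & (fi (x + s *. axis i 1 + s *. axis j 1) - fi (x + s *. axis j 1)) - (fi (x + s *. axis i 1 + 0 *. axis j 1) - fi (x + 0 *. axis j 1))
  = (s - 0) * (g j (x + s *. axis i 1 + z *. axis j 1) - g j (x + z *. axis j 1))"
  by (rule MVT2[OF s]) (intro DERIV_diff sh[OF d])
  then obtain z where z: "0 < z" "z < s" "fi (x + s *. axis i 1 + s *. axis j 1) - fi (x + s *. axis i 1) - (fi (x + s *. axis j 1) - fi x)
  = s * (g j (x + s *. axis i 1 + z *. axis j 1) - g j (x + z *. axis j 1))" by (auto simp: algebra_simps)
  have "EX r>0. r < s & g j (x + z *. axis j 1 + s *. axis i 1) - g j (x + z *. axis j 1 + 0 *. axis i 1) = (s - 0) * H i j (x + z *. axis j 1 + r *. axis i 1)"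
  by (rule MVT2[OF s]) (rule sh[OF d2])
  then obtain r where r: "0 < r" "r < s" "g j (x + s *. axis i 1 + z *. axis j 1) - g j (x + z *. axis j 1) = s * H i j (x + z *. axis j 1 + r *. axis i 1)"
  by (auto simp: add_ac)
  have "dist (x + z *. axis j 1 + r *. axis i 1) x <= norm (z *. axis j (1::real)) + norm (r *. axis i (1::real))"
  unfolding dist_norm using norm_triangle_ineq[of "z *. axis j 1" "r *. axis i (1::real)"] by (simp add: algebra_simps)
  also have "... <= 2 * s" using z r by simp
  finally show ?thesis using z(3) r(3) by (intro exI[of _ "x + z *. axis j 1 + r *. axis i 1"]) simp
 qed
 assume ne: "H i j x ~= H j i x"
 define e where "e = \<bar>H i j x - H j i x\<bar> / 2"
 have e: "0 < e" using ne by (simp add: e_def)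
 have cd: "EX d>0. ALL p. dist p x < d --> \<bar>H i j p - H i j x\<bar> < e" for i j
  using c[of i j] e unfolding continuous_on_iff dist_real_def by blast
 obtain d1 where d1: "0 < d1" "!!p. dist p x < d1 ==> \<bar>H i j p - H i j x\<bar> < e" using cd[of i j] by blast
 obtain d2 where d2': "0 < d2" "!!p. dist p x < d2 ==> \<bar>H j i p - H j i x\<bar> < e" using cd[of j i] by blast
 define s where "s = min d1 d2 / 4"
 have s: "0 < s" "2 * s < d1" "2 * s < d2" using d1(1) d2'(1) by (auto simp: s_def)
 obtain p where p: "dist p x <= 2 * s" "fi (x + s *. axis i 1 + s *. axis j 1) - fi (x + s *. axis i 1) - (fi (x + s *. axis j 1) - fi x) = s * (s * H i j p)"
  using P[OF s(1)] by blast
 obtain q where q: "dist q x <= 2 * s" "fi (x + s *. axis j 1 + s *. axis i 1) - fi (x + s *. axis j 1) - (fi (x + s *. axis i 1) - fi x) = s * (s * H j i q)"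
  using P[OF s(1)] by blast
 have sw: "x + s *. axis j 1 + s *. axis i 1 = x + s *. axis i 1 + s *. axis j (1::real)" by (simp add: add_ac)
 have "s * (s * H i j p) = s * (s * H j i q)" using p(2) q(2)[unfolded sw] by linarith
 hence "H i j p = H j i q" using s(1) by simp
 moreover have "\<bar>H i j p - H i j x\<bar> < e" "\<bar>H j i q - H j i x\<bar> < e"
  using p(1) q(1) s by (auto intro!: d1(2) d2'(2))
 ultimately show False unfolding e_def by (smt (verit) field_sum_of_halves)
qed

text \<open>Elimination of one index instead of diagonalisation: subtracting the rank-one part A i k
  A j k / A k k leaves a Schur complement, again positive semidefinite, on the remaining indices,
  and the rank-one part meets H in its quadratic form. If A k k = 0, semidefiniteness annihilates
  the whole row.\<close>

lemma trace_nonpos: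
 fixes A H :: "'i => 'i => real"
 assumes "finite I" and "!!i j. A i j = A j i"
  and "!!z. 0 <= (SUM i:I. SUM j:I. z i * z j * A i j)"
  and "!!z. (SUM i:I. SUM j:I. z i * z j * H i j) <= 0"
 shows "(SUM i:I. SUM j:I. A i j * H i j) <= 0"
 using assms
proof (induction I arbitrary: A rule: finite_induct)
 case (insert k I)
 note sym = insert.prems(1) and psd = insert.prems(2) and nsd = insert.prems(3)
 have ex: "(SUM i:insert k I. SUM j:insert k I. B i j) = B k k + (SUM j:I. B k j) + (SUM i:I. B i k) + (SUM i:I. SUM j:I. B i j)" for B :: "'i => 'i => real"
  using insert.hyps by (simp add: sum.distrib)
 have pk: "0 <= c * c * A k k + 2 * c * (SUM i:I. z i * A i k) + (SUM i:I. SUM j:I. z i * z j * A i j)" for c z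
 proof -
  have zi: "i : I ==> (if i = k then c else z i) = z i" for i using insert.hyps by auto
  have "0 <= (SUM i:insert k I. SUM j:insert k I. (if i = k then c else z i) * (if j = k then c else z j) * A i j)" by (rule psd)
  also have "... = c * c * A k k + (SUM j:I. c * z j * A k j) + (SUM i:I. z i * c * A i k) + (SUM i:I. SUM j:I. z i * z j * A i j)"
  unfolding ex by (simp add: zi cong: sum.cong)
  also have "(SUM j:I. c * z j * A k j) = c * (SUM i:I. z i * A i k)" by (simp add: sum_distrib_left sym[of k] mult_ac)
  also have "(SUM i:I. z i * c * A i k) = c * (SUM i:I. z i * A i k)" by (simp add: sum_distrib_left mult_ac)
  finally show ?thesis by simp
 qed
 have Akk: "0 <= A k k" using pk[of 1 "%_. 0"] by simp
 have HI: "(SUM i:I. SUM j:I. z i * z j * H i j) <= 0" for z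
 proof -
  have zi: "i : I ==> (if i = k then 0 else z i) = z i" for i using insert.hyps by auto
  have "(SUM i:insert k I. SUM j:insert k I. (if i = k then 0 else z i) * (if j = k then 0 else z j) * H i j) <= 0" by (rule nsd)
  thus ?thesis unfolding ex by (simp add: zi cong: sum.cong)
 qed
 show ?case
 proof (cases "A k k = 0")
  case True
  have Aik: "A i k = 0" if i: "i : I" for i
  proof (rule ccontr)
  assume n: "A i k ~= 0"
  have c1: "(if m = i then 1 else 0) * A m k = (if m = i then A i k else 0)" for m by simp
  have c2: "(SUM j:I. (if m = i then 1 else 0) * (if j = i then 1 else 0) * A m j) = (if m = i then A i i else 0)" for m
  proof -
  have "(if m = i then 1 else 0) * (if j = i then 1 else 0) * A m j = (if j = i then (if m = i then A i i else 0) else 0)" for j by simp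
  thus ?thesis using i insert.hyps by (simp only: sum.delta) simp
  qed
  have e: "(SUM m:I. (if m = i then 1 else 0) * A m k) = A i k" "(SUM m:I. SUM j:I. (if m = i then 1 else 0) * (if j = i then 1 else 0) * A m j) = A i i"
  unfolding c1 c2 using i insert.hyps by simp_all
  \<comment> \<open>At this multiple of the k-th unit vector plus the i-th one the form would take
    the value -1.\<close>
  show False using pk[of "- (A i i + 1) / (2 * A i k)" "%m. if m = i then 1 else 0"] n unfolding e True by (simp add: field_simps)
  qed
  have "(SUM i:I. SUM j:I. A i j * H i j) <= 0"
  by (rule insert.IH[OF sym _ HI]) (use pk[of 0] in simp)
  moreover have "A k i = 0" if "i : I" for i using Aik[OF that] sym[of k i] by simp
  ultimately show ?thesis unfolding ex by (simp add: True Aik)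
 next
  case False
  with Akk have p: "0 < A k k" by simp
  define A' where "A' i j = A i j - A i k * A j k / A k k" for i j
  have e2: "(SUM i:J. SUM j:J. (u i * u j) * wa) = (SUM i:J. u i)^2 * wa" for J :: "'i set" and u :: "'i => real" and wa
  proof -
  have "(SUM i:J. u i)^2 = (SUM i:J. SUM j:J. u i * u j)" by (simp add: power2_eq_square sum_product)
  thus ?thesis by (simp only: sum_distrib_right)
  qed
  have psd': "0 <= (SUM i:I. SUM j:I. z i * z j * A' i j)" for z
  proof -
  define b where "b = (SUM i:I. z i * A i k)"
  have "(SUM i:I. SUM j:I. z i * z j * A' i j) = (SUM i:I. SUM j:I. z i * z j * A i j) - (SUM i:I. SUM j:I. ((z i * A i k) * (z j * A j k)) * (1 / A k k))"
  unfolding sum_subtractf[symmetric] by (intro sum.cong refl) (simp add: A'_def algebra_simps)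
  also have "... = (SUM i:I. SUM j:I. z i * z j * A i j) - b^2 / A k k" unfolding e2 by (simp add: b_def)
  also have "... >= 0" using pk[of "- b / A k k" z] p by (simp add: b_def[symmetric] power2_eq_square)
  finally show ?thesis .
  qed
  have "(SUM i:I. SUM j:I. A' i j * H i j) <= 0"
  proof (rule insert.IH[OF _ psd' HI])
  show "A' i j = A' j i" for i j using sym[of i j] by (simp add: A'_def mult.commute)
  qed
  moreover have "(SUM i:insert k I. SUM j:insert k I. A' i j * H i j) = (SUM i:I. SUM j:I. A' i j * H i j)"
  proof -
  have "A' k j = 0" "A' j k = 0" for j using p sym[of k j] by (simp_all add: A'_def)
  thus ?thesis unfolding ex by simp
  qed
  moreover have "(SUM i:insert k I. SUM j:insert k I. A i j * H i j) = (SUM i:insert k I. SUM j:insert k I. A' i j * H i j)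
  + (SUM i:insert k I. SUM j:insert k I. A i k * A j k * H i j) / A k k"
  unfolding sum_divide_distrib sum.distrib[symmetric] by (intro sum.cong refl) (simp add: A'_def algebra_simps)
  moreover have "(SUM i:insert k I. SUM j:insert k I. A i k * A j k * H i j) / A k k <= 0"
  using nsd[of "%i. A i k"] p by (intro divide_nonpos_pos)
  ultimately show ?thesis by linarith
 qed
qed simp

text \<open>With c > 0 the derivative, which vanishes at 0, would be positive just to the right of
  0, and f would exceed f 0.\<close>

lemma second_derivative_at_max:
 fixes f :: "real => real"
 assumes d: "!!s. (f has_real_derivative f' s) (at s)" and d2: "(f' has_real_derivative c) (at 0)" and m: "!!s. f s <= f 0"
 shows "c <= 0"
proof (rule ccontr)
 assume "\<not> c <= 0"
 hence c: "0 < c" by simp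
 have z: "f' 0 = 0" by (rule DERIV_local_max[OF d[of 0], of 1]) (use m in auto)
 obtain e where e: "0 < e" "!!h. 0 < h ==> h < e ==> f' 0 < f' (0 + h)" using DERIV_pos_inc_right[OF d2 c] by auto
 obtain r where r: "0 < r" "r < e / 2" "f (e / 2) - f 0 = (e / 2 - 0) * f' r" using MVT2[of 0 "e / 2" f f'] d e(1) by auto
 have "0 < f' r" using e(2)[of r] r z by simp
 hence "0 < (e / 2 - 0) * f' r" using e(1) by simp
 thus False using r(3) m[of "e / 2"] by linarith
qed

text \<open>Subtracting the penalty de (|x|^2 + C t) makes a positive maximum over space and the
  time interval exist, since v is bounded. At this maximum the time derivative of v is at least de
  C, while the second-order part is at most 2 de times the trace of A, which is de (C - 1). The
  summand 1 in C is the contradiction.\<close>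

lemma heat_le:
 fixes A :: "real^'d::finite^'d"
 assumes h: "heat_sol A g v" and A: "!!z. 0 <= z \<bullet> (A *v z)" and g: "!!x. g x <= m" and t0: "0 <= t0"
 shows "v x0 t0 <= m"
proof (rule ccontr)
 assume "\<not> v x0 t0 <= m"
 hence gt: "m < v x0 t0" by simp
 obtain Dt Dx Dxx where
  dt: "!!x t. 0 < t ==> ((%s. v x s) has_real_derivative Dt x t) (at t)"
  and dx: "!!i x t. 0 < t ==> ((%s. v (x + s *. axis i 1) t) has_real_derivative Dx i x t) (at 0)"
  and dxx: "!!i j x t. 0 < t ==> ((%s. Dx j (x + s *. axis i 1) t) has_real_derivative Dxx i j x t) (at 0)"
  and cx: "!!i. continuous_on (UNIV \<times> {0<..}) (%(x, t). Dx i x t)"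
  and cxx: "!!i j. continuous_on (UNIV \<times> {0<..}) (%(x, t). Dxx i j x t)"
  and eq: "!!x t. 0 < t ==> Dt x t = (SUM i:UNIV. SUM j:UNIV. A $ i $ j * Dxx i j x t)"
  using h unfolding heat_sol_def by (elim conjE exE) blast
 obtain K where K: "!!x t. 0 <= t ==> v x t <= K" using h unfolding heat_sol_def by (auto simp: abs_le_iff)
 have v0: "v x 0 = g x" for x using h by (simp add: heat_sol_def)
 have cv: "continuous_on (UNIV \<times> {0..}) (%(x, t). v x t)" using h by (simp add: heat_sol_def)
 define C where "C = 2 * (SUM i:UNIV. A $ i $ i) + 1"
 have Aii: "0 <= A $ i $ i" for i using A[of "axis i 1"] by (simp add: inner_axis' matrix_vector_mult_basis column_def)
 have C: "1 <= C" unfolding C_def using sum_nonneg[of UNIV "%i. A $ i $ i"] Aii by simp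
 have t0': "0 < t0" using gt v0[of x0] g[of x0] t0 by (cases "t0 = 0") auto
 \<comment> \<open>At (x0, t0) the penalty then takes exactly half of the excess of v over
   m.\<close>
 define de where "de = (v x0 t0 - m) / (2 * ((norm x0)^2 + C * t0))"
 have den: "0 < (norm x0)^2 + C * t0" using C t0' by (simp add: add_nonneg_pos)
 have de: "0 < de" unfolding de_def using gt den by (intro divide_pos_pos mult_pos_pos) auto
 define wa where "wa x t = v x t - m - de * ((norm x)^2 + C * t)" for x t
 have "de * ((norm x0)^2 + C * t0) = (v x0 t0 - m) / 2"
 proof -
  have "(v x0 t0 - m) / (2 * X) * X = (v x0 t0 - m) / 2" if "0 < X" for X :: real using that by (simp add: field_simps)
  from this[OF den] show ?thesis by (simp only: de_def)
 qed
 note deX = this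
 have w0: "0 < wa x0 t0" unfolding wa_def deX using gt by simp
 define R where "R = norm x0 + (\<bar>K\<bar> + \<bar>m\<bar>) / de + 1"
 have R1: "1 <= R" "norm x0 <= R" "(\<bar>K\<bar> + \<bar>m\<bar>) / de < R" using de by (auto simp: R_def intro!: add_nonneg_nonneg divide_nonneg_nonneg add_nonneg_pos)
 have out: "wa x t < 0" if "R < norm x" "0 <= t" for x t
 proof -
  have "(\<bar>K\<bar> + \<bar>m\<bar>) / de < norm x * 1" using R1 that by simp
  also have "... <= norm x * norm x" using R1 that by (intro mult_left_mono) auto
  finally have "\<bar>K\<bar> + \<bar>m\<bar> < de * (norm x)^2" using de by (simp add: field_simps power2_eq_square)
  moreover have "0 <= de * (C * t)" using de C that by simp
  ultimately show ?thesis unfolding wa_def using K[OF that(2), of x] by (simp add: distrib_left)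
 qed
 have "compact (cball (0::real^'d) R \<times> {0..t0})" by (intro compact_Times) auto
 moreover have "cball (0::real^'d) R \<times> {0..t0} ~= {}" using R1 t0 by auto
 moreover have "continuous_on (cball 0 R \<times> {0..t0}) (%(x, t). wa x t)"
  unfolding wa_def case_prod_beta
  by (intro continuous_intros continuous_on_subset[OF cv[unfolded case_prod_beta]]) auto
 ultimately obtain p where p: "p : cball 0 R \<times> {0..t0}" "!!q. q : cball 0 R \<times> {0..t0} ==> (case q of (x, t) => wa x t) <= (case p of (x, t) => wa x t)"
  using continuous_attains_sup[of "cball 0 R \<times> {0..t0}" "%(x, t). wa x t"] by blast
 obtain x1 t1 where p1: "p = (x1, t1)" by (cases p)
 have t1: "0 <= t1" "t1 <= t0" and mx: "!!x t. norm x <= R ==> 0 <= t ==> t <= t0 ==> wa x t <= wa x1 t1"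
  using p unfolding p1 by (auto simp: dist_norm)
 have w1: "0 < wa x1 t1" using mx[of x0 t0] w0 R1 t0 by simp
 have t1p: "0 < t1"
 proof (rule ccontr)
  assume "\<not> 0 < t1"
  hence "t1 = 0" using t1 by simp
  hence "wa x1 t1 = g x1 - m - de * (norm x1)^2" by (simp add: wa_def v0)
  moreover have "0 <= de * (norm x1)^2" using de by simp
  ultimately have "wa x1 t1 <= 0" using g[of x1] by linarith
  thus False using w1 by simp
 qed
 have sp: "wa x t1 <= wa x1 t1" for x using mx[of x t1] out[of x t1] w1 t1 by (cases "norm x <= R") auto
 have Dtge: "de * C <= Dt x1 t1"
 proof (rule ccontr)
  assume "\<not> de * C <= Dt x1 t1"
  hence n: "Dt x1 t1 - de * C < 0" by simp
  have "((%s. wa x1 s) has_real_derivative (Dt x1 t1 - de * C)) (at t1)"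
  unfolding wa_def by (auto intro!: derivative_eq_intros dt[OF t1p])
  from DERIV_neg_dec_left[OF this n] obtain d where d: "0 < d" "!!h. 0 < h ==> h < d ==> wa x1 t1 < wa x1 (t1 - h)" by blast
  have "wa x1 t1 < wa x1 (t1 - min (d / 2) t1)" by (rule d(2)) (use d(1) t1p in auto)
  moreover have "wa x1 (t1 - min (d / 2) t1) <= wa x1 t1" using p(1) t1 d(1) unfolding p1 by (intro mx) (auto simp: dist_norm)
  ultimately show False by simp
 qed
 have cp: "continuous_on UNIV (%x::real^'d. (x, t1))" "range (%x::real^'d. (x, t1)) \<subseteq> UNIV \<times> {0<..}"
  using t1p by (auto intro!: continuous_intros)
 have cx1: "continuous_on UNIV (%x. Dx i x t1)" for i
  using continuous_on_compose2[OF cx[of i] cp] by simp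
 have cxx1: "continuous_on UNIV (%x. Dxx i j x t1)" for i j
  using continuous_on_compose2[OF cxx[of i j] cp] by simp
 define H where "H i j = Dxx i j x1 t1 - (if i = j then 2 * de else 0)" for i j
 have Hs: "H i j = H j i" for i j
  unfolding H_def using mixed_partials[of "%x. v x t1" "%i x. Dx i x t1" "%i j x. Dxx i j x t1", OF dx[OF t1p] dxx[OF t1p] cxx1, of i j x1] by simp
 have Hn: "(SUM i:UNIV. SUM j:UNIV. z i * z j * H i j) <= 0" for z :: "'d => real"
 proof -
  define ze where "ze = (\<chi> i. z i)"
  have line: "((%s. x1 + s *. ze) has_derivative (%h. h *. ze)) (at s)" for s by (auto intro!: derivative_eq_intros)
  have ch: "((%s. fi (x1 + s *. ze)) has_real_derivative (SUM i:UNIV. z i * gg i (x1 + s *. ze))) (at s)"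
  if "!!i y. ((%s. fi (y + s *. axis i 1)) has_real_derivative gg i y) (at 0)" "!!i. continuous_on UNIV (gg i)" for fi gg s
  proof -
  have "(%h. SUM i:UNIV. (h *. ze) $ i * gg i (x1 + s *. ze)) = (*) (SUM i:UNIV. z i * gg i (x1 + s *. ze))"
  by (auto simp: fun_eq_iff ze_def sum_distrib_left mult_ac)
  with has_derivative_compose[OF line[of s] has_derivative_of_partials[OF that]] show ?thesis
  by (simp only: has_field_derivative_def)
  qed
  have d1: "((%s. v (x1 + s *. ze) t1) has_real_derivative (SUM i:UNIV. z i * Dx i (x1 + s *. ze) t1)) (at s)" for s
  by (rule ch[OF dx[OF t1p] cx1])
  have d2: "((%s. SUM i:UNIV. z i * Dx i (x1 + s *. ze) t1) has_real_derivative (SUM j:UNIV. z j * (SUM i:UNIV. z i * Dxx i j (x1 + 0 *. ze) t1))) (at 0)"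
  by (intro DERIV_sum DERIV_cmult ch[OF dxx[OF t1p] cxx1])
  have nrm: "(norm (x1 + s *. ze))^2 = (norm x1)^2 + 2 * s * (x1 \<bullet> ze) + s^2 * (norm ze)^2" for s
  unfolding power2_norm_eq_inner by (simp add: inner_add inner_commute power2_eq_square algebra_simps)
  have e1: "((%s. wa (x1 + s *. ze) t1) has_real_derivative (SUM i:UNIV. z i * Dx i (x1 + s *. ze) t1) - de * (2 * (x1 \<bullet> ze) + 2 * s * (norm ze)^2)) (at s)" for s
  unfolding wa_def nrm by (rule derivative_eq_intros d1 refl | simp)+
  have e2: "((%s. (SUM i:UNIV. z i * Dx i (x1 + s *. ze) t1) - de * (2 * (x1 \<bullet> ze) + 2 * s * (norm ze)^2)) has_real_derivative
  (SUM j:UNIV. z j * (SUM i:UNIV. z i * Dxx i j (x1 + 0 *. ze) t1)) - de * (2 * (norm ze)^2)) (at 0)"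
  by (rule derivative_eq_intros d2 refl | simp)+
  have "(SUM j:UNIV. z j * (SUM i:UNIV. z i * Dxx i j (x1 + 0 *. ze) t1)) - de * (2 * (norm ze)^2) <= 0"
  by (rule second_derivative_at_max[OF e1 e2]) (use sp in simp)
  moreover have "(SUM i:UNIV. SUM j:UNIV. z i * z j * H i j) = (SUM i:UNIV. SUM j:UNIV. z i * z j * Dxx i j x1 t1) - (SUM i:UNIV. z i * z i * (2 * de))"
  unfolding H_def right_diff_distrib sum_subtractf by (simp add: if_distrib cong: if_cong)
  moreover have "(SUM i:UNIV. SUM j:UNIV. z i * z j * Dxx i j x1 t1) = (SUM j:UNIV. z j * (SUM i:UNIV. z i * Dxx i j x1 t1))"
  by (subst sum.swap) (simp add: sum_distrib_left mult_ac)
  moreover have "(norm ze)^2 = (SUM i:UNIV. z i * z i)" unfolding power2_norm_eq_inner by (simp add: inner_vec_def ze_def)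
  moreover have "(SUM i:UNIV. z i * z i * (2 * de)) = de * (2 * (SUM i:UNIV. z i * z i))"
  unfolding sum_distrib_right[symmetric] by simp
  ultimately show ?thesis by simp
 qed
 \<comment> \<open>A is given only through its quadratic form, while \<open>trace_nonpos\<close>
   asks for symmetry. H is symmetric, so passing to the symmetric part of A leaves the sum
   unchanged.\<close>
 have "(SUM i:UNIV. SUM j:UNIV. ((A $ i $ j + A $ j $ i) / 2) * H i j) <= 0"
 proof (rule trace_nonpos[OF finite _ _ Hn])
  fix z :: "'d => real"
  have "0 <= (\<chi> i. z i) \<bullet> (A *v (\<chi> i. z i))" by (rule A)
  also have "... = (SUM i:UNIV. SUM j:UNIV. z i * z j * A $ i $ j)" by (simp add: inner_vec_def matrix_vector_mult_def sum_distrib_left mult_ac)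
  finally have q: "0 <= (SUM i:UNIV. SUM j:UNIV. z i * z j * A $ i $ j)" .
  have "(SUM i:UNIV. SUM j:UNIV. z i * z j * A $ j $ i) = (SUM i:UNIV. SUM j:UNIV. z i * z j * A $ i $ j)"
  by (subst sum.swap) (simp add: mult_ac)
  hence "(SUM i:UNIV. SUM j:UNIV. z i * z j * ((A $ i $ j + A $ j $ i) / 2)) = (SUM i:UNIV. SUM j:UNIV. z i * z j * A $ i $ j)"
  by (simp add: distrib_left sum.distrib add_divide_distrib sum_divide_distrib[symmetric])
  with q show "0 <= (SUM i:UNIV. SUM j:UNIV. z i * z j * ((A $ i $ j + A $ j $ i) / 2))" by simp
 qed simp
 moreover have "(SUM i:UNIV. SUM j:UNIV. A $ j $ i * H i j) = (SUM i:UNIV. SUM j:UNIV. A $ i $ j * H i j)"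
  by (subst sum.swap) (simp add: Hs)
 hence "(SUM i:UNIV. SUM j:UNIV. ((A $ i $ j + A $ j $ i) / 2) * H i j) = (SUM i:UNIV. SUM j:UNIV. A $ i $ j * H i j)"
  by (simp add: distrib_right sum.distrib add_divide_distrib sum_divide_distrib[symmetric])
 moreover have "(SUM i:UNIV. SUM j:UNIV. A $ i $ j * H i j) = Dt x1 t1 - (SUM i:UNIV. A $ i $ i * (2 * de))"
  unfolding H_def eq[OF t1p] right_diff_distrib sum_subtractf by (simp add: if_distrib cong: if_cong)
 moreover have "(SUM i:UNIV. A $ i $ i * (2 * de)) = de * (C - 1)" by (simp add: C_def sum_distrib_left sum_distrib_right mult_ac)
 ultimately show False using Dtge de by (simp add: right_diff_distrib)
qed

lemma heat_sol_diff:
 assumes "heat_sol A g v" "heat_sol A g' v'"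
 shows "heat_sol A (%x. g x - g' x) (%x t. v x t - v' x t)"
proof -
 have ex: "heat_sol A g v ==> EX C Dt Dx Dxx. (ALL x t. 0 <= t --> \<bar>v x t\<bar> <= C) &
  (ALL x. ALL t>0. ((%s. v x s) has_real_derivative Dt x t) (at t)) &
  (ALL i x. ALL t>0. ((%s. v (x + s *. axis i 1) t) has_real_derivative Dx i x t) (at 0)) &
  (ALL i j x. ALL t>0. ((%s. Dx j (x + s *. axis i 1) t) has_real_derivative Dxx i j x t) (at 0)) &
  continuous_on (UNIV \<times> {0<..}) (%(x, t). Dt x t) &
  (ALL i. continuous_on (UNIV \<times> {0<..}) (%(x, t). Dx i x t)) &
  (ALL i j. continuous_on (UNIV \<times> {0<..}) (%(x, t). Dxx i j x t)) &
  (ALL x. ALL t>0. Dt x t = (SUM i:UNIV. SUM j:UNIV. A $ i $ j * Dxx i j x t))" for g v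
  unfolding heat_sol_def by (elim conjE exE) (intro exI conjI, assumption+)
 obtain C Dt Dx Dxx where
  1: "!!x t. 0 <= t ==> \<bar>v x t\<bar> <= C" "!!x t. 0 < t ==> ((%s. v x s) has_real_derivative Dt x t) (at t)"
  "!!i x t. 0 < t ==> ((%s. v (x + s *. axis i 1) t) has_real_derivative Dx i x t) (at 0)"
  "!!i j x t. 0 < t ==> ((%s. Dx j (x + s *. axis i 1) t) has_real_derivative Dxx i j x t) (at 0)"
  "continuous_on (UNIV \<times> {0<..}) (%(x, t). Dt x t)" "!!i. continuous_on (UNIV \<times> {0<..}) (%(x, t). Dx i x t)"
  "!!i j. continuous_on (UNIV \<times> {0<..}) (%(x, t). Dxx i j x t)"
  "!!x t. 0 < t ==> Dt x t = (SUM i:UNIV. SUM j:UNIV. A $ i $ j * Dxx i j x t)"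
  using ex[OF assms(1)] apply (elim exE conjE) subgoal for C Dt Dx Dxx by (rule that[of C Dt Dx Dxx]) simp_all done
 obtain C' Dt' Dx' Dxx' where
  2: "!!x t. 0 <= t ==> \<bar>v' x t\<bar> <= C'" "!!x t. 0 < t ==> ((%s. v' x s) has_real_derivative Dt' x t) (at t)"
  "!!i x t. 0 < t ==> ((%s. v' (x + s *. axis i 1) t) has_real_derivative Dx' i x t) (at 0)"
  "!!i j x t. 0 < t ==> ((%s. Dx' j (x + s *. axis i 1) t) has_real_derivative Dxx' i j x t) (at 0)"
  "continuous_on (UNIV \<times> {0<..}) (%(x, t). Dt' x t)" "!!i. continuous_on (UNIV \<times> {0<..}) (%(x, t). Dx' i x t)"
  "!!i j. continuous_on (UNIV \<times> {0<..}) (%(x, t). Dxx' i j x t)"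
  "!!x t. 0 < t ==> Dt' x t = (SUM i:UNIV. SUM j:UNIV. A $ i $ j * Dxx' i j x t)"
  using ex[OF assms(2)] apply (elim exE conjE) subgoal for C Dt Dx Dxx by (rule that[of C Dt Dx Dxx]) simp_all done
 show ?thesis
  unfolding heat_sol_def case_prod_beta
 proof (intro conjI allI impI exI[of _ "C + C'"] exI[of _ "%x t. Dt x t - Dt' x t"] exI[of _ "%i x t. Dx i x t - Dx' i x t"] exI[of _ "%i j x t. Dxx i j x t - Dxx' i j x t"]
  continuous_on_diff DERIV_diff 1(2-7)[unfolded case_prod_beta] 2(2-7)[unfolded case_prod_beta])
  show "v x 0 - v' x 0 = g x - g' x" for x using assms by (simp add: heat_sol_def)
  show "continuous_on (UNIV \<times> {0..}) (%p. v (fst p) (snd p))" "continuous_on (UNIV \<times> {0..}) (%p. v' (fst p) (snd p))"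
  using assms by (auto simp: heat_sol_def case_prod_beta)
  show "\<bar>v x t - v' x t\<bar> <= C + C'" if "0 <= t" for x t
  using 1(1)[OF that, of x] 2(1)[OF that, of x] by linarith
  show "Dt x t - Dt' x t = (SUM i:UNIV. SUM j:UNIV. A $ i $ j * (Dxx i j x t - Dxx' i j x t))" if "0 < t" for x t
  unfolding 1(8)[OF that] 2(8)[OF that] by (simp add: right_diff_distrib sum_subtractf)
 qed
qed

text \<open>Stability in the initial data and not only uniqueness: the approximating Fourier
  integrals start from data that differ from f by O(\<epsilon>).\<close>

lemma heat_maximum_principle:
 fixes A :: "real^'d::finite^'d"
 assumes h: "heat_sol A g v" "heat_sol A g' v'" and A: "!!z. 0 <= z \<bullet> (A *v z)" and g: "!!x. \<bar>g x - g' x\<bar> <= m" and t: "0 <= t"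
 shows "\<bar>v x t - v' x t\<bar> <= m"
proof -
 have "v x t - v' x t <= m" by (rule heat_le[OF heat_sol_diff[OF h] A _ t]) (use g in \<open>simp add: abs_le_iff\<close>)
 moreover have "v' x t - v x t <= m" by (rule heat_le[OF heat_sol_diff[OF h(2,1)] A _ t]) (use g in \<open>simp add: abs_le_iff\<close>)
 ultimately show ?thesis by (simp add: abs_le_iff)
qed

section \<open>Lattice Fourier coefficients: orthogonality, decay, inversion\<close>

definition rbox :: "real => (real^'d::finite) set" where "rbox r = cbox (\<chi> i. - r) (\<chi> i. r)"

lemma mem_rbox: "ze : rbox r \<longleftrightarrow> (ALL i. \<bar>ze $ i\<bar> <= r)"
 by (auto simp: rbox_def mem_box_cart abs_le_iff minus_le_iff)

lemma integral_translate: "(\<integral>x. f (c + x) \<partial>lborel) = (\<integral>x. f x \<partial>lborel)"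
 if [measurable]: "f : borel_measurable borel" for f :: "'a::euclidean_space => complex"
 by (subst lborel_distr_plus[symmetric, of c], subst integral_distr) auto

text \<open>Shifting by s = r / |m_j|, half a period in direction j, changes the sign of the
  exponential. Modulo 2 r this shift maps the half-open cube H onto itself in two pieces: X1 moves
  by s and X2 by s - 2 r. The integral therefore equals its own negative.\<close>

lemma fourier_orthogonal:
 fixes m :: "int^'d::finite"
 assumes m: "m ~= 0" and r: "0 < r"
 shows "(\<integral>ze. indicator (rbox r) ze *. ei (pi / r * (rvec m \<bullet> ze)) \<partial>lborel) = 0"
proof -
 obtain j where j: "m $ j ~= 0" using m by (auto simp: vec_eq_iff)
 define E where "E ze = ei (pi / r * (rvec m \<bullet> ze))" for ze :: "real^'d"
 define s where "s = r / real_of_int \<bar>m $ j\<bar>"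
 have mj: "1 <= real_of_int \<bar>m $ j\<bar>" using j by linarith
 have s: "0 < s" "s <= r" using r mj by (auto simp: s_def divide_le_eq mult_le_cancel_left1)
 define H where "H = {ze::real^'d. ALL i. - r <= ze $ i & ze $ i < r}"
 have Hm [measurable]: "H : sets borel"
 proof -
  have "H = (\<Inter>i. {ze. - r <= ze $ i} \<inter> {ze. ze $ i < r})" by (auto simp: H_def)
  moreover have "closed {ze::real^'d. - r <= ze $ i}" "open {ze::real^'d. ze $ i < r}" for i
  by (rule closed_Collect_le, auto intro!: continuous_intros) (rule open_Collect_less, auto intro!: continuous_intros)
  ultimately show ?thesis by (auto intro!: sets.finite_INT sets.Int)
 qed
 have Em [measurable]: "E : borel_measurable borel"
  unfolding E_def by (intro borel_measurable_continuous_onI continuous_intros)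
 have nth [measurable]: "(%ze::real^'d. ze $ j) : borel_measurable borel" by (intro borel_measurable_continuous_onI continuous_intros)
 have shift: "E (t *. axis j 1 + ze) = - E ze" if "t = s \<or> t = s - 2 * r" for t ze
 proof -
  define k where "k = real_of_int (m $ j)"
  have k: "k ~= 0" "real_of_int \<bar>m $ j\<bar> = \<bar>k\<bar>" using j by (auto simp: k_def)
  have "pi / r * (rvec m \<bullet> (t *. axis j 1 + ze)) = pi / r * (rvec m \<bullet> ze) + pi / r * t * k"
  by (simp add: inner_add_right inner_axis rvec_def k_def algebra_simps)
  hence "E (t *. axis j 1 + ze) = E ze * ei (pi / r * t * k)"
  unfolding E_def by (simp only: of_real_add distrib_left exp_add)
  moreover have "ei (pi / r * t * k) = -1"
  proof -
  have "pi / r * s * k = pi * sgn k" using r k by (simp add: s_def sgn_if)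
  moreover have "pi / r * (s - 2 * r) * k = pi / r * s * k - 2 * pi * k" using r by (simp add: field_simps)
  moreover have "cos (pi * sgn k) = -1" "sin (pi * sgn k) = 0" using k by (auto simp: sgn_if)
  moreover have "cos (2 * pi * k) = 1" "sin (2 * pi * k) = 0" unfolding k_def using cos_int_2pin[of "m $ j"] sin_int_2pin[of "m $ j"] by auto
  ultimately have "cos (pi / r * t * k) = -1 & sin (pi / r * t * k) = 0"
  using that by (auto simp: cos_diff sin_diff)
  thus ?thesis unfolding cis_conv_exp[symmetric] by (simp add: complex_eq_iff)
  qed
  ultimately show ?thesis by simp
 qed
 define I where "I X = (\<integral>ze. indicator X ze *. E ze \<partial>lborel)" for X
 have tr: "I Y = - I X" if X: "X : sets borel" "Y : sets borel" and t: "t = s \<or> t = s - 2 * r" and XY: "!!ze. t *. axis j 1 + ze : Y \<longleftrightarrow> ze : X" for X Y t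
 proof -
  note [measurable] = X
  have "I Y = (\<integral>ze. indicator Y (t *. axis j 1 + ze) *. E (t *. axis j 1 + ze) \<partial>lborel)"
  unfolding I_def by (rule integral_translate[symmetric]) measurable
  also have "... = (\<integral>ze. - (indicator X ze *. E ze) \<partial>lborel)"
  by (intro Bochner_Integration.integral_cong refl) (simp add: shift[OF t] XY indicator_def)
  finally show ?thesis by (simp add: I_def)
 qed
 define X1 X2 Y1 Y2 where "X1 = {ze : H. ze $ j < r - s}" and "X2 = {ze : H. r - s <= ze $ j}"
  and "Y1 = {ze : H. - r + s <= ze $ j}" and "Y2 = {ze : H. ze $ j < - r + s}"
 have sb: "X1 : sets borel" "X2 : sets borel" "Y1 : sets borel" "Y2 : sets borel"
  unfolding X1_def X2_def Y1_def Y2_def by measurable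
 have Hj: "t *. axis j 1 + ze : H \<longleftrightarrow> (ALL i. i ~= j --> - r <= ze $ i & ze $ i < r) & - r <= ze $ j + t & ze $ j + t < r" for t ze
  unfolding H_def by (auto simp: axis_def add.commute)
 have H': "ze : H \<longleftrightarrow> (ALL i. i ~= j --> - r <= ze $ i & ze $ i < r) & - r <= ze $ j & ze $ j < r" for ze using Hj[of 0 ze] by simp
 have tj: "(t *. axis j 1 + ze) $ j = t + ze $ j" for t ze by simp
 have x1: "I Y1 = - I X1"
 proof (rule tr[OF sb(1,3), of s])
  show "s *. axis j 1 + ze : Y1 \<longleftrightarrow> ze : X1" for ze
  unfolding Y1_def X1_def mem_Collect_eq Hj tj unfolding H' using s by auto
 qed simp
 have x2: "I Y2 = - I X2"
 proof (rule tr[OF sb(2,4), of "s - 2 * r"])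
  show "(s - 2 * r) *. axis j 1 + ze : Y2 \<longleftrightarrow> ze : X2" for ze
  unfolding Y2_def X2_def mem_Collect_eq Hj tj unfolding H' using s by auto
 qed simp
 have fin: "integrable lborel (%ze. indicator X ze *. E ze)" if [measurable]: "X : sets borel" and XH: "X \<subseteq> H" for X
 proof (rule Bochner_Integration.integrable_bound)
  show "integrable lborel (%ze. indicator (rbox r) ze *. (1::complex))" unfolding rbox_def by (intro borel_integrable_compact compact_cbox) auto
  show "AE ze in lborel. norm (indicator X ze *. E ze) <= norm (indicator (rbox r) ze *. (1::complex))"
  proof (rule AE_I2)
  fix ze
  have "ze : X ==> ze : rbox r" using XH by (auto simp: H_def mem_rbox abs_le_iff minus_le_iff less_imp_le)
  thus "norm (indicator X ze *. E ze) <= norm (indicator (rbox r) ze *. (1::complex))"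
  by (auto simp: indicator_def E_def)
  qed
 qed measurable
 have sp: "I H = I X + I Y" if "X : sets borel" "Y : sets borel" "X \<union> Y = H" "X \<inter> Y = {}" for X Y
 proof -
  have "I H = (\<integral>ze. indicator X ze *. E ze + indicator Y ze *. E ze \<partial>lborel)"
  unfolding I_def by (intro Bochner_Integration.integral_cong refl) (use that(3,4) in \<open>auto simp: indicator_def\<close>)
  also have "... = I X + I Y" unfolding I_def by (intro Bochner_Integration.integral_add fin) (use that in auto)
  finally show ?thesis .
 qed
 have "I H = I X1 + I X2" "I H = I Y1 + I Y2"
  by (intro sp sb; auto simp: X1_def X2_def Y1_def Y2_def)+
 hence "I H = - I H" using x1 x2 by simp
 hence H0: "I H = 0" by (simp add: complex_eq_iff)
 have "AE ze::real^'d in lborel. ALL i. ze $ i ~= r"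
 proof -
  have "AE ze::real^'d in lborel. ze $ i ~= r" for i
  proof -
  have "negligible {ze::real^'d. ze \<bullet> axis i 1 = r}" by (intro negligible_standard_hyperplane) (simp add: axis_in_Basis_iff)
  hence "{ze::real^'d. ze $ i = r} : null_sets lebesgue" by (simp add: negligible_iff_null_sets inner_axis)
  moreover have "closed {ze::real^'d. ze $ i = r}" by (rule closed_Collect_eq) (auto intro!: continuous_intros)
  ultimately have "{ze::real^'d. ze $ i = r} : null_sets lborel" by (subst (asm) null_sets_completion_iff) auto
  thus ?thesis by (rule AE_I'[of _ lborel]) auto
  qed
  thus ?thesis by (subst AE_all_countable) (auto simp: countable_finite)
 qed
 hence "AE ze in lborel. indicator (rbox r) ze *. E ze = indicator H ze *. E ze"
 proof eventually_elim
  case (elim ze)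
  have "\<bar>ze $ i\<bar> <= r \<longleftrightarrow> - r <= ze $ i & ze $ i < r" for i using spec[OF elim, of i] by linarith
  hence "ze : rbox r \<longleftrightarrow> ze : H" unfolding mem_rbox H_def mem_Collect_eq by blast
  thus ?case by (simp add: indicator_def)
 qed
 hence "(\<integral>ze. indicator (rbox r) ze *. E ze \<partial>lborel) = I H"
  unfolding I_def by (intro integral_cong_AE) (auto simp: rbox_def)
 thus ?thesis using H0 by (simp add: E_def)
qed

text \<open>\<open>Sum_any\<close> over the whole lattice lets translations be treated by
  reindexing, without following the support.\<close>

definition latF :: "real => (real^'d::finite => real) => real^'d => complex" where
 "latF ep g ze = Sum_any (%y. cr (g (ep *. rvec y)) * ei (ep * (rvec y \<bullet> ze)))"

abbreviation lfin :: "real => (real^'d::finite => real) => bool" where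
 "lfin ep g \<equiv> finite {y. g (ep *. rvec y) ~= 0}"

lemma latF_sum: "lfin ep g ==> latF ep g ze = (\<Sum>y | g (ep *. rvec y) ~= 0. cr (g (ep *. rvec y)) * ei (ep * (rvec y \<bullet> ze)))"
 unfolding latF_def by (rule Sum_any.expand_superset) auto

lemma latF_add: "lfin ep g ==> lfin ep g' ==> latF ep (%x. g x + g' x) ze = latF ep g ze + latF ep g' ze"
 unfolding latF_def by (subst Sum_any.distrib[symmetric]) (auto simp: algebra_simps)

lemma latF_cmult: "lfin ep g ==> latF ep (%x. c * g x) ze = cr c * latF ep g ze"
 unfolding latF_def by (subst Sum_any_right_distrib) (auto simp: algebra_simps)

lemma rvec_add: "rvec (y + v) = rvec y + rvec v" and rvec_uminus: "rvec (- v) = - rvec v" and rvec_ue: "rvec (ue i) = axis i 1"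
 by (simp_all add: rvec_def ue_def axis_def vec_eq_iff)

lemma lfin_shift: "lfin ep g ==> lfin ep (%x. g (x + ep *. rvec v))"
proof (rule finite_subset)
 assume "lfin ep g"
 thus "finite ((%y. y - v) ` {y. g (ep *. rvec y) ~= 0})" by simp
 show "{y. g (ep *. rvec y + ep *. rvec v) ~= 0} \<subseteq> (%y. y - v) ` {y. g (ep *. rvec y) ~= 0}"
 proof
  fix y assume "y : {y. g (ep *. rvec y + ep *. rvec v) ~= 0}"
  thus "y : (%y. y - v) ` {y. g (ep *. rvec y) ~= 0}"
  by (intro image_eqI[of _ _ "y + v"]) (auto simp: rvec_add scaleR_add_right)
 qed
qed

lemma latF_shift:
 assumes "lfin ep g"
 shows "latF ep (%x. g (x + ep *. rvec v)) ze = em (ep * (rvec v \<bullet> ze)) * latF ep g ze"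
proof -
 define q where "q y = cr (g (ep *. rvec y)) * ei (ep * (rvec y \<bullet> ze))" for y
 have "bij (%y::int^'a. y + v)" by (rule bij_betw_byWitness[where f' = "%y. y - v"]) auto
 hence "latF ep g ze = Sum_any (q \<circ> (%y. y + v))"
  unfolding latF_def q_def[symmetric] by (rule Sum_any.reindex_cong) simp
 also have "q \<circ> (%y. y + v) = (%y. ei (ep * (rvec v \<bullet> ze)) * (cr (g (ep *. rvec y + ep *. rvec v)) * ei (ep * (rvec y \<bullet> ze))))"
  by (simp add: fun_eq_iff q_def rvec_add inner_add_left scaleR_add_right distrib_left exp_add)
 also have "Sum_any ... = ei (ep * (rvec v \<bullet> ze)) * latF ep (%x. g (x + ep *. rvec v)) ze"
  unfolding latF_def using lfin_shift[OF assms, of v] by (subst Sum_any_right_distrib) auto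
 finally show ?thesis by (simp add: mult.assoc[symmetric] exp_add[symmetric])
qed

text \<open>The identity minus the second difference quotient in direction i. On \<open>latF\<close>
  it multiplies by a factor that grows like the square of the frequency; this is how smoothness
  turns into decay.\<close>

definition Th :: "real => 'd => (real^'d::finite => real) => real^'d => real" where
 "Th ep i g x = g x - (g (x + ep *. axis i 1) - 2 * g x + g (x - ep *. axis i 1)) / ep^2"

primrec ThL :: "real => 'd list => (real^'d::finite => real) => real^'d => real" where
 "ThL ep [] g = g"
| "ThL ep (i # is) g = ThL ep is (Th ep i g)"

lemma Th_alt: "Th ep i g = (%x. (1 + 2 / ep^2) * g x + (- (1 / ep^2) * g (x + ep *. rvec (ue i)) + - (1 / ep^2) * g (x + ep *. rvec (- ue i))))"
 by (simp add: fun_eq_iff Th_def rvec_ue rvec_uminus diff_divide_distrib add_divide_distrib algebra_simps)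

lemma lfin_add: "lfin ep g ==> lfin ep g' ==> lfin ep (%x. g x + g' x)"
 by (rule finite_subset[of _ "{y. g (ep *. rvec y) ~= 0} \<union> {y. g' (ep *. rvec y) ~= 0}"]) auto

lemma lfin_cmult: "lfin ep g ==> lfin ep (%x. c * g x)"
 by (rule finite_subset[of _ "{y. g (ep *. rvec y) ~= 0}"]) auto

lemma lfin_Th: "lfin ep g ==> lfin ep (Th ep i g)"
 unfolding Th_alt by (intro lfin_add lfin_cmult lfin_shift)

lemma latF_Th:
 assumes "lfin ep g"
 shows "latF ep (Th ep i g) ze = cr (1 + (2 - 2 * cos (ep * ze $ i)) / ep^2) * latF ep g ze"
proof -
 note s = lfin_shift[OF assms]
 have "latF ep (Th ep i g) ze = cr (1 + 2 / ep^2) * latF ep g ze +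
  (cr (- (1 / ep^2)) * (em (ep * (rvec (ue i) \<bullet> ze)) * latF ep g ze)
  + cr (- (1 / ep^2)) * (em (ep * (rvec (- ue i) \<bullet> ze)) * latF ep g ze))"
  unfolding Th_alt
  by (subst latF_add latF_cmult latF_shift; (intro lfin_add lfin_cmult lfin_shift assms)?)+ (rule refl)
 also have "... = (cr (1 + 2 / ep^2) - cr (1 / ep^2) * (em (ep * ze $ i) + ei (ep * ze $ i))) * latF ep g ze"
  by (simp add: rvec_ue rvec_uminus inner_axis' algebra_simps)
 also have "em (ep * ze $ i) + ei (ep * ze $ i) = cr (2 * cos (ep * ze $ i))"
 proof -
  have "- \<i> * cr x = \<i> * cr (- x)" for x by simp
  thus ?thesis by (simp only: cis_conv_exp[symmetric]) (simp add: complex_eq_iff)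
 qed
 also have "cr (1 + 2 / ep^2) - cr (1 / ep^2) * cr (2 * cos (ep * ze $ i)) = cr (1 + (2 - 2 * cos (ep * ze $ i)) / ep^2)"
  by (simp add: diff_divide_distrib)
 finally show ?thesis .
qed

text \<open>2 - 2 cos th is 4 times the square of sin (th / 2). For |x| \<le> 2 the cubic remainder
  |x|^3 / 6 is at most 2/3 |x|, which leaves |sin x| \<ge> |x| / 3 and explains the 9.\<close>

lemma cos_quadratic_bound:
 assumes "\<bar>th\<bar> <= pi" shows "th^2 / 9 <= 2 - 2 * cos th"
proof -
 define x where "x = th / 2"
 have x: "\<bar>x\<bar> <= 2" using assms pi_less_4 by (simp add: x_def)
 have "\<bar>sin x - x\<bar> <= inverse (fact 3) * \<bar>x\<bar> ^ 3"
  using Maclaurin_sin_bound[of x 3] by (simp add: sin_coeff_def numeral_3_eq_3)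
 also have "... = \<bar>x\<bar> * (\<bar>x\<bar> * \<bar>x\<bar>) / 6" by (simp add: fact_numeral numeral_3_eq_3)
 also have "... <= \<bar>x\<bar> * (2 * 2) / 6" using x by (intro divide_right_mono mult_left_mono mult_mono) auto
 finally have "\<bar>x\<bar> / 3 <= \<bar>sin x\<bar>" by linarith
 hence "(\<bar>x\<bar> / 3)^2 <= \<bar>sin x\<bar>^2" by (intro power_mono) auto
 hence "x^2 / 9 <= (sin x)^2" by (simp add: power_divide)
 moreover have "cos th = 1 - 2 * (sin x)^2" using cos_double_sin[of x] by (simp add: x_def)
 moreover have "th^2 = 4 * x^2" by (simp add: x_def power2_eq_square)
 ultimately show ?thesis by simp
qed

lemma latF_ThL:
 assumes "lfin ep g" and ep: "0 < ep" and ze: "ze : rbox (pi / ep)"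
 shows "cmod (latF ep g ze) * (\<Prod>i\<leftarrow>is. 1 + (ze $ i)^2 / 9) <= cmod (latF ep (ThL ep is g) ze)"
 using assms(1)
proof (induction "is" arbitrary: g)
 case (Cons i "is")
 have "\<bar>ep * ze $ i\<bar> <= pi" using ze ep by (auto simp: mem_rbox abs_mult field_simps)
 from cos_quadratic_bound[OF this] have "(ze $ i)^2 / 9 <= (2 - 2 * cos (ep * ze $ i)) / ep^2"
  using ep by (simp add: power_mult_distrib pos_le_divide_eq mult_ac)
 hence "1 + (ze $ i)^2 / 9 <= cmod (cr (1 + (2 - 2 * cos (ep * ze $ i)) / ep^2))"
  unfolding norm_of_real by linarith
 hence "(1 + (ze $ i)^2 / 9) * cmod (latF ep g ze) <= cmod (latF ep (Th ep i g) ze)"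
  unfolding latF_Th[OF Cons.prems] norm_mult by (intro mult_right_mono) auto
 hence "((1 + (ze $ i)^2 / 9) * cmod (latF ep g ze)) * (\<Prod>i\<leftarrow>is. 1 + (ze $ i)^2 / 9) <= cmod (latF ep (Th ep i g) ze) * (\<Prod>i\<leftarrow>is. 1 + (ze $ i)^2 / 9)"
  by (intro mult_right_mono prod_list_nonneg) auto
 also have "... <= cmod (latF ep (ThL ep is (Th ep i g)) ze)" by (rule Cons.IH[OF lfin_Th[OF Cons.prems]])
 finally show ?case by (simp add: mult_ac)
qed simp

definition dtab :: "('d list => real^'d::finite => real) => bool" where
 "dtab D \<longleftrightarrow> (ALL is i x. ((%s. D is (x + s *. axis i 1)) has_real_derivative D (i # is) x) (at 0))"

lemma dtab_along: "dtab D ==> ((%s. D is (y + s *. axis i 1)) has_real_derivative D (i # is) (y + s *. axis i 1)) (at s)"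
 by (rule partial_along[where f' = "%i. D (i # is)"]) (simp add: dtab_def)

lemma second_difference:
 assumes D: "dtab D" and B: "!!x. \<bar>D (i # i # J) x\<bar> <= b" and ep: "0 < ep"
 shows "\<bar>D J (x + ep *. axis i 1) - 2 * D J x + D J (x - ep *. axis i 1)\<bar> <= b * ep^2"
proof -
 have "EX z>0. z < ep & (D J (x + ep *. axis i 1) - D J ((x - ep *. axis i 1) + ep *. axis i 1)) - (D J (x + 0 *. axis i 1) - D J ((x - ep *. axis i 1) + 0 *. axis i 1))
  = (ep - 0) * (D (i # J) (x + z *. axis i 1) - D (i # J) ((x - ep *. axis i 1) + z *. axis i 1))"
  by (rule MVT2[OF ep]) (intro DERIV_diff dtab_along D)
 then obtain z where z0: "(D J (x + ep *. axis i 1) - D J ((x - ep *. axis i 1) + ep *. axis i 1)) - (D J (x + 0 *. axis i 1) - D J ((x - ep *. axis i 1) + 0 *. axis i 1))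
  = (ep - 0) * (D (i # J) (x + z *. axis i 1) - D (i # J) ((x - ep *. axis i 1) + z *. axis i 1))" by blast
 hence z: "D J (x + ep *. axis i 1) - 2 * D J x + D J (x - ep *. axis i 1)
  = ep * (D (i # J) (x + z *. axis i 1) - D (i # J) ((x - ep *. axis i 1) + z *. axis i 1))" by (simp add: algebra_simps)
 define y where "y = (x - ep *. axis i 1) + z *. axis i 1"
 have "EX wa>0. wa < ep & D (i # J) (y + ep *. axis i 1) - D (i # J) (y + 0 *. axis i 1) = (ep - 0) * D (i # i # J) (y + wa *. axis i 1)"
  by (rule MVT2[OF ep]) (intro dtab_along D)
 moreover have "y + ep *. axis i 1 = x + z *. axis i 1" by (simp add: y_def)
 ultimately obtain wa where wa: "D (i # J) (x + z *. axis i 1) - D (i # J) y = ep * D (i # i # J) (y + wa *. axis i 1)" by auto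
 have "D J (x + ep *. axis i 1) - 2 * D J x + D J (x - ep *. axis i 1) = ep^2 * D (i # i # J) (y + wa *. axis i 1)"
  unfolding z y_def[symmetric] wa by (simp add: power2_eq_square)
 thus ?thesis using B[of "y + wa *. axis i 1"] ep by (simp add: abs_mult mult.commute mult_right_mono)
qed

text \<open>Applied to every entry of a derivative table, \<open>Th\<close> gives a derivative table
  again, with entries bounded by B J + B (i # i # J) independently of \<epsilon>. The induction
  therefore runs over all tables and all bounds at once, and the constant precedes D and ep.\<close>

lemma ThL_bound: "EX C. ALL D ep x. dtab D --> (ALL J x. \<bar>D J x\<bar> <= B J) --> 0 < ep --> \<bar>ThL ep is (D []) x\<bar> <= C"
proof (induction "is" arbitrary: B)
 case Nil
 thus ?case by (intro exI[of _ "B []"]) auto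
next
 case (Cons i "is")
 obtain C where C: "!!D ep x. dtab D ==> (!!J x. \<bar>D J x\<bar> <= B J + B (i # i # J)) ==> 0 < ep ==> \<bar>ThL ep is (D []) x\<bar> <= C"
  using Cons[of "%J. B J + B (i # i # J)"] by blast
 show ?case
 proof (intro exI[of _ C] allI impI)
  fix D :: "'a list => real^'a => real" and ep :: real and x
  assume D: "dtab D" and B: "ALL J x. \<bar>D J x\<bar> <= B J" and ep: "0 < ep"
  have "\<bar>ThL ep is ((%J. Th ep i (D J)) []) x\<bar> <= C"
  proof (rule C[OF _ _ ep])
  show "\<bar>Th ep i (D J) x\<bar> <= B J + B (i # i # J)" for J x
  proof -
  have "\<bar>D J (x + ep *. axis i 1) - 2 * D J x + D J (x - ep *. axis i 1)\<bar> / ep^2 <= B (i # i # J)"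
  using second_difference[OF D _ ep, of i J "B (i # i # J)" x] B ep by (simp add: pos_divide_le_eq)
  moreover have "\<bar>D J x\<bar> <= B J" using B by blast
  ultimately show ?thesis unfolding Th_def
  using abs_triangle_ineq4[of "D J x" "(D J (x + ep *. axis i 1) - 2 * D J x + D J (x - ep *. axis i 1)) / ep^2"] by simp
  qed
  show "dtab (%J. Th ep i (D J))"
  unfolding dtab_def Th_def
  proof (intro allI)
  fix J k y
  have d: "((%s. D J (y + s *. axis k 1 + wa)) has_real_derivative D (k # J) (y + wa)) (at 0)" for wa
  using D[unfolded dtab_def, rule_format, of J "y + wa" k] by (simp add: add_ac)
  show "((%s. D J (y + s *. axis k 1) - (D J (y + s *. axis k 1 + ep *. axis i 1) - 2 * D J (y + s *. axis k 1) + D J (y + s *. axis k 1 - ep *. axis i 1)) / ep^2)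
  has_real_derivative D (k # J) y - (D (k # J) (y + ep *. axis i 1) - 2 * D (k # J) y + D (k # J) (y - ep *. axis i 1)) / ep^2) (at 0)"
  using d[of 0] d[of "ep *. axis i 1"] d[of "- ep *. axis i 1"]
  by (intro DERIV_diff DERIV_cdivide DERIV_add DERIV_cmult) simp_all
  qed
  qed
  thus "\<bar>ThL ep (i # is) (D []) x\<bar> <= C" by simp
 qed
qed

text \<open>Each application enlarges the radius by at most \<epsilon> \<le> 1. The support stays in
  a ball independent of \<epsilon>, so that \<open>lattice_count\<close> applies.\<close>

lemma ThL_support:
 assumes "!!x. R < norm x ==> g x = 0" "0 < ep" "ep <= 1" "R + real (length is) < norm x"
 shows "ThL ep is g x = 0"
 using assms(1,4)
proof (induction "is" arbitrary: g R)
 case (Cons i "is")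
 show ?case
  unfolding ThL.simps
 proof (rule Cons.IH)
  show "Th ep i g x = 0" if "R + 1 < norm x" for x
  proof -
  have n: "norm (ep *. axis i (1::real)) <= 1" using assms(2,3) by simp
  have "R < norm x" "R < norm (x + ep *. axis i 1)" "R < norm (x - ep *. axis i 1)"
  using that n norm_diff_ineq[of x "ep *. axis i 1"] norm_triangle_ineq2[of x "ep *. axis i 1"] by linarith+
  thus ?thesis by (simp add: Th_def Cons.prems(1))
  qed
  show "R + 1 + real (length is) < norm x" using Cons.prems(2) by simp
 qed
qed simp

lemma lattice_count:
 assumes R: "0 <= R" and ep: "0 < ep" "ep <= 1"
 shows "finite {y::int^'d::finite. norm (ep *. rvec y) <= R}" (is "finite ?Y")
  and "real (card {y::int^'d. norm (ep *. rvec y) <= R}) <= ((2 * R + 1) / ep) ^ CARD('d)"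
proof -
 define n where "n = \<lfloor>R / ep\<rfloor>"
 have n0: "0 <= n" using R ep by (simp add: n_def)
 have sub: "vec_nth ` ?Y \<subseteq> PiE UNIV (%_::'d. {-n..n})"
 proof (clarsimp simp: PiE_UNIV_domain)
  fix y :: "int^'d" and i assume "\<bar>ep\<bar> * norm (rvec y) <= R"
  hence "norm (rvec y) <= R / ep" using ep by (simp add: field_simps)
  hence "\<bar>real_of_int (y $ i)\<bar> <= R / ep" using component_le_norm_cart[of "rvec y" i] by (simp add: rvec_def)
  hence "\<bar>y $ i\<bar> <= n" unfolding n_def le_floor_iff by simp
  thus "- n <= y $ i & y $ i <= n" by linarith
 qed
 have inj: "inj_on vec_nth ?Y" by (auto intro: inj_onI simp: vec_eq_iff)
 have fin: "finite (PiE UNIV (%_::'d. {-n..n}))" by (intro finite_PiE) auto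
 show "finite ?Y" by (rule finite_imageD[OF finite_subset[OF sub fin] inj])
 have "card ?Y <= card (PiE UNIV (%_::'d. {-n..n}))" by (rule card_inj_on_le[OF inj sub fin])
 also have "... = nat (2 * n + 1) ^ CARD('d)" by (subst card_PiE) (auto simp: algebra_simps)
 finally have "real (card ?Y) <= real (nat (2 * n + 1)) ^ CARD('d)" by (metis of_nat_le_iff of_nat_power)
 also have "... <= ((2 * R + 1) / ep) ^ CARD('d)"
 proof (rule power_mono)
  have "real_of_int n <= R / ep" by (simp add: n_def)
  moreover have "1 <= 1 / ep" using ep by simp
  ultimately show "real (nat (2 * n + 1)) <= (2 * R + 1) / ep" using n0 by (simp add: add_divide_distrib)
 qed simp
 finally show "real (card ?Y) <= ((2 * R + 1) / ep) ^ CARD('d)" .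
qed

text \<open>\<open>smooth_fun\<close> provides the derivatives without bounds. By induction on the
  order each of them vanishes outside the ball where f is supported, and on the ball it is bounded
  by compactness.\<close>

lemma smooth_bounded_table:
 assumes "smooth_fun f" "compact_support f"
 obtains D R B where "dtab D" "D [] = f" "0 <= R" "!!J x. R < norm x ==> D J x = 0" "!!J x. \<bar>D J x\<bar> <= B J" "!!J. continuous_on UNIV (D J)"
proof -
 obtain D where D0: "D [] = f" and Dc: "!!J. continuous_on UNIV (D J)" and Dt: "dtab D"
  using assms(1) by (auto simp: smooth_fun_def dtab_def)
 have "bounded {x. f x ~= 0}"
  using assms(2) unfolding compact_support_def by (rule bounded_subset[OF compact_imp_bounded closure_subset])
 then obtain R where R: "0 < R" "!!x. f x ~= 0 ==> norm x <= R" by (auto simp: bounded_pos)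
 have supp: "D J x = 0" if "R < norm x" for J x
  using that
 proof (induction J arbitrary: x)
  case Nil
  thus ?case using R(2)[of x] D0 by auto
 next
  case (Cons i J)
  have "isCont (%s. norm (x + s *. axis i (1::real))) 0" by (intro continuous_intros)
  hence "((%s. norm (x + s *. axis i (1::real))) \<longlongrightarrow> norm x) (nhds 0)" by (simp add: isCont_def tendsto_nhds_iff)
  hence "\<forall>\<^sub>F s in nhds 0. R < norm (x + s *. axis i 1)" by (rule order_tendstoD(1)) (rule Cons.prems)
  hence "\<forall>\<^sub>F s in nhds 0. D J (x + s *. axis i 1) = 0" by eventually_elim (rule Cons.IH)
  hence "((%s. D J (x + s *. axis i 1)) has_real_derivative D (i # J) x) (at 0) \<longleftrightarrow> ((%s. 0) has_real_derivative D (i # J) x) (at 0)"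
  by (intro DERIV_cong_ev) auto
  hence "((%s::real. 0) has_real_derivative D (i # J) x) (at 0)" using Dt by (simp add: dtab_def)
  thus ?case by (rule DERIV_unique) (rule DERIV_const)
 qed
 have "EX b. ALL x. \<bar>D J x\<bar> <= b" for J
 proof -
  have "compact (D J ` cball 0 R)" by (intro compact_continuous_image continuous_on_subset[OF Dc]) auto
  then obtain b where b0: "ALL x:cball 0 R. \<bar>D J x\<bar> <= b" by (auto dest!: compact_imp_bounded simp: bounded_iff)
  have b: "\<bar>D J x\<bar> <= b" if "norm x <= R" for x using b0 that by auto
  have "\<bar>D J x\<bar> <= max b 0" for x using b[of x] supp[of x J] by (cases "norm x <= R") auto
  thus ?thesis by blast
 qed
 then obtain B where "!!J x. \<bar>D J x\<bar> <= B J" by metis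
 thus ?thesis using that[OF Dt D0 less_imp_le[OF R(1)] supp _ Dc] by blast
qed

text \<open>Normalised so that f at the lattice point \<epsilon> x is the integral of
  \<open>coef\<close> times the plane wave over the cube of side 2 pi / \<epsilon>, as
  \<open>coef_inversion\<close> shows.\<close>

definition coef :: "real => (real^'d::finite => real) => real^'d => complex" where
 "coef ep f ze = cr ((ep / (2 * pi)) ^ CARD('d)) * latF ep f ze"

definition wt :: "real^'d::finite => real" where "wt ze = (\<Prod>i\<in>UNIV. 1 / (1 + (ze $ i)^2 / 9))"

lemma wt_pos: "0 < wt ze" and wt_le_1: "wt ze <= 1"
 unfolding wt_def by (auto intro!: prod_pos prod_le_1 add_pos_nonneg simp: divide_le_eq_1)

lemma support_lfin: "(!!x. R < norm x ==> f x = 0) ==> 0 <= R ==> 0 < ep ==> ep <= 1 ==> lfin ep f"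
 by (rule finite_subset[OF _ lattice_count(1)[of R ep]]) (auto simp: not_less[symmetric] simp del: norm_scaleR)

text \<open>Every coordinate occurs twice in the list K, so \<open>ThL\<close> multiplies the
  lattice sum by at least wt^(-2). The sum has O(\<epsilon>^(-d)) terms, which the normalisation of
  \<open>coef\<close> compensates. Of the two powers of \<open>wt\<close> one provides
  integrability, and the other absorbs a factor |\<zeta>_i| in \<open>gI_initial\<close>.\<close>

lemma coef_decay:
 assumes "smooth_fun f" "compact_support f"
 obtains C where "0 <= C" "!!ep ze. 0 < ep ==> ep <= 1 ==> ze : rbox (pi / ep) ==> cmod (coef ep f ze) <= C * (wt ze)^2"
proof -
 obtain D R B where D: "dtab D" "D [] = f" "0 <= R" "!!J x. R < norm x ==> D J x = 0" "!!J x. \<bar>D J x\<bar> <= B J"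
  using smooth_bounded_table[OF assms] by metis
 obtain ls :: "'a list" where ls: "set ls = UNIV" "distinct ls" using finite_distinct_list[OF finite[of "UNIV :: 'a set"]] by auto
 define K where "K = ls @ ls"
 obtain C where C: "!!ep x. 0 < ep ==> \<bar>ThL ep K f x\<bar> <= C" using ThL_bound[of B K] D by metis
 have C0: "0 <= C" by (rule order_trans[OF abs_ge_zero C[of 1]]) simp
 define R' where "R' = R + real (length K)"
 have R': "0 <= R'" using D(3) by (simp add: R'_def)
 define C' where "C' = ((2 * R' + 1) / (2 * pi)) ^ CARD('a) * C"
 show ?thesis
 proof (rule that[of C'])
  show "0 <= C'" using R' C0 by (simp add: C'_def)
  fix ep :: real and ze :: "real^'a" assume ep: "0 < ep" "ep <= 1" and ze: "ze : rbox (pi / ep)"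
  have fsupp: "!!x. R < norm x ==> f x = 0" using D(4)[of _ "[]"] D(2) by simp
  have lf: "lfin ep f" by (rule support_lfin[OF fsupp D(3) ep])
  have ThS: "!!x. R' < norm x ==> ThL ep K f x = 0" unfolding R'_def by (rule ThL_support[OF fsupp ep])
  have lT: "lfin ep (ThL ep K f)" by (rule support_lfin[OF ThS R' ep])
  have "cmod (latF ep (ThL ep K f) ze) <= (\<Sum>y | ThL ep K f (ep *. rvec y) ~= 0. C)"
  unfolding latF_sum[OF lT] using C[OF ep(1)] by (intro sum_norm_le) (auto simp: norm_mult)
  also have "... = real (card {y. ThL ep K f (ep *. rvec y) ~= 0}) * C" by simp
  also have "... <= ((2 * R' + 1) / ep) ^ CARD('a) * C"
  proof (rule mult_right_mono[OF _ C0], rule order_trans[OF _ lattice_count(2)[OF R' ep]])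
  show "real (card {y. ThL ep K f (ep *. rvec y) ~= 0}) <= real (card {y::int^'a. norm (ep *. rvec y) <= R'})"
  unfolding of_nat_le_iff using ThS by (intro card_mono lattice_count(1) R' ep) (auto simp: not_less[symmetric] simp del: norm_scaleR)
  qed
  finally have b: "cmod (latF ep (ThL ep K f) ze) <= ((2 * R' + 1) / ep) ^ CARD('a) * C" .
  have pr: "(\<Prod>i\<leftarrow>K. 1 + (ze $ i)^2 / 9) * (wt ze)^2 = 1"
  proof -
  have "(\<Prod>i\<leftarrow>ls. 1 + (ze $ i)^2 / 9) * wt ze = (\<Prod>i\<in>UNIV. (1 + (ze $ i)^2 / 9) * (1 / (1 + (ze $ i)^2 / 9)))"
  unfolding wt_def prod.distrib using prod.distinct_set_conv_list[OF ls(2), of "%i. 1 + (ze $ i)^2 / 9"] ls(1) by simp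
  also have "... = 1"
  proof (intro prod.neutral ballI)
  fix i
  have "0 < 1 + (ze $ i)^2 / 9" by (simp add: add_pos_nonneg)
  thus "(1 + (ze $ i)^2 / 9) * (1 / (1 + (ze $ i)^2 / 9)) = 1" by simp
  qed
  finally have w1: "(\<Prod>i\<leftarrow>ls. 1 + (ze $ i)^2 / 9) * wt ze = 1" .
  have "(\<Prod>i\<leftarrow>K. 1 + (ze $ i)^2 / 9) * (wt ze)^2 = ((\<Prod>i\<leftarrow>ls. 1 + (ze $ i)^2 / 9) * wt ze) * ((\<Prod>i\<leftarrow>ls. 1 + (ze $ i)^2 / 9) * wt ze)"
  by (simp add: K_def power2_eq_square mult_ac)
  thus ?thesis unfolding w1 by simp
  qed
  have "cmod (latF ep f ze) = cmod (latF ep f ze) * (\<Prod>i\<leftarrow>K. 1 + (ze $ i)^2 / 9) * (wt ze)^2" using pr by (simp only: mult.assoc mult_1_right)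
  also have "... <= (((2 * R' + 1) / ep) ^ CARD('a) * C) * (wt ze)^2"
  by (intro mult_right_mono order_trans[OF latF_ThL[OF lf ep(1) ze] b]) simp
  finally have "cmod (coef ep f ze) <= (ep / (2 * pi)) ^ CARD('a) * ((((2 * R' + 1) / ep) ^ CARD('a) * C) * (wt ze)^2)"
  unfolding coef_def norm_mult norm_of_real using ep by (intro mult_mono) auto
  also have "... = ((ep / (2 * pi)) * ((2 * R' + 1) / ep)) ^ CARD('a) * C * (wt ze)^2" unfolding power_mult_distrib by (simp only: mult.assoc)
  also have "(ep / (2 * pi)) * ((2 * R' + 1) / ep) = (2 * R' + 1) / (2 * pi)" using ep by simp
  finally show "cmod (coef ep f ze) <= C' * (wt ze)^2" by (simp add: C'_def)
 qed
qed

lemma continuous_coef: assumes "lfin ep f" shows "continuous_on UNIV (coef ep f)"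
proof -
 have "coef ep f = (%ze. cr ((ep / (2 * pi)) ^ CARD('a)) *
  (\<Sum>y | f (ep *. rvec y) ~= 0. cr (f (ep *. rvec y)) * ei (ep * (rvec y \<bullet> ze))))"
  by (rule ext) (simp add: coef_def latF_sum[OF assms])
 thus ?thesis by (simp only:) (intro continuous_intros)
qed

lemma coef_inversion:
 assumes lf: "lfin ep f" and ep: "0 < ep"
 shows "cr (f (ep *. rvec x)) =
  (\<integral>ze. indicator (rbox (pi / ep)) ze *. (coef ep f ze * em ((ep *. ze) \<bullet> rvec x)) \<partial>lborel)"
proof -
 define r where "r = pi / ep"
 have r: "0 < r" and pr: "pi / r = ep" using ep by (auto simp: r_def)
 define E where "E m ze = indicator (rbox r) ze *. ei (pi / r * (rvec m \<bullet> ze))" for m :: "int^'a" and ze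
 have iE: "integrable lborel (E m)" for m
  unfolding E_def[abs_def] rbox_def by (intro borel_integrable_compact compact_cbox continuous_intros)
 have E0: "(\<integral>ze. E m ze \<partial>lborel) = (if m = 0 then cr ((2 * pi / ep) ^ CARD('a)) else 0)" for m
 proof (cases "m = 0")
  case True
  have "E m = (%ze::real^'a. cr (indicator (rbox r) ze))"
  by (rule ext) (simp add: E_def True rvec_def inner_vec_def scaleR_conv_of_real)
  hence "(\<integral>ze. E m ze \<partial>lborel) = (\<integral>ze. cr (indicator (rbox r) (ze::real^'a)) \<partial>lborel)" by (simp only:)
  also have "... = cr (measure lborel (rbox r :: (real^'a) set))" unfolding integral_complex_of_real by (simp add: rbox_def)
  also have "measure lborel (rbox r :: (real^'a) set) = (2 * pi / ep) ^ CARD('a)"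
  proof -
  have "0 : (rbox r :: (real^'a) set)" using r by (simp add: mem_rbox)
  hence "cbox (\<chi> i. - r) (\<chi> i. r) ~= ({} :: (real^'a) set)" unfolding rbox_def by blast
  from content_cbox_cart[OF this] show ?thesis unfolding rbox_def by (simp add: r_def)
  qed
  finally show ?thesis by (simp add: True)
 next
  case False
  thus ?thesis unfolding E_def using fourier_orthogonal[OF False r] by simp
 qed
 define Y where "Y = {y. f (ep *. rvec y) ~= 0}"
 have fY: "finite Y" using lf by (simp add: Y_def)
 define k where "k = cr ((ep / (2 * pi)) ^ CARD('a))"
 have "indicator (rbox r) ze *. (coef ep f ze * em ((ep *. ze) \<bullet> rvec x))
  = (SUM y:Y. k * cr (f (ep *. rvec y)) * E (y - x) ze)" for ze
 proof -
  have "ei (ep * (rvec y \<bullet> ze)) * em ((ep *. ze) \<bullet> rvec x) = ei (pi / r * (rvec (y - x) \<bullet> ze))" for y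
  proof -
  have rd: "rvec (y - x) = rvec y - rvec x" by (simp add: rvec_def vec_eq_iff)
  show ?thesis
  unfolding pr exp_add[symmetric] rd by (simp add: inner_diff_left inner_commute[of ze] algebra_simps)
  qed
  thus ?thesis unfolding coef_def latF_sum[OF lf] Y_def[symmetric] E_def k_def[symmetric]
  by (simp add: sum_distrib_left sum_distrib_right scaleR_sum_right mult.assoc)
 qed
 hence "(\<integral>ze. indicator (rbox r) ze *. (coef ep f ze * em ((ep *. ze) \<bullet> rvec x)) \<partial>lborel)
  = (SUM y:Y. k * cr (f (ep *. rvec y)) * (\<integral>ze. E (y - x) ze \<partial>lborel))"
  by (simp add: iE)
 also have "... = (SUM y:Y. if y = x then cr (f (ep *. rvec y)) else 0)"
 proof (intro sum.cong refl)
  have "k * cr ((2 * pi / ep) ^ CARD('a)) = 1"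
  unfolding k_def of_real_mult[symmetric] power_mult_distrib[symmetric] using ep by simp
  thus "k * cr (f (ep *. rvec y)) * (\<integral>ze. E (y - x) ze \<partial>lborel) = (if y = x then cr (f (ep *. rvec y)) else 0)" for y
  unfolding E0 by (simp add: mult_ac)
 qed
 also have "... = cr (f (ep *. rvec x))" using fY by (auto simp: Y_def)
 finally show ?thesis by (simp add: r_def)
qed

lemma wt_integrable: "integrable lborel (wt :: real^'d::finite => real)"
proof -
 let ?f = "%x::real. 1 / (1 + x^2 / 9)"
 have "integrable lborel (%x::real. inverse (1 + (0 + (1/3) * x)^2))"
  using integrable_inverse_1_plus_square by (subst lborel_integrable_real_affine_iff) (auto simp: set_integrable_def einterval_def)
 hence i1: "integrable lborel ?f" by (simp add: power_divide inverse_eq_divide)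
 have B: "(\<Prod>b\<in>Basis. ?f ((x::real^'d) \<bullet> b)) = wt x" for x
 proof -
  have i: "inj (%i::'d. axis i (1::real))" by (auto intro!: injI simp: axis_eq_axis)
  have b: "(Basis :: (real^'d) set) = (%i. axis i 1) ` UNIV" by (auto simp: Basis_vec_def)
  show ?thesis unfolding b wt_def by (subst prod.reindex[OF i]) (simp add: inner_axis)
 qed
 have "(\<integral>\<^sup>+x. ennreal (wt (x::real^'d)) \<partial>lborel) = (\<integral>\<^sup>+x. (\<Prod>b\<in>Basis. ennreal (?f ((x::real^'d) \<bullet> b))) \<partial>lborel)"
  by (intro nn_integral_cong) (subst prod_ennreal, auto simp: B)
 also have "... = (\<Prod>b\<in>(Basis::(real^'d) set). (\<integral>\<^sup>+x. ennreal (?f x) \<partial>lborel))"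
  by (rule nn_integral_lborel_prod) auto
 also have "... < \<infinity>"
 proof -
  have "(\<integral>\<^sup>+x. ennreal (?f x) \<partial>lborel) = ennreal (\<integral>x. ?f x \<partial>lborel)" by (rule nn_integral_eq_integral[OF i1]) auto
  moreover have "0 <= (\<integral>x. ?f x \<partial>lborel)" by (rule integral_nonneg_AE) simp
  ultimately show ?thesis by (simp add: ennreal_power)
 qed
 finally have fin: "(\<integral>\<^sup>+x. ennreal (wt (x::real^'d)) \<partial>lborel) < \<infinity>" .
 have "continuous_on UNIV (wt :: real^'d => real)"
  unfolding wt_def[abs_def] by (intro continuous_intros) (auto simp: add_nonneg_eq_0_iff)
 hence "(wt :: real^'d => real) : borel_measurable lborel" using borel_measurable_continuous_onI by auto
 thus ?thesis using fin wt_pos by (intro integrableI_nonneg) (auto intro: less_imp_le)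
qed

section \<open>The heat solution as a Fourier integral and the passage to the limit\<close>

definition qf :: "real^'d::finite^'d => real^'d => real" where "qf A ze = ze \<bullet> (A *v ze)"

lemma continuous_qf [continuous_intros]: "continuous_on S g ==> continuous_on S (%x. qf A (g x))"
 unfolding qf_def by (intro continuous_on_inner bounded_linear.continuous_on[OF matrix_vector_mul_bounded_linear])

text \<open>Serves derivatives in x and in t alike, since both variables enter the exponent
  linearly.\<close>

lemma leibniz_exp:
 fixes p u wa :: "real^'d::finite => complex"
 assumes c: "continuous_on UNIV p" "continuous_on UNIV u" "continuous_on UNIV wa"
 shows "((%s. integral (cbox a b) (%ze. p ze * exp (u ze + cr s * wa ze))) has_vector_derivative
  integral (cbox a b) (%ze. wa ze * p ze * exp (u ze + cr s * wa ze))) (at s)"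
proof -
 have c': "continuous_on S g ==> continuous_on S (%x. p (g x))" "continuous_on S g ==> continuous_on S (%x. u (g x))"
  "continuous_on S g ==> continuous_on S (%x. wa (g x))" for S :: "'b::topological_space set" and g
  using continuous_on_compose2[OF c(1)] continuous_on_compose2[OF c(2)] continuous_on_compose2[OF c(3)] by auto
 show ?thesis
 proof (rule leibniz_rule_vector_derivative[where U = UNIV, simplified])
  fix s ze
  have "((%z. p ze * exp (u ze + z * wa ze)) has_field_derivative (wa ze * p ze * exp (u ze + cr s * wa ze))) (at (cr s))"
  by (rule derivative_eq_intros refl | simp)+
  thus "((%s. p ze * exp (u ze + cr s * wa ze)) has_vector_derivative wa ze * p ze * exp (u ze + cr s * wa ze)) (at s)"
  by (rule has_vector_derivative_real_field)
 next
  fix s show "(%ze. p ze * exp (u ze + cr s * wa ze)) integrable_on cbox a b"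
  by (intro integrable_continuous continuous_intros c' continuous_on_id)
 next
  show "continuous_on (UNIV \<times> cbox a b) (%(s, ze). wa ze * p ze * exp (u ze + cr s * wa ze))"
  unfolding case_prod_beta by (intro continuous_intros c')
 qed
qed

text \<open>The heat evolution of the function whose Fourier density is p on a box. Because the box
  is bounded, differentiation under the integral asks only for continuity of p.\<close>

definition gI :: "real^'d::finite^'d => real^'d => real^'d => (real^'d => complex) => real^'d => real => complex" where
 "gI A a b p x t = integral (cbox a b) (%ze. p ze * exp (- \<i> * cr (x \<bullet> ze) - cr (t * qf A ze)))"

lemma gI_dx:
 assumes "continuous_on UNIV p"
 shows "((%s. Re (gI A a b p (x + s *. axis i 1) t)) has_real_derivative Re (gI A a b (%ze. - \<i> * cr (ze $ i) * p ze) x t)) (at 0)"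
proof -
 have e: "- \<i> * cr ((x + s *. axis i 1) \<bullet> ze) - cr (t * qf A ze)
  = (- \<i> * cr (x \<bullet> ze) - cr (t * qf A ze)) + cr s * (- \<i> * cr (ze $ i))" for s ze
  by (simp add: inner_add_left inner_axis' algebra_simps)
 have "((%s. gI A a b p (x + s *. axis i 1) t) has_vector_derivative gI A a b (%ze. - \<i> * cr (ze $ i) * p ze) x t) (at 0)"
  using leibniz_exp[of p "%ze. - \<i> * cr (x \<bullet> ze) - cr (t * qf A ze)" "%ze. - \<i> * cr (ze $ i)" a b 0, OF assms]
  unfolding gI_def e by (simp add: continuous_intros)
 from bounded_linear.has_vector_derivative[OF bounded_linear_Re this] show ?thesis
  by (simp add: has_real_derivative_iff_has_vector_derivative)
qed

lemma gI_dt: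
 assumes "continuous_on UNIV p"
 shows "((%s. Re (gI A a b p x s)) has_real_derivative Re (gI A a b (%ze. - cr (qf A ze) * p ze) x t)) (at t)"
proof -
 have e: "- \<i> * cr (x \<bullet> ze) - cr (s * qf A ze) = - \<i> * cr (x \<bullet> ze) + cr s * (- cr (qf A ze))" for s ze
  by simp
 have "((%s. gI A a b p x s) has_vector_derivative gI A a b (%ze. - cr (qf A ze) * p ze) x t) (at t)"
  unfolding gI_def e by (intro leibniz_exp continuous_intros assms)
 from bounded_linear.has_vector_derivative[OF bounded_linear_Re this] show ?thesis
  by (simp add: has_real_derivative_iff_has_vector_derivative)
qed

lemma gI_cont:
 assumes "continuous_on UNIV p" shows "continuous_on S (%(x, t). Re (gI A a b p x t))"
proof -
 have c': "continuous_on S' g ==> continuous_on S' (%x. p (g x))" for S' :: "'b::topological_space set" and g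
  using continuous_on_compose2[OF assms] by auto
 have "continuous_on S (%z. integral (cbox a b) (%ze. p ze * exp (- \<i> * cr (fst z \<bullet> ze) - cr (snd z * qf A ze))))"
  by (rule integral_continuous_on_param) (unfold case_prod_beta, intro continuous_intros c')
 thus ?thesis unfolding gI_def case_prod_beta by (intro continuous_intros)
qed

lemma gI_heat_sol:
 assumes p: "continuous_on UNIV p" and A: "!!ze. 0 <= qf A ze"
 shows "heat_sol A (%x. Re (gI A a b p x 0)) (%x t. Re (gI A a b p x t))"
proof -
 define p1 where "p1 i ze = - \<i> * cr (ze $ i) * p ze" for i ze
 define p2 where "p2 i j ze = - \<i> * cr (ze $ i) * p1 j ze" for i j ze
 define pt where "pt ze = - cr (qf A ze) * p ze" for ze
 have c: "continuous_on UNIV (p1 i)" "continuous_on UNIV (p2 i j)" "continuous_on UNIV pt" for i j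
  unfolding p1_def[abs_def] p2_def[abs_def] pt_def[abs_def] by (intro continuous_intros p)+
 have int: "(%ze. q ze * exp (- \<i> * cr (x \<bullet> ze) - cr (t * qf A ze))) integrable_on cbox a b" if "continuous_on UNIV q" for q x t
  by (intro integrable_continuous continuous_intros continuous_on_subset[OF that]) auto
 show ?thesis
  unfolding heat_sol_def
 proof (intro conjI allI impI exI[of _ "%x t. Re (gI A a b pt x t)"] exI[of _ "%i x t. Re (gI A a b (p1 i) x t)"] exI[of _ "%i j x t. Re (gI A a b (p2 i j) x t)"] gI_cont p c
  exI[of _ "integral (cbox a b) (%ze. cmod (p ze))"])
  show "\<bar>Re (gI A a b p x t)\<bar> <= integral (cbox a b) (%ze. cmod (p ze))" if "0 <= t" for x t
  proof (rule order_trans[OF abs_Re_le_cmod], unfold gI_def, rule integral_norm_bound_integral[OF int[OF p]])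
  show "(%ze. cmod (p ze)) integrable_on cbox a b" by (intro integrable_continuous continuous_intros continuous_on_subset[OF p]) auto
  show "cmod (p ze * exp (- \<i> * cr (x \<bullet> ze) - cr (t * qf A ze))) <= cmod (p ze)" for ze
  using A[of ze] that by (simp add: norm_mult mult_left_le)
  qed
  show "((%s. Re (gI A a b p x s)) has_real_derivative Re (gI A a b pt x t)) (at t)" for x t unfolding pt_def[abs_def] by (rule gI_dt[OF p])
  show "((%s. Re (gI A a b p (x + s *. axis i 1) t)) has_real_derivative Re (gI A a b (p1 i) x t)) (at 0)" for i x t
  unfolding p1_def[abs_def] by (rule gI_dx[OF p])
  show "((%s. Re (gI A a b (p1 j) (x + s *. axis i 1) t)) has_real_derivative Re (gI A a b (p2 i j) x t)) (at 0)" for i j x t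
  unfolding p2_def[abs_def] by (rule gI_dx[OF c(1)])
  show "Re (gI A a b pt x t) = (SUM i:UNIV. SUM j:UNIV. A $ i $ j * Re (gI A a b (p2 i j) x t))" for x t
  proof -
  let ?e = "%ze. exp (- \<i> * cr (x \<bullet> ze) - cr (t * qf A ze))"
  have pp: "pt ze * ?e ze = (SUM i:UNIV. SUM j:UNIV. cr (A $ i $ j) * (p2 i j ze * ?e ze))" for ze
  proof -
  have "qf A ze = (SUM i:UNIV. SUM j:UNIV. A $ i $ j * (ze $ i * ze $ j))"
  by (simp add: qf_def inner_vec_def matrix_vector_mult_def sum_distrib_left mult_ac)
  thus ?thesis by (simp add: pt_def p2_def p1_def sum_distrib_left sum_distrib_right sum_negf mult_ac)
  qed
  have i2: "(%ze. cr (A $ i $ j) * (p2 i j ze * ?e ze)) integrable_on cbox a b" for i j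
  by (intro integrable_on_mult_right int c)
  have "gI A a b pt x t = (SUM i:UNIV. integral (cbox a b) (%ze. SUM j:UNIV. cr (A $ i $ j) * (p2 i j ze * ?e ze)))"
  unfolding gI_def pp by (intro integral_sum finite integrable_sum i2)
  also have "... = (SUM i:UNIV. SUM j:UNIV. integral (cbox a b) (%ze. cr (A $ i $ j) * (p2 i j ze * ?e ze)))"
  by (intro sum.cong refl integral_sum finite i2)
  also have "... = (SUM i:UNIV. SUM j:UNIV. cr (A $ i $ j) * gI A a b (p2 i j) x t)"
  unfolding gI_def integral_mult_right ..
  finally have "gI A a b pt x t = (SUM i:UNIV. SUM j:UNIV. cr (A $ i $ j) * gI A a b (p2 i j) x t)" .
  thus ?thesis by simp
  qed
 qed simp
qed

lemma lborel_cbox_integral: "continuous_on UNIV f ==> (\<integral>ze. indicator (cbox a b) ze *. f ze \<partial>lborel) = integral (cbox a b) f"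
 and lborel_cbox_integrable: "continuous_on UNIV f ==> integrable lborel (%ze. indicator (cbox a b) ze *. f ze)"
 for f :: "real^'d::finite => complex"
proof -
 assume c: "continuous_on UNIV f"
 show i: "integrable lborel (%ze. indicator (cbox a b) ze *. f ze)"
  by (intro borel_integrable_compact compact_cbox continuous_on_subset[OF c]) auto
 show "(\<integral>ze. indicator (cbox a b) ze *. f ze \<partial>lborel) = integral (cbox a b) f"
  using set_borel_integral_eq_integral(2)[of "cbox a b" f] i by (simp add: set_integrable_def set_lebesgue_integral_def)
qed

lemma smooth_lipschitz:
 assumes "smooth_fun f" "compact_support f"
 obtains K where "0 <= K" "!!x y. \<bar>f x - f y\<bar> <= K * norm (x - y)"
proof -
 obtain D R B where D: "dtab D" "D [] = f" "!!J x. \<bar>D J x\<bar> <= B J" "!!J. continuous_on UNIV (D J)"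
  using smooth_bounded_table[OF assms] by metis
 define K where "K = (SUM i:UNIV. B [i])"
 have B0: "0 <= B J" for J by (rule order_trans[OF abs_ge_zero D(3)[of J 0]])
 show ?thesis
 proof (rule that[of K])
  show "0 <= K" unfolding K_def by (intro sum_nonneg B0)
  fix x y
  have "norm (f x - f y) <= K * norm (x - y)"
  proof (rule differentiable_bound[of UNIV f "%x h. SUM i:UNIV. h $ i * D [i] x"])
  show "(f has_derivative (%h. SUM i:UNIV. h $ i * D [i] x)) (at x within UNIV)" for x
  using has_derivative_of_partials[of f "%i. D [i]" x] D(1)[unfolded dtab_def, rule_format, of "[]"] D(2,4) by simp
  show "onorm (%h. SUM i:UNIV. h $ i * D [i] x) <= K" for x
  proof (rule onorm_le)
  fix h :: "real^'a"
  have "norm (SUM i:UNIV. h $ i * D [i] x) <= (SUM i:UNIV. norm h * B [i])"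
  by (intro sum_norm_le) (auto simp: abs_mult intro!: mult_mono component_le_norm_cart D(3) B0)
  thus "norm (SUM i:UNIV. h $ i * D [i] x) <= K * norm h" by (simp add: K_def sum_distrib_left mult.commute)
  qed
  qed auto
  thus "\<bar>f x - f y\<bar> <= K * norm (x - y)" by simp
 qed
qed

lemma component_wt: "\<bar>ze $ i\<bar> * wt ze <= 3"
proof -
 have f: "0 <= 1 / (1 + (ze $ k)^2 / 9)" "1 / (1 + (ze $ k)^2 / 9) <= 1" for k by (auto simp: divide_le_eq_1 add_pos_nonneg)
 have "wt ze = 1 / (1 + (ze $ i)^2 / 9) * (\<Prod>k\<in>UNIV - {i}. 1 / (1 + (ze $ k)^2 / 9))"
  unfolding wt_def by (subst prod.remove[of _ i]) auto
 also have "... <= 1 / (1 + (ze $ i)^2 / 9) * 1" by (intro mult_left_mono prod_le_1) (use f in auto)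
 finally have "\<bar>ze $ i\<bar> * wt ze <= \<bar>ze $ i\<bar> * (1 / (1 + (ze $ i)^2 / 9))" by (intro mult_left_mono) auto
 also have "... <= 3"
 proof -
  have "b <= 3 * (1 + b^2 / 9)" for b :: real
  proof -
  have "12 * b <= 4 * b^2 + 36" using zero_le_power2[of "2 * b - 3"] by (simp add: power2_eq_square algebra_simps)
  thus ?thesis by simp
  qed
  from this[of "\<bar>ze $ i\<bar>"] have "\<bar>ze $ i\<bar> <= 3 * (1 + (ze $ i)^2 / 9)" by simp
  thus ?thesis by (simp add: divide_le_eq add_pos_nonneg)
 qed
 finally show ?thesis .
qed

text \<open>At points of the lattice the integral equals f by \<open>coef_inversion\<close>. Between
  x and the lattice point y obtained by rounding down, both sides move by O(\<epsilon>): f because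
  it is Lipschitz, the integral because |\<zeta>_i| wt \<le> 3 leaves an integrable bound.\<close>

lemma gI_initial:
 assumes f: "smooth_fun f" "compact_support f"
 obtains K where "!!ep x. 0 < ep ==> ep <= 1 ==>
  \<bar>Re (gI A (\<chi> i. - (pi / ep)) (\<chi> i. pi / ep) (coef ep f) x 0) - f x\<bar> <= K * ep"
proof -
 obtain C where C: "0 <= C" "!!ep ze. 0 < ep ==> ep <= 1 ==> ze : rbox (pi / ep) ==> cmod (coef ep f ze) <= C * (wt ze)^2"
  using coef_decay[OF f] by metis
 obtain K where K: "0 <= K" "!!x y. \<bar>f x - f y\<bar> <= K * norm (x - y)" using smooth_lipschitz[OF f] by metis
 obtain D R B where D: "dtab D" "D [] = f" "0 <= R" "!!J x. R < norm x ==> D J x = 0" using smooth_bounded_table[OF f] by metis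
 have fs: "R < norm x ==> f x = 0" for x using D(4)[of x "[]"] D(2) by simp
 define d where "d = real CARD('a)"
 define IW where "IW = (\<integral>ze. wt (ze::real^'a) \<partial>lborel)"
 define K' where "K' = 3 * d * C * IW + K * d"
 show ?thesis
 proof (rule that[of K'])
  fix ep :: real and x :: "real^'a" assume ep: "0 < ep" "ep <= 1"
  have lf: "lfin ep f" by (rule support_lfin[OF fs D(3) ep])
  note cc = continuous_coef[OF lf]
  define z :: "int^'a" where "z = (\<chi> i. \<lfloor>x $ i / ep\<rfloor>)"
  define y where "y = ep *. rvec z"
  have xy: "\<bar>x $ i - y $ i\<bar> <= ep" for i
  proof -
  have "ep * real_of_int \<lfloor>x $ i / ep\<rfloor> <= ep * (x $ i / ep)" "ep * (x $ i / ep) <= ep * (real_of_int \<lfloor>x $ i / ep\<rfloor> + 1)"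
  using ep by (intro mult_left_mono; linarith)+
  hence "ep * real_of_int \<lfloor>x $ i / ep\<rfloor> <= x $ i" "x $ i <= ep * real_of_int \<lfloor>x $ i / ep\<rfloor> + ep" using ep by (simp_all add: distrib_left)
  thus ?thesis by (simp add: y_def z_def rvec_def abs_le_iff)
  qed
  define W where "W x = (\<integral>ze. indicator (rbox (pi / ep)) ze *. (coef ep f ze * em (x \<bullet> ze)) \<partial>lborel)" for x
  have int: "integrable lborel (%ze. indicator (rbox (pi / ep)) ze *. (coef ep f ze * em (x \<bullet> ze)))" for x
  unfolding rbox_def by (intro lborel_cbox_integrable continuous_intros cc)
  have gW: "gI A (\<chi> i. - (pi / ep)) (\<chi> i. pi / ep) (coef ep f) x 0 = W x" for x
  unfolding gI_def W_def rbox_def by (subst lborel_cbox_integral) (auto intro!: continuous_intros cc)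
  have Wy: "W y = cr (f y)"
  unfolding W_def y_def coef_inversion[OF lf ep(1)] by (simp add: inner_commute)
  have "cmod (W x - W y) = cmod (\<integral>ze. indicator (rbox (pi / ep)) ze *. (coef ep f ze * em (x \<bullet> ze)) - indicator (rbox (pi / ep)) ze *. (coef ep f ze * em (y \<bullet> ze)) \<partial>lborel)"
  unfolding W_def Bochner_Integration.integral_diff[OF int int] ..
  also have "... <= (\<integral>ze. (3 * d * C * ep) * wt (ze::real^'a) \<partial>lborel)"
  proof (rule Bochner_Integration.integral_norm_bound_integral)
  show "integrable lborel (%ze::real^'a. (3 * d * C * ep) * wt ze)" by (intro integrable_mult_right wt_integrable)
  fix ze :: "real^'a"
  show "cmod (indicator (rbox (pi / ep)) ze *. (coef ep f ze * em (x \<bullet> ze)) - indicator (rbox (pi / ep)) ze *. (coef ep f ze * em (y \<bullet> ze))) <= (3 * d * C * ep) * wt ze"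
  proof (cases "ze : rbox (pi / ep)")
  case True
  have "\<bar>x \<bullet> ze - y \<bullet> ze\<bar> = \<bar>SUM i:UNIV. (x $ i - y $ i) * ze $ i\<bar>"
  by (simp add: inner_vec_def left_diff_distrib sum_subtractf)
  also have "... <= (SUM i:UNIV. \<bar>(x $ i - y $ i) * ze $ i\<bar>)" by (rule sum_abs)
  also have "... <= (SUM i:UNIV. ep * \<bar>ze $ i\<bar>)" unfolding abs_mult by (intro sum_mono mult_right_mono xy) auto
  finally have p: "\<bar>x \<bullet> ze - y \<bullet> ze\<bar> <= (SUM i:UNIV. ep * \<bar>ze $ i\<bar>)" .
  have w0: "0 <= wt ze" using wt_pos[of ze] by simp
  have "cmod (coef ep f ze * (em (x \<bullet> ze) - em (y \<bullet> ze))) <= (C * (wt ze)^2) * (SUM i:UNIV. ep * \<bar>ze $ i\<bar>)"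
  unfolding norm_mult using C(1) by (intro mult_mono C(2)[OF ep True] order_trans[OF phase_diff p]) auto
  also have "... = C * ep * wt ze * (SUM i:UNIV. \<bar>ze $ i\<bar> * wt ze)"
  by (simp add: power2_eq_square sum_distrib_left mult_ac)
  also have "... <= C * ep * wt ze * (SUM i:(UNIV::'a set). 3)"
  using C(1) ep w0 by (intro mult_left_mono sum_mono component_wt) auto
  finally show ?thesis using True by (simp add: right_diff_distrib d_def mult_ac)
  next
  case False
  thus ?thesis using C(1) ep wt_pos[of ze] by (simp add: d_def)
  qed
  qed (intro Bochner_Integration.integrable_diff int)
  also have "... = 3 * d * C * IW * ep" by (simp add: IW_def)
  finally have "\<bar>Re (W x) - f y\<bar> <= 3 * d * C * IW * ep" using abs_Re_le_cmod[of "W x - W y"] by (simp add: Wy)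
  moreover have "\<bar>f x - f y\<bar> <= K * (d * ep)"
  proof (rule order_trans[OF K(2) mult_left_mono[OF _ K(1)]])
  have "norm (x - y) <= (SUM i:UNIV. \<bar>(x - y) $ i\<bar>)" by (rule norm_le_l1_cart)
  also have "... <= (SUM i:(UNIV::'a set). ep)" by (intro sum_mono) (simp add: xy)
  finally show "norm (x - y) <= d * ep" by (simp add: d_def)
  qed
  ultimately show "\<bar>Re (gI A (\<chi> i. - (pi / ep)) (\<chi> i. pi / ep) (coef ep f) x 0) - f x\<bar> <= K' * ep"
  unfolding gW K'_def by (simp add: algebra_simps abs_le_iff)
 qed
qed

text \<open>Shared by both settings. \<open>Adm ep\<close> is the set of macroscopic times, and
  \<open>F ep t N\<close> a multiplier whose limit in N represents the expected solution; it is
  constant in N for discrete time, and N counts Euler steps otherwise. Negating the claim picks one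
  sequence of parameters, sites and times. Along it no supremum is left inside the integral, and
  dominated convergence in \<zeta> applies with the dominating function 2 C wt.\<close>

lemma homogenization_from_plane_waves:
 fixes f :: "real^'d::finite => real" and F :: "real => real => nat => real^'d => complex" and U :: "real => int^'d => real => real"
  and Adm :: "real => real set"
 assumes f: "smooth_fun f" "compact_support f" and A: "!!ze. 0 <= qf A ze" and u: "heat_sol A f uhom"
  and Fm: "!!ep t N. 0 < ep ==> ep <= 1 ==> t : Adm ep ==> F ep t N : borel_measurable borel"
  and F1: "!!ep t N ze. 0 < ep ==> ep <= 1 ==> t : Adm ep ==> cmod (F ep t N ze) <= 1"
  and U: "!!ep t z. 0 < ep ==> ep <= 1 ==> t : Adm ep ==>
  (%N. \<integral>ze. indicator (rbox (pi / ep)) ze *. (coef ep f ze * (em ((ep *. ze) \<bullet> rvec z) * F ep t N ze)) \<partial>lborel)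
  \<longlonglongrightarrow> cr (U ep z t)"
  and pw: "!!ze ka. ze ~= 0 ==> 0 < ka ==> \<forall>\<^sub>F ep in at_right 0. ALL t:Adm ep. \<forall>\<^sub>F N in sequentially.
  cmod (F ep t N ze - cr (exp (- t * qf A ze))) <= ka"
  and Adm: "!!ep t. t : Adm ep ==> 0 <= t"
  and de: "0 < de"
 shows "EX ep0>0. ALL ep. 0 < ep & ep < ep0 & ep <= 1 --> (ALL z. ALL t:Adm ep. \<bar>U ep z t - uhom (ep *. rvec z) t\<bar> <= de)"
proof (rule ccontr)
 assume neg: "\<not> ?thesis"
 have "EX p. 0 < fst p & fst p < 1 / (real k + 1) & fst p <= 1 & snd (snd p) : Adm (fst p) &
  de < \<bar>U (fst p) (fst (snd p)) (snd (snd p)) - uhom (fst p *. rvec (fst (snd p))) (snd (snd p))\<bar>" for k :: nat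
 proof -
  have "0 < 1 / (real k + 1)" by simp
  then obtain ep z t where "0 < ep" "ep < 1 / (real k + 1)" "ep <= 1" "t : Adm ep" "\<not> \<bar>U ep z t - uhom (ep *. rvec z) t\<bar> <= de"
  using neg by blast
  thus ?thesis by (intro exI[of _ "(ep, z, t)"]) simp
 qed
 then obtain p where p: "!!k::nat. 0 < fst (p k) & fst (p k) < 1 / (real k + 1) & fst (p k) <= 1 & snd (snd (p k)) : Adm (fst (p k)) &
  de < \<bar>U (fst (p k)) (fst (snd (p k))) (snd (snd (p k))) - uhom (fst (p k) *. rvec (fst (snd (p k)))) (snd (snd (p k)))\<bar>"
  by metis
 define e where "e k = fst (p k)" for k
 define z where "z k = fst (snd (p k))" for k
 define t where "t k = snd (snd (p k))" for k
 have e: "0 < e k" "e k < 1 / (real k + 1)" "e k <= 1" and t: "t k : Adm (e k)"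
  and far: "de < \<bar>U (e k) (z k) (t k) - uhom (e k *. rvec (z k)) (t k)\<bar>" for k
  using p[of k] by (auto simp: e_def z_def t_def)
 have e0: "e \<longlonglongrightarrow> 0"
 proof (rule tendsto_sandwich[of "%_. 0", OF _ _ tendsto_const])
  show "(%k. 1 / (real k + 1)) \<longlonglongrightarrow> 0" using LIMSEQ_inverse_real_of_nat by (simp add: inverse_eq_divide add.commute)
 qed (intro always_eventually allI less_imp_le e)+
 hence er: "filterlim e (at_right 0) sequentially" using e by (intro filterlim_at_withinI) (auto simp: eventually_sequentially)
 obtain C where C: "0 <= C" "!!ep ze. 0 < ep ==> ep <= 1 ==> ze : rbox (pi / ep) ==> cmod (coef ep f ze) <= C * (wt ze)^2"
  using coef_decay[OF f] by metis
 obtain K where K: "!!ep x. 0 < ep ==> ep <= 1 ==> \<bar>Re (gI A (\<chi> i. - (pi / ep)) (\<chi> i. pi / ep) (coef ep f) x 0) - f x\<bar> <= K * ep"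
  using gI_initial[OF f] by metis
 obtain D :: "'d list => real^'d => real" and R where D: "D [] = f" "0 <= R" "!!J x. R < norm x ==> D J x = 0" using smooth_bounded_table[OF f] by metis
 have fs: "R < norm x ==> f x = 0" for x using D(3)[of x "[]"] D(1) by simp
 have lf: "lfin (e k) f" for k by (rule support_lfin[OF fs D(2) e(1,3)])
 note cc = continuous_coef[OF lf]
 have wtm [measurable]: "(wt :: real^'d => real) : borel_measurable borel" using borel_measurable_integrable[OF wt_integrable] by simp
 define E where "E k ze = cr (exp (- t k * qf A ze))" for k ze
 define u' where "u' k N ze = ennreal (C * wt ze * cmod (F (e k) (t k) N ze - E k ze))" for k N ze
 define g where "g k ze = limsup (%N. u' k N ze)" for k ze
 have Em [measurable]: "E k : borel_measurable borel" for k
  unfolding E_def by (intro borel_measurable_continuous_onI continuous_intros)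
 have Fm' [measurable]: "F (e k) (t k) N : borel_measurable borel" for k N by (rule Fm[OF e(1,3) t])
 have um [measurable]: "u' k N : borel_measurable borel" for k N unfolding u'_def by measurable
 have gm [measurable]: "g k : borel_measurable borel" for k unfolding g_def by measurable
 have E1: "cmod (E k ze) <= 1" for k ze using Adm[OF t[of k]] A[of ze] by (simp add: E_def)
 have ub: "u' k N ze <= ennreal (2 * C * wt ze)" for k N ze
 proof -
  have "cmod (F (e k) (t k) N ze) <= 1" by (rule F1[OF e(1,3) t])
  hence "cmod (F (e k) (t k) N ze - E k ze) <= 2"
  using norm_triangle_ineq4[of "F (e k) (t k) N ze" "E k ze"] E1[of k ze] by linarith
  hence "C * wt ze * cmod (F (e k) (t k) N ze - E k ze) <= C * wt ze * 2" using C(1) wt_pos[of ze] by (intro mult_left_mono) auto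
  thus ?thesis unfolding u'_def by (intro ennreal_leI) (simp add: mult_ac)
 qed
 have wfin: "(\<integral>\<^sup>+ze. ennreal (2 * C * wt (ze::real^'d)) \<partial>lborel) < \<infinity>"
 proof -
  have "0 <= 2 * C * wt (ze::real^'d)" for ze using C(1) wt_pos[of ze] by simp
  hence "AE ze in lborel. 0 <= 2 * C * wt (ze::real^'d)" by (intro AE_I2)
  from nn_integral_eq_integral[OF integrable_mult_right[OF wt_integrable, of "2 * C"] this] show ?thesis by simp
 qed
 have J0: "(%k. \<integral>\<^sup>+ze. g k ze \<partial>lborel) \<longlonglongrightarrow> (\<integral>\<^sup>+ze. 0 \<partial>(lborel :: (real^'d) measure))"
 proof (rule nn_integral_dominated_convergence[OF _ _ _ _ wfin])
  show "AE ze in lborel. g k ze <= ennreal (2 * C * wt ze)" for k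
  unfolding g_def by (intro AE_I2 Limsup_bounded always_eventually allI ub)
  \<comment> \<open>\<open>pw\<close> excludes \<zeta> = 0, where the decay rate vanishes; a single
    point is a null set.\<close>
  have "AE ze in lborel. ze ~= (0 :: real^'d)" by (rule AE_lborel_singleton)
  thus "AE ze in lborel. (%k. g k ze) \<longlonglongrightarrow> 0"
  proof eventually_elim
  case (elim ze)
  show ?case
  proof (rule order_tendstoI)
  fix a :: ennreal assume "0 < a"
  then obtain b where b: "0 < b" "b < a" using dense by blast
  have "b < top" by (rule less_le_trans[OF b(2) top_greatest])
  then obtain ka where "b = ennreal ka" by (cases b) auto
  hence bk: "b = ennreal ka" "0 < ka" using b(1) by (simp_all add: ennreal_less_zero_iff)
  define c where "c = C * wt ze + 1"
  have c: "0 < c" "C * wt ze <= c" using C(1) wt_pos[of ze] by (auto simp: c_def add_nonneg_pos)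
  have "0 < ka / c" using bk c by simp
  from pw[OF elim this] have "\<forall>\<^sub>F k in sequentially. ALL t:Adm (e k). \<forall>\<^sub>F N in sequentially. cmod (F (e k) t N ze - cr (exp (- t * qf A ze))) <= ka / c"
  using er unfolding filterlim_iff by blast
  thus "\<forall>\<^sub>F k in sequentially. g k ze < a"
  proof eventually_elim
  case (elim k)
  hence "\<forall>\<^sub>F N in sequentially. cmod (F (e k) (t k) N ze - E k ze) <= ka / c" using t[of k] unfolding E_def by blast
  hence "\<forall>\<^sub>F N in sequentially. u' k N ze <= ennreal ka"
  proof eventually_elim
  case (elim N)
  have "C * wt ze * cmod (F (e k) (t k) N ze - E k ze) <= c * (ka / c)" using c elim C(1) wt_pos[of ze] by (intro mult_mono) auto
  thus ?case unfolding u'_def using c by (intro ennreal_leI) simp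
  qed
  hence "g k ze <= ennreal ka" unfolding g_def by (rule Limsup_bounded)
  thus ?case using b(2) unfolding bk(1) by (rule le_less_trans)
  qed
  qed simp
  qed
 qed auto
 have close: "ennreal (cmod (cr (U (e k) (z k) (t k)) - gI A (\<chi> i. - (pi / e k)) (\<chi> i. pi / e k) (coef (e k) f) (e k *. rvec (z k)) (t k))) <= (\<integral>\<^sup>+ze. g k ze \<partial>lborel)" for k
 proof -
  define ph where "ph ze = em ((e k *. ze) \<bullet> rvec (z k))" for ze
  define V where "V = gI A (\<chi> i. - (pi / e k)) (\<chi> i. pi / e k) (coef (e k) f) (e k *. rvec (z k)) (t k)"
  define a where "a N = (\<integral>ze. indicator (rbox (pi / e k)) ze *. (coef (e k) f ze * (ph ze * F (e k) (t k) N ze)) \<partial>lborel)" for N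
  have phm [measurable]: "ph : borel_measurable borel" and ph1: "cmod (ph ze) = 1" for ze
  unfolding ph_def by (intro borel_measurable_continuous_onI continuous_intros) simp
  have cm [measurable]: "coef (e k) f : borel_measurable borel" by (intro borel_measurable_continuous_onI cc)
  have rm [measurable]: "(rbox (pi / e k) :: (real^'d) set) : sets borel" by (simp add: rbox_def)
  have ib: "integrable lborel (%ze. indicator (rbox (pi / e k)) ze *. (coef (e k) f ze * (ph ze * G ze)))"
  if [measurable]: "G : borel_measurable borel" and G: "!!ze. cmod (G ze) <= 1" for G
  proof (rule Bochner_Integration.integrable_bound)
  show "integrable lborel (%ze. indicator (rbox (pi / e k)) ze *. coef (e k) f ze)" unfolding rbox_def by (intro lborel_cbox_integrable cc)
  show "AE ze in lborel. norm (indicator (rbox (pi / e k)) ze *. (coef (e k) f ze * (ph ze * G ze))) <= norm (indicator (rbox (pi / e k)) ze *. coef (e k) f ze)"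
  by (intro AE_I2) (simp add: norm_mult ph1 G mult_left_le indicator_def)
  qed measurable
  have V: "V = (\<integral>ze. indicator (rbox (pi / e k)) ze *. (coef (e k) f ze * (ph ze * E k ze)) \<partial>lborel)"
  proof -
  have "(\<integral>ze. indicator (rbox (pi / e k)) ze *. (coef (e k) f ze * (ph ze * E k ze)) \<partial>lborel) = integral (cbox (\<chi> i. - (pi / e k)) (\<chi> i. pi / e k)) (%ze. coef (e k) f ze * (ph ze * E k ze))"
  unfolding rbox_def by (rule lborel_cbox_integral) (unfold ph_def E_def, intro continuous_intros cc)
  also have "... = V" unfolding V_def gI_def
  proof (intro integral_cong)
  fix ze
  have "ph ze * E k ze = exp (- \<i> * cr ((e k *. rvec (z k)) \<bullet> ze) - cr (t k * qf A ze))"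
  unfolding ph_def E_def exp_of_real[symmetric] exp_add[symmetric] by (simp add: inner_commute)
  thus "coef (e k) f ze * (ph ze * E k ze) = coef (e k) f ze * exp (- \<i> * cr ((e k *. rvec (z k)) \<bullet> ze) - cr (t k * qf A ze))" by simp
  qed
  finally show ?thesis ..
  qed
  have aV: "ennreal (cmod (a N - V)) <= (\<integral>\<^sup>+ze. u' k N ze \<partial>lborel)" for N
  proof -
  have F1': "cmod (F (e k) (t k) N ze) <= 1" for ze by (rule F1[OF e(1,3) t])
  let ?h = "%ze. indicator (rbox (pi / e k)) ze *. (coef (e k) f ze * (ph ze * F (e k) (t k) N ze)) - indicator (rbox (pi / e k)) ze *. (coef (e k) f ze * (ph ze * E k ze))"
  have ih: "integrable lborel ?h" by (intro Bochner_Integration.integrable_diff ib Fm' Em F1' E1)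
  have "a N - V = (\<integral>ze. ?h ze \<partial>lborel)" unfolding a_def V by (intro Bochner_Integration.integral_diff[symmetric] ib Fm' Em F1' E1)
  hence "ennreal (cmod (a N - V)) <= (\<integral>\<^sup>+ze. norm (?h ze) \<partial>lborel)" using integral_norm_bound_ennreal[OF ih] by simp
  also have "... <= (\<integral>\<^sup>+ze. u' k N ze \<partial>lborel)"
  proof (intro nn_integral_mono)
  fix ze :: "real^'d"
  have wa: "0 <= wt ze" "wt ze * wt ze <= wt ze * 1" using wt_pos[of ze] wt_le_1[of ze] by (auto intro!: mult_left_mono)
  show "ennreal (norm (?h ze)) <= u' k N ze"
  proof (cases "ze : rbox (pi / e k)")
  case True
  have "norm (?h ze) = cmod (coef (e k) f ze * (ph ze * (F (e k) (t k) N ze - E k ze)))" using True by (simp add: right_diff_distrib)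
  also have "... <= (C * (wt ze)^2) * cmod (F (e k) (t k) N ze - E k ze)"
  unfolding norm_mult ph1 using C(2)[OF e(1,3) True] by (simp add: mult_right_mono)
  also have "... <= (C * wt ze) * cmod (F (e k) (t k) N ze - E k ze)"
  using wa C(1) by (intro mult_right_mono mult_left_mono) (auto simp: power2_eq_square)
  finally show ?thesis unfolding u'_def by (rule ennreal_leI)
  qed (simp add: u'_def)
  qed
  finally show ?thesis .
  qed
  have "a \<longlonglongrightarrow> cr (U (e k) (z k) (t k))" unfolding a_def ph_def by (rule U[OF e(1,3) t])
  hence "(%N. ennreal (cmod (a N - V))) \<longlonglongrightarrow> ennreal (cmod (cr (U (e k) (z k) (t k)) - V))"
  by (intro tendsto_ennrealI tendsto_intros)
  hence "ennreal (cmod (cr (U (e k) (z k) (t k)) - V)) = limsup (%N. ennreal (cmod (a N - V)))"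
  by (intro lim_imp_Limsup[symmetric]) auto
  also have "... <= limsup (%N. \<integral>\<^sup>+ze. u' k N ze \<partial>lborel)" by (intro Limsup_mono always_eventually allI aV)
  also have "... <= (\<integral>\<^sup>+ze. g k ze \<partial>lborel)"
  unfolding g_def by (rule nn_integral_limsup[OF _ _ _ wfin]) (auto intro!: AE_I2 ub)
  finally show ?thesis unfolding V_def .
 qed
 have "\<forall>\<^sub>F k in sequentially. (\<integral>\<^sup>+ze. g k ze \<partial>lborel) < ennreal (de / 2)"
  using J0 de by (intro order_tendstoD(2)[of _ 0]) auto
 moreover have "\<forall>\<^sub>F k in sequentially. \<bar>K\<bar> * e k < de / 2"
 proof -
  have "(%k. \<bar>K\<bar> * e k) \<longlonglongrightarrow> \<bar>K\<bar> * 0" by (intro tendsto_intros e0)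
  thus ?thesis using de by (intro order_tendstoD(2)[of _ 0]) auto
 qed
 ultimately have "\<forall>\<^sub>F k in sequentially. False"
 proof eventually_elim
  case (elim k)
  define V where "V = gI A (\<chi> i. - (pi / e k)) (\<chi> i. pi / e k) (coef (e k) f) (e k *. rvec (z k)) (t k)"
  have "ennreal (cmod (cr (U (e k) (z k) (t k)) - V)) < ennreal (de / 2)"
  unfolding V_def by (rule le_less_trans[OF close elim(1)])
  hence "cmod (cr (U (e k) (z k) (t k)) - V) < de / 2" by (simp add: ennreal_less_iff)
  hence a: "\<bar>U (e k) (z k) (t k) - Re V\<bar> < de / 2" using abs_Re_le_cmod[of "cr (U (e k) (z k) (t k)) - V"] by simp
  have "\<bar>Re V - uhom (e k *. rvec (z k)) (t k)\<bar> <= K * e k"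
  unfolding V_def
  by (rule heat_maximum_principle[OF gI_heat_sol[OF cc A] u A[unfolded qf_def] K[OF e(1,3)] Adm[OF t]])
  also have "... <= \<bar>K\<bar> * e k" using e(1)[of k] by (intro mult_right_mono) auto
  finally show False using a elim(2) far[of k] by linarith
 qed
 thus False by simp
qed

section \<open>Conclusion in discrete and in continuous time\<close>

lemma smooth_lfin:
 fixes f :: "real^'d::finite => real"
 assumes "smooth_fun f" "compact_support f" "0 < ep" "ep <= 1"
 shows "lfin ep f"
proof -
 obtain D :: "'d list => real^'d => real" and R where D: "D [] = f" "0 <= R" "!!J x. R < norm x ==> D J x = 0" using smooth_bounded_table[OF assms(1,2)] by metis
 show ?thesis by (rule support_lfin[OF _ D(2) assms(3,4)]) (use D(3)[of _ "[]"] D(1) in simp)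
qed

context disc
begin

lemma homogenization_disc:
 fixes f :: "real^'d => real"
 assumes erg: "(EX j. ergodic_map M (T (ue j))) \<or> ergodic_map M (S 1)"
  and ah: "is_ahom M T a (Phi_eq_disc M T S a) A"
  and f: "smooth_fun f" "compact_support f" and u: "heat_sol A f uhom" and de: "0 < de"
 shows "EX ep0>0. ALL ep. 0 < ep & ep < ep0 & ep <= 1 -->
  (ALL z n. \<bar>(\<integral>w. dsol T S a (%y. f (ep *. rvec y)) w n z \<partial>M) - uhom (ep *. rvec z) (ep^2 * real n)\<bar> <= de)"
proof -
 have qA: "0 <= qf A ze" for ze
 proof -
  have "l * (norm ze)^2 <= 2 * (ze \<bullet> (A *v ze))"
  by (rule ahom_coercive[OF dense_disc[OF erg] a lL ah PhiEq_disc])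
  moreover have "0 <= l * (norm ze)^2" using lL by simp
  ultimately show ?thesis unfolding qf_def by linarith
 qed
 \<comment> \<open>Recovers the number n of steps from the macroscopic time \<epsilon>^2 n. The
   index k of F below is a dummy, so the limit over it is that of a constant sequence.\<close>
 define N where "N ep t = nat \<lfloor>t / ep^2\<rfloor>" for ep t :: real
 have N: "N ep (ep^2 * real n) = n" if "0 < ep" for ep n using that by (simp add: N_def)
 define F where "F ep t k ze = expectation (wd (ep *. ze) (N ep t))" for ep t and k :: nat and ze
 define U where "U ep z t = (\<integral>w. dsol T S a (%y. f (ep *. rvec y)) w (N ep t) z \<partial>M)" for ep z t
 have "EX ep0>0. ALL ep. 0 < ep & ep < ep0 & ep <= 1 --> (ALL z. ALL t:range (%n. ep^2 * real n). \<bar>U ep z t - uhom (ep *. rvec z) t\<bar> <= de)"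
 proof (rule homogenization_from_plane_waves[OF f qA u, where F = F and U = U and Adm = "%ep. range (%n. ep^2 * real n)", OF _ _ _ _ _ de])
  fix ep t :: real and k :: nat and ze z
  show "F ep t k : borel_measurable borel" unfolding F_def[abs_def] by (rule measurable_expectation_wd)
  show "cmod (F ep t k ze) <= 1" unfolding F_def by (rule cmod_expectation_wd)
  show "0 <= t" if "t : range (%n. ep^2 * real n)" using that by auto
  assume ep: "0 < ep" "ep <= 1"
  note lf = smooth_lfin[OF f ep]
  have "cr (U ep z t) = (\<integral>ze. indicator (rbox (pi / ep)) ze *. (coef ep f ze * (em ((ep *. ze) \<bullet> rvec z) * F ep t k ze)) \<partial>lborel)" for k
  unfolding U_def F_def rbox_def
  by (rule expectation_dsol(2)[OF continuous_coef[OF lf] coef_inversion[OF lf ep(1), unfolded rbox_def]])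
  thus "(%k. \<integral>ze. indicator (rbox (pi / ep)) ze *. (coef ep f ze * (em ((ep *. ze) \<bullet> rvec z) * F ep t k ze)) \<partial>lborel)
  \<longlonglongrightarrow> cr (U ep z t)" by simp
 next
  fix ze :: "real^'d" and ka :: real assume "ze ~= 0" "0 < ka"
  from plane_wave_limit[OF erg ah this] eventually_at_right_less[of "0::real"]
  show "\<forall>\<^sub>F ep in at_right 0. ALL t:range (%n. ep^2 * real n). \<forall>\<^sub>F k in sequentially. cmod (F ep t k ze - cr (exp (- t * qf A ze))) <= ka"
  proof eventually_elim
  case (elim ep)
  thus ?case by (auto simp: F_def N qf_def)
  qed
 qed
 then obtain ep0 where ep0: "0 < ep0" "!!ep z t. 0 < ep ==> ep < ep0 ==> ep <= 1 ==> t : range (%n. ep^2 * real n) ==> \<bar>U ep z t - uhom (ep *. rvec z) t\<bar> <= de"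
  by blast
 show ?thesis
 proof (intro exI[of _ ep0] conjI allI impI ep0(1))
  fix ep z n assume "0 < ep & ep < ep0 & ep <= 1"
  thus "\<bar>(\<integral>w. dsol T S a (%y. f (ep *. rvec y)) w n z \<partial>M) - uhom (ep *. rvec z) (ep^2 * real n)\<bar> <= de"
  using ep0(2)[of ep "ep^2 * real n" z] by (simp add: U_def N)
 qed
qed

end

context cont
begin

lemma homogenization_cont:
 fixes f :: "real^'d => real"
 assumes erg: "(EX j. ergodic_map M (T (ue j))) \<or> ergodic_flow M S"
  and ah: "is_ahom M T a (Phi_eq_cont M T S a) A"
  and f: "smooth_fun f" "compact_support f" and uh: "heat_sol A f uhom" and de: "0 < de"
  and u: "!!ep. 0 < ep ==> ep <= 1 ==> is_csol M T S a (%y. f (ep *. rvec y)) (u ep)"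
 shows "EX ep0>0. ALL ep. 0 < ep & ep < ep0 & ep <= 1 -->
  (ALL z. ALL t>0. \<bar>(\<integral>w. u ep z (t / ep^2) w \<partial>M) - uhom (ep *. rvec z) t\<bar> <= de)"
proof -
 have qA: "0 <= qf A ze" for ze
 proof -
  have "l * (norm ze)^2 <= 2 * (ze \<bullet> (A *v ze))"
  by (rule ahom_coercive[OF dense_cont[OF erg] a lL ah PhiEq_cont])
  moreover have "0 <= l * (norm ze)^2" using lL by simp
  ultimately show ?thesis unfolding qf_def by linarith
 qed
 obtain D :: "'d list => real^'d => real" and B where D: "D [] = f" "!!J x. \<bar>D J x\<bar> <= B J" using smooth_bounded_table[OF f] by metis
 have H: "\<bar>f x\<bar> <= B []" for x using D(2)[of "[]" x] D(1) by simp
 define F where "F ep t k ze = euler_F (t / ep^2) k (ep *. ze)" for ep t k ze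
 define U where "U ep z t = (\<integral>w. u ep z (t / ep^2) w \<partial>M)" for ep z t
 have "EX ep0>0. ALL ep. 0 < ep & ep < ep0 & ep <= 1 --> (ALL z. ALL t:{0<..}. \<bar>U ep z t - uhom (ep *. rvec z) t\<bar> <= de)"
 proof (rule homogenization_from_plane_waves[OF f qA uh, where F = F and U = U and Adm = "%ep. {0<..}", OF _ _ _ _ _ de])
  fix ep t :: real and k :: nat and ze z
  show "0 <= t" if "t : {0<..}" using that by auto
  assume ep: "0 < ep" "ep <= 1" and "t : {0<..}"
  hence t: "0 < t / ep^2" by simp
  show "F ep t k : borel_measurable borel" unfolding F_def[abs_def] by (rule euler_F_props(1)[OF t])
  show "cmod (F ep t k ze) <= 1" unfolding F_def by (rule euler_F_props(2)[OF t])
  note lf = smooth_lfin[OF f ep]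
  show "(%k. \<integral>ze. indicator (rbox (pi / ep)) ze *. (coef ep f ze * (em ((ep *. ze) \<bullet> rvec z) * F ep t k ze)) \<partial>lborel)
  \<longlonglongrightarrow> cr (U ep z t)"
  unfolding U_def F_def rbox_def
  by (rule expectation_csol[OF u[OF ep] H t continuous_coef[OF lf] coef_inversion[OF lf ep(1), unfolded rbox_def]])
 next
  fix ze :: "real^'d" and ka :: real assume "ze ~= 0" "0 < ka"
  from euler_plane_wave_limit[OF erg ah this] eventually_at_right_less[of "0::real"]
  show "\<forall>\<^sub>F ep in at_right 0. ALL t:{0<..}. \<forall>\<^sub>F k in sequentially. cmod (F ep t k ze - cr (exp (- t * qf A ze))) <= ka"
  proof eventually_elim
  case (elim ep)
  show ?case
  proof
  fix t :: real assume "t : {0<..}"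
  hence t: "0 < t / ep^2" and e: "ep^2 * (t / ep^2) = t" using elim(2) by auto
  from elim(1)[rule_format, OF t] eventually_stable[of "t / ep^2"]
  show "\<forall>\<^sub>F k in sequentially. cmod (F ep t k ze - cr (exp (- t * qf A ze))) <= ka"
  proof eventually_elim
  case (elim k)
  thus ?case unfolding F_def euler_F_def e qf_def by (simp only: if_True simp_thms)
  qed
  qed
  qed
 qed
 thus ?thesis unfolding U_def Ball_def greaterThan_iff .
qed

end

no_notation scaleR (infixr "*." 75)

theorem theorem1p1:
  fixes M :: "'w measure" and a :: "'w \<Rightarrow> real^'d::finite^'d"
    and l L :: real and f :: "real^'d \<Rightarrow> real"
    and T :: "int^'d \<Rightarrow> 'w \<Rightarrow> 'w"
  assumes P: "prob_space M"
    and lL: "0 < l" "l \<le> L"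
    and a: "coeff_ok M l L a"
    and f: "smooth_fun f" "compact_support f"
  shows
    "(\<forall>(S :: int \<Rightarrow> 'w \<Rightarrow> 'w) A uhom.
       translation_groups M T S \<longrightarrow>
       ((\<exists>j. ergodic_map M (T (ue j))) \<or> ergodic_map M (S 1)) \<longrightarrow>
       4 * real CARD('d) * L \<le> 1 \<longrightarrow>
       is_ahom M T a (Phi_eq_disc M T S a) A \<longrightarrow>
       heat_sol A f uhom \<longrightarrow>
       (\<forall>\<delta>>0. \<exists>\<epsilon>0>0. \<forall>\<epsilon>. 0 < \<epsilon> \<and> \<epsilon> < \<epsilon>0 \<and> \<epsilon> \<le> 1 \<longrightarrow>
          (\<forall>z n. \<bar>(\<integral>\<omega>. dsol T S a (\<lambda>y. f (\<epsilon> *\<^sub>R rvec y)) \<omega> n z \<partial>M)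
                   - uhom (\<epsilon> *\<^sub>R rvec z) (\<epsilon>\<^sup>2 * real n)\<bar> \<le> \<delta>)))
   \<and>
     (\<forall>(S :: real \<Rightarrow> 'w \<Rightarrow> 'w) A uhom u.
       translation_groups M T S \<longrightarrow>
       (\<lambda>(t, \<omega>). S t \<omega>) \<in> measurable (lborel \<Otimes>\<^sub>M M) M \<longrightarrow>
       ((\<exists>j. ergodic_map M (T (ue j))) \<or> ergodic_flow M S) \<longrightarrow>
       is_ahom M T a (Phi_eq_cont M T S a) A \<longrightarrow>
       heat_sol A f uhom \<longrightarrow>
       (\<forall>\<epsilon>. 0 < \<epsilon> \<and> \<epsilon> \<le> 1 \<longrightarrow> is_csol M T S a (\<lambda>y. f (\<epsilon> *\<^sub>R rvec y)) (u \<epsilon>)) \<longrightarrow>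
       (\<forall>\<delta>>0. \<exists>\<epsilon>0>0. \<forall>\<epsilon>. 0 < \<epsilon> \<and> \<epsilon> < \<epsilon>0 \<and> \<epsilon> \<le> 1 \<longrightarrow>
          (\<forall>z. \<forall>t>0. \<bar>(\<integral>\<omega>. u \<epsilon> z (t / \<epsilon>\<^sup>2) \<omega> \<partial>M) - uhom (\<epsilon> *\<^sub>R rvec z) t\<bar> \<le> \<delta>)))"
proof -
 have env: "environment M T S a l L" if g: "translation_groups M T S" for S :: "'t::ab_group_add => 'w => 'w"
 proof (intro environment.intro environment_axioms.intro g a lL)
  show "space_shift M T"
  using P g by (intro space_shift.intro space_shift_axioms.intro) (auto simp: translation_groups_def)
 qed
 show ?thesis
 proof (intro conjI allI impI)
  fix S :: "int => 'w => 'w" and A uhom de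
  assume g: "translation_groups M T S" and rest: "(EX j. ergodic_map M (T (ue j))) \<or> ergodic_map M (S 1)"
  "is_ahom M T a (Phi_eq_disc M T S a) A" "heat_sol A f uhom" "0 < (de::real)" and st: "4 * real CARD('d) * L <= 1"
  interpret disc M T S a l L by (intro disc.intro env g disc_axioms.intro st)
  show "EX ep0>0. ALL ep. 0 < ep & ep < ep0 & ep <= 1 -->
  (ALL z n. \<bar>(\<integral>w. dsol T S a (%y. f (ep *\<^sub>R rvec y)) w n z \<partial>M) - uhom (ep *\<^sub>R rvec z) (ep^2 * real n)\<bar> <= de)"
  by (rule homogenization_disc[OF rest(1,2) f rest(3,4)])
 next
  fix S :: "real => 'w => 'w" and A uhom u de
  assume g: "translation_groups M T S" and j: "(%(t, w). S t w) : measurable (lborel \<Otimes>\<^sub>M M) M"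
  and rest: "(EX j. ergodic_map M (T (ue j))) \<or> ergodic_flow M S"
  "is_ahom M T a (Phi_eq_cont M T S a) A" "heat_sol A f uhom" "0 < (de::real)"
  and u: "ALL ep. 0 < ep & ep <= 1 --> is_csol M T S a (%y. f (ep *\<^sub>R rvec y)) (u ep)"
  interpret cont M T S a l L by (intro cont.intro env g cont_axioms.intro j)
  show "EX ep0>0. ALL ep. 0 < ep & ep < ep0 & ep <= 1 -->
  (ALL z. ALL t>0. \<bar>(\<integral>w. u ep z (t / ep^2) w \<partial>M) - uhom (ep *\<^sub>R rvec z) t\<bar> <= de)"
  by (rule homogenization_cont[OF rest(1,2) f rest(3,4)]) (use u in blast)
 qed
qed

end
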